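(* Let $1<p<\infty$, $w\in A_p$ and $r\in(0,\infty)$ with $r\ne2$. Let $s=\min(r,2)$. Then there is a constant $C$ such that for any Littlewood--Paley family $(f_j)_{j\in\mathbb Z}$, $$\Big\|\sup_{K,\;N_0<\dots<N_K}\Big(\sum_{k=1}^K\Big|\sum_{N_{k-1}<j\le N_k}f_j\Big|^r\Big)^{1/r}\Big\|_{L^p(w)}\le C\,\Big\|\Big(\sum_{j\in\mathbb Z}|f_j|^s\Big)^{1/s}\Big\|_{L^p(w)},$$ where the supremum is over all $K\ge1$ and all integers $N_0<\dots<N_K$.
   Context: Fix absolute constants $C_0\in(1,\infty)$, $\{C_N: N\in\mathbb N\}$ and $m\ge1$. A sequence of functions $(f_j)_{j\in\mathbb Z}$ on $\mathbb R$ is a Littlewood--Paley family (with these constants) if each $f_j$ has frequency support (support of its Fourier transform) inside $\{\frac1{C_0}2^{-j}<|\xi|<C_02^{-j}\}$ and $$\Big|\frac{d^N}{dx^N}f_j(x)\Big|\le C_N2^{-jN}\,[1+|x|2^{-j}]^{-m}\qquad\text{for all } N,\ j,\ x.$$ The constant $C$ in the claim depends only on $p,r,w$ and these fixed constants. $w\in A_p$ means that $w$ is an a.e. positive, locally integrable function on $\mathbb R$ with $\sup_I\frac1{|I|}\big[\int_Iw\big]\big[\frac1{|I|}\int_Iw^{-1/(p-1)}\big]^{p-1}<\infty$, the supremum being over bounded intervals. $\|h\|_{L^p(w)}=(\int_{\mathbb R}|h|^pw\,dx)^{1/p}$. *)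

theory Defs
  imports "HOL-Analysis.Analysis"
begin

definition nth_vderiv :: "nat \<Rightarrow> (real \<Rightarrow> complex) \<Rightarrow> real \<Rightarrow> complex" where
  "nth_vderiv N f = ((\<lambda>g x. vector_derivative g (at x)) ^^ N) f"

definition smooth_fun :: "(real \<Rightarrow> complex) \<Rightarrow> bool" where
  "smooth_fun f \<longleftrightarrow> (\<forall>N x. nth_vderiv N f differentiable (at x))"

definition fun_supp :: "(real \<Rightarrow> complex) \<Rightarrow> real set" where
  "fun_supp f = closure {x. f x \<noteq> 0}"

definition test_function :: "(real \<Rightarrow> complex) \<Rightarrow> bool" where
  "test_function \<phi> \<longleftrightarrow> smooth_fun \<phi> \<and> compact (fun_supp \<phi>)"

definition fourier :: "(real \<Rightarrow> complex) \<Rightarrow> real \<Rightarrow> complex" where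
  "fourier \<phi> \<xi> = (LINT x|lborel. \<phi> x * cis (- (2 * pi * x * \<xi>)))"

text \<open>A member of a Littlewood--Paley family need not be integrable when \<open>m = 1\<close>, so its Fourier
  transform is taken in the sense of tempered distributions: for bounded continuous \<open>f\<close> it is the
  functional \<open>\<phi> \<mapsto> \<integral> f \<cdot> fourier \<phi>\<close>, and its support is the complement of the largest open set on
  which this functional vanishes.\<close>

definition fourier_dist :: "(real \<Rightarrow> complex) \<Rightarrow> (real \<Rightarrow> complex) \<Rightarrow> complex" where
  "fourier_dist f \<phi> = (LINT x|lborel. f x * fourier \<phi> x)"

definition freq_supp :: "(real \<Rightarrow> complex) \<Rightarrow> real set" where
  "freq_supp f = - \<Union>{U. open U \<and>
     (\<forall>\<phi>. test_function \<phi> \<and> fun_supp \<phi> \<subseteq> U \<longrightarrow> fourier_dist f \<phi> = 0)}"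

text \<open>\<open>C0\<close> is the constant of the frequency annuli and \<open>A N\<close> the constant in the bound for the
  \<open>N\<close>-th derivative (\<open>N \<ge> 0\<close>).\<close>

definition LP_family :: "real \<Rightarrow> (nat \<Rightarrow> real) \<Rightarrow> real \<Rightarrow> (int \<Rightarrow> real \<Rightarrow> complex) \<Rightarrow> bool" where
  "LP_family C0 A m f \<longleftrightarrow>
     (\<forall>j. smooth_fun (f j) \<and>
          freq_supp (f j) \<subseteq> {\<xi>. 1 / C0 * 2 powi (- j) < \<bar>\<xi>\<bar> \<and> \<bar>\<xi>\<bar> < C0 * 2 powi (- j)} \<and>
          (\<forall>N x. norm (nth_vderiv N (f j) x)
                   \<le> A N * 2 powi (- j * int N) * (1 + \<bar>x\<bar> * 2 powi (- j)) powr (- m)))"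

text \<open>Powers of extended nonnegative reals; only used with exponent \<open>a > 0\<close>.\<close>

definition epowr :: "ennreal \<Rightarrow> real \<Rightarrow> ennreal" where
  "epowr x a = (if x = \<infinity> then \<infinity> else ennreal (enn2real x powr a))"

text \<open>The supremum of the defining quantity over all bounded nondegenerate intervals. Here \<open>epowr\<close> carries the
  outer exponent \<open>p - 1\<close> because the integral of \<open>w powr (- 1 / (p - 1))\<close> may be infinite.\<close>

definition Ap_const :: "real \<Rightarrow> (real \<Rightarrow> real) \<Rightarrow> ennreal" where
  "Ap_const p w = (SUP (a, b) \<in> {(a, b). a < b}.
     (ennreal (1 / (b - a)) * (\<integral>\<^sup>+ x \<in> {a..b}. ennreal (w x) \<partial>lebesgue)) *
     epowr (ennreal (1 / (b - a)) *
        (\<integral>\<^sup>+ x \<in> {a..b}. ennreal (w x powr (- 1 / (p - 1))) \<partial>lebesgue)) (p - 1))"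

definition Ap_weight :: "real \<Rightarrow> (real \<Rightarrow> real) \<Rightarrow> bool" where
  "Ap_weight p w \<longleftrightarrow>
     (AE x in lebesgue. 0 < w x) \<and>
     (\<forall>a b. set_integrable lebesgue {a..b} w) \<and>
     Ap_const p w < \<infinity>"

definition weighted_Lp_norm :: "real \<Rightarrow> (real \<Rightarrow> real) \<Rightarrow> (real \<Rightarrow> ennreal) \<Rightarrow> ennreal" where
  "weighted_Lp_norm p w h = epowr (\<integral>\<^sup>+ x. epowr (h x) p * ennreal (w x) \<partial>lebesgue) (1 / p)"

definition block_variation :: "real \<Rightarrow> (int \<Rightarrow> real \<Rightarrow> complex) \<Rightarrow> real \<Rightarrow> ennreal" where
  "block_variation r f x =
     (SUP (K, n) \<in> {(K :: nat, n :: nat \<Rightarrow> int). 1 \<le> K \<and> strict_mono_on {0..K} n}.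
        ennreal ((\<Sum>k = 1..K. norm (\<Sum>j \<in> {n (k - 1)<..n k}. f j x) powr r) powr (1 / r)))"

definition ls_function :: "real \<Rightarrow> (int \<Rightarrow> real \<Rightarrow> complex) \<Rightarrow> real \<Rightarrow> ennreal" where
  "ls_function s f x = epowr (\<Sum>\<^sub>\<infinity>j\<in>UNIV. ennreal (norm (f j x) powr s)) (1 / s)"

end

theory Submission
  imports Defs "HOL-Probability.Probability"
begin

text \<open>Let \<open>s = min r 2\<close>. For \<open>r \<le> 1\<close> the inequality holds pointwise with constant one, because \<open>t \<mapsto> t\<^sup>r\<close> is subadditive and
  the blocks are disjoint (\<open>block_variation_le_ls\<close>). The rest concerns \<open>r > 1\<close>, so that \<open>1 < s \<le> 2\<close>.

  The right-hand side is the \<open>L\<^sup>p\<close> norm of an \<open>l\<^sup>s\<close> sum. By Rubio de Francia extrapolation (\<open>extrapolation\<close>) it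
  suffices to treat \<open>p = s\<close> for all weights of class \<open>A\<^sub>s\<close> with a controlled constant, and there the right-hand side is
  additive in \<open>j\<close>. Extrapolation rests on Muckenhoupt's theorem for the maximal operator (\<open>maxfun_bounded\<close>).

  If \<open>f\<^sub>j\<close> is replaced by a dyadic martingale difference \<open>d\<^sub>j\<close> the estimate is an \<open>s\<close>-variation version of Lepingle's
  inequality (\<open>martingale_variation\<close>). On one dyadic interval, the number of jumps of height \<open>l\<close> of the martingale has
  mean at most \<open>l\<^sup>-\<^sup>2\<close> times the sum of the truncated squares \<open>min(|d\<^sub>j|, l)\<^sup>2\<close> (\<open>jump_potential\<close>). Summing over dyadic
  heights with the weights \<open>l\<^sup>r\<close> turns these squares into \<open>|d\<^sub>j|\<^sup>s\<close> exactly because \<open>r \<noteq> 2\<close> (\<open>jump_weights\<close>): for \<open>r < 2\<close>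
  the heights below \<open>|d\<^sub>j|\<close> form a convergent geometric series and so do the ones above it, and for \<open>r > 2\<close> the sum is
  dominated by a cutoff height above which jumps are rare. A good-lambda inequality transports this local
  estimate to the weighted space.

  A Littlewood--Paley function \<open>f\<^sub>j\<close> is expanded in its martingale differences, \<open>f\<^sub>j = \<Sum>\<^sub>i D\<^sub>j\<^sub>+\<^sub>i f\<^sub>j\<close>. For fixed \<open>i\<close> the
  functions \<open>D\<^sub>j\<^sub>+\<^sub>i f\<^sub>j\<close> are differences of one martingale, so that its variation is bounded by the \<open>l\<^sup>s\<close> sum of the
  \<open>D\<^sub>j\<^sub>+\<^sub>i f\<^sub>j\<close>; and \<open>\<parallel>D\<^sub>j\<^sub>+\<^sub>i f\<^sub>j\<parallel> \<le> C 2\<^sup>-\<^sup>\<epsilon>\<^sup>|\<^sup>i\<^sup>| \<parallel>f\<^sub>j\<parallel>\<close> in the weighted space (\<open>mdiff_norm\<close>), which makes the sum over \<open>i\<close>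
  converge (\<open>LP_variation\<close>). The decay needs of \<open>f\<^sub>j\<close> only that it reproduces itself under convolution with a kernel of scale
  \<open>2\<^sup>j\<close> that is a derivative (\<open>LP_kernel\<close>), which is what the frequency support gives: the kernel is smooth, so fine
  differences are small, and it has a primitive, so that integrals over long intervals only see the end points. For coarse
  differences the loss \<open>2\<^sup>i\<^sup>s\<close> from comparing the weight of a long interval with that of its ends would cancel the gain from
  the primitive; reverse doubling of the dual weight makes the loss slightly smaller (\<open>weight_ratio\<close>).\<close>

section \<open>Powers and sums of extended nonnegative reals\<close>

lemma epowr_ennreal [simp]: "0 \<le> x \<Longrightarrow> epowr (ennreal x) a = ennreal (x powr a)"
  by (simp add: epowr_def)

lemma epowr_top [simp]: "epowr top a = top"
  by (simp add: epowr_def)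

lemma epowr_zero [simp]: "epowr 0 a = 0"
  by (simp add: epowr_def)

lemma epowr_one [simp]: "epowr 1 a = 1"
  using epowr_ennreal[of 1 a] by simp

lemma epowr_1 [simp]: "epowr x 1 = x"
  by (cases x) (auto simp: epowr_def)

lemma epowr_mono: "x \<le> y \<Longrightarrow> 0 \<le> a \<Longrightarrow> epowr x a \<le> epowr y a"
  by (cases x; cases y) (auto simp: top_unique powr_mono2 intro!: ennreal_leI)

lemma epowr_epowr: "0 < a \<Longrightarrow> 0 < b \<Longrightarrow> epowr (epowr x a) b = epowr x (a * b)"
  by (cases x) (auto simp: powr_powr)

lemma epowr_inverse [simp]:
  "0 < a \<Longrightarrow> epowr (epowr x a) (1 / a) = x" "0 < a \<Longrightarrow> epowr (epowr x (1 / a)) a = x"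
  by (simp_all add: epowr_epowr)

lemma epowr_le_iff: "0 < a \<Longrightarrow> epowr x a \<le> y \<longleftrightarrow> x \<le> epowr y (1 / a)"
  by (metis epowr_inverse epowr_mono less_imp_le zero_less_divide_1_iff)

lemma epowr_mult: "0 < a \<Longrightarrow> epowr (x * y) a = epowr x a * epowr y a"
proof (cases "x = top \<or> y = top")
  case True
  then show "0 < a \<Longrightarrow> ?thesis"
    by (cases x; cases y) (auto simp: ennreal_mult_top ennreal_top_mult)
next
  case False
  then show "0 < a \<Longrightarrow> ?thesis"
    by (cases x; cases y) (auto simp: ennreal_mult[symmetric] powr_mult)
qed

lemma epowr_add: "0 < a \<Longrightarrow> 0 < b \<Longrightarrow> epowr x (a + b) = epowr x a * epowr x b"
  by (cases x) (auto simp: ennreal_mult[symmetric] powr_add)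

lemma epowr_eq_0_iff [simp]: "epowr x a = 0 \<longleftrightarrow> x = 0"
  by (cases x) (auto simp: ennreal_eq_0_iff)

lemma epowr_eq_top_iff [simp]: "epowr x a = top \<longleftrightarrow> x = top"
  by (cases x) auto

lemma epowr_SUP:
  assumes "0 < a"
  shows "epowr (SUP i\<in>I. f i) a = (SUP i\<in>I. epowr (f i) a)"
proof (rule antisym)
  show "epowr (SUP i\<in>I. f i) a \<le> (SUP i\<in>I. epowr (f i) a)"
    unfolding epowr_le_iff[OF assms]
  proof (rule SUP_least)
    fix i assume "i \<in> I"
    then have "epowr (f i) a \<le> (SUP i\<in>I. epowr (f i) a)" by (rule SUP_upper)
    then show "f i \<le> epowr (SUP i\<in>I. epowr (f i) a) (1 / a)"
      unfolding epowr_le_iff[OF assms] .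
  qed
  show "(SUP i\<in>I. epowr (f i) a) \<le> epowr (SUP i\<in>I. f i) a"
    using assms by (auto intro!: SUP_least epowr_mono SUP_upper)
qed

lemma epowr_measurable [measurable]:
  assumes [measurable]: "f \<in> borel_measurable M"
  shows "(\<lambda>x. epowr (f x) a) \<in> borel_measurable M"
  unfolding epowr_def by measurable

abbreviation enorm :: "complex \<Rightarrow> ennreal" where
  "enorm z \<equiv> ennreal (norm z)"

abbreviation sumZ :: "(int \<Rightarrow> ennreal) \<Rightarrow> ennreal"
  where "sumZ F \<equiv> (\<integral>\<^sup>+ m. F m \<partial>count_space UNIV)"

lemma sumZ_suminf: "sumZ F = (\<Sum>n. F (int_decode n))"
  by (simp add: nn_integral_bij_count_space[OF bij_int_decode, symmetric] nn_integral_count_space_nat)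

lemma sumZ_measurable [measurable]:
  "(\<And>m. F m \<in> borel_measurable M) \<Longrightarrow> (\<lambda>x. sumZ (\<lambda>m. F m x)) \<in> borel_measurable M"
  unfolding sumZ_suminf by measurable

lemma sumZ_mono: "(\<And>m. F m \<le> G m) \<Longrightarrow> sumZ F \<le> sumZ G"
  by (rule nn_integral_mono) auto

lemma le_sumZ: "F (k::int) \<le> sumZ F"
proof -
  have "F k = (\<integral>\<^sup>+ m. F m * indicator {k} m \<partial>count_space UNIV)"
    by (subst nn_integral_count_space'[of "{k}"]) (auto split: split_indicator)
  also have "\<dots> \<le> sumZ F"
    by (intro nn_integral_mono) (auto split: split_indicator)
  finally show ?thesis .
qed

lemma sumZ_half_line:
  assumes "e = 1 \<or> e = (-1::int)"
  shows "(\<integral>\<^sup>+ m. F m * indicator {m. e * m \<le> k} m \<partial>count_space UNIV)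
     = (\<Sum>n. F (e * (k - int n)))"
proof -
  have b: "bij_betw (\<lambda>n. e * (k - int n)) UNIV {m. e * m \<le> k}"
    using assms by (intro bij_betw_byWitness[where f' = "\<lambda>m. nat (k - e * m)"]) auto
  have "(\<integral>\<^sup>+ m. F m * indicator {m. e * m \<le> k} m \<partial>count_space UNIV)
     = (\<integral>\<^sup>+ m. F m \<partial>count_space {m. e * m \<le> k})"
    by (simp add: nn_integral_count_space_indicator)
  also have "\<dots> = (\<integral>\<^sup>+ n. F (e * (k - int n)) \<partial>count_space UNIV)"
    by (rule nn_integral_bij_count_space[OF b, symmetric])
  finally show ?thesis by (simp add: nn_integral_count_space_nat)
qed

lemma geometric_half_line:
  fixes k :: int and a :: real
  assumes q: "1 < q" and a: "0 < a" and e: "e = 1 \<or> e = (-1::int)"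
  shows "(\<integral>\<^sup>+ m. ennreal (q powr (a * e * real_of_int m)) * indicator {m. e * m \<le> k} m \<partial>count_space UNIV)
     = ennreal (q powr (a * k) / (1 - q powr - a))"
proof -
  have e2: "real_of_int e * (real_of_int e * x) = x" for x using e by auto
  have r: "0 < q powr - a" "q powr - a < 1"
    using q a by (auto simp: powr_less_one)
  have "(\<integral>\<^sup>+ m. ennreal (q powr (a * e * real_of_int m)) * indicator {m. e * m \<le> k} m \<partial>count_space UNIV)
     = (\<Sum>n. ennreal (q powr (a * e * real_of_int (e * (k - int n)))))"
    by (rule sumZ_half_line[OF e])
  also have "\<dots> = (\<Sum>n. ennreal (q powr (a * k) * (q powr - a) ^ n))"
    using q by (intro suminf_cong arg_cong[of _ _ ennreal])
       (simp add: mult.assoc e2, simp add: powr_realpow[symmetric] powr_powr powr_add[symmetric] algebra_simps)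
  also have "\<dots> = ennreal (\<Sum>n. q powr (a * k) * (q powr - a) ^ n)"
    using r by (intro suminf_ennreal2 summable_mult summable_geometric) auto
  also have "(\<Sum>n. q powr (a * k) * (q powr - a) ^ n) = q powr (a * k) / (1 - q powr - a)"
    using r by (subst suminf_mult) (auto simp: suminf_geometric summable_geometric)
  finally show ?thesis .
qed

lemma geometric_below:
  assumes q: "1 < q" and a: "0 < a" and y: "0 < y"
  shows "(\<integral>\<^sup>+ m. ennreal (q powr (a * real_of_int m)) * indicator {m::int. q powr m \<le> y} m \<partial>count_space UNIV)
     \<le> ennreal (y powr a / (1 - q powr - a))"
proof -
  define k where "k = \<lfloor>log q y\<rfloor>"
  have r: "q powr - a < 1" using q a by (auto simp: powr_less_one)
  have s: "{m. q powr real_of_int m \<le> y} = {m. 1 * m \<le> k}"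
    using q y by (auto simp: k_def le_log_iff le_floor_iff)
  have kl: "q powr k \<le> y" using q y by (simp add: k_def le_log_iff[symmetric])
  have "q powr (a * k) = (q powr k) powr a" by (simp add: powr_powr mult.commute)
  also have "\<dots> \<le> y powr a" using kl a by (intro powr_mono2) auto
  finally have "q powr (a * k) / (1 - q powr - a) \<le> y powr a / (1 - q powr - a)"
    using r by (intro divide_right_mono) auto
  moreover have "(\<integral>\<^sup>+ m. ennreal (q powr (a * real_of_int m)) * indicator {m. 1 * m \<le> k} m \<partial>count_space UNIV)
      = ennreal (q powr (a * k) / (1 - q powr - a))"
    using geometric_half_line[OF q a, of 1 k] by simp
  ultimately show ?thesis
    unfolding s by (simp add: ennreal_leI)
qed

lemma geometric_above:
  assumes q: "1 < q" and a: "0 < a" and y: "0 < y"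
  shows "(\<integral>\<^sup>+ m. ennreal (q powr (- a * real_of_int m)) * indicator {m::int. y \<le> q powr m} m \<partial>count_space UNIV)
     \<le> ennreal (y powr - a / (1 - q powr - a))"
proof -
  define k where "k = \<lfloor>log q (1/y)\<rfloor>"
  have r: "q powr - a < 1" using q a by (auto simp: powr_less_one)
  have s: "{m. y \<le> q powr real_of_int m} = {m. -1 * m \<le> k}"
  proof -
    have "y \<le> q powr real_of_int m \<longleftrightarrow> - m \<le> k" for m
      using q y by (simp add: k_def le_floor_iff log_le_iff[symmetric] log_divide)
    then show ?thesis by auto
  qed
  have kl: "q powr k \<le> 1 / y" using q y by (simp add: k_def le_log_iff[symmetric])
  have "q powr (a * k) = (q powr k) powr a" by (simp add: powr_powr mult.commute)
  also have "\<dots> \<le> (1 / y) powr a" using kl a by (intro powr_mono2) auto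
  also have "\<dots> = y powr - a" using y by (simp add: powr_minus_divide powr_divide)
  finally have "q powr (a * k) / (1 - q powr - a) \<le> y powr - a / (1 - q powr - a)"
    using r by (intro divide_right_mono) auto
  moreover have "(\<integral>\<^sup>+ m. ennreal (q powr (- a * real_of_int m)) * indicator {m. -1 * m \<le> k} m \<partial>count_space UNIV)
      = ennreal (q powr (a * k) / (1 - q powr - a))"
    using geometric_half_line[OF q a, of "-1" k] by simp
  ultimately show ?thesis
    unfolding s by (simp add: ennreal_leI)
qed

text \<open>The layer cake formula discretized to geometric levels: up to constants this is \<open>v powr a\<close>, and its integral is a
  weighted sum of the measures of the level sets.\<close>

definition layer :: "real \<Rightarrow> real \<Rightarrow> ennreal \<Rightarrow> ennreal" where
  "layer q a v = sumZ (\<lambda>m. ennreal (q powr (a * real_of_int m)) * indicator {m::int. ennreal (q powr m) < v} m)"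

lemma layer_measurable [measurable]:
  assumes [measurable]: "f \<in> borel_measurable M"
  shows "(\<lambda>x. layer q a (f x)) \<in> borel_measurable M"
  unfolding layer_def by (intro sumZ_measurable) (auto simp: indicator_def)

lemma epowr_le_layer:
  assumes q: "1 < q" and a: "0 < a"
  shows "epowr v a \<le> ennreal (q powr a) * layer q a v"
proof (cases v)
  case top
  have "of_nat n \<le> layer q a v" for n
  proof -
    obtain k :: nat where k: "real n \<le> (q powr a) ^ k"
      using real_arch_pow[of "q powr a" "real n"] q a less_imp_le by fastforce
    have "of_nat n \<le> ennreal (q powr (a * int k))"
      using k q by (simp add: ennreal_of_nat_eq_real_of_nat powr_powr[symmetric] powr_realpow)
    also have "\<dots> \<le> layer q a v"
      unfolding layer_def by (rule order_trans[OF _ le_sumZ[of _ "int k"]]) (auto simp: top)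
    finally show ?thesis .
  qed
  then have "layer q a v = top"
    by (metis ennreal_Ex_less_of_nat linorder_not_less top.not_eq_extremum)
  then show ?thesis using q by (simp add: ennreal_mult_top)
next
  case (real y)
  show ?thesis
  proof (cases "y = 0")
    case True then show ?thesis using real by simp
  next
    case False
    then have y: "0 < y" using real by simp
    define m where "m = \<lceil>log q y\<rceil> - 1"
    have 1: "q powr m < y"
      using q y by (simp add: m_def less_log_iff[symmetric]) linarith
    have "log q y \<le> m + 1" by (simp add: m_def)
    then have "y \<le> q powr (m + 1)" using q y by (simp add: log_le_iff)
    then have "y powr a \<le> (q powr (m + 1)) powr a" using a y by (intro powr_mono2) auto
    also have "\<dots> = q powr a * q powr (a * m)"
      by (simp add: powr_powr powr_add[symmetric] algebra_simps)
    finally have "epowr v a \<le> ennreal (q powr a) * ennreal (q powr (a * m))"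
      using real by (simp add: ennreal_mult[symmetric] ennreal_leI)
    also have "ennreal (q powr (a * m)) \<le> layer q a v"
      unfolding layer_def using 1 real
      by (intro order_trans[OF _ le_sumZ[of _ m]]) (auto simp: ennreal_less_iff)
    finally show ?thesis by (simp add: mult_left_mono)
  qed
qed

lemma layer_le_epowr:
  assumes q: "1 < q" and a: "0 < a"
  shows "layer q a v \<le> ennreal (1 / (1 - q powr - a)) * epowr v a"
proof (cases v)
  case top
  have "q powr - a < 1" using q a by (auto simp: powr_less_one)
  then show ?thesis using top by (simp add: ennreal_mult_top)
next
  case (real y)
  have r: "q powr - a < 1" using q a by (auto simp: powr_less_one)
  show ?thesis
  proof (cases "y = 0")
    case True then show ?thesis using real by (simp add: layer_def)
  next
    case False
    then have y: "0 < y" using real by simp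
    have "layer q a v \<le> (\<integral>\<^sup>+ m. ennreal (q powr (a * real_of_int m)) * indicator {m::int. q powr m \<le> y} m \<partial>count_space UNIV)"
      unfolding layer_def using real
      by (intro sumZ_mono) (auto simp: ennreal_less_iff split: split_indicator)
    also have "\<dots> \<le> ennreal (y powr a / (1 - q powr - a))" by (rule geometric_below[OF q a y])
    also have "\<dots> = ennreal (1 / (1 - q powr - a)) * epowr v a"
      using real r by (simp add: ennreal_mult[symmetric])
    finally show ?thesis .
  qed
qed

lemma nn_integral_layer:
  assumes [measurable]: "f \<in> borel_measurable M"
  shows "(\<integral>\<^sup>+ x. layer q a (f x) \<partial>M)
       = sumZ (\<lambda>m. ennreal (q powr (a * real_of_int m)) * emeasure M {x \<in> space M. ennreal (q powr m) < f x})"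
proof -
  have "(\<integral>\<^sup>+ x. layer q a (f x) \<partial>M)
     = (\<integral>\<^sup>+ x. sumZ (\<lambda>m. ennreal (q powr (a * real_of_int m)) * indicator {x \<in> space M. ennreal (q powr m) < f x} x) \<partial>M)"
    unfolding layer_def by (intro nn_integral_cong) (auto split: split_indicator)
  also have "\<dots> = sumZ (\<lambda>m. (\<integral>\<^sup>+ x. ennreal (q powr (a * real_of_int m)) * indicator {x \<in> space M. ennreal (q powr m) < f x} x \<partial>M))"
    by (rule nn_integral_count_space_nn_integral) auto
  finally show ?thesis by (simp add: nn_integral_cmult_indicator)
qed

section \<open>Hoelder's inequality\<close>

lemma ennreal_Young:
  assumes p: "1 < p" and q: "q = p / (p - 1)"
  shows "x * y \<le> ennreal (1/p) * epowr x p + ennreal (1/q) * epowr y q"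
proof (cases "x = top \<or> y = top")
  case True
  have "0 < q" using p q by auto
  then show ?thesis using True p by (auto simp: ennreal_mult_top)
next
  case False
  then obtain a b where ab: "x = ennreal a" "y = ennreal b" "0 \<le> a" "0 \<le> b"
    by (metis ennreal_cases)
  have q': "1 < q" "1/p + 1/q = 1" using p unfolding q by (auto simp: field_simps)
  have "a * b \<le> a powr p / p + b powr q / q"
    using Youngs_inequality[of p q a b] p q' ab by auto
  then show ?thesis using ab p q'
    by (simp add: ennreal_mult[symmetric] ennreal_plus[symmetric] del: ennreal_plus)
qed

lemma nn_integral_Holder:
  assumes p: "1 < p" and q: "q = p / (p - 1)"
    and [measurable]: "f \<in> borel_measurable M" "g \<in> borel_measurable M"
  shows "(\<integral>\<^sup>+ x. f x * g x \<partial>M)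
     \<le> epowr (\<integral>\<^sup>+ x. epowr (f x) p \<partial>M) (1/p) * epowr (\<integral>\<^sup>+ x. epowr (g x) q \<partial>M) (1/q)"
proof -
  define A where "A = (\<integral>\<^sup>+ x. epowr (f x) p \<partial>M)"
  define B where "B = (\<integral>\<^sup>+ x. epowr (g x) q \<partial>M)"
  have q': "1 < q" "1/p + 1/q = 1" using p unfolding q by (auto simp: field_simps)
  show ?thesis
  proof (cases "A = 0 \<or> B = 0")
    case True
    then have "AE x in M. f x * g x = 0"
    proof
      assume "A = 0"
      then have "AE x in M. epowr (f x) p = 0" unfolding A_def by (subst (asm) nn_integral_0_iff_AE) auto
      then show ?thesis by eventually_elim simp
    next
      assume "B = 0"
      then have "AE x in M. epowr (g x) q = 0" unfolding B_def by (subst (asm) nn_integral_0_iff_AE) auto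
      then show ?thesis by eventually_elim simp
    qed
    then have "(\<integral>\<^sup>+ x. f x * g x \<partial>M) = 0" by (subst nn_integral_0_iff_AE) auto
    then show ?thesis by simp
  next
    case nz: False
    show ?thesis
    proof (cases "A = top \<or> B = top")
      case True
      then show ?thesis using nz
        unfolding A_def[symmetric] B_def[symmetric] by (auto simp: ennreal_mult_top ennreal_top_mult)
    next
      case False
      define a where "a = epowr A (1/p)"
      define b where "b = epowr B (1/q)"
      have a: "a \<noteq> 0" "a \<noteq> top" "epowr a p = A" and b: "b \<noteq> 0" "b \<noteq> top" "epowr b q = B"
        using nz False p q' by (auto simp: a_def b_def)
      have inv: "z \<noteq> 0 \<Longrightarrow> z \<noteq> top \<Longrightarrow> z * inverse z = 1" for z :: ennreal
        by (metis divide_ennreal_def ennreal_divide_self top.not_eq_extremum)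
      have cancel: "z \<noteq> 0 \<Longrightarrow> z \<noteq> top \<Longrightarrow> u = z * (inverse z * u)" for z u :: ennreal
        by (simp add: mult.assoc[symmetric] inv)
      have "epowr (inverse a * a) p = 1" "epowr (inverse b * b) q = 1"
        using inv[OF a(1,2)] inv[OF b(1,2)] by (simp_all add: mult.commute)
      then have ip: "epowr (inverse a) p * A = 1" "epowr (inverse b) q * B = 1"
        using a(3) b(3) p q' by (simp_all add: epowr_mult)
      have "(\<integral>\<^sup>+ x. f x * g x \<partial>M) = (\<integral>\<^sup>+ x. (a * b) * ((inverse a * f x) * (inverse b * g x)) \<partial>M)"
      proof (rule nn_integral_cong)
        fix x show "f x * g x = (a * b) * ((inverse a * f x) * (inverse b * g x))"
          using cancel[OF a(1,2), of "f x"] cancel[OF b(1,2), of "g x"]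
          by (metis mult.assoc mult.left_commute)
      qed
      also have "\<dots> = (a * b) * (\<integral>\<^sup>+ x. (inverse a * f x) * (inverse b * g x) \<partial>M)"
        by (rule nn_integral_cmult) auto
      also have "(\<integral>\<^sup>+ x. (inverse a * f x) * (inverse b * g x) \<partial>M)
          \<le> (\<integral>\<^sup>+ x. ennreal (1/p) * epowr (inverse a * f x) p + ennreal (1/q) * epowr (inverse b * g x) q \<partial>M)"
        by (intro nn_integral_mono ennreal_Young p q)
      also have "\<dots> = ennreal (1/p) * (epowr (inverse a) p * A) + ennreal (1/q) * (epowr (inverse b) q * B)"
        using p q' by (simp add: nn_integral_add nn_integral_cmult epowr_mult A_def B_def)
      also have "\<dots> = ennreal (1/p + 1/q)"
        unfolding ip using p q'(1) by (simp add: ennreal_plus)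
      finally show ?thesis
        unfolding q'(2) A_def[symmetric] B_def[symmetric] a_def[symmetric] b_def[symmetric]
        by (simp add: mult_left_mono)
    qed
  qed
qed

lemma nn_integral_Holder_powr:
  assumes p: "1 < p"
    and [measurable]: "f \<in> borel_measurable M" "g \<in> borel_measurable M"
  shows "epowr (\<integral>\<^sup>+ x. f x * g x \<partial>M) p
     \<le> (\<integral>\<^sup>+ x. epowr (f x) p \<partial>M) * epowr (\<integral>\<^sup>+ x. epowr (g x) (p / (p - 1)) \<partial>M) (p - 1)"
proof -
  have "epowr (\<integral>\<^sup>+ x. f x * g x \<partial>M) p
     \<le> epowr (epowr (\<integral>\<^sup>+ x. epowr (f x) p \<partial>M) (1/p) * epowr (\<integral>\<^sup>+ x. epowr (g x) (p/(p-1)) \<partial>M) (1/(p/(p-1)))) p"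
    using p by (intro epowr_mono nn_integral_Holder) auto
  also have "\<dots> = (\<integral>\<^sup>+ x. epowr (f x) p \<partial>M) * epowr (\<integral>\<^sup>+ x. epowr (g x) (p / (p - 1)) \<partial>M) (p - 1)"
    using p by (simp add: epowr_mult) (simp add: epowr_epowr)
  finally show ?thesis .
qed

section \<open>Muckenhoupt weights\<close>

definition wt :: "(real \<Rightarrow> real) \<Rightarrow> real measure" where
  "wt w = density lborel (\<lambda>x. ennreal (w x))"

definition dualw :: "real \<Rightarrow> (real \<Rightarrow> real) \<Rightarrow> real \<Rightarrow> real" where
  "dualw p w x = w x powr (- 1 / (p - 1))"

abbreviation mass :: "(real \<Rightarrow> real) \<Rightarrow> real set \<Rightarrow> ennreal" where
  "mass w \<equiv> emeasure (wt w)"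

text \<open>The \<open>A\<^sub>p\<close> condition without quotients, for Borel weights that are positive everywhere. In this form it is manifestly
  symmetric in \<open>w\<close> and its dual weight.\<close>

definition Apw :: "real \<Rightarrow> real \<Rightarrow> (real \<Rightarrow> real) \<Rightarrow> bool" where
  "Apw p K w \<longleftrightarrow> w \<in> borel_measurable borel \<and> (\<forall>x. 0 < w x) \<and>
     (\<forall>a b. a < b \<longrightarrow> mass w {a..b} * epowr (mass (dualw p w) {a..b}) (p - 1)
        \<le> ennreal (K * (b - a) powr p))"

lemma sets_wt [simp, measurable_cong]: "sets (wt w) = sets borel"
  by (simp add: wt_def)

lemma space_wt [simp]: "space (wt w) = UNIV"
  by (simp add: wt_def)

abbreviation Lpow :: "real \<Rightarrow> (real \<Rightarrow> real) \<Rightarrow> (real \<Rightarrow> ennreal) \<Rightarrow> ennreal" where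
  "Lpow p w h \<equiv> (\<integral>\<^sup>+ x. epowr (h x) p \<partial>wt w)"

lemma dualw_measurable [measurable]: "w \<in> borel_measurable borel \<Longrightarrow> dualw p w \<in> borel_measurable borel"
  unfolding dualw_def by measurable

lemma nn_integral_wt:
  "w \<in> borel_measurable borel \<Longrightarrow> f \<in> borel_measurable borel \<Longrightarrow>
    (\<integral>\<^sup>+ x. f x \<partial>wt w) = (\<integral>\<^sup>+ x. ennreal (w x) * f x \<partial>lborel)"
  unfolding wt_def by (subst nn_integral_density) auto

lemma emeasure_wt:
  "w \<in> borel_measurable borel \<Longrightarrow> A \<in> sets borel \<Longrightarrow>
    mass w A = (\<integral>\<^sup>+ x\<in>A. ennreal (w x) \<partial>lborel)"
  unfolding wt_def by (subst emeasure_density) auto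

lemma emeasure_wt_pos:
  assumes [measurable]: "w \<in> borel_measurable borel" and w: "\<And>x. 0 < w x" and "a < b"
  shows "0 < mass w {a..b}"
proof (rule ccontr)
  assume "\<not> 0 < mass w {a..b}"
  then have "AE x in lborel. ennreal (w x) * indicator {a..b} x = 0"
    by (simp add: emeasure_wt nn_integral_0_iff_AE)
  then have "AE x in lborel. x \<notin> {a..b}"
  proof eventually_elim
    case (elim x)
    then show ?case using w[of x] by (auto split: split_indicator_asm simp: ennreal_eq_0_iff)
  qed
  then have "emeasure lborel {a..b} = 0"
    by (subst (asm) AE_iff_measurable[of "{a..b}"]) auto
  then show False using \<open>a < b\<close> by simp
qed

locale Ap =
  fixes p K :: real and w :: "real \<Rightarrow> real"
  assumes p: "1 < p" and Ap: "Apw p K w"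
begin

abbreviation "\<sigma> \<equiv> dualw p w"

lemma w_meas [measurable]: "w \<in> borel_measurable borel" and w_pos: "0 < w x"
  and Ap_bound: "a < b \<Longrightarrow> mass w {a..b} * epowr (mass \<sigma> {a..b}) (p - 1)
        \<le> ennreal (K * (b - a) powr p)"
  using Ap by (auto simp: Apw_def)

lemma \<sigma>_meas [measurable]: "\<sigma> \<in> borel_measurable borel" by measurable

lemma \<sigma>_pos: "0 < \<sigma> x" using w_pos[of x] by (simp add: dualw_def)

lemma w_interval: "a < b \<Longrightarrow> 0 < mass w {a..b}" "a < b \<Longrightarrow> mass w {a..b} < top"
  and \<sigma>_interval: "a < b \<Longrightarrow> 0 < mass \<sigma> {a..b}" "a < b \<Longrightarrow> mass \<sigma> {a..b} < top"
proof -
  assume ab: "a < b"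
  show 1: "0 < mass w {a..b}" "0 < mass \<sigma> {a..b}"
    using ab w_pos \<sigma>_pos by (auto intro!: emeasure_wt_pos)
  have "mass w {a..b} * epowr (mass \<sigma> {a..b}) (p - 1) < top"
    using Ap_bound[OF ab] le_less_trans by fastforce
  then show "mass w {a..b} < top" "mass \<sigma> {a..b} < top"
    using 1 by (auto simp: ennreal_mult_less_top)
      (metis epowr_eq_top_iff not_less_zero top.not_eq_extremum)+
qed

lemma K_pos: "0 < K"
proof -
  have "0 < mass w {0..1} * epowr (mass \<sigma> {0..1}) (p - 1)"
    using w_interval[of 0 1] \<sigma>_interval[of 0 1]
    by (simp add: ennreal_zero_less_mult_iff zero_less_iff_neq_zero)
  also have "\<dots> \<le> ennreal K" using Ap_bound[of 0 1] by simp
  finally show ?thesis by simp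
qed

lemma dual_dual: "dualw (p / (p - 1)) \<sigma> = w"
proof
  fix x
  have "- 1 / (p - 1) * (- 1 / (p / (p - 1) - 1)) = 1" using p by (simp add: field_simps)
  then show "dualw (p / (p - 1)) \<sigma> x = w x"
    using w_pos[of x] by (simp add: dualw_def powr_powr)
qed

lemma Apw_dual: "Apw (p / (p - 1)) (K powr (1 / (p - 1))) \<sigma>"
  unfolding Apw_def dual_dual
proof (intro conjI allI impI \<sigma>_pos \<sigma>_meas)
  fix a b :: real assume ab: "a < b"
  have e: "p / (p - 1) - 1 = 1 / (p - 1)" using p by (simp add: field_simps)
  have "mass \<sigma> {a..b} * epowr (mass w {a..b}) (p / (p - 1) - 1)
     = epowr (mass w {a..b} * epowr (mass \<sigma> {a..b}) (p - 1)) (1 / (p - 1))"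
    using p unfolding e by (simp add: epowr_mult mult.commute)
  also have "\<dots> \<le> epowr (ennreal (K * (b - a) powr p)) (1 / (p - 1))"
    using p by (intro epowr_mono Ap_bound ab) auto
  also have "\<dots> = ennreal (K powr (1 / (p - 1)) * (b - a) powr (p / (p - 1)))"
    using K_pos ab by (simp add: powr_mult powr_powr)
  finally show "mass \<sigma> {a..b} * epowr (mass w {a..b}) (p / (p - 1) - 1)
     \<le> ennreal (K powr (1 / (p - 1)) * (b - a) powr (p / (p - 1)))" .
qed

lemma dual_exponent: "1 < p / (p - 1)" "p / (p - 1) / (p / (p - 1) - 1) = p"
  using p by (auto simp: field_simps)

lemma Holder_dual:
  assumes [measurable]: "A \<in> sets borel" "f \<in> borel_measurable borel"
  shows "epowr (\<integral>\<^sup>+ x\<in>A. f x \<partial>lborel) p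
     \<le> (\<integral>\<^sup>+ x\<in>A. epowr (f x) p \<partial>wt w) * epowr (mass \<sigma> A) (p - 1)"
proof -
  have "(\<integral>\<^sup>+ x\<in>A. f x \<partial>lborel)
      = (\<integral>\<^sup>+ x. (f x * ennreal (w x powr (1/p)) * indicator A x) * (ennreal (w x powr (-1/p)) * indicator A x) \<partial>lborel)"
  proof (rule nn_integral_cong)
    fix x
    have "ennreal (w x powr (1/p)) * ennreal (w x powr (-1/p)) = 1"
      using w_pos[of x] by (simp add: ennreal_mult[symmetric] powr_add[symmetric])
    then show "f x * indicator A x
      = (f x * ennreal (w x powr (1/p)) * indicator A x) * (ennreal (w x powr (-1/p)) * indicator A x)"
      by (auto split: split_indicator simp: mult.assoc)
  qed
  then have "epowr (\<integral>\<^sup>+ x\<in>A. f x \<partial>lborel) p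
     \<le> (\<integral>\<^sup>+ x. epowr (f x * ennreal (w x powr (1/p)) * indicator A x) p \<partial>lborel)
       * epowr (\<integral>\<^sup>+ x. epowr (ennreal (w x powr (-1/p)) * indicator A x) (p/(p-1)) \<partial>lborel) (p-1)"
    by (simp only:) (intro nn_integral_Holder_powr p; measurable)
  also have "(\<integral>\<^sup>+ x. epowr (f x * ennreal (w x powr (1/p)) * indicator A x) p \<partial>lborel)
     = (\<integral>\<^sup>+ x\<in>A. epowr (f x) p \<partial>wt w)"
    using p w_pos by (subst nn_integral_wt)
      (auto intro!: nn_integral_cong split: split_indicator simp: epowr_mult powr_powr less_imp_le mult.commute)
  also have "(\<integral>\<^sup>+ x. epowr (ennreal (w x powr (-1/p)) * indicator A x) (p/(p-1)) \<partial>lborel)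
     = mass \<sigma> A"
    using p w_pos by (subst emeasure_wt)
      (auto intro!: nn_integral_cong split: split_indicator simp: powr_powr dualw_def)
  finally show ?thesis .
qed

text \<open>Hoelder's inequality with the dual weight turns the weight condition into a bound for averages.\<close>

lemma average_bound:
  assumes ab: "a < b" and A: "A \<in> sets borel" "A \<subseteq> {a..b}" and [measurable]: "f \<in> borel_measurable borel"
  shows "epowr (\<integral>\<^sup>+ x\<in>A. f x \<partial>lborel) p * mass w {a..b}
     \<le> ennreal (K * (b - a) powr p) * (\<integral>\<^sup>+ x\<in>A. epowr (f x) p \<partial>wt w)"
proof -
  have "epowr (\<integral>\<^sup>+ x\<in>A. f x \<partial>lborel) p
     \<le> (\<integral>\<^sup>+ x\<in>A. epowr (f x) p \<partial>wt w) * epowr (mass \<sigma> A) (p - 1)"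
    by (rule Holder_dual) (use A in auto)
  also have "epowr (mass \<sigma> A) (p - 1) \<le> epowr (mass \<sigma> {a..b}) (p - 1)"
    using p A by (intro epowr_mono emeasure_mono) auto
  finally have "epowr (\<integral>\<^sup>+ x\<in>A. f x \<partial>lborel) p * mass w {a..b}
     \<le> (\<integral>\<^sup>+ x\<in>A. epowr (f x) p \<partial>wt w) * epowr (mass \<sigma> {a..b}) (p - 1) * mass w {a..b}"
    by (simp add: mult_left_mono mult_right_mono)
  also have "\<dots> = (mass w {a..b} * epowr (mass \<sigma> {a..b}) (p - 1)) * (\<integral>\<^sup>+ x\<in>A. epowr (f x) p \<partial>wt w)"
    by (simp add: mult_ac)
  also have "\<dots> \<le> ennreal (K * (b - a) powr p) * (\<integral>\<^sup>+ x\<in>A. epowr (f x) p \<partial>wt w)"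
    by (intro mult_right_mono Ap_bound ab) auto
  finally show ?thesis .
qed

lemma measure_ratio:
  assumes ab: "a < b" and A: "A \<in> sets borel" "A \<subseteq> {a..b}"
  shows "epowr (emeasure lborel A) p * mass w {a..b}
     \<le> ennreal (K * (b - a) powr p) * mass w A"
  using average_bound[OF ab A, of "\<lambda>_. 1"] A by simp

end

lemma Ap_dual: "Ap p K w \<Longrightarrow> Ap (p / (p - 1)) (K powr (1 / (p - 1))) (dualw p w)"
  using Ap.Apw_dual Ap.dual_exponent(1) by (auto simp: Ap_def)

section \<open>Maximal functions\<close>

abbreviation rat_Icc :: "rat \<Rightarrow> rat \<Rightarrow> real set" where
  "rat_Icc a b \<equiv> {of_rat a..of_rat b}"

text \<open>Rational end points make the supremum countable and the maximal function measurable.\<close>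

definition maxfun :: "real measure \<Rightarrow> (real \<Rightarrow> ennreal) \<Rightarrow> real \<Rightarrow> ennreal" where
  "maxfun \<mu> f x = (SUP (a, b) \<in> {(a :: rat, b). a < b}.
     (\<integral>\<^sup>+ y\<in>rat_Icc a b. f y \<partial>\<mu>) / emeasure \<mu> (rat_Icc a b)
       * indicator (rat_Icc a b) x)"

lemma maxfun_measurable [measurable]:
  "maxfun \<mu> f \<in> borel_measurable borel"
  unfolding maxfun_def by (intro borel_measurable_SUP) (auto intro: countable_subset[OF subset_UNIV])

text \<open>In a subfamily of minimal cardinality with the same union no three intervals share a point: among three such
  intervals, the one that reaches furthest to the left and the one that reaches furthest to the right cover the
  third. This replaces the Vitali covering lemma on the line and does not require a doubling measure.\<close>

lemma finite_intervals_overlap: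
  fixes F :: "(real \<times> real) set"
  assumes "finite F"
  obtains G where "G \<subseteq> F" "(\<Union>(a,b)\<in>G. {a..b}) = (\<Union>(a,b)\<in>F. {a..b})"
    "\<And>x. card {(a,b)\<in>G. x \<in> {a..b}} \<le> 2"
proof -
  define P where "P G \<longleftrightarrow> G \<subseteq> F \<and> (\<Union>(a,b)\<in>G. {a..b}) = (\<Union>(a,b)\<in>F. {a..b})" for G
  have "P F" by (simp add: P_def)
  then obtain G where G: "P G" and least: "\<And>H. P H \<Longrightarrow> card G \<le> card H"
    using ex_has_least_nat[of P F card] by blast
  have finG: "finite G" using G assms by (auto simp: P_def intro: finite_subset)
  have "card {(a,b)\<in>G. x \<in> {a..b}} \<le> 2" for x
  proof (rule ccontr)
    let ?S = "{(a,b)\<in>G. x \<in> {a..b}}"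
    assume "\<not> card ?S \<le> 2"
    then have c: "3 \<le> card ?S" by simp
    have fS: "finite ?S" using finG by (rule rev_finite_subset) auto
    have neS: "?S \<noteq> {}" using c by (metis card.empty not_numeral_le_zero)
    obtain i where i: "i \<in> ?S" "\<And>k. k \<in> ?S \<Longrightarrow> fst i \<le> fst k"
      using arg_min_if_finite[OF fS neS, of fst] by (metis (no_types, lifting) not_le)
    obtain j where j: "j \<in> ?S" "\<And>k. k \<in> ?S \<Longrightarrow> - snd j \<le> - snd k"
      using arg_min_if_finite[OF fS neS, of "\<lambda>k. - snd k"] by (metis (no_types, lifting) not_le)
    obtain k where k: "k \<in> ?S" "k \<noteq> i" "k \<noteq> j"
    proof (atomize_elim, rule ccontr)
      assume "\<nexists>k. k \<in> ?S \<and> k \<noteq> i \<and> k \<noteq> j"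
      then have "?S \<subseteq> {i, j}" by blast
      then have "card ?S \<le> card {i, j}" by (intro card_mono) auto
      also have "\<dots> \<le> 2" by (simp add: card_insert_if)
      finally show False using c by simp
    qed
    have sub: "{fst k..snd k} \<subseteq> {fst i..snd i} \<union> {fst j..snd j}"
      using i(1) j(1) i(2)[OF k(1)] j(2)[OF k(1)] k(1) by (auto split: prod.splits)
    have ij: "i \<in> G - {k}" "j \<in> G - {k}" using i(1) j(1) k by auto
    have "(\<Union>I\<in>G. {fst I..snd I}) \<subseteq> (\<Union>I\<in>G - {k}. {fst I..snd I})"
    proof (rule UN_least)
      fix I assume "I \<in> G"
      show "{fst I..snd I} \<subseteq> (\<Union>I\<in>G - {k}. {fst I..snd I})"
      proof (cases "I = k")
        case True
        then show ?thesis using sub UN_upper[OF ij(1), of "\<lambda>I. {fst I..snd I}"]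
          UN_upper[OF ij(2), of "\<lambda>I. {fst I..snd I}"] by blast
      next
        case False
        then show ?thesis using \<open>I \<in> G\<close> UN_upper[of I "G - {k}" "\<lambda>I. {fst I..snd I}"] by blast
      qed
    qed
    then have "(\<Union>I\<in>G - {k}. {fst I..snd I}) = (\<Union>I\<in>G. {fst I..snd I})"
      by blast
    then have "P (G - {k})" using G unfolding P_def case_prod_beta by blast
    moreover have "card (G - {k}) < card G"
      using k finG by (auto intro!: psubset_card_mono)
    ultimately show False using least by fastforce
  qed
  then show ?thesis using that G by (auto simp: P_def)
qed

definition interval_measure :: "real measure \<Rightarrow> bool" where
  "interval_measure \<mu> \<longleftrightarrow> sets \<mu> = sets borel \<and>
     (\<forall>a b. a < b \<longrightarrow> 0 < emeasure \<mu> {a..b} \<and> emeasure \<mu> {a..b} < top)"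

lemma (in Ap) interval_measure_wt: "interval_measure (wt w)" "interval_measure (wt \<sigma>)"
  using w_interval \<sigma>_interval by (auto simp: interval_measure_def)

lemma interval_measure_lborel: "interval_measure lborel"
  by (auto simp: interval_measure_def)

lemma maxfun_upper:
  assumes "a < b" "x \<in> rat_Icc a b"
  shows "(\<integral>\<^sup>+ y\<in>rat_Icc a b. f y \<partial>\<mu>) / emeasure \<mu> (rat_Icc a b) \<le> maxfun \<mu> f x"
  unfolding maxfun_def
  by (rule SUP_upper2[of "(a,b)"]) (use assms in auto)

lemma maxfun_average:
  assumes "interval_measure \<mu>" "a < b" "x \<in> rat_Icc a b"
  shows "(\<integral>\<^sup>+ y\<in>rat_Icc a b. f y \<partial>\<mu>) \<le> emeasure \<mu> (rat_Icc a b) * maxfun \<mu> f x"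
proof -
  let ?m = "emeasure \<mu> (rat_Icc a b)"
  have "?m \<noteq> 0" "?m < top" using assms by (auto simp: interval_measure_def of_rat_less zero_less_iff_neq_zero)
  then have "(\<integral>\<^sup>+ y\<in>rat_Icc a b. f y \<partial>\<mu>) = ?m * ((\<integral>\<^sup>+ y\<in>rat_Icc a b. f y \<partial>\<mu>) / ?m)"
    by (metis ennreal_mult_divide_eq ennreal_times_divide mult.commute top.not_eq_extremum)
  also have "\<dots> \<le> ?m * maxfun \<mu> f x"
    by (intro mult_left_mono maxfun_upper assms) auto
  finally show ?thesis .
qed

lemma maxfun_weak_type:
  assumes mu: "interval_measure \<mu>" and [measurable]: "f \<in> borel_measurable borel"
  shows "l * emeasure \<mu> {x. l < maxfun \<mu> f x} \<le> 2 * (\<integral>\<^sup>+ x. f x \<partial>\<mu>)"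
proof -
  have [measurable_cong]: "sets \<mu> = sets borel" using mu by (simp add: interval_measure_def)
  define Q where "Q = {(a, b). a < b \<and>
     l * emeasure \<mu> (rat_Icc a b) \<le> (\<integral>\<^sup>+ y\<in>rat_Icc a b. f y \<partial>\<mu>)}"
  define J where "J n = (if from_nat n \<in> Q then (case from_nat n of (a,b) \<Rightarrow> {(real_of_rat a, real_of_rat b)}) else {})" for n :: nat
  define U where "U n = (\<Union>(a,b)\<in>(\<Union>i\<le>n. J i). {a..b})" for n
  have finJ: "finite (\<Union>i\<le>n. J i)" for n by (auto simp: J_def split: prod.splits)
  have Um [measurable]: "U n \<in> sets borel" for n
    unfolding U_def using finJ by (intro sets.finite_UN) auto
  have main: "l * emeasure \<mu> (U n) \<le> 2 * (\<integral>\<^sup>+ x. f x \<partial>\<mu>)" for n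
  proof -
    obtain G where G: "G \<subseteq> (\<Union>i\<le>n. J i)" "(\<Union>(a,b)\<in>G. {a..b}) = U n"
      "\<And>x. card {(a,b)\<in>G. x \<in> {a..b}} \<le> 2"
      by (rule finite_intervals_overlap[OF finJ[of n], folded U_def]) (rule that)
    have fG: "finite G" using G(1) finJ by (rule finite_subset)
    have "l * emeasure \<mu> (U n) \<le> l * (\<Sum>(a,b)\<in>G. emeasure \<mu> {a..b})"
      unfolding G(2)[symmetric] using fG
      by (intro mult_left_mono order_trans[OF emeasure_subadditive_finite]) (auto simp: case_prod_beta)
    also have "\<dots> = (\<Sum>(a,b)\<in>G. l * emeasure \<mu> {a..b})"
      by (simp add: sum_distrib_left case_prod_beta)
    also have "\<dots> \<le> (\<Sum>(a,b)\<in>G. (\<integral>\<^sup>+ y\<in>{a..b}. f y \<partial>\<mu>))"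
      using G(1) by (intro sum_mono) (auto simp: J_def Q_def split: if_split_asm prod.splits)
    also have "\<dots> = (\<integral>\<^sup>+ y. f y * (\<Sum>(a,b)\<in>G. indicator {a..b} y) \<partial>\<mu>)"
      by (simp add: case_prod_beta sum_distrib_left nn_integral_sum)
    also have "\<dots> \<le> (\<integral>\<^sup>+ y. f y * 2 \<partial>\<mu>)"
    proof (intro nn_integral_mono mult_left_mono)
      fix y
      have "(\<Sum>(a,b)\<in>G. indicator {a..b} y) = (\<Sum>k\<in>G. if k \<in> {(a,b)\<in>G. y \<in> {a..b}} then 1 else (0::ennreal))"
        by (intro sum.cong) (auto simp: indicator_def)
      also have "\<dots> = of_nat (card {(a,b)\<in>G. y \<in> {a..b}})"
        using fG by (simp add: sum.If_cases) (intro arg_cong[of _ _ card], auto)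
      also have "\<dots> \<le> of_nat 2" using G(3)[of y] by (simp only: of_nat_le_iff)
      finally show "(\<Sum>(a,b)\<in>G. indicator {a..b} y) \<le> (2::ennreal)" by simp
    qed auto
    finally show ?thesis by (simp add: nn_integral_multc mult.commute)
  qed
  have sub: "{x. l < maxfun \<mu> f x} \<subseteq> (\<Union>n. U n)"
  proof
    fix x assume "x \<in> {x. l < maxfun \<mu> f x}"
    then obtain a b where ab: "a < b" "l < (\<integral>\<^sup>+ y\<in>rat_Icc a b. f y \<partial>\<mu>) / emeasure \<mu> (rat_Icc a b)
       * indicator (rat_Icc a b) x"
      by (auto simp: maxfun_def less_SUP_iff)
    let ?m = "emeasure \<mu> (rat_Icc a b)"
    have m: "?m \<noteq> 0" "?m < top" using ab mu by (auto simp: interval_measure_def of_rat_less zero_less_iff_neq_zero)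
    have x: "x \<in> rat_Icc a b" and l: "l < (\<integral>\<^sup>+ y\<in>rat_Icc a b. f y \<partial>\<mu>) / ?m"
      using ab by (auto split: split_indicator_asm)
    have "l * ?m \<le> (\<integral>\<^sup>+ y\<in>rat_Icc a b. f y \<partial>\<mu>) / ?m * ?m"
      using l by (intro mult_right_mono) auto
    also have "\<dots> = (\<integral>\<^sup>+ y\<in>rat_Icc a b. f y \<partial>\<mu>)"
      using m by (metis ennreal_mult_divide_eq ennreal_times_divide mult.commute top.not_eq_extremum)
    finally have "(a, b) \<in> Q" using ab by (simp add: Q_def)
    then have "(of_rat a, of_rat b) \<in> J (to_nat (a, b))" by (simp add: J_def)
    then have "x \<in> U (to_nat (a, b))" using x unfolding U_def by fastforce
    then show "x \<in> (\<Union>n. U n)" by blast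
  qed
  have "l * emeasure \<mu> {x. l < maxfun \<mu> f x} \<le> l * emeasure \<mu> (\<Union>n. U n)"
    by (intro mult_left_mono emeasure_mono sub) auto
  also have "emeasure \<mu> (\<Union>n. U n) = (SUP n. emeasure \<mu> (U n))"
  proof (rule SUP_emeasure_incseq[symmetric])
    show "range U \<subseteq> sets \<mu>" by auto
    show "incseq U" unfolding incseq_def U_def by (intro allI impI UN_mono) auto
  qed
  also have "l * (SUP n. emeasure \<mu> (U n)) = (SUP n. l * emeasure \<mu> (U n))"
    by (rule SUP_mult_left_ennreal)
  also have "\<dots> \<le> 2 * (\<integral>\<^sup>+ x. f x \<partial>\<mu>)"
    by (intro SUP_least main)
  finally show ?thesis .
qed

lemma maxfun_mono:
  "(\<And>x. f x \<le> g x) \<Longrightarrow> maxfun \<mu> f x \<le> maxfun \<mu> g x"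
  unfolding maxfun_def
  by (intro SUP_mono') (auto simp: case_prod_beta intro!: mult_right_mono divide_right_mono_ennreal nn_integral_mono)

lemma maxfun_cmult:
  assumes "interval_measure \<mu>" and [measurable]: "f \<in> borel_measurable borel"
  shows "maxfun \<mu> (\<lambda>x. c * f x) x = c * maxfun \<mu> f x"
proof -
  have [measurable_cong]: "sets \<mu> = sets borel" using assms by (simp add: interval_measure_def)
  show ?thesis
    unfolding maxfun_def SUP_mult_left_ennreal
    by (intro SUP_cong) (auto simp: mult.assoc nn_integral_cmult divide_ennreal_def)
qed

lemma maxfun_suminf:
  assumes "interval_measure \<mu>" and [measurable]: "\<And>n. f n \<in> borel_measurable borel"
  shows "maxfun \<mu> (\<lambda>x. \<Sum>n. f n x) x \<le> (\<Sum>n. maxfun \<mu> (f n) x)"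
proof -
  have [measurable_cong]: "sets \<mu> = sets borel" using assms by (simp add: interval_measure_def)
  show ?thesis
    unfolding maxfun_def[of _ "\<lambda>x. \<Sum>n. f n x"]
  proof (intro SUP_least, clarify)
    fix a b :: rat assume ab: "a < b"
    have "(\<integral>\<^sup>+ y\<in>rat_Icc a b. (\<Sum>n. f n y) \<partial>\<mu>) / emeasure \<mu> (rat_Icc a b) * indicator (rat_Icc a b) x
      = (\<Sum>n. (\<integral>\<^sup>+ y\<in>rat_Icc a b. f n y \<partial>\<mu>) / emeasure \<mu> (rat_Icc a b) * indicator (rat_Icc a b) x)"
    proof -
      have "(\<integral>\<^sup>+ y\<in>rat_Icc a b. (\<Sum>n. f n y) \<partial>\<mu>)
         = (\<Sum>n. (\<integral>\<^sup>+ y\<in>rat_Icc a b. f n y \<partial>\<mu>))"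
        by (simp add: nn_integral_suminf flip: ennreal_suminf_multc)
      then show ?thesis by simp
    qed
    also have "\<dots> \<le> (\<Sum>n. maxfun \<mu> (f n) x)"
      by (intro suminf_le) (auto intro!: maxfun_upper ab split: split_indicator)
    finally show "(\<integral>\<^sup>+ y\<in>rat_Icc a b. (\<Sum>n. f n y) \<partial>\<mu>) / emeasure \<mu> (rat_Icc a b) * indicator (rat_Icc a b) x \<le> (\<Sum>n. maxfun \<mu> (f n) x)" .
  qed
qed

lemma maxfun_add_const:
  assumes mu: "interval_measure \<mu>" and [measurable]: "f \<in> borel_measurable borel"
  shows "maxfun \<mu> (\<lambda>x. f x + c) x \<le> maxfun \<mu> f x + c"
proof -
  have [measurable_cong]: "sets \<mu> = sets borel" using assms by (simp add: interval_measure_def)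
  show ?thesis
    unfolding maxfun_def[of _ "\<lambda>x. f x + c"]
  proof (intro SUP_least, clarify)
    fix a b :: rat assume ab: "a < b"
    let ?I = "rat_Icc a b"
    have m: "emeasure \<mu> ?I \<noteq> 0" "emeasure \<mu> ?I < top"
      using ab mu by (auto simp: interval_measure_def of_rat_less zero_less_iff_neq_zero)
    show "(\<integral>\<^sup>+ y\<in>?I. (f y + c) \<partial>\<mu>) / emeasure \<mu> ?I * indicator ?I x \<le> maxfun \<mu> f x + c"
    proof (cases "x \<in> ?I")
      case True
      have "(\<integral>\<^sup>+ y\<in>?I. (f y + c) \<partial>\<mu>) / emeasure \<mu> ?I
         = (\<integral>\<^sup>+ y\<in>?I. f y \<partial>\<mu>) / emeasure \<mu> ?I + c * emeasure \<mu> ?I / emeasure \<mu> ?I"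
        by (simp add: distrib_right nn_integral_add nn_integral_cmult_indicator add_divide_distrib_ennreal)
      also have "c * emeasure \<mu> ?I / emeasure \<mu> ?I = c"
        using m by (intro ennreal_mult_divide_eq) auto
      finally show ?thesis using maxfun_upper[OF ab, where f = f and \<mu> = \<mu> and x = x] True by (simp add: add_right_mono)
    qed auto
  qed
qed

definition max_const :: "real \<Rightarrow> real" where
  "max_const p = 2 powr p * 4 * (1 / (1 - 2 powr - (p - 1))) * 2 powr (p - 1)"

lemma max_const_pos: "1 < p \<Longrightarrow> 0 < max_const p"
  unfolding max_const_def by (intro mult_pos_pos) (auto simp: powr_less_one)

text \<open>Marcinkiewicz interpolation between the weak type bound and the trivial bound on \<open>L\<^sup>\<infinity>\<close>: above the level \<open>t\<close> only the
  part of \<open>f\<close> that exceeds \<open>t / 2\<close> matters.\<close>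

lemma maxfun_strong_type:
  assumes p: "1 < p" and mu: "interval_measure \<mu>" and [measurable]: "f \<in> borel_measurable borel"
  shows "(\<integral>\<^sup>+ x. epowr (maxfun \<mu> f x) p \<partial>\<mu>) \<le> ennreal (max_const p) * (\<integral>\<^sup>+ x. epowr (f x) p \<partial>\<mu>)"
proof -
  have se [measurable_cong]: "sets \<mu> = sets borel" using mu by (simp add: interval_measure_def)
  have sp: "space \<mu> = UNIV" using sets_eq_imp_space_eq[OF se] by simp
  have level: "emeasure \<mu> {x. ennreal (2 powr m) < maxfun \<mu> f x}
     \<le> 4 * ennreal (2 powr - m) * (\<integral>\<^sup>+ x. f x * indicator {x. ennreal (2 powr m) < 2 * f x} x \<partial>\<mu>)" for m :: real
  proof -
    define l where "l = (2::real) powr m / 2"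
    define h where "h x = f x * indicator {x. ennreal (2 powr m) < 2 * f x} x" for x
    have hm [measurable]: "h \<in> borel_measurable borel" unfolding h_def by measurable
    have l: "0 < l" "ennreal (2 powr m) = ennreal l + ennreal l"
      by (auto simp: l_def ennreal_plus[symmetric] simp del: ennreal_plus)
    have "f x \<le> h x + ennreal l" for x
    proof (cases "ennreal (2 powr m) < 2 * f x")
      case True then show ?thesis by (simp add: h_def)
    next
      case False
      then have "2 * f x \<le> 2 * ennreal l" using l by (simp add: mult_2)
      then have "f x \<le> ennreal l" by (subst (asm) ennreal_mult_le_mult_iff) auto
      then show ?thesis by (simp add: add_increasing)
    qed
    then have mx: "maxfun \<mu> f x \<le> maxfun \<mu> h x + ennreal l" for x
      by (intro order_trans[OF maxfun_mono maxfun_add_const[OF mu hm]])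
    have "{x. ennreal (2 powr m) < maxfun \<mu> f x} \<subseteq> {x. ennreal l < maxfun \<mu> h x}"
    proof (intro subsetI CollectI, rule ccontr)
      fix x assume x: "x \<in> {x. ennreal (2 powr m) < maxfun \<mu> f x}" and "\<not> ennreal l < maxfun \<mu> h x"
      then have "maxfun \<mu> h x + ennreal l \<le> ennreal l + ennreal l" by (intro add_right_mono) simp
      then have "maxfun \<mu> f x \<le> ennreal (2 powr m)" unfolding l(2) by (rule order_trans[OF mx])
      then show False using x by simp
    qed
    then have "ennreal l * emeasure \<mu> {x. ennreal (2 powr m) < maxfun \<mu> f x} \<le> ennreal l * emeasure \<mu> {x. ennreal l < maxfun \<mu> h x}"
      by (intro mult_left_mono emeasure_mono) auto
    also have "\<dots> \<le> 2 * (\<integral>\<^sup>+ x. h x \<partial>\<mu>)" by (rule maxfun_weak_type[OF mu hm])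
    finally have "ennreal (1/l) * (ennreal l * emeasure \<mu> {x. ennreal (2 powr m) < maxfun \<mu> f x}) \<le> ennreal (1/l) * (2 * (\<integral>\<^sup>+ x. h x \<partial>\<mu>))"
      by (rule mult_left_mono) auto
    also have "ennreal (1/l) * (ennreal l * emeasure \<mu> {x. ennreal (2 powr m) < maxfun \<mu> f x}) = emeasure \<mu> {x. ennreal (2 powr m) < maxfun \<mu> f x}"
      using l(1) by (simp add: mult.assoc[symmetric] ennreal_mult[symmetric])
    also have "ennreal (1/l) = 2 * ennreal (2 powr - m)"
      using ennreal_mult[of 2 "2 powr - m"] by (simp add: l_def powr_minus field_simps)
    finally show ?thesis by (simp add: h_def mult_ac)
  qed
  have r: "2 powr - (p - 1) < (1::real)" using p by (auto simp: powr_less_one)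
  have "(\<integral>\<^sup>+ x. epowr (maxfun \<mu> f x) p \<partial>\<mu>) \<le> (\<integral>\<^sup>+ x. ennreal (2 powr p) * layer 2 p (maxfun \<mu> f x) \<partial>\<mu>)"
    using p by (intro nn_integral_mono epowr_le_layer) auto
  also have "\<dots> = ennreal (2 powr p) * (\<integral>\<^sup>+ x. layer 2 p (maxfun \<mu> f x) \<partial>\<mu>)"
    by (intro nn_integral_cmult) measurable
  also have "(\<integral>\<^sup>+ x. layer 2 p (maxfun \<mu> f x) \<partial>\<mu>)
     = sumZ (\<lambda>m. ennreal (2 powr (p * real_of_int m)) * emeasure \<mu> {x. ennreal (2 powr m) < maxfun \<mu> f x})"
    by (subst nn_integral_layer) (auto simp: sp)
  also have "\<dots> \<le> sumZ (\<lambda>m. ennreal (2 powr (p * real_of_int m)) * (4 * ennreal (2 powr - real_of_int m)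
       * (\<integral>\<^sup>+ x. f x * indicator {x. ennreal (2 powr real_of_int m) < 2 * f x} x \<partial>\<mu>)))"
    by (intro sumZ_mono mult_left_mono level) auto
  also have "\<dots> = sumZ (\<lambda>m. (\<integral>\<^sup>+ x. 4 * (f x * (ennreal (2 powr ((p - 1) * real_of_int m)) * indicator {m::int. ennreal (2 powr real_of_int m) < 2 * f x} m)) \<partial>\<mu>))"
  proof (rule nn_integral_cong)
    fix m :: int
    have e: "ennreal (2 powr (p * real_of_int m)) * ennreal (2 powr - real_of_int m) = ennreal (2 powr ((p - 1) * real_of_int m))"
      by (simp add: ennreal_mult[symmetric] powr_add[symmetric] algebra_simps)
    have "ennreal (2 powr (p * real_of_int m)) * (4 * ennreal (2 powr - real_of_int m)
       * (\<integral>\<^sup>+ x. f x * indicator {x. ennreal (2 powr real_of_int m) < 2 * f x} x \<partial>\<mu>))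
      = 4 * (ennreal (2 powr (p * real_of_int m)) * ennreal (2 powr - real_of_int m)) * (\<integral>\<^sup>+ x. f x * indicator {x. ennreal (2 powr real_of_int m) < 2 * f x} x \<partial>\<mu>)"
      by (simp add: mult_ac)
    also have "\<dots> = (\<integral>\<^sup>+ x. 4 * ennreal (2 powr ((p - 1) * real_of_int m)) * (f x * indicator {x. ennreal (2 powr real_of_int m) < 2 * f x} x) \<partial>\<mu>)"
      unfolding e by (rule nn_integral_cmult[symmetric]) measurable
    also have "\<dots> = (\<integral>\<^sup>+ x. 4 * (f x * (ennreal (2 powr ((p - 1) * real_of_int m)) * indicator {m::int. ennreal (2 powr real_of_int m) < 2 * f x} m)) \<partial>\<mu>)"
      by (intro nn_integral_cong) (auto split: split_indicator simp: mult_ac)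
    finally show "ennreal (2 powr (p * real_of_int m)) * (4 * ennreal (2 powr - real_of_int m)
       * (\<integral>\<^sup>+ x. f x * indicator {x. ennreal (2 powr real_of_int m) < 2 * f x} x \<partial>\<mu>)) = \<dots>" .
  qed
  also have "\<dots> = (\<integral>\<^sup>+ x. sumZ (\<lambda>m. 4 * (f x * (ennreal (2 powr ((p - 1) * real_of_int m)) * indicator {m::int. ennreal (2 powr real_of_int m) < 2 * f x} m))) \<partial>\<mu>)"
    by (rule nn_integral_count_space_nn_integral[symmetric]) (auto simp: indicator_def)
  also have "\<dots> = (\<integral>\<^sup>+ x. 4 * (f x * layer 2 (p - 1) (2 * f x)) \<partial>\<mu>)"
    unfolding layer_def by (simp add: nn_integral_cmult)
  also have "\<dots> \<le> (\<integral>\<^sup>+ x. 4 * (f x * (ennreal (1 / (1 - 2 powr - (p - 1))) * epowr (2 * f x) (p - 1))) \<partial>\<mu>)"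
    using p by (intro nn_integral_mono mult_left_mono layer_le_epowr) auto
  also have "\<dots> = (\<integral>\<^sup>+ x. ennreal (4 * (1 / (1 - 2 powr - (p - 1))) * 2 powr (p - 1)) * epowr (f x) p \<partial>\<mu>)"
  proof (rule nn_integral_cong)
    fix x
    have a: "epowr (2::ennreal) (p - 1) = ennreal (2 powr (p - 1))" using epowr_ennreal[of 2 "p - 1"] by simp
    have b: "epowr (f x) p = f x * epowr (f x) (p - 1)" using epowr_add[of 1 "p - 1" "f x"] p by simp
    have c: "ennreal (4 * (1 / (1 - 2 powr - (p - 1))) * 2 powr (p - 1)) = 4 * ennreal (1 / (1 - 2 powr - (p - 1))) * ennreal (2 powr (p - 1))"
      using r by (subst ennreal_mult; (subst ennreal_mult)?) auto
    show "4 * (f x * (ennreal (1 / (1 - 2 powr - (p - 1))) * epowr (2 * f x) (p - 1)))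
      = ennreal (4 * (1 / (1 - 2 powr - (p - 1))) * 2 powr (p - 1)) * epowr (f x) p"
      unfolding b c using p by (simp add: epowr_mult a mult_ac)
  qed
  also have "\<dots> = ennreal (4 * (1 / (1 - 2 powr - (p - 1))) * 2 powr (p - 1)) * (\<integral>\<^sup>+ x. epowr (f x) p \<partial>\<mu>)"
    by (rule nn_integral_cmult) measurable
  finally have "(\<integral>\<^sup>+ x. epowr (maxfun \<mu> f x) p \<partial>\<mu>) \<le> ennreal (2 powr p) * (ennreal (4 * (1 / (1 - 2 powr - (p - 1))) * 2 powr (p - 1)) * (\<integral>\<^sup>+ x. epowr (f x) p \<partial>\<mu>))"
    by (simp add: mult_left_mono)
  also have "\<dots> = ennreal (max_const p) * (\<integral>\<^sup>+ x. epowr (f x) p \<partial>\<mu>)"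
    using r unfolding max_const_def
    by (subst mult.assoc[symmetric], subst ennreal_mult[symmetric]) (auto simp: mult_ac)
  finally show ?thesis .
qed


text \<open>On an interval \<open>I\<close> the average of \<open>f\<close> is the product of \<open>\<sigma>(I) / |I|\<close> and the \<open>\<sigma>\<close>-average of \<open>f / \<sigma>\<close>. The latter is
  at most \<open>N\<close> everywhere on \<open>I\<close>, so its power \<open>p - 1\<close> is at most an average of \<open>N\<close> and hence a \<open>w\<close>-average of \<open>g\<close>; the
  weight condition absorbs the remaining factors.\<close>

lemma (in Ap) maxfun_pointwise:
  assumes [measurable]: "f \<in> borel_measurable borel"
  defines "N \<equiv> maxfun (wt \<sigma>) (\<lambda>y. f y * ennreal (1 / \<sigma> y))"
  defines "g \<equiv> \<lambda>y. epowr (N y) (p - 1) * ennreal (1 / w y)"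
  shows "epowr (maxfun lborel f x) (p - 1) \<le> ennreal K * maxfun (wt w) g x"
proof -
  have [measurable]: "N \<in> borel_measurable borel" "g \<in> borel_measurable borel"
    unfolding N_def g_def by measurable
  have *: "epowr ((\<integral>\<^sup>+ y\<in>rat_Icc a b. f y \<partial>lborel) / emeasure lborel (rat_Icc a b)) (p - 1)
     \<le> ennreal K * maxfun (wt w) g x" if ab: "a < b" and x: "x \<in> rat_Icc a b" for a b
  proof -
    let ?I = "rat_Icc a b"
    define L where "L = real_of_rat b - of_rat a"
    define F where "F = (\<integral>\<^sup>+ y\<in>?I. f y \<partial>lborel)"
    define s where "s = mass \<sigma> ?I"
    define t where "t = F / s"
    have L: "0 < L" using ab by (simp add: L_def of_rat_less)
    have s: "0 < s" "s < top" using \<sigma>_interval[of "of_rat a" "of_rat b"] ab by (auto simp: s_def of_rat_less)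
    have F: "F = (\<integral>\<^sup>+ y\<in>?I. f y * ennreal (1 / \<sigma> y) \<partial>wt \<sigma>)"
      unfolding F_def
    proof (subst nn_integral_wt, measurable, rule nn_integral_cong)
      fix y
      have "ennreal (\<sigma> y) * ennreal (1 / \<sigma> y) = 1" using \<sigma>_pos[of y] by (simp add: ennreal_mult[symmetric])
      then show "f y * indicator ?I y = ennreal (\<sigma> y) * (f y * ennreal (1 / \<sigma> y) * indicator ?I y)"
        by (metis mult.assoc mult.commute mult.right_neutral)
    qed
    have tN: "t \<le> N y" if "y \<in> ?I" for y
      unfolding t_def s_def F N_def by (rule maxfun_upper[OF ab that])
    have "epowr t (p - 1) * ennreal L = (\<integral>\<^sup>+ y\<in>?I. epowr t (p - 1) \<partial>lborel)"
      using ab by (subst nn_integral_cmult_indicator) (auto simp: L_def of_rat_less_eq)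
    also have "\<dots> \<le> (\<integral>\<^sup>+ y\<in>?I. epowr (N y) (p - 1) \<partial>lborel)"
      using p tN by (intro nn_integral_mono) (auto split: split_indicator intro!: epowr_mono)
    also have "\<dots> = (\<integral>\<^sup>+ y\<in>?I. g y \<partial>wt w)"
    proof (subst nn_integral_wt, measurable, rule nn_integral_cong)
      fix y
      have "ennreal (w y) * ennreal (1 / w y) = 1" using w_pos[of y] by (simp add: ennreal_mult[symmetric])
      then show "epowr (N y) (p - 1) * indicator ?I y = ennreal (w y) * (g y * indicator ?I y)"
        unfolding g_def by (metis mult.assoc mult.commute mult.right_neutral)
    qed
    also have "\<dots> \<le> mass w ?I * maxfun (wt w) g x"
      by (rule maxfun_average[OF interval_measure_wt(1) ab x])
    finally have 1: "epowr t (p - 1) * ennreal L \<le> mass w ?I * maxfun (wt w) g x" .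
    have F': "F = t * s"
      using s unfolding t_def by (metis ennreal_mult_divide_eq ennreal_times_divide mult.commute less_irrefl)
    have Ld: "F / emeasure lborel ?I = t * s * ennreal (1 / L)"
      using ab L by (simp add: F' divide_ennreal_def L_def[symmetric] of_rat_less_eq inverse_ennreal inverse_eq_divide)
    have "(1 / L) powr (p - 1) = L powr (1 - p)"
      using powr_minus_divide[of L "p - 1"] L by (simp add: powr_divide)
    then have "epowr (F / emeasure lborel ?I) (p - 1) = epowr t (p - 1) * epowr s (p - 1) * ennreal (L powr - (p - 1))"
      unfolding Ld using p L by (simp add: epowr_mult)
    also have "ennreal (L powr - (p - 1)) = ennreal L * ennreal (L powr - p)"
      using L by (simp add: ennreal_mult[symmetric] powr_minus_divide powr_diff)
    also have "epowr t (p - 1) * epowr s (p - 1) * (ennreal L * ennreal (L powr - p))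
       = (epowr t (p - 1) * ennreal L) * (epowr s (p - 1) * ennreal (L powr - p))"
      by (simp add: mult_ac)
    also have "\<dots> \<le> (mass w ?I * maxfun (wt w) g x) * (epowr s (p - 1) * ennreal (L powr - p))"
      by (intro mult_right_mono 1) auto
    also have "\<dots> = (mass w ?I * epowr s (p - 1)) * (ennreal (L powr - p) * maxfun (wt w) g x)"
      by (simp add: mult_ac)
    also have "\<dots> \<le> ennreal (K * L powr p) * (ennreal (L powr - p) * maxfun (wt w) g x)"
      unfolding s_def L_def using ab by (intro mult_right_mono Ap_bound) (auto simp: of_rat_less)
    also have "\<dots> = ennreal K * maxfun (wt w) g x"
      using L K_pos by (simp add: mult.assoc[symmetric] ennreal_mult[symmetric] powr_minus_divide)
    finally show ?thesis by (simp add: F_def)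
  qed
  show ?thesis
    unfolding maxfun_def[of lborel] epowr_SUP[OF p[THEN iffD2[OF diff_gt_0_iff_gt]]]
  proof (intro SUP_least, clarify)
    fix a b :: rat assume ab: "a < b"
    let ?q = "(\<integral>\<^sup>+ y\<in>rat_Icc a b. f y \<partial>lborel) / emeasure lborel (rat_Icc a b)"
    show "epowr (?q * indicator (rat_Icc a b) x) (p - 1) \<le> ennreal K * maxfun (wt w) g x"
      using *[OF ab] by (cases "x \<in> rat_Icc a b") simp_all
  qed
qed

text \<open>Muckenhoupt's theorem, by Lerner's argument: the pointwise bound dominates the maximal function by
  two maximal functions with respect to the measures \<open>w\<close> and \<open>\<sigma>\<close>, each bounded with a
  constant that does not see the weight.\<close>

lemma (in Ap) maxfun_bounded:
  assumes [measurable]: "f \<in> borel_measurable borel"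
  shows "Lpow p w (maxfun lborel f)
     \<le> ennreal (K powr (p/(p-1)) * max_const (p/(p-1)) * max_const p) * Lpow p w f"
proof -
  let ?q = "p / (p - 1)"
  define N where "N = maxfun (wt \<sigma>) (\<lambda>y. f y * ennreal (1 / \<sigma> y))"
  define g where "g = (\<lambda>y. epowr (N y) (p - 1) * ennreal (1 / w y))"
  have [measurable]: "N \<in> borel_measurable borel" "g \<in> borel_measurable borel"
    unfolding N_def g_def by measurable
  have q: "1 < ?q" "(p - 1) * ?q = p" using p by auto
  have "Lpow p w (maxfun lborel f) \<le> (\<integral>\<^sup>+ x. ennreal (K powr ?q) * epowr (maxfun (wt w) g x) ?q \<partial>wt w)"
  proof (rule nn_integral_mono)
    fix x
    have "epowr (maxfun lborel f x) p = epowr (epowr (maxfun lborel f x) (p - 1)) ?q"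
      using p q by (subst epowr_epowr) auto
    also have "\<dots> \<le> epowr (ennreal K * maxfun (wt w) g x) ?q"
      using q maxfun_pointwise[of f x, folded N_def, folded g_def] by (intro epowr_mono) auto
    finally show "epowr (maxfun lborel f x) p \<le> ennreal (K powr ?q) * epowr (maxfun (wt w) g x) ?q"
      using q K_pos by (simp add: epowr_mult)
  qed
  also have "\<dots> = ennreal (K powr ?q) * Lpow ?q w (\<lambda>x. maxfun (wt w) g x)"
    by (rule nn_integral_cmult) measurable
  also have "Lpow ?q w (\<lambda>x. maxfun (wt w) g x) \<le> ennreal (max_const ?q) * Lpow ?q w g"
    by (intro maxfun_strong_type q interval_measure_wt) measurable
  also have "Lpow ?q w g = Lpow p \<sigma> N"
  proof -
    have "Lpow ?q w g = (\<integral>\<^sup>+ x. ennreal (w x) * epowr (g x) ?q \<partial>lborel)"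
      "Lpow p \<sigma> N = (\<integral>\<^sup>+ x. ennreal (\<sigma> x) * epowr (N x) p \<partial>lborel)"
      by (intro nn_integral_wt; measurable)+
    moreover have "(\<integral>\<^sup>+ x. ennreal (w x) * epowr (g x) ?q \<partial>lborel) = (\<integral>\<^sup>+ x. ennreal (\<sigma> x) * epowr (N x) p \<partial>lborel)"
    proof (rule nn_integral_cong)
    fix x
    have "w x * (1 / w x) powr ?q = w x powr (1 - ?q)"
      using w_pos[of x] by (simp add: powr_diff powr_divide)
    also have "1 - ?q = - 1 / (p - 1)" using p by (simp add: field_simps)
    finally have "ennreal (w x) * ennreal ((1 / w x) powr ?q) = ennreal (\<sigma> x)"
      using w_pos[of x] by (simp add: ennreal_mult[symmetric] dualw_def)
    moreover have "epowr (g x) ?q = ennreal ((1 / w x) powr ?q) * epowr (N x) p"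
      unfolding g_def using p q w_pos[of x] by (simp add: epowr_mult epowr_epowr mult.commute)
    ultimately show "ennreal (w x) * epowr (g x) ?q = ennreal (\<sigma> x) * epowr (N x) p"
      by (simp add: mult.assoc[symmetric])
  qed
  ultimately show ?thesis by simp
  qed
  also have "\<dots> \<le> ennreal (max_const p) * Lpow p \<sigma> (\<lambda>x. f x * ennreal (1 / \<sigma> x))"
    unfolding N_def by (intro maxfun_strong_type p interval_measure_wt) measurable
  also have "Lpow p \<sigma> (\<lambda>x. f x * ennreal (1 / \<sigma> x)) = Lpow p w f"
  proof -
    have "Lpow p \<sigma> (\<lambda>x. f x * ennreal (1 / \<sigma> x)) = (\<integral>\<^sup>+ x. ennreal (\<sigma> x) * epowr (f x * ennreal (1 / \<sigma> x)) p \<partial>lborel)"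
      "Lpow p w f = (\<integral>\<^sup>+ x. ennreal (w x) * epowr (f x) p \<partial>lborel)"
      by (intro nn_integral_wt; measurable)+
    moreover have "(\<integral>\<^sup>+ x. ennreal (\<sigma> x) * epowr (f x * ennreal (1 / \<sigma> x)) p \<partial>lborel) = (\<integral>\<^sup>+ x. ennreal (w x) * epowr (f x) p \<partial>lborel)"
    proof (rule nn_integral_cong)
    fix x
    have "\<sigma> x * (1 / \<sigma> x) powr p = \<sigma> x powr (1 - p)"
      using \<sigma>_pos[of x] by (simp add: powr_diff powr_divide)
    also have "\<dots> = w x powr (- 1 / (p - 1) * (1 - p))" unfolding dualw_def by (rule powr_powr)
    also have "- 1 / (p - 1) * (1 - p) = 1" using p by (simp add: field_simps)
    finally have "ennreal (\<sigma> x) * ennreal ((1 / \<sigma> x) powr p) = ennreal (w x)"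
      using w_pos[of x] \<sigma>_pos[of x] by (simp add: ennreal_mult[symmetric])
    then show "ennreal (\<sigma> x) * epowr (f x * ennreal (1 / \<sigma> x)) p = ennreal (w x) * epowr (f x) p"
      using p \<sigma>_pos[of x] by (simp add: epowr_mult) (metis mult.assoc mult.commute)
  qed
  ultimately show ?thesis by simp
  qed
  finally have "Lpow p w (maxfun lborel f)
     \<le> ennreal (K powr ?q) * (ennreal (max_const ?q) * (ennreal (max_const p) * Lpow p w f))"
    by (simp add: mult_left_mono)
  then show ?thesis
    using max_const_pos[OF p] max_const_pos[OF q(1)] by (simp add: ennreal_mult mult.assoc)
qed

section \<open>Rubio de Francia extrapolation\<close>

lemma maxfun_pos:
  assumes [measurable]: "g \<in> borel_measurable borel" and nz: "\<not> (AE x in lborel. g x = 0)"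
  shows "0 < maxfun lborel g x"
proof -
  define I where "I n = {real_of_rat (- of_nat n)..of_rat (of_nat n)}" for n
  have I: "I n = {- real n..real n}" for n by (simp add: I_def of_rat_minus)
  have "\<exists>n. (\<integral>\<^sup>+ y\<in>I n. g y \<partial>lborel) \<noteq> 0 \<and> x \<in> I n \<and> 0 < n"
  proof (rule ccontr)
    assume *: "\<not> ?thesis"
    obtain n0 :: nat where n0: "\<bar>x\<bar> \<le> real n0" using real_arch_simple by blast
    have "x \<in> I (n + Suc n0)" "0 < n + Suc n0" for n
      using n0 by (auto simp: I)
    then have "(\<integral>\<^sup>+ y\<in>I (n + Suc n0). g y \<partial>lborel) = 0" for n
      using * by blast
    then have "AE y in lborel. \<forall>n. g y * indicator (I (n + Suc n0)) y = 0"
      by (subst AE_all_countable, subst (asm) nn_integral_0_iff_AE) (auto simp: I)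
    then have "AE y in lborel. g y = 0"
    proof eventually_elim
      case (elim y)
      obtain n :: nat where "\<bar>y\<bar> \<le> real n" using real_arch_simple by blast
      then have "y \<in> I (n + Suc n0)" by (auto simp: I)
      then show ?case using elim[rule_format, of n] by simp
    qed
    then show False using nz by simp
  qed
  then obtain n where n: "(\<integral>\<^sup>+ y\<in>I n. g y \<partial>lborel) \<noteq> 0" "x \<in> I n" "0 < n" by blast
  have "0 < (\<integral>\<^sup>+ y\<in>I n. g y \<partial>lborel) / emeasure lborel (I n)"
    unfolding ennreal_zero_less_divide
  proof
    show "0 < (\<integral>\<^sup>+ y\<in>I n. g y \<partial>lborel)" using n(1) by (simp add: zero_less_iff_neq_zero)
    show "emeasure lborel (I n) < top" by (simp add: I)
  qed
  also have "\<dots> \<le> maxfun lborel g x"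
    using n unfolding I_def by (intro maxfun_upper) auto
  finally show ?thesis .
qed

text \<open>The Rubio de Francia iteration: the geometrically damped sum of all iterates of the maximal
  operator majorises its starting function, has comparable norm, and is an \<open>A\<^sub>1\<close> weight.\<close>

abbreviation A1_majorized :: "real \<Rightarrow> (real \<Rightarrow> real) \<Rightarrow> real \<Rightarrow> (real \<Rightarrow> ennreal) \<Rightarrow> bool" where
  "A1_majorized p w B g \<equiv> \<exists>u\<in>borel_measurable borel. (\<forall>x. g x \<le> u x) \<and>
     (\<forall>x. maxfun lborel u x \<le> ennreal B * u x) \<and> (\<forall>x. 0 < u x) \<and> Lpow p w u \<le> ennreal B * Lpow p w g"

lemma (in Ap) A1_majorant:
  "\<exists>B>0. \<forall>g\<in>borel_measurable borel. \<not> (AE x in lborel. g x = 0) \<longrightarrow>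
     A1_majorized p w B g"
proof -
  define C where "C = K powr (p/(p-1)) * max_const (p/(p-1)) * max_const p"
  have C: "0 < C" using K_pos max_const_pos[OF p] max_const_pos[OF dual_exponent(1)] by (simp add: C_def)
  define D where "D = C powr (1/p)"
  have D: "0 < D" "D powr p = C" using C p by (auto simp: D_def powr_powr)
  define B where "B = max (4 * D) (2 powr p * 2)"
  have B: "0 < B" "4 * D \<le> B" "2 powr p * 2 \<le> B" using D by (auto simp: B_def)
  show ?thesis
  proof (intro exI[of _ B] conjI ballI impI B(1))
    fix g :: "real \<Rightarrow> ennreal"
    assume g [measurable]: "g \<in> borel_measurable borel" and nz: "\<not> (AE x in lborel. g x = 0)"
    define T where "T n = (maxfun lborel ^^ n) g" for n
    have T0: "T 0 = g" and TS: "T (Suc n) = maxfun lborel (T n)" for n by (auto simp: T_def)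
    have Tm [measurable]: "T n \<in> borel_measurable borel" for n
      by (induction n) (auto simp: T0 TS)
    \<comment> \<open>\<open>T n\<close> has norm at most \<open>D^n\<close> times that of \<open>g\<close>, so that even \<open>2^n c n T n\<close> decays geometrically\<close>
    define c where "c n = (1 / (4 * D)) ^ n" for n :: nat
    have c: "0 < c n" "c n = 4 * D * c (Suc n)" for n using D by (auto simp: c_def)
    define u where "u x = (\<Sum>n. ennreal (c n) * T n x)" for x
    have um [measurable]: "u \<in> borel_measurable borel" unfolding u_def by measurable
    have ule: "ennreal (c n) * T n x \<le> u x" for n x
      unfolding u_def using sum_le_suminf[of "\<lambda>n. ennreal (c n) * T n x" "{n}"] by simp
    have gu: "g x \<le> u x" for x using ule[of 0 x] by (simp add: T0 c_def)
    have Mu: "maxfun lborel u x \<le> ennreal (4 * D) * u x" for x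
    proof -
      have "maxfun lborel u x \<le> (\<Sum>n. maxfun lborel (\<lambda>x. ennreal (c n) * T n x) x)"
        unfolding u_def by (intro maxfun_suminf interval_measure_lborel) measurable
      also have "\<dots> = (\<Sum>n. ennreal (4 * D) * (ennreal (c (Suc n)) * T (Suc n) x))"
        by (intro suminf_cong)
          (simp add: maxfun_cmult interval_measure_lborel TS c(2)[symmetric] c(1) less_imp_le D mult.assoc[symmetric] ennreal_mult[symmetric])
      also have "\<dots> = ennreal (4 * D) * (\<Sum>n. ennreal (c (Suc n)) * T (Suc n) x)" by simp
      also have "(\<Sum>n. ennreal (c (Suc n)) * T (Suc n) x) \<le> u x"
        unfolding u_def by (subst (2) suminf_offset[of _ 1]) (auto intro: summableI)
      finally show ?thesis by (simp add: mult_left_mono)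
    qed
    have MuB: "maxfun lborel u x \<le> ennreal B * u x" for x
      using B by (intro order_trans[OF Mu] mult_right_mono ennreal_leI) auto
    have unz: "\<not> (AE x in lborel. u x = 0)"
    proof
      assume "AE x in lborel. u x = 0"
      then have "AE x in lborel. g x = 0" by eventually_elim (use gu in \<open>metis le_zero_eq\<close>)
      then show False using nz by simp
    qed
    have upos: "0 < u x" for x
    proof (rule ccontr)
      assume "\<not> 0 < u x"
      then have "maxfun lborel u x \<le> 0" using MuB[of x] by simp
      then show False using maxfun_pos[OF um unz, of x] by simp
    qed
    have Tn: "Lpow p w (T n) \<le> ennreal (C ^ n) * Lpow p w g" for n
    proof (induction n)
      case (Suc n)
      have "Lpow p w (\<lambda>x. T (Suc n) x) \<le> ennreal C * Lpow p w (T n)"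
        unfolding TS C_def by (rule maxfun_bounded) measurable
      also have "\<dots> \<le> ennreal C * (ennreal (C ^ n) * Lpow p w g)"
        by (intro mult_left_mono Suc) auto
      finally show ?case using C by (simp add: ennreal_mult mult.assoc)
    qed (simp add: T0)
    have up: "epowr (u x) p \<le> ennreal (2 powr p) * (\<Sum>n. ennreal ((2 ^ n * c n) powr p) * epowr (T n x) p)" for x
    proof -
      define S where "S = (\<Sum>n. ennreal ((2 ^ n * c n) powr p) * epowr (T n x) p)"
      have "ennreal (c n) * T n x \<le> ennreal ((1/2) ^ n) * epowr S (1/p)" for n
      proof -
        have "ennreal ((2 ^ n * c n) powr p) * epowr (T n x) p \<le> S"
          unfolding S_def using sum_le_suminf[of "\<lambda>n. ennreal ((2 ^ n * c n) powr p) * epowr (T n x) p" "{n}"] by simp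
        then have "epowr (ennreal (2 ^ n * c n) * T n x) p \<le> S"
          using p c(1)[of n] by (simp add: epowr_mult less_imp_le)
        then have "ennreal (2 ^ n * c n) * T n x \<le> epowr S (1/p)"
          using p by (simp add: epowr_le_iff)
        then have "ennreal ((1/2)^n) * (ennreal (2 ^ n * c n) * T n x) \<le> ennreal ((1/2)^n) * epowr S (1/p)"
          by (rule mult_left_mono) auto
        then show ?thesis using c(1)[of n]
          by (simp add: mult.assoc[symmetric] ennreal_mult[symmetric] power_one_over less_imp_le)
      qed
      then have "u x \<le> (\<Sum>n. ennreal ((1/2) ^ n) * epowr S (1/p))"
        unfolding u_def by (intro suminf_le) auto
      also have "\<dots> = (\<Sum>n. ennreal ((1/2) ^ n)) * epowr S (1/p)" by simp
      also have "(\<Sum>n. ennreal ((1/2) ^ n)) = 2"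
        by (subst suminf_ennreal2) (auto simp: suminf_geometric summable_geometric)
      finally have "epowr (u x) p \<le> epowr (2 * epowr S (1/p)) p" using p by (intro epowr_mono) auto
      also have "\<dots> = epowr (ennreal 2) p * S" using p by (simp add: epowr_mult)
      also have "epowr (ennreal 2) p = ennreal (2 powr p)" by (rule epowr_ennreal) simp
      finally show ?thesis by (simp add: S_def)
    qed
    have half: "(2 ^ n * c n) powr p * C ^ n \<le> (1/2) ^ n" for n
    proof -
      have "(2 ^ n * c n) powr p * C ^ n = ((1 / (2 * D)) powr p * C) ^ n"
      proof -
        have "2 ^ n * c n = (1 / (2 * D)) ^ n" by (simp add: c_def power_mult_distrib[symmetric])
        also have "\<dots> powr p = ((1 / (2 * D)) powr p) ^ n"
          using D by (simp add: powr_realpow[symmetric] powr_powr powr_mult mult.commute)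
        finally show ?thesis by (simp add: power_mult_distrib)
      qed
      also have "(1 / (2 * D)) powr p * C = 1 / 2 powr p"
        using C D by (simp add: powr_divide powr_mult)
      also have "(1 / 2 powr p) ^ n \<le> (1/2::real) ^ n"
        using p powr_mono[of 1 p 2] by (intro power_mono) (auto simp: field_simps)
      finally show ?thesis .
    qed
    have "Lpow p w u \<le> (\<integral>\<^sup>+ x. ennreal (2 powr p) * (\<Sum>n. ennreal ((2 ^ n * c n) powr p) * epowr (T n x) p) \<partial>wt w)"
      by (intro nn_integral_mono up)
    also have "\<dots> = ennreal (2 powr p) * (\<Sum>n. ennreal ((2 ^ n * c n) powr p) * Lpow p w (T n))"
      by (simp add: nn_integral_cmult nn_integral_suminf)
    also have "\<dots> \<le> ennreal (2 powr p) * (\<Sum>n. ennreal ((1/2)^n) * Lpow p w g)"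
    proof (intro mult_left_mono suminf_le allI)
      fix n
      have "ennreal ((2 ^ n * c n) powr p) * Lpow p w (T n)
         \<le> ennreal ((2 ^ n * c n) powr p) * (ennreal (C ^ n) * Lpow p w g)"
        by (intro mult_left_mono Tn) auto
      also have "\<dots> = ennreal ((2 ^ n * c n) powr p * C ^ n) * Lpow p w g"
        using C by (simp add: ennreal_mult mult.assoc)
      also have "\<dots> \<le> ennreal ((1/2)^n) * Lpow p w g"
        by (intro mult_right_mono ennreal_leI half) auto
      finally show "ennreal ((2 ^ n * c n) powr p) * Lpow p w (T n)
         \<le> ennreal ((1/2)^n) * Lpow p w g" .
    qed auto
    also have "\<dots> = ennreal (2 powr p) * ((\<Sum>n. ennreal ((1/2)^n)) * Lpow p w g)"
      by simp
    also have "(\<Sum>n. ennreal ((1/2) ^ n)) = ennreal 2"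
      by (subst suminf_ennreal2) (auto simp: suminf_geometric summable_geometric)
    also have "ennreal (2 powr p) * (ennreal 2 * Lpow p w g) = ennreal (2 powr p * 2) * Lpow p w g"
      by (subst ennreal_mult) (auto simp: mult.assoc)
    also have "\<dots> \<le> ennreal B * Lpow p w g"
      using B by (intro mult_right_mono ennreal_leI) auto
    finally have "Lpow p w u \<le> ennreal B * Lpow p w g" .
    then show "A1_majorized p w B g"
      using gu MuB upos um by blast
  qed
qed

text \<open>The end points of the interval are approximated by rational ones from outside; this is the source of the factor two.\<close>

lemma A1_average:
  assumes u [measurable]: "u \<in> borel_measurable borel" and Mu: "maxfun lborel u x \<le> ennreal B * u x"
    and x: "x \<in> {a..b}" and ab: "a < b" and B: "0 < B"
  shows "(\<integral>\<^sup>+ y\<in>{a..b}. u y \<partial>lborel) \<le> ennreal (2 * B * (b - a)) * u x"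
proof -
  define d where "d = (b - a) / 2"
  obtain a' :: rat where a': "a - d < of_rat a'" "of_rat a' < a"
    using of_rat_dense[of "a - d" a] ab by (auto simp: d_def)
  obtain b' :: rat where b': "b < of_rat b'" "of_rat b' < b + d"
    using of_rat_dense[of b "b + d"] ab by (auto simp: d_def)
  have ab': "a' < b'" using a' b' ab by (metis less_trans of_rat_less)
  have "(\<integral>\<^sup>+ y\<in>{a..b}. u y \<partial>lborel) \<le> (\<integral>\<^sup>+ y\<in>rat_Icc a' b'. u y \<partial>lborel)"
    using a' b' by (intro nn_integral_mono) (auto split: split_indicator)
  also have "\<dots> \<le> emeasure lborel (rat_Icc a' b') * maxfun lborel u x"
    using a' b' x by (intro maxfun_average interval_measure_lborel ab') auto
  also have "\<dots> \<le> ennreal (2 * (b - a)) * (ennreal B * u x)"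
  proof (intro mult_mono Mu)
    have "real_of_rat b' - of_rat a' \<le> 2 * (b - a)" using a' b' unfolding d_def by argo
    then show "emeasure lborel (rat_Icc a' b') \<le> ennreal (2 * (b - a))"
      using ab' by (simp add: of_rat_less_eq ennreal_leI)
  qed auto
  also have "\<dots> = ennreal (2 * B * (b - a)) * u x"
  proof -
    have "ennreal (2 * B * (b - a)) = ennreal (2 * (b - a)) * ennreal B"
      using ab B by (subst ennreal_mult[symmetric]) (auto simp: mult_ac)
    then show ?thesis by (simp only: mult.assoc)
  qed
  finally show ?thesis .
qed

lemma interval_not_AE: "a < b \<Longrightarrow> \<not> (AE x in lborel. x \<notin> {a..b::real})"
proof
  assume "a < b" "AE x in lborel. x \<notin> {a..b}"
  then have "emeasure lborel {a..b} = 0"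
    by (subst (asm) AE_iff_measurable[of "{a..b}"]) auto
  then show False using \<open>a < b\<close> by simp
qed

lemma A1_integral:
  assumes u [measurable]: "u \<in> borel_measurable borel" and Mu: "\<And>x. maxfun lborel u x \<le> ennreal B * u x"
    and pos: "\<And>x. 0 < u x" and fin: "AE x in lborel. u x \<noteq> top" and ab: "a < b" and B: "0 < B"
  obtains A where "0 < A" "(\<integral>\<^sup>+ y\<in>{a..b}. u y \<partial>lborel) = ennreal A"
    "\<And>x. x \<in> {a..b} \<Longrightarrow> ennreal (A / (2 * B * (b - a))) \<le> u x"
proof -
  let ?i = "(\<integral>\<^sup>+ y\<in>{a..b}. u y \<partial>lborel)"
  have up: "?i \<le> ennreal (2 * B * (b - a)) * u x" if "x \<in> {a..b}" for x
    by (rule A1_average[OF u Mu that ab B])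
  have "\<exists>x\<in>{a..b}. u x \<noteq> top"
  proof (rule ccontr)
    assume "\<not> ?thesis"
    then have "AE x in lborel. x \<notin> {a..b}" using fin by (auto elim: eventually_mono)
    then show False using interval_not_AE[OF ab] by simp
  qed
  then obtain x where "x \<in> {a..b}" "u x \<noteq> top" by blast
  then have "?i \<noteq> top" using up[of x] by (auto simp: top_unique ennreal_mult_eq_top_iff)
  then obtain A where A: "?i = ennreal A" "0 \<le> A" by (metis ennreal_cases)
  have "?i \<noteq> 0"
  proof
    assume "?i = 0"
    then have "AE x in lborel. u x * indicator {a..b} x = 0" by (simp add: nn_integral_0_iff_AE)
    then have "AE x in lborel. x \<notin> {a..b}"
    proof eventually_elim
      case (elim x) then show ?case using pos[of x] by (auto split: split_indicator_asm)
    qed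
    then show False using interval_not_AE[OF ab] by simp
  qed
  then have A0: "0 < A" using A by (cases "A = 0") auto
  show ?thesis
  proof (rule that[OF A0 A(1)])
    fix x assume x: "x \<in> {a..b}"
    let ?c = "2 * B * (b - a)"
    have c: "0 < ?c" using B ab by simp
    have "ennreal (1 / ?c) * ennreal A \<le> ennreal (1 / ?c) * (ennreal ?c * u x)"
      using up[OF x] unfolding A(1) by (rule mult_left_mono) auto
    also have "\<dots> = u x" using B ab by (simp add: mult.assoc[symmetric] ennreal_mult[symmetric])
    finally show "ennreal (A / ?c) \<le> u x" using c A0 by (simp add: ennreal_mult[symmetric])
  qed
qed

text \<open>The easy half of the factorization of \<open>A\<^sub>s\<close> weights through pairs of \<open>A\<^sub>1\<close> weights: an \<open>A\<^sub>1\<close> weight is bounded below on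
  an interval by its average, which is used for the factor with the negative exponent in \<open>W\<close> and in its dual.\<close>

lemma A1_product_Ap:
  assumes s: "1 < s" and B: "0 < B"
    and [measurable]: "u \<in> borel_measurable borel" "H \<in> borel_measurable borel"
    and Mu: "\<And>x. maxfun lborel u x \<le> ennreal B * u x" and MH: "\<And>x. maxfun lborel H x \<le> ennreal B * H x"
    and pos: "\<And>x. 0 < u x" "\<And>x. 0 < H x"
    and fin: "AE x in lborel. u x \<noteq> top" "AE x in lborel. H x \<noteq> top"
  obtains u' H' where "u' \<in> borel_measurable borel" "H' \<in> borel_measurable borel"
    "\<And>x. 0 < u' x" "\<And>x. 0 < H' x"
    "AE x in lborel. u x = ennreal (u' x) \<and> H x = ennreal (H' x)"
    "Ap s ((2 * B) powr s) (\<lambda>x. u' x powr (1 - s) * H' x)"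
proof -
  define u' where "u' x = (if u x = top then 1 else enn2real (u x))" for x
  define H' where "H' x = (if H x = top then 1 else enn2real (H x))" for x
  have m [measurable]: "u' \<in> borel_measurable borel" "H' \<in> borel_measurable borel"
    unfolding u'_def H'_def by measurable
  have pos': "0 < u' x" "0 < H' x" for x
    using pos[of x] by (auto simp: u'_def H'_def enn2real_positive_iff top.not_eq_extremum)
  have ae: "AE x in lborel. u x = ennreal (u' x) \<and> H x = ennreal (H' x)"
    using fin by eventually_elim (simp add: u'_def H'_def top.not_eq_extremum)
  define W where "W x = u' x powr (1 - s) * H' x" for x
  have Wm [measurable]: "W \<in> borel_measurable borel" unfolding W_def by measurable
  have Wpos: "0 < W x" for x using pos'[of x] by (simp add: W_def)
  have "mass W {a..b} * epowr (mass (dualw s W) {a..b}) (s - 1)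
        \<le> ennreal ((2 * B) powr s * (b - a) powr s)" if ab: "a < b" for a b
  proof -
    obtain A where A: "0 < A" "(\<integral>\<^sup>+ y\<in>{a..b}. u y \<partial>lborel) = ennreal A"
      "\<And>x. x \<in> {a..b} \<Longrightarrow> ennreal (A / (2 * B * (b - a))) \<le> u x"
      using A1_integral[of u B a b] Mu pos fin ab B by (metis assms(3))
    obtain E where E: "0 < E" "(\<integral>\<^sup>+ y\<in>{a..b}. H y \<partial>lborel) = ennreal E"
      "\<And>x. x \<in> {a..b} \<Longrightarrow> ennreal (E / (2 * B * (b - a))) \<le> H x"
      using A1_integral[of H B a b] MH pos fin ab B by (metis assms(4))
    define c where "c = 2 * B * (b - a)"
    have c: "0 < c" using B ab by (simp add: c_def)
    have "mass W {a..b} = (\<integral>\<^sup>+ x\<in>{a..b}. ennreal (W x) \<partial>lborel)"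
      by (rule emeasure_wt) auto
    also have "\<dots> \<le> (\<integral>\<^sup>+ x. ennreal ((A / c) powr (1 - s)) * (H x * indicator {a..b} x) \<partial>lborel)"
    proof (rule nn_integral_mono_AE, use ae in eventually_elim)
      case (elim x)
      show ?case
      proof (cases "x \<in> {a..b}")
        case True
        then have "A / c \<le> u' x" using A(3)[OF True] elim pos'[of x] by (simp add: c_def)
        then have "u' x powr (1 - s) \<le> (A / c) powr (1 - s)" using A(1) c s by (intro powr_mono2') auto
        then have "W x \<le> (A / c) powr (1 - s) * H' x" unfolding W_def using pos'[of x] by (intro mult_right_mono) auto
        then show ?thesis using elim True pos'[of x] by (simp add: ennreal_mult[symmetric] ennreal_leI)
      qed auto
    qed
    also have "\<dots> = ennreal ((A / c) powr (1 - s)) * ennreal E"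
      unfolding E(2)[symmetric] by (rule nn_integral_cmult) measurable
    finally have 1: "mass W {a..b} \<le> ennreal ((A / c) powr (1 - s) * E)"
      by (simp add: ennreal_mult')
    have "mass (dualw s W) {a..b} = (\<integral>\<^sup>+ x\<in>{a..b}. ennreal (dualw s W x) \<partial>lborel)"
      by (rule emeasure_wt) auto
    also have "\<dots> \<le> (\<integral>\<^sup>+ x. ennreal ((E / c) powr (- 1 / (s - 1))) * (u x * indicator {a..b} x) \<partial>lborel)"
    proof (rule nn_integral_mono_AE, use ae in eventually_elim)
      case (elim x)
      show ?case
      proof (cases "x \<in> {a..b}")
        case True
        then have "E / c \<le> H' x" using E(3)[OF True] elim pos'[of x] by (simp add: c_def)
        then have le: "H' x powr (- 1 / (s - 1)) \<le> (E / c) powr (- 1 / (s - 1))"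
          using E(1) c s by (intro powr_mono2') auto
        have "(1 - s) * (- 1 / (s - 1)) = 1" using s by (simp add: field_simps)
        then have "dualw s W x = u' x * H' x powr (- 1 / (s - 1))"
          using pos'[of x] by (simp add: dualw_def W_def powr_mult powr_powr)
        also have "\<dots> \<le> (E / c) powr (- 1 / (s - 1)) * u' x"
          using le pos'[of x] by (subst mult.commute) (intro mult_right_mono, auto)
        finally show ?thesis using elim True pos'[of x] by (simp add: ennreal_mult[symmetric] ennreal_leI)
      qed auto
    qed
    also have "\<dots> = ennreal ((E / c) powr (- 1 / (s - 1))) * ennreal A"
      unfolding A(2)[symmetric] by (rule nn_integral_cmult) measurable
    finally have "mass (dualw s W) {a..b} \<le> ennreal ((E / c) powr (- 1 / (s - 1)) * A)"
      by (simp add: ennreal_mult')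
    then have 2: "epowr (mass (dualw s W) {a..b}) (s - 1) \<le> epowr (ennreal ((E / c) powr (- 1 / (s - 1)) * A)) (s - 1)"
      using s by (intro epowr_mono) auto
    have "- 1 / (s - 1) * (s - 1) = - 1" using s by (simp add: field_simps)
    then have e: "((E / c) powr (- 1 / (s - 1)) * A) powr (s - 1) = (E / c) powr - 1 * A powr (s - 1)"
      using A(1) by (simp only: powr_mult powr_powr)
    have "mass W {a..b} * epowr (mass (dualw s W) {a..b}) (s - 1)
       \<le> ennreal ((A / c) powr (1 - s) * E) * ennreal ((E / c) powr - 1 * A powr (s - 1))"
      using mult_mono[OF 1 2] A(1) unfolding e[symmetric] by simp
    also have "\<dots> = ennreal (((A / c) powr (1 - s) * E) * ((E / c) powr - 1 * A powr (s - 1)))"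
      using A E by (intro ennreal_mult[symmetric]) auto
    also have "((A / c) powr (1 - s) * E) * ((E / c) powr - 1 * A powr (s - 1)) = c powr s"
    proof -
      have "(A / c) powr (1 - s) = c powr (s - 1) / A powr (s - 1)"
        using A c powr_minus_divide[of "A / c" "s - 1"] by (simp add: powr_divide)
      moreover have "(E / c) powr - 1 = c / E" using E c by (simp add: powr_minus_divide)
      moreover have "c powr s = c powr (s - 1) * c" using c by (simp add: powr_diff)
      ultimately show ?thesis using A E by simp
    qed
    also have "c powr s = (2 * B) powr s * (b - a) powr s" using ab B by (simp add: c_def powr_mult)
    finally show ?thesis .
  qed
  then have "Ap s ((2 * B) powr s) W" using s Wm Wpos by (auto simp: Ap_def Apw_def)
  then show ?thesis using that[OF m pos' ae] by (simp add: W_def[abs_def])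
qed

lemma AE_finite_wt:
  assumes [measurable]: "w \<in> borel_measurable borel" "u \<in> borel_measurable borel"
    and w: "\<And>x. 0 < w x" and "Lpow p w u < top"
  shows "AE x in lborel. u x \<noteq> top"
proof -
  have "AE x in wt w. epowr (u x) p \<noteq> \<infinity>"
    using assms(4) by (intro nn_integral_noteq_infinite) auto
  then show ?thesis
    unfolding wt_def by (subst (asm) AE_density) (use w in auto)
qed

text \<open>By duality the norm of \<open>U\<close> is the integral of \<open>U\<close> against \<open>h\<close>, which lies in the dual space. Replace \<open>h\<close> and \<open>g\<close> by
  their \<open>A\<^sub>1\<close> majorants \<open>H\<close> and \<open>u\<close>. Then \<open>W = u\<^sup>1\<^sup>-\<^sup>s H\<close> is an \<open>A\<^sub>s\<close> weight; Hoelder's inequality bounds \<open>\<integral> V H\<close> by the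
  \<open>L\<^sup>s(W)\<close> norm of \<open>V\<close> and a power of \<open>\<integral> u H\<close>, the hypothesis replaces \<open>V\<close> by \<open>S \<le> g \<le> u\<close>, and the powers of \<open>\<integral> u H\<close> combine
  to the first.

  The function \<open>g\<close> is separate from \<open>S\<close> because a majorant exists only for a function that is not null; \<open>U\<close> is a truncation
  of \<open>V\<close>, since its norm is divided out.\<close>

lemma (in Ap) extrapolation_step:
  assumes s: "1 < s" and B: "0 < B"
    and B1: "\<And>g. g \<in> borel_measurable borel \<Longrightarrow> \<not> (AE x in lborel. g x = 0) \<Longrightarrow>
     A1_majorized p w B g"
    and B2: "\<And>g. g \<in> borel_measurable borel \<Longrightarrow> \<not> (AE x in lborel. g x = 0) \<Longrightarrow>
     A1_majorized (p / (p - 1)) \<sigma> B g"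
    and [measurable]: "V \<in> borel_measurable borel" "S \<in> borel_measurable borel" "g \<in> borel_measurable borel"
      "U \<in> borel_measurable borel"
    and hyp: "\<And>W. Ap s ((2 * B) powr s) W \<Longrightarrow> Lpow s W V \<le> ennreal C * Lpow s W S"
    and C: "0 \<le> C" and Sg: "AE x in lborel. S x \<le> g x" and gnz: "\<not> (AE x in lborel. g x = 0)"
    and gfin: "Lpow p w g < top"
    and UV: "\<And>x. U x \<le> V x" and Ufin: "Lpow p w U < top"
  shows "Lpow p w U \<le> ennreal (C powr (p / s) * B powr p) * Lpow p w g"
proof (cases "AE x in lborel. U x = 0")
  case True
  then have "Lpow p w U = 0"
    by (subst nn_integral_wt, measurable) (subst nn_integral_0_iff_AE, measurable, auto elim: eventually_mono)
  then show ?thesis by simp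
next
  case False
  let ?q = "p / (p - 1)"
  define X where "X = Lpow p w U"
  define Y where "Y = Lpow p w g"
  have Xw: "X = (\<integral>\<^sup>+ x. ennreal (w x) * epowr (U x) p \<partial>lborel)" unfolding X_def by (rule nn_integral_wt) auto
  have X0: "X \<noteq> 0"
  proof
    assume "X = 0"
    then have "AE x in lborel. ennreal (w x) * epowr (U x) p = 0" unfolding Xw by (subst (asm) nn_integral_0_iff_AE) auto
    then have "AE x in lborel. U x = 0"
    proof eventually_elim
      case (elim x) then show ?case using w_pos[of x] by (auto simp: ennreal_eq_0_iff)
    qed
    then show False using False by simp
  qed
  \<comment> \<open>\<open>h\<close> is the extremal function for the duality of \<open>L\<^sup>p(w)\<close> and \<open>L\<^sup>q(\<sigma>)\<close>\<close>
  define h where "h x = epowr (U x) (p - 1) * ennreal (w x)" for x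
  have hm [measurable]: "h \<in> borel_measurable borel" unfolding h_def by measurable
  have hnz: "\<not> (AE x in lborel. h x = 0)"
  proof
    assume "AE x in lborel. h x = 0"
    then have "AE x in lborel. U x = 0"
    proof eventually_elim
      case (elim x) then show ?case using w_pos[of x] by (auto simp: h_def ennreal_eq_0_iff)
    qed
    then show False using False by simp
  qed
  have hX: "Lpow ?q \<sigma> h = X"
  proof -
    have "Lpow ?q \<sigma> h = (\<integral>\<^sup>+ x. ennreal (\<sigma> x) * epowr (h x) ?q \<partial>lborel)"
      by (rule nn_integral_wt) auto
    also have "\<dots> = X" unfolding Xw
    proof (rule nn_integral_cong)
      fix x
      have "\<sigma> x * w x powr ?q = w x powr (- 1 / (p - 1) + ?q)" by (simp only: dualw_def powr_add)
      also have "- 1 / (p - 1) + ?q = 1" using p by (simp add: diff_divide_distrib[symmetric])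
      finally have "ennreal (\<sigma> x) * ennreal (w x powr ?q) = ennreal (w x)"
        using w_pos[of x] \<sigma>_pos[of x] by (simp add: ennreal_mult[symmetric])
      moreover have "epowr (h x) ?q = ennreal (w x powr ?q) * epowr (U x) p"
        unfolding h_def using p w_pos[of x] by (simp add: epowr_mult epowr_epowr mult.commute)
      ultimately show "ennreal (\<sigma> x) * epowr (h x) ?q = ennreal (w x) * epowr (U x) p"
        by (simp add: mult.assoc[symmetric])
    qed
    finally show ?thesis .
  qed
  obtain u where u [measurable]: "u \<in> borel_measurable borel" "\<And>x. g x \<le> u x"
    "\<And>x. maxfun lborel u x \<le> ennreal B * u x" "\<And>x. 0 < u x" "Lpow p w u \<le> ennreal B * Y"
    using B1[of g] gnz unfolding Y_def by auto
  obtain H where H [measurable]: "H \<in> borel_measurable borel" "\<And>x. h x \<le> H x"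
    "\<And>x. maxfun lborel H x \<le> ennreal B * H x" "\<And>x. 0 < H x" "Lpow ?q \<sigma> H \<le> ennreal B * X"
    using B2[of h] hnz unfolding hX by auto
  have ufin: "AE x in lborel. u x \<noteq> top"
    by (rule AE_finite_wt[where w = w and p = p]) (use u gfin w_pos in \<open>auto simp: Y_def ennreal_mult_less_top intro: le_less_trans\<close>)
  have Hfin: "AE x in lborel. H x \<noteq> top"
    by (rule AE_finite_wt[where w = \<sigma> and p = ?q]) (use H Ufin \<sigma>_pos in \<open>auto simp: X_def ennreal_mult_less_top intro: le_less_trans\<close>)
  obtain u' H' where m [measurable]: "u' \<in> borel_measurable borel" "H' \<in> borel_measurable borel"
    and pos': "\<And>x. 0 < u' x" "\<And>x. 0 < H' x"
    and ae: "AE x in lborel. u x = ennreal (u' x) \<and> H x = ennreal (H' x)"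
    and ApW: "Ap s ((2 * B) powr s) (\<lambda>x. u' x powr (1 - s) * H' x)"
    using A1_product_Ap[OF s B u(1) H(1) u(3) H(3) u(4) H(4) ufin Hfin] by blast
  define W where "W x = u' x powr (1 - s) * H' x" for x
  have Wm [measurable]: "W \<in> borel_measurable borel" unfolding W_def by measurable
  have Wpos: "0 < W x" for x using pos'[of x] by (simp add: W_def)
  define Z where "Z = (\<integral>\<^sup>+ x. u x * H x \<partial>lborel)"
  have XH: "X \<le> (\<integral>\<^sup>+ x. V x * H x \<partial>lborel)"
    unfolding Xw
  proof (rule nn_integral_mono)
    fix x
    have "ennreal (w x) * epowr (U x) p = U x * h x"
      using epowr_add[of 1 "p - 1" "U x"] p by (simp add: h_def mult_ac)
    also have "\<dots> \<le> V x * H x" by (intro mult_mono UV H) auto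
    finally show "ennreal (w x) * epowr (U x) p \<le> V x * H x" .
  qed
  also have "(\<integral>\<^sup>+ x. V x * H x \<partial>lborel) = (\<integral>\<^sup>+ x. (V x * ennreal (W x powr (1/s))) * ennreal (H' x * W x powr (-1/s)) \<partial>lborel)"
  proof (rule nn_integral_cong_AE, use ae in eventually_elim)
    case (elim x)
    have "W x powr (1/s) * (H' x * W x powr (-1/s)) = H' x"
      using Wpos[of x] by (simp add: powr_minus_divide)
    then have "ennreal (W x powr (1/s)) * ennreal (H' x * W x powr (-1/s)) = ennreal (H' x)"
      using pos'[of x] by (simp add: ennreal_mult[symmetric])
    then show ?case using elim by (simp add: mult.assoc)
  qed
  finally have "epowr X s \<le> epowr (\<integral>\<^sup>+ x. (V x * ennreal (W x powr (1/s))) * ennreal (H' x * W x powr (-1/s)) \<partial>lborel) s"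
    using s by (intro epowr_mono) auto
  also have "\<dots> \<le> (\<integral>\<^sup>+ x. epowr (V x * ennreal (W x powr (1/s))) s \<partial>lborel)
      * epowr (\<integral>\<^sup>+ x. epowr (ennreal (H' x * W x powr (-1/s))) (s / (s - 1)) \<partial>lborel) (s - 1)"
    by (intro nn_integral_Holder_powr s) measurable
  also have "(\<integral>\<^sup>+ x. epowr (V x * ennreal (W x powr (1/s))) s \<partial>lborel) = Lpow s W V"
    using s Wpos by (subst nn_integral_wt) (auto intro!: nn_integral_cong simp: epowr_mult powr_powr mult.commute less_imp_le)
  also have "(\<integral>\<^sup>+ x. epowr (ennreal (H' x * W x powr (-1/s))) (s / (s - 1)) \<partial>lborel) = Z"
    unfolding Z_def
  proof (rule nn_integral_cong_AE, use ae in eventually_elim)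
    case (elim x)
    have e: "(-1/s) * (s / (s - 1)) = - 1 / (s - 1)" "(1 - s) * (- 1 / (s - 1)) = 1"
      using s by (simp_all add: field_simps)
    have e3: "s / (s - 1) + - 1 / (s - 1) = 1"
      using s by (simp add: diff_divide_distrib[symmetric])
    have "(H' x * W x powr (-1/s)) powr (s / (s - 1)) = H' x powr (s / (s - 1)) * W x powr (- 1 / (s - 1))"
      using pos'[of x] by (simp only: powr_mult powr_powr e)
    also have "W x powr (- 1 / (s - 1)) = u' x * H' x powr (- 1 / (s - 1))"
      unfolding W_def using pos'[of x] by (simp only: powr_mult powr_powr e powr_one less_imp_le)
    also have "H' x powr (s / (s - 1)) * (u' x * H' x powr (- 1 / (s - 1))) = u' x * H' x powr (s / (s - 1) + - 1 / (s - 1))"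
      by (simp only: powr_add mult_ac)
    also have "\<dots> = u' x * H' x" unfolding e3 using pos'[of x] by simp
    finally show ?case using elim pos'[of x] Wpos[of x] by (simp add: ennreal_mult[symmetric])
  qed
  also have "Lpow s W V \<le> ennreal C * Lpow s W S"
    by (rule hyp) (use ApW in \<open>simp add: W_def[abs_def]\<close>)
  also have "Lpow s W S = (\<integral>\<^sup>+ x. ennreal (W x) * epowr (S x) s \<partial>lborel)"
    by (rule nn_integral_wt) auto
  also have "\<dots> \<le> Z"
    unfolding Z_def
  proof (rule nn_integral_mono_AE, use ae Sg in eventually_elim)
    case (elim x)
    have "S x \<le> ennreal (u' x)" using elim u(2)[of x] by auto
    then have "epowr (S x) s \<le> ennreal (u' x powr s)"
      using epowr_mono[of "S x" "ennreal (u' x)" s] s pos'[of x] by simp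
    then have "ennreal (W x) * epowr (S x) s \<le> ennreal (W x) * ennreal (u' x powr s)"
      by (rule mult_left_mono) auto
    also have "\<dots> = ennreal (u' x * H' x)"
    proof -
      have "W x * u' x powr s = u' x * H' x"
        using pos'[of x] by (simp add: W_def powr_diff)
      then show ?thesis using Wpos[of x] by (simp add: ennreal_mult[symmetric])
    qed
    finally show ?case using elim pos'[of x] by (simp add: ennreal_mult)
  qed
  finally have "epowr X s \<le> ennreal C * Z * epowr Z (s - 1)"
    by (simp add: mult_left_mono mult_right_mono)
  also have "\<dots> = ennreal C * epowr Z s"
    using epowr_add[of 1 "s - 1" Z] s by (simp add: mult.assoc)
  finally have "epowr (epowr X s) (p / s) \<le> epowr (ennreal C * epowr Z s) (p / s)"
    using s p by (intro epowr_mono) auto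
  then have 1: "epowr X p \<le> ennreal (C powr (p / s)) * epowr Z p"
    using s p C by (simp add: epowr_mult epowr_epowr)
  have "epowr Z p = epowr (\<integral>\<^sup>+ x. (u x * ennreal (w x powr (1/p))) * (H x * ennreal (w x powr (-1/p))) \<partial>lborel) p"
    unfolding Z_def
  proof (intro arg_cong2[of _ _ _ _ epowr] nn_integral_cong refl)
    fix x
    have "ennreal (w x powr (1/p)) * ennreal (w x powr (-1/p)) = 1"
      using w_pos[of x] by (simp add: ennreal_mult[symmetric] powr_add[symmetric])
    then show "u x * H x = (u x * ennreal (w x powr (1/p))) * (H x * ennreal (w x powr (-1/p)))"
      by (metis (no_types, lifting) mult.assoc mult.left_commute mult.right_neutral)
  qed
  also have "\<dots> \<le> (\<integral>\<^sup>+ x. epowr (u x * ennreal (w x powr (1/p))) p \<partial>lborel)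
      * epowr (\<integral>\<^sup>+ x. epowr (H x * ennreal (w x powr (-1/p))) ?q \<partial>lborel) (p - 1)"
    by (intro nn_integral_Holder_powr p) measurable
  also have "(\<integral>\<^sup>+ x. epowr (u x * ennreal (w x powr (1/p))) p \<partial>lborel) = Lpow p w u"
    using p w_pos by (subst nn_integral_wt) (auto intro!: nn_integral_cong simp: epowr_mult powr_powr mult.commute less_imp_le)
  also have "(\<integral>\<^sup>+ x. epowr (H x * ennreal (w x powr (-1/p))) ?q \<partial>lborel) = Lpow ?q \<sigma> H"
    using p w_pos by (subst nn_integral_wt) (auto intro!: nn_integral_cong simp: epowr_mult powr_powr mult.commute less_imp_le dualw_def)
  also have "Lpow p w u * epowr (Lpow ?q \<sigma> H) (p - 1)
      \<le> (ennreal B * Y) * epowr (ennreal B * X) (p - 1)"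
    using p by (intro mult_mono u epowr_mono H) auto
  finally have 2: "epowr Z p \<le> (ennreal B * Y) * epowr (ennreal B * X) (p - 1)" .
  have "epowr X (p - 1) * X = epowr X p" using epowr_add[of "p - 1" 1 X] p by simp
  also have "\<dots> \<le> ennreal (C powr (p / s)) * ((ennreal B * Y) * epowr (ennreal B * X) (p - 1))"
    using 1 2 by (meson mult_left_mono order_trans zero_le)
  also have "\<dots> = epowr X (p - 1) * (ennreal (C powr (p / s)) * (ennreal B * ennreal (B powr (p - 1))) * Y)"
    using p B by (simp add: epowr_mult mult_ac)
  also have "ennreal B * ennreal (B powr (p - 1)) = ennreal (B powr p)"
    using B by (simp add: ennreal_mult[symmetric] powr_diff)
  finally have "X \<le> ennreal (C powr (p / s)) * ennreal (B powr p) * Y"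
    using X0 Ufin by (subst (asm) ennreal_mult_le_mult_iff) (auto simp: X_def)
  then show ?thesis unfolding X_def Y_def by (simp add: ennreal_mult)
qed


text \<open>The constant of the auxiliary weights has to be fixed before \<open>C\<close>, because the constant of the inequality to be
  extrapolated is only known once the class of weights is.\<close>

theorem (in Ap) extrapolation:
  assumes s: "1 < s"
  shows "\<exists>K'. \<forall>C\<ge>0. \<exists>C'>0. \<forall>V\<in>borel_measurable borel. \<forall>S\<in>borel_measurable borel.
     (\<forall>W. Ap s K' W \<longrightarrow> Lpow s W V \<le> ennreal C * Lpow s W S) \<longrightarrow>
     Lpow p w V \<le> ennreal C' * Lpow p w S"
proof -
  interpret D: Ap "p / (p - 1)" "K powr (1 / (p - 1))" \<sigma>
    using Ap_dual[OF Ap_axioms] .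
  obtain B1 where B1: "0 < B1" "\<And>g. g \<in> borel_measurable borel \<Longrightarrow> \<not> (AE x in lborel. g x = 0) \<Longrightarrow>
     A1_majorized p w B1 g"
    using A1_majorant by blast
  obtain B2 where B2: "0 < B2" "\<And>g. g \<in> borel_measurable borel \<Longrightarrow> \<not> (AE x in lborel. g x = 0) \<Longrightarrow>
     A1_majorized (p/(p-1)) \<sigma> B2 g"
    using D.A1_majorant by blast
  define B where "B = max B1 B2"
  have B: "0 < B" "B1 \<le> B" "B2 \<le> B" using B1(1) by (auto simp: B_def)
  have up: "x \<le> ennreal b * y \<Longrightarrow> b \<le> B \<Longrightarrow> x \<le> ennreal B * y" for b x y
    by (erule order_trans) (intro mult_right_mono ennreal_leI, auto)
  have B1': "A1_majorized p w B g"
    if "g \<in> borel_measurable borel" "\<not> (AE x in lborel. g x = 0)" for g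
    using B1(2)[OF that] up[OF _ B(2)] by blast
  have B2': "A1_majorized (p/(p-1)) \<sigma> B g"
    if "g \<in> borel_measurable borel" "\<not> (AE x in lborel. g x = 0)" for g
    using B2(2)[OF that] up[OF _ B(3)] by blast
  show ?thesis
  proof (rule exI[of _ "(2 * B) powr s"], intro allI impI)
    fix C :: real assume C: "0 \<le> C"
    define C' where "C' = C powr (p / s) * B powr p + 1"
    have C': "0 < C'" "C powr (p / s) * B powr p \<le> C'" by (auto simp: C'_def add_nonneg_pos)
    show "\<exists>C'>0. \<forall>V\<in>borel_measurable borel. \<forall>S\<in>borel_measurable borel.
     (\<forall>W. Ap s ((2 * B) powr s) W \<longrightarrow> Lpow s W V \<le> ennreal C * Lpow s W S) \<longrightarrow>
     Lpow p w V \<le> ennreal C' * Lpow p w S"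
    proof (intro exI[of _ C'] conjI C' ballI impI)
      fix V S :: "real \<Rightarrow> ennreal"
      assume [measurable]: "V \<in> borel_measurable borel" "S \<in> borel_measurable borel"
      assume hyp: "\<forall>W. Ap s ((2 * B) powr s) W \<longrightarrow> Lpow s W V \<le> ennreal C * Lpow s W S"
      \<comment> \<open>truncations with finite norm that increase to \<open>V\<close>\<close>
      define U where "U n x = min (V x) (of_nat n) * indicator {- real n..real n} x" for n :: nat and x
      have Um [measurable]: "U n \<in> borel_measurable borel" for n unfolding U_def by measurable
      have UV: "U n x \<le> V x" for n x by (auto simp: U_def split: split_indicator)
      have Ufin: "Lpow p w (U n) < top" for n
      proof -
        have "Lpow p w (U n) \<le> (\<integral>\<^sup>+ x\<in>{- real n - 1..real n}. ennreal (real n powr p) \<partial>wt w)"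
        proof (rule nn_integral_mono)
          fix x
          have "epowr (min (V x) (of_nat n)) p \<le> epowr (of_nat n) p" using p by (intro epowr_mono) auto
          also have "\<dots> = ennreal (real n powr p)" by (simp add: ennreal_of_nat_eq_real_of_nat)
          finally show "epowr (U n x) p \<le> ennreal (real n powr p) * indicator {- real n - 1..real n} x"
            by (auto simp: U_def split: split_indicator)
        qed
        also have "\<dots> = ennreal (real n powr p) * mass w {- real n - 1..real n}"
          by (rule nn_integral_cmult_indicator) simp
        also have "\<dots> < top" using w_interval(2)[of "- real n - 1" "real n"] by (simp add: ennreal_mult_less_top)
        finally show ?thesis .
      qed
      have step: "Lpow p w (U n) \<le> ennreal C' * Lpow p w g"
        if [measurable]: "g \<in> borel_measurable borel" and "AE x in lborel. S x \<le> g x" "\<not> (AE x in lborel. g x = 0)"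
        "Lpow p w g < top" for g n
      proof -
        have "Lpow p w (U n) \<le> ennreal (C powr (p / s) * B powr p) * Lpow p w g"
          by (rule extrapolation_step[OF s B(1) B1' B2', where V = V and S = S])
            (use hyp C that UV Ufin in auto)
        also have "\<dots> \<le> ennreal C' * Lpow p w g"
          using C' by (intro mult_right_mono ennreal_leI) auto
        finally show ?thesis .
      qed
      have bound: "Lpow p w (U n) \<le> ennreal C' * Lpow p w S" for n
      proof (cases "Lpow p w S = top")
        case True then show ?thesis using C' by (simp add: ennreal_mult_top)
      next
        case fin: False
        show ?thesis
        proof (cases "AE x in lborel. S x = 0")
          case False
          then show ?thesis using fin by (intro step) (auto simp: top.not_eq_extremum)
        next
          case True
          define c where "c = mass w {0..1}"
          have c: "c \<noteq> top" using w_interval(2)[of 0 1] by (simp add: c_def)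
          have dd: "Lpow p w (U n) \<le> ennreal (d * (C' * enn2real c))" if d: "0 < d" for d
          proof -
            \<comment> \<open>\<open>S\<close> vanishes almost everywhere and has no majorant; use small multiples of an indicator function instead\<close>
            let ?g = "\<lambda>x. ennreal (d powr (1/p)) * indicator {0..1::real} x"
            have gi: "Lpow p w (\<lambda>x. ?g x) = ennreal d * c"
            proof -
              have "Lpow p w (\<lambda>x. ?g x) = (\<integral>\<^sup>+ x\<in>{0..1::real}. ennreal d \<partial>wt w)"
                using d p by (intro nn_integral_cong) (auto simp: powr_powr split: split_indicator)
              then show ?thesis by (simp add: nn_integral_cmult_indicator c_def)
            qed
            have "Lpow p w (U n) \<le> ennreal C' * Lpow p w (\<lambda>x. ?g x)"
            proof (rule step)
              show "AE x in lborel. S x \<le> ?g x" using True by (auto elim: eventually_mono)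
              show "\<not> (AE x in lborel. ?g x = 0)"
              proof
                assume "AE x in lborel. ?g x = 0"
                then have "AE x in lborel. x \<notin> {0..1::real}"
                  by (rule eventually_mono) (use d in \<open>auto split: split_indicator_asm simp: ennreal_eq_0_iff\<close>)
                then show False using interval_not_AE[of 0 1] by simp
              qed
              show "Lpow p w (\<lambda>x. ?g x) < top" unfolding gi using c by (simp add: ennreal_mult_less_top top.not_eq_extremum)
            qed measurable
            also have "\<dots> = ennreal (d * (C' * enn2real c))"
              unfolding gi using c C' d by (simp add: ennreal_mult top.not_eq_extremum mult_ac)
            finally show ?thesis .
          qed
          have "Lpow p w (U n) \<le> 0"
          proof (rule ennreal_le_epsilon)
            fix e :: real assume e: "0 < e"
            define d where "d = e / (C' * enn2real c + 1)"
            have c0: "0 \<le> C' * enn2real c" using C' by simp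
            have d: "0 < d" using e c0 by (simp add: d_def add_nonneg_pos)
            have "d * (C' * enn2real c) \<le> d * (C' * enn2real c + 1)" using d by simp
            also have "\<dots> = e" using c0 by (simp add: d_def)
            finally have "ennreal (d * (C' * enn2real c)) \<le> ennreal e" by (rule ennreal_leI)
            then show "Lpow p w (U n) \<le> 0 + ennreal e"
              unfolding add_0_left by (rule order_trans[OF dd[OF d]])
          qed
          then show ?thesis by simp
        qed
      qed
      have VU: "V x = (SUP n. U n x)" for x
      proof (rule antisym)
        show "V x \<le> (SUP n. U n x)"
        proof (rule dense_le)
          fix y assume y: "y < V x"
          then have "y < top" by (rule less_le_trans) simp
          then obtain n1 where n1: "y < of_nat n1" using ennreal_Ex_less_of_nat by blast
          obtain n2 :: nat where n2: "\<bar>x\<bar> \<le> real n2" using real_arch_simple by blast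
          let ?n = "max n1 n2"
          have "of_nat n1 \<le> (of_nat ?n :: ennreal)" by (intro of_nat_mono) simp
          then have "y \<le> of_nat ?n" using n1 by (meson less_imp_le order_trans)
          then have "y \<le> U ?n x" using y n2 by (auto simp: U_def split: split_indicator)
          then show "y \<le> (SUP n. U n x)" by (rule SUP_upper2[OF UNIV_I])
        qed
        show "(SUP n. U n x) \<le> V x" by (intro SUP_least UV)
      qed
      have inc: "incseq U"
      proof (rule incseq_SucI, rule le_funI)
        fix n x
        have "min (V x) (of_nat n) \<le> min (V x) (of_nat (Suc n))" by (intro min.mono of_nat_mono) auto
        then show "U n x \<le> U (Suc n) x" unfolding U_def by (intro mult_mono) (auto split: split_indicator)
      qed
      have "Lpow p w V = (\<integral>\<^sup>+ x. (SUP n. epowr (U n x) p) \<partial>wt w)"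
        using p by (subst VU) (simp add: epowr_SUP)
      also have "\<dots> = (SUP n. (Lpow p w (U n)))"
        using inc p by (intro nn_integral_monotone_convergence_SUP) (auto simp: incseq_def le_fun_def intro!: epowr_mono)
      also have "\<dots> \<le> ennreal C' * Lpow p w S" by (intro SUP_least bound)
      finally show "Lpow p w V \<le> ennreal C' * Lpow p w S" .
    qed
  qed
qed

section \<open>The variation of a sequence\<close>

definition blocks :: "(int \<Rightarrow> complex) \<Rightarrow> (nat \<Rightarrow> int) \<Rightarrow> nat \<Rightarrow> complex" where
  "blocks c n k = (\<Sum>j\<in>{n k<..n (Suc k)}. c j)"

abbreviation pvar :: "real \<Rightarrow> (int \<Rightarrow> complex) \<Rightarrow> (nat \<Rightarrow> int) \<Rightarrow> nat \<Rightarrow> real" where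
  "pvar r c n K \<equiv> (\<Sum>k<K. norm (blocks c n k) powr r)"

text \<open>The index sequences are monotone rather than strictly monotone and defined on all of \<open>nat\<close>: empty blocks contribute
  nothing, and every finite increasing sequence extends to one of this kind.\<close>

definition bvar :: "real \<Rightarrow> (int \<Rightarrow> complex) \<Rightarrow> ennreal" where
  "bvar r c = (SUP (K, n)\<in>{(K, n). mono n}.
     ennreal (pvar r c n K powr (1 / r)))"

lemma bvar_upper:
  "mono n \<Longrightarrow> ennreal (pvar r c n K powr (1 / r)) \<le> bvar r c"
  unfolding bvar_def by (rule SUP_upper2[of "(K, n)"]) auto

lemma bvar_least:
  "(\<And>K n. mono n \<Longrightarrow> ennreal (pvar r c n K powr (1 / r)) \<le> y) \<Longrightarrow> bvar r c \<le> y"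
  unfolding bvar_def by (rule SUP_least) auto

lemma powr_convex_nonneg:
  fixes x y t r :: real
  assumes r: "1 \<le> r" and "0 \<le> x" "0 \<le> y" and t: "0 \<le> t" "t \<le> 1"
  shows "((1 - t) * x + t * y) powr r \<le> (1 - t) * x powr r + t * y powr r"
proof -
  have le: "u powr r \<le> u" if "0 \<le> u" "u \<le> 1" for u
    using powr_mono'[of 1 r u] that r by (cases "u = 0") auto
  consider "x = 0" | "y = 0" | "0 < x" "0 < y" using assms by linarith
  then show ?thesis
  proof cases
    case 1
    then show ?thesis using le[OF t] by (simp add: powr_mult mult_right_mono)
  next
    case 2
    then show ?thesis using le[of "1 - t"] t by (simp add: powr_mult mult_right_mono)
  next
    case 3
    then show ?thesis using convex_onD[OF powr_convex[OF r] t, of x y] by simp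
  qed
qed

lemma Minkowski_sum_powr:
  fixes a b :: "'i \<Rightarrow> complex" and r :: real
  assumes r: "1 \<le> r" and fin: "finite I"
  shows "(\<Sum>i\<in>I. norm (a i + b i) powr r) powr (1/r)
      \<le> (\<Sum>i\<in>I. norm (a i) powr r) powr (1/r) + (\<Sum>i\<in>I. norm (b i) powr r) powr (1/r)"
proof -
  define A where "A = (\<Sum>i\<in>I. norm (a i) powr r) powr (1/r)"
  define B where "B = (\<Sum>i\<in>I. norm (b i) powr r) powr (1/r)"
  have Ar: "A powr r = (\<Sum>i\<in>I. norm (a i) powr r)" and Br: "B powr r = (\<Sum>i\<in>I. norm (b i) powr r)"
    using r by (simp_all add: A_def B_def powr_powr sum_nonneg)
  have nn: "0 \<le> A" "0 \<le> B" by (auto simp: A_def B_def)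
  have root: "(X powr r) powr (1/r) = X" if "0 \<le> X" for X using that r by (simp add: powr_powr)
  consider "A = 0" | "B = 0" | "0 < A" "0 < B" using nn by linarith
  then show ?thesis
  proof cases
    case 1
    then have "(\<Sum>i\<in>I. norm (a i) powr r) = 0" using Ar by simp
    then have "\<forall>i\<in>I. a i = 0" using fin by (simp add: sum_nonneg_eq_0_iff)
    then have "(\<Sum>i\<in>I. norm (a i + b i) powr r) = (\<Sum>i\<in>I. norm (b i) powr r)" by (intro sum.cong) auto
    then show ?thesis by simp
  next
    case 2
    then have "(\<Sum>i\<in>I. norm (b i) powr r) = 0" using Br by simp
    then have "\<forall>i\<in>I. b i = 0" using fin by (simp add: sum_nonneg_eq_0_iff)
    then have "(\<Sum>i\<in>I. norm (a i + b i) powr r) = (\<Sum>i\<in>I. norm (a i) powr r)" by (intro sum.cong) auto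
    then show ?thesis by simp
  next
    case 3
    define t where "t = B / (A + B)"
    have t: "0 \<le> t" "t \<le> 1" "1 - t = A / (A + B)" using 3 by (auto simp: t_def field_simps)
    have "norm (a i + b i) powr r \<le> (A + B) powr r * ((1 - t) * (norm (a i) powr r / A powr r) + t * (norm (b i) powr r / B powr r))" for i
    proof -
      let ?x = "norm (a i) / A" and ?y = "norm (b i) / B"
      have "norm (a i + b i) \<le> (A + B) * ((1 - t) * ?x + t * ?y)"
      proof -
        have "(A + B) * ((1 - t) * ?x + t * ?y) = norm (a i) + norm (b i)"
        proof -
          have "A + B \<noteq> 0" using 3 by simp
          then have "(A + B) * ((A / (A + B)) * ?x + (B / (A + B)) * ?y) = A * ?x + B * ?y"
            by (simp add: distrib_left mult.assoc[symmetric])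
          then show ?thesis unfolding t(3) unfolding t_def using 3 by simp
        qed
        then show ?thesis using norm_triangle_ineq[of "a i" "b i"] by simp
      qed
      then have "norm (a i + b i) powr r \<le> ((A + B) * ((1 - t) * ?x + t * ?y)) powr r"
        using r by (intro powr_mono2) auto
      also have "\<dots> = (A + B) powr r * ((1 - t) * ?x + t * ?y) powr r"
        by (rule powr_mult)
      also have "((1 - t) * ?x + t * ?y) powr r \<le> (1 - t) * ?x powr r + t * ?y powr r"
        using t 3 r by (intro powr_convex_nonneg) auto
      finally show ?thesis using 3 by (simp add: powr_divide mult_left_mono)
    qed
    then have "(\<Sum>i\<in>I. norm (a i + b i) powr r) \<le> (\<Sum>i\<in>I. (A + B) powr r * ((1 - t) * (norm (a i) powr r / A powr r) + t * (norm (b i) powr r / B powr r)))"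
      by (rule sum_mono)
    also have "\<dots> = (A + B) powr r * ((1 - t) * (A powr r / A powr r) + t * (B powr r / B powr r))"
    proof -
      have "(\<Sum>i\<in>I. c * ((1 - t) * (f i / \<alpha>) + t * (g i / \<beta>)))
         = c * ((1 - t) * (sum f I / \<alpha>) + t * (sum g I / \<beta>))" for c \<alpha> \<beta> :: real and f g
        by (simp add: sum.distrib sum_distrib_left[symmetric] sum_divide_distrib[symmetric])
      then show ?thesis by (simp only: Ar[symmetric] Br[symmetric])
    qed
    also have "\<dots> = (A + B) powr r" using 3 by simp
    finally have "(\<Sum>i\<in>I. norm (a i + b i) powr r) powr (1/r) \<le> ((A + B) powr r) powr (1/r)"
      using r by (intro powr_mono2) (auto intro: sum_nonneg)
    also have "\<dots> = A + B" using nn by (intro root) simp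
    finally show ?thesis by (simp add: A_def B_def)
  qed
qed

lemma bvar_add:
  assumes r: "1 \<le> r"
  shows "bvar r (\<lambda>j. c j + d j) \<le> bvar r c + bvar r d"
proof (rule bvar_least)
  fix K n assume n: "mono (n :: nat \<Rightarrow> int)"
  have "pvar r (\<lambda>j. c j + d j) n K powr (1 / r)
     \<le> pvar r c n K powr (1 / r) + pvar r d n K powr (1 / r)"
    using Minkowski_sum_powr[OF r, of "{..<K}" "blocks c n" "blocks d n"]
    by (simp add: blocks_def sum.distrib)
  then have "ennreal (pvar r (\<lambda>j. c j + d j) n K powr (1 / r))
     \<le> ennreal (pvar r c n K powr (1 / r)) + ennreal (pvar r d n K powr (1 / r))"
    by (simp add: ennreal_plus[symmetric] ennreal_leI del: ennreal_plus)
  also have "\<dots> \<le> bvar r c + bvar r d" by (intro add_mono bvar_upper n)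
  finally show "ennreal (pvar r (\<lambda>j. c j + d j) n K powr (1 / r)) \<le> bvar r c + bvar r d" .
qed

lemma bvar_zero: "1 \<le> r \<Longrightarrow> bvar r (\<lambda>_. 0) = 0"
  by (rule antisym, rule bvar_least) (auto simp: blocks_def)

lemma mono_blocks_disjoint:
  assumes "mono (n :: nat \<Rightarrow> int)" "i \<noteq> k"
  shows "{n i<..n (Suc i)} \<inter> {n k<..n (Suc k)} = {}"
proof -
  have "n (Suc i) \<le> n k \<or> n (Suc k) \<le> n i"
    using assms by (cases "i < k") (auto intro: monoD)
  then show ?thesis by auto
qed

lemma bvar_single:
  assumes r: "1 \<le> r"
  shows "bvar r (\<lambda>j. if j = l then z else 0) \<le> ennreal (norm z)"
proof (rule bvar_least)
  fix K n assume n: "mono (n :: nat \<Rightarrow> int)"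
  let ?c = "\<lambda>j. if j = l then z else 0"
  have bl: "blocks ?c n k = (if l \<in> {n k<..n (Suc k)} then z else 0)" for k
    by (simp add: blocks_def)
  have "pvar r ?c n K \<le> norm z powr r"
  proof (cases "\<exists>k0<K. l \<in> {n k0<..n (Suc k0)}")
    case True
    then obtain k0 where k0: "k0 < K" "l \<in> {n k0<..n (Suc k0)}" by blast
    have "blocks ?c n k = 0" if "k \<noteq> k0" for k
      using mono_blocks_disjoint[OF n that] k0(2) unfolding bl by auto
    then have "pvar r ?c n K = (\<Sum>k\<in>{k0}. norm (blocks ?c n k) powr r)"
      using k0 by (intro sum.mono_neutral_right) auto
    then show ?thesis using k0 by (simp add: bl)
  next
    case False
    then have "blocks ?c n k = 0" if "k < K" for k using that unfolding bl by auto
    then show ?thesis by (simp add: sum_nonneg)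
  qed
  then have "pvar r ?c n K powr (1/r) \<le> (norm z powr r) powr (1/r)"
    using r by (intro powr_mono2) (auto intro: sum_nonneg)
  then show "ennreal (pvar r ?c n K powr (1 / r)) \<le> ennreal (norm z)"
    using r by (simp add: powr_powr ennreal_leI)
qed

lemma bvar_restrict:
  "bvar r (\<lambda>j. if a \<le> j \<and> j \<le> b then c j else 0) \<le> bvar r c"
proof (cases "a \<le> b")
  case False
  then have "bvar r (\<lambda>j. if a \<le> j \<and> j \<le> b then c j else 0) = bvar r (\<lambda>j. 0)"
    by (intro arg_cong[of _ _ "bvar r"] ext) auto
  also have "\<dots> = 0"
    by (rule antisym, rule bvar_least) (auto simp: blocks_def)
  finally show ?thesis by simp
next
  case ab: True
  show ?thesis
  proof (rule bvar_least)
    fix K n assume n: "mono (n :: nat \<Rightarrow> int)"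
    define n' where "n' k = max (a - 1) (min b (n k))" for k
    have n': "mono n'"
  proof (rule monoI)
    fix x y :: nat assume "x \<le> y"
    then have "n x \<le> n y" by (rule monoD[OF n])
    then show "n' x \<le> n' y" unfolding n'_def by (intro max.mono min.mono order_refl)
  qed
    have "blocks (\<lambda>j. if a \<le> j \<and> j \<le> b then c j else 0) n k = blocks c n' k" for k
    proof -
      have "{n' k<..n' (Suc k)} = {n k<..n (Suc k)} \<inter> {a..b}"
        using ab n[THEN monoD, of k "Suc k"] by (auto simp: n'_def)
      then show ?thesis unfolding blocks_def
        by (simp add: sum.inter_restrict)
    qed
    then show "ennreal (pvar r (\<lambda>j. if a \<le> j \<and> j \<le> b then c j else 0) n K powr (1 / r)) \<le> bvar r c"
      using bvar_upper[OF n', where K = K and c = c and r = r] by simp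
  qed
qed

lemma bvar_cmult:
  assumes r: "1 \<le> r" and b: "0 \<le> b"
  shows "bvar r (\<lambda>j. of_real b * c j) = ennreal b * bvar r c"
proof -
  have "blocks (\<lambda>j. of_real b * c j) n k = of_real b * blocks c n k" for n k
    by (simp add: blocks_def sum_distrib_left)
  then have "pvar r (\<lambda>j. of_real b * c j) n K powr (1 / r)
      = b * pvar r c n K powr (1 / r)" for n K
    using b r by (simp add: norm_mult powr_mult sum_distrib_left[symmetric] powr_powr)
  then show ?thesis
    unfolding bvar_def SUP_mult_left_ennreal using b
    by (intro SUP_cong) (auto simp: ennreal_mult)
qed

lemma bvar_le_sum:
  assumes r: "1 \<le> r" and fin: "finite J"
  shows "bvar r (\<lambda>j. if j \<in> J then c j else 0) \<le> (\<Sum>j\<in>J. enorm (c j))"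
  using fin
proof (induction J)
  case empty then show ?case using bvar_zero[OF r] by simp
next
  case (insert l J)
  have "(\<lambda>j. if j \<in> insert l J then c j else 0) = (\<lambda>j. (if j = l then c l else 0) + (if j \<in> J then c j else 0))"
    using insert by auto
  then have "bvar r (\<lambda>j. if j \<in> insert l J then c j else 0) \<le> bvar r (\<lambda>j. if j = l then c l else 0) + bvar r (\<lambda>j. if j \<in> J then c j else 0)"
    using bvar_add[OF r] by simp
  also have "\<dots> \<le> enorm (c l) + (\<Sum>j\<in>J. enorm (c j))"
    by (intro add_mono bvar_single r insert)
  finally show ?case using insert by (simp del: sum_ennreal)
qed

section \<open>Counting jumps\<close>

text \<open>The greedy count of jumps when the martingale is run from coarse to fine scales, i.e. for \<open>j\<close> descending from \<open>k - 1\<close>.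
  The first component is the excursion since the last reset. A reset happens when the excursion would reach height \<open>l\<close> or when
  a single increment exceeds \<open>l\<close>; the second alternative bounds the loss at a reset by the truncated increment.\<close>

fun jump_state :: "real \<Rightarrow> (int \<Rightarrow> complex) \<Rightarrow> int \<Rightarrow> complex \<Rightarrow> nat \<Rightarrow> complex \<times> nat" where
  "jump_state l c k z 0 = (z, 0)"
| "jump_state l c k z (Suc n) =
     (let (u, N) = jump_state l c k z n; e = c (k - 1 - int n)
      in if l < norm e \<or> l \<le> norm (u + e) then (0, Suc N) else (u + e, N))"

text \<open>The recursion unfolds at the fine end; the induction over dyadic generations peels off the coarse end.\<close>

lemma jump_state_head:
  "jump_state l c k z (Suc n) =
     (let e = c (k - 1) in
      if l < norm e \<or> l \<le> norm (z + e)
      then (fst (jump_state l c (k - 1) 0 n), Suc (snd (jump_state l c (k - 1) 0 n)))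
      else jump_state l c (k - 1) (z + e) n)"
proof (induction n)
  case (Suc n)
  have e: "k - 1 - int (Suc n) = k - 1 - 1 - int n" by simp
  show ?case
    by (subst jump_state.simps(2), subst Suc, unfold e)
      (auto simp: Let_def case_prod_beta)
qed (simp add: Let_def)

lemma jump_state_small: "0 < l \<Longrightarrow> norm z < l \<Longrightarrow> norm (fst (jump_state l c k z n)) < l"
  by (induction n) (auto simp: Let_def case_prod_beta)

lemma jump_state_mono: "n \<le> n' \<Longrightarrow> snd (jump_state l c k z n) \<le> snd (jump_state l c k z n')"
  by (induction n' rule: dec_induct) (auto simp: Let_def case_prod_beta)

lemma jump_state_no_jump:
  assumes "n \<le> n'" "snd (jump_state l c k z n) = snd (jump_state l c k z n')"
  shows "fst (jump_state l c k z n') = fst (jump_state l c k z n) + (\<Sum>i\<in>{n..<n'}. c (k - 1 - int i))"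
  using assms
proof (induction n' rule: dec_induct)
  case (step m)
  let ?s = "jump_state l c k z"
  have "snd (?s n) \<le> snd (?s m)" "snd (?s m) \<le> snd (?s (Suc m))"
    using step.hyps by (intro jump_state_mono; simp)+
  then have eq: "snd (?s n) = snd (?s m)" "snd (?s m) = snd (?s (Suc m))" using step.prems by linarith+
  have "fst (?s (Suc m)) = fst (?s m) + c (k - 1 - int m)"
    using eq(2) by (auto simp: Let_def case_prod_beta split: if_splits)
  then show ?case using step.IH[OF eq(1)] step.hyps by (simp del: jump_state.simps)
qed simp

lemma jump_state_tail:
  assumes "0 < l" and "\<And>j. j < k - int N \<Longrightarrow> c j = 0" and "norm z < l"
  shows "snd (jump_state l c k z n) \<le> snd (jump_state l c k z N)"
proof (cases "n \<le> N")
  case True then show ?thesis by (rule jump_state_mono)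
next
  case False
  then have "N \<le> n" by simp
  then show ?thesis
  proof (induction n rule: dec_induct)
    case (step m)
    have "c (k - 1 - int m) = 0" using step assms by auto
    then have "snd (jump_state l c k z (Suc m)) = snd (jump_state l c k z m)"
      using jump_state_small[OF assms(1,3), of c k m] assms(1) by (auto simp: Let_def case_prod_beta)
    then show ?case using step by (simp del: jump_state.simps)
  qed simp
qed

text \<open>Without a reset the excursion changes over a block by the block sum, and it stays below \<open>l\<close> in norm; so a block of
  size \<open>2 l\<close> contains a reset.\<close>

lemma jump_count:
  assumes l: "0 < l" and up: "\<And>j. k \<le> j \<Longrightarrow> c j = 0" and low: "\<And>j. j < k - int N \<Longrightarrow> c j = 0" and n: "mono n"
  shows "card {i. i < K \<and> 2 * l \<le> norm (blocks c n i)} \<le> snd (jump_state l c k 0 N)"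
proof -
  define t where "t v = nat (k - 1 - v)" for v
  let ?s = "jump_state l c k 0"
  define J where "J i = snd (?s (t (n i)))" for i
  have nS: "n i \<le> n (Suc i)" for i using n by (simp add: monoD)
  have tS: "t (n (Suc i)) \<le> t (n i)" for i using nS[of i] by (simp add: t_def nat_mono)
  have bl: "blocks c n i = (\<Sum>i\<in>{t (n (Suc i))..<t (n i)}. c (k - 1 - int i))" for i
  proof -
    have "blocks c n i = (\<Sum>j\<in>{n i<..n (Suc i)} \<inter> {..<k}. c j)"
      unfolding blocks_def by (rule sum.mono_neutral_right) (auto, metis up not_less)
    also have "\<dots> = (\<Sum>i\<in>{t (n (Suc i))..<t (n i)}. c (k - 1 - int i))"
      by (rule sum.reindex_bij_witness[where i = "\<lambda>i. k - 1 - int i" and j = "\<lambda>j. nat (k - 1 - j)"])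
        (auto simp: t_def)
    finally show ?thesis .
  qed
  have step: "(if 2 * l \<le> norm (blocks c n i) then 1 else 0) + J (Suc i) \<le> J i" for i
  proof (cases "2 * l \<le> norm (blocks c n i)")
    case True
    have "J (Suc i) \<noteq> J i"
    proof
      assume "J (Suc i) = J i"
      then have "fst (?s (t (n i))) = fst (?s (t (n (Suc i)))) + blocks c n i"
        unfolding bl J_def by (intro jump_state_no_jump tS)
      then have "norm (blocks c n i) \<le> norm (fst (?s (t (n i)))) + norm (fst (?s (t (n (Suc i)))))"
        by (metis add_diff_cancel_left' norm_triangle_ineq4)
      moreover have "norm (fst (?s m)) < l" for m using l by (intro jump_state_small) auto
      ultimately show False using True by (smt (verit))
    qed
    moreover have "J (Suc i) \<le> J i" unfolding J_def by (intro jump_state_mono tS)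
    ultimately show ?thesis by simp
  next
    case False
    then show ?thesis unfolding J_def by (simp add: jump_state_mono tS)
  qed
  have "card {i. i < K \<and> 2 * l \<le> norm (blocks c n i)} + J K \<le> J 0"
  proof (induction K)
    case (Suc K)
    have "{i. i < Suc K \<and> 2 * l \<le> norm (blocks c n i)}
       = (if 2 * l \<le> norm (blocks c n K) then insert K {i. i < K \<and> 2 * l \<le> norm (blocks c n i)} else {i. i < K \<and> 2 * l \<le> norm (blocks c n i)})"
      by (auto simp: less_Suc_eq)
    then have "card {i. i < Suc K \<and> 2 * l \<le> norm (blocks c n i)} =
       card {i. i < K \<and> 2 * l \<le> norm (blocks c n i)} + (if 2 * l \<le> norm (blocks c n K) then 1 else 0)"
      by simp
    then show ?case using Suc step[of K] by linarith
  qed simp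
  also have "J 0 \<le> snd (?s N)" unfolding J_def by (rule jump_state_tail) (use l low in auto)
  finally show ?thesis by simp
qed

abbreviation jump_weight :: "real \<Rightarrow> int \<Rightarrow> ennreal" where
  "jump_weight r m \<equiv> ennreal ((4 * 2 powr m) powr r)"

abbreviation sq_cap :: "int \<Rightarrow> real \<Rightarrow> real" where
  "sq_cap m a \<equiv> 2 powr (- 2 * real_of_int m) * (min a (2 powr m))\<^sup>2"

lemma powr_le_levels:
  assumes r: "0 < r" and y: "0 \<le> y"
  shows "ennreal (y powr r) \<le> sumZ (\<lambda>m. jump_weight r m * indicator {m::int. 2 * 2 powr m \<le> y} m)"
proof (cases "y = 0")
  case False
  then have y: "0 < y" using y by simp
  define m where "m = \<lfloor>log 2 (y / 2)\<rfloor>"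
  have "2 powr m \<le> 2 powr (log 2 (y / 2))" unfolding m_def by (intro powr_mono) auto
  then have "2 powr m \<le> y / 2" using y by simp
  moreover have "log 2 (y / 2) < m + 1" by (simp add: m_def)
  then have "y / 2 < 2 powr (m + 1)" using y by (simp add: log_less_iff)
  then have "y \<le> 4 * 2 powr m" by (simp add: powr_add)
  then have "y powr r \<le> (4 * 2 powr m) powr r" using r y by (intro powr_mono2) auto
  ultimately have "ennreal (y powr r) \<le> jump_weight r m * indicator {m::int. 2 * 2 powr m \<le> y} m"
    by (simp add: ennreal_leI)
  also have "\<dots> \<le> sumZ (\<lambda>m. jump_weight r m * indicator {m::int. 2 * 2 powr m \<le> y} m)"
    by (rule le_sumZ)
  finally show ?thesis .
qed simp

text \<open>The variation is controlled by the numbers of jumps at all dyadic heights; if there is no jump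
  of height \<open>2^M\<close>, only the heights below it count.\<close>

lemma bvar_le_jumps:
  assumes r: "1 \<le> r" and up: "\<And>j. k \<le> j \<Longrightarrow> c j = 0" and low: "\<And>j. j < k - int N \<Longrightarrow> c j = 0"
    and M: "snd (jump_state (2 powr real_of_int M) c k 0 N) = 0"
  shows "epowr (bvar r c) r \<le> sumZ (\<lambda>m. jump_weight r m * indicator {..<M} m *
     of_nat (snd (jump_state (2 powr m) c k 0 N)))"
proof -
  have r0: "0 < r" using r by simp
  define Q where "Q = sumZ (\<lambda>m. jump_weight r m * indicator {..<M} m * of_nat (snd (jump_state (2 powr m) c k 0 N)))"
  have "bvar r c \<le> epowr Q (1/r)"
  proof (rule bvar_least)
    fix K n assume n: "mono (n :: nat \<Rightarrow> int)"
    have cnt: "card {i. i < K \<and> 2 * 2 powr m \<le> norm (blocks c n i)} \<le> snd (jump_state (2 powr m) c k 0 N)" for m :: real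
      by (intro jump_count up low n) auto
    have "ennreal (\<Sum>i<K. norm (blocks c n i) powr r) = (\<Sum>i<K. ennreal (norm (blocks c n i) powr r))"
      by simp
    also have "\<dots> \<le> (\<Sum>i<K. sumZ (\<lambda>m. jump_weight r m * indicator {m::int. 2 * 2 powr m \<le> norm (blocks c n i)} m))"
      by (intro sum_mono powr_le_levels r0) auto
    also have "\<dots> = sumZ (\<lambda>m. \<Sum>i<K. jump_weight r m * indicator {m::int. 2 * 2 powr m \<le> norm (blocks c n i)} m)"
      by (rule nn_integral_sum[symmetric]) auto
    also have "\<dots> \<le> Q" unfolding Q_def
    proof (rule sumZ_mono)
      fix m :: int
      have "(\<Sum>i<K. jump_weight r m * indicator {m::int. 2 * 2 powr m \<le> norm (blocks c n i)} m)
         = jump_weight r m * of_nat (card {i. i < K \<and> 2 * 2 powr m \<le> norm (blocks c n i)})"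
        unfolding sum_distrib_left[symmetric]
        by (simp add: indicator_def of_bool_def sum.If_cases) (intro arg_cong2[of _ _ _ _ "(*)"] arg_cong[of _ _ card] arg_cong[of _ _ of_nat], auto)
      also have "\<dots> \<le> jump_weight r m * (indicator {..<M} m * of_nat (snd (jump_state (2 powr m) c k 0 N)))"
      proof (intro mult_left_mono)
        show "(of_nat (card {i. i < K \<and> 2 * 2 powr m \<le> norm (blocks c n i)}) :: ennreal)
          \<le> indicator {..<M} m * of_nat (snd (jump_state (2 powr m) c k 0 N))"
        proof (cases "m < M")
          case True then show ?thesis using cnt[of m] by simp
        next
          case False
          have "card {i. i < K \<and> 2 * 2 powr m \<le> norm (blocks c n i)} \<le> card {i. i < K \<and> 2 * 2 powr M \<le> norm (blocks c n i)}"
          proof (intro card_mono subsetI CollectI conjI)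
            fix i assume i: "i \<in> {i. i < K \<and> 2 * 2 powr m \<le> norm (blocks c n i)}"
            have "2 powr M \<le> 2 powr real_of_int m" using False by (intro powr_mono) auto
            moreover have "2 * 2 powr m \<le> norm (blocks c n i)" using i by blast
            ultimately show "2 * 2 powr M \<le> norm (blocks c n i)" by linarith
            show "i < K" using i by simp
          qed auto
          also have "\<dots> \<le> 0" using cnt[of M] M by simp
          finally have "card {i. i < K \<and> 2 * 2 powr m \<le> norm (blocks c n i)} = 0" by (simp only: le_zero_eq)
          then show ?thesis by (simp only: of_nat_0 zero_le)
        qed
      qed auto
      finally show "(\<Sum>i<K. jump_weight r m * indicator {m::int. 2 * 2 powr m \<le> norm (blocks c n i)} m)
        \<le> jump_weight r m * indicator {..<M} m * of_nat (snd (jump_state (2 powr m) c k 0 N))"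
        by (simp add: mult.assoc)
    qed
    finally have "epowr (ennreal (\<Sum>i<K. norm (blocks c n i) powr r)) (1/r) \<le> epowr Q (1/r)"
      using r by (intro epowr_mono) auto
    then show "ennreal (pvar r c n K powr (1 / r)) \<le> epowr Q (1/r)"
      by (simp add: sum_nonneg del: sum_ennreal)
  qed
  then show ?thesis using r0 unfolding Q_def[symmetric] by (simp add: epowr_le_iff)
qed

text \<open>This is where the exponent two is excluded: for \<open>r = 2\<close> the sum over the heights between
  \<open>a\<close> and the cutoff has a logarithmic size.\<close>

lemma jump_weights:
  assumes r: "0 < r" "r \<noteq> 2"
  shows "\<exists>C\<ge>0. \<forall>a. 0 \<le> a \<and> a \<le> 1 \<longrightarrow>
    sumZ (\<lambda>m. jump_weight r m * indicator {..<M} m * ennreal (sq_cap m a))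
      \<le> ennreal (C * a powr (min r 2))"
proof (cases "2 < r")
  case True
  define C where "C = 4 powr r * ((2 powr M) powr (r - 2) / (1 - 2 powr - (r - 2)))"
  have d: "2 powr - (r - 2) < (1::real)" using True by (intro powr_less_one) auto
  show ?thesis
  proof (intro exI[of _ C] conjI allI impI)
    show "0 \<le> C" using d by (auto simp: C_def)
    fix a :: real assume a: "0 \<le> a \<and> a \<le> 1"
    have "sumZ (\<lambda>m. jump_weight r m * indicator {..<M} m * ennreal (sq_cap m a))
       \<le> sumZ (\<lambda>m. ennreal (4 powr r * a\<^sup>2) * (ennreal (2 powr ((r - 2) * real_of_int m)) * indicator {m::int. 2 powr m \<le> 2 powr M} m))"
    proof (rule sumZ_mono)
      fix m :: int
      have "(4 * 2 powr m) powr r * (sq_cap m a) \<le> (4 * 2 powr m) powr r * (2 powr (- 2 * real_of_int m) * a\<^sup>2)"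
        using a by (intro mult_left_mono power_mono) auto
      also have "\<dots> = 4 powr r * a\<^sup>2 * 2 powr ((r - 2) * real_of_int m)"
        by (simp add: powr_mult powr_powr powr_add[symmetric] algebra_simps)
      finally show "jump_weight r m * indicator {..<M} m * ennreal (sq_cap m a)
        \<le> ennreal (4 powr r * a\<^sup>2) * (ennreal (2 powr ((r - 2) * real_of_int m)) * indicator {m::int. 2 powr m \<le> 2 powr M} m)"
        by (auto simp: ennreal_mult[symmetric] ennreal_leI split: split_indicator)
    qed
    also have "\<dots> = ennreal (4 powr r * a\<^sup>2) * (\<integral>\<^sup>+ m. ennreal (2 powr ((r - 2) * real_of_int m)) * indicator {m::int. 2 powr m \<le> 2 powr M} m \<partial>count_space UNIV)"
      by (rule nn_integral_cmult) auto
    also have "\<dots> \<le> ennreal (4 powr r * a\<^sup>2) * ennreal ((2 powr M) powr (r - 2) / (1 - 2 powr - (r - 2)))"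
      using True by (intro mult_left_mono geometric_below) auto
    also have "\<dots> = ennreal (C * a powr (min r 2))"
      using True a d unfolding C_def by (subst ennreal_mult[symmetric]) (auto simp: mult_ac)
    finally show "sumZ (\<lambda>m. jump_weight r m * indicator {..<M} m * ennreal (sq_cap m a))
      \<le> ennreal (C * a powr (min r 2))" .
  qed
next
  case False
  then have r2: "r < 2" using r by simp
  define C1 where "C1 = 1 / (1 - 2 powr - r :: real)"
  define C2 where "C2 = 1 / (1 - 2 powr - (2 - r) :: real)"
  have d: "2 powr - r < (1::real)" "2 powr - (2 - r) < (1::real)" using r r2 by (auto intro!: powr_less_one)
  have C12: "0 \<le> C1" "0 \<le> C2" using d by (auto simp: C1_def C2_def)
  show ?thesis
  proof (intro exI[of _ "4 powr r * (C1 + C2)"] conjI allI impI)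
    show "0 \<le> 4 powr r * (C1 + C2)" using C12 by auto
    fix a :: real assume a: "0 \<le> a \<and> a \<le> 1"
    show "sumZ (\<lambda>m. jump_weight r m * indicator {..<M} m * ennreal (sq_cap m a))
      \<le> ennreal (4 powr r * (C1 + C2) * a powr (min r 2))"
    proof (cases "a = 0")
      case True then show ?thesis by simp
    next
      case False
      then have a0: "0 < a" using a by simp
      have "sumZ (\<lambda>m. jump_weight r m * indicator {..<M} m * ennreal (sq_cap m a))
       \<le> sumZ (\<lambda>m. ennreal (4 powr r) * (ennreal (2 powr (r * real_of_int m)) * indicator {m::int. 2 powr m \<le> a} m)
            + ennreal (4 powr r * a\<^sup>2) * (ennreal (2 powr (- (2 - r) * real_of_int m)) * indicator {m::int. a \<le> 2 powr m} m))"
      proof (rule sumZ_mono)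
        fix m :: int
        have e1: "(4 * 2 powr m) powr r * (2 powr (- 2 * real_of_int m) * (2 powr m)\<^sup>2) = 4 powr r * 2 powr (r * real_of_int m)"
          by (simp add: powr_mult powr_powr powr_add[symmetric] algebra_simps power2_eq_square)
        have e2: "(4 * 2 powr m) powr r * (2 powr (- 2 * real_of_int m) * a\<^sup>2) = 4 powr r * a\<^sup>2 * 2 powr (- (2 - r) * real_of_int m)"
          by (simp add: powr_mult powr_powr powr_add[symmetric] algebra_simps)
        have "jump_weight r m * indicator {..<M} m * ennreal (sq_cap m a)
          \<le> jump_weight r m * ennreal (sq_cap m a)"
          by (intro mult_right_mono) (auto split: split_indicator)
        also have "\<dots> = ennreal ((4 * 2 powr m) powr r * (sq_cap m a))"
          by (rule ennreal_mult[symmetric]) auto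
        also have "\<dots> \<le> ennreal (4 powr r) * (ennreal (2 powr (r * real_of_int m)) * indicator {m::int. 2 powr m \<le> a} m)
            + ennreal (4 powr r * a\<^sup>2) * (ennreal (2 powr (- (2 - r) * real_of_int m)) * indicator {m::int. a \<le> 2 powr m} m)"
        proof (cases "2 powr m \<le> a")
          case True
          then have "min a (2 powr m) = 2 powr m" by simp
          then show ?thesis using True unfolding e1[symmetric]
            by (simp only: e1) (simp add: ennreal_mult[symmetric] add_increasing2)
        next
          case False
          then have "min a (2 powr m) = a" by simp
          then show ?thesis using False by (simp only: e2) (simp add: ennreal_mult[symmetric])
        qed
        finally show "jump_weight r m * indicator {..<M} m * ennreal (sq_cap m a) \<le> \<dots>" .
      qed
      also have "\<dots> = ennreal (4 powr r) * (\<integral>\<^sup>+ m. ennreal (2 powr (r * real_of_int m)) * indicator {m::int. 2 powr m \<le> a} m \<partial>count_space UNIV)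
            + ennreal (4 powr r * a\<^sup>2) * (\<integral>\<^sup>+ m. ennreal (2 powr (- (2 - r) * real_of_int m)) * indicator {m::int. a \<le> 2 powr m} m \<partial>count_space UNIV)"
        by (subst nn_integral_add) (simp_all add: nn_integral_cmult)
      also have "\<dots> \<le> ennreal (4 powr r) * ennreal (a powr r / (1 - 2 powr - r)) + ennreal (4 powr r * a\<^sup>2) * ennreal (a powr - (2 - r) / (1 - 2 powr - (2 - r)))"
        using r r2 a0 by (intro add_mono mult_left_mono geometric_below geometric_above) auto
      also have "\<dots> = ennreal (4 powr r * (a powr r * C1) + 4 powr r * a\<^sup>2 * (a powr - (2 - r) * C2))"
        using C12 d by (simp add: ennreal_mult[symmetric] ennreal_plus[symmetric] C1_def C2_def del: ennreal_plus)
      also have "4 powr r * (a powr r * C1) + 4 powr r * a\<^sup>2 * (a powr - (2 - r) * C2) = 4 powr r * (C1 + C2) * a powr (min r 2)"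
      proof -
        have "a\<^sup>2 * a powr - (2 - r) = a powr r"
          using a0 powr_add[of a 2 "r - 2"] by simp
        then have "4 powr r * a\<^sup>2 * (a powr - (2 - r) * C2) = 4 powr r * a powr r * C2" by (metis mult.assoc)
        then show ?thesis using r2 by (simp add: algebra_simps min_def)
      qed
      finally show ?thesis .
    qed
  qed
qed

section \<open>Dyadic intervals and Haar functions\<close>

definition ix :: "int \<Rightarrow> real \<Rightarrow> int" where
  "ix k x = \<lfloor>x / 2 powi k\<rfloor>"

definition dyI :: "int \<Rightarrow> int \<Rightarrow> real set" where
  "dyI k i = {x. ix k x = i}"

text \<open>Multiples of Haar functions on every dyadic interval of length \<open>2^(k + 1)\<close>: the values on the two halves are opposite.
  This is a martingale difference, with the additional feature that its modulus is predictable.\<close>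

definition haar :: "int \<Rightarrow> (real \<Rightarrow> complex) \<Rightarrow> bool" where
  "haar k g \<longleftrightarrow> (\<exists>\<alpha>. \<forall>x. g x = (if even (ix k x) then \<alpha> (ix (k + 1) x) else - \<alpha> (ix (k + 1) x)))"

lemma dyI_eq: "dyI k i = {of_int i * 2 powi k..<(of_int i + 1) * 2 powi k}"
  by (auto simp: dyI_def ix_def floor_eq_iff field_simps)

lemma dyI_measurable [measurable]: "dyI k i \<in> sets borel"
  by (simp add: dyI_eq)

lemma emeasure_dyI: "emeasure lborel (dyI k i) = ennreal (2 powi k)"
  by (simp add: dyI_eq algebra_simps)

lemma ix_measurable [measurable]: "ix k \<in> measurable borel (count_space UNIV)"
  unfolding ix_def by measurable

lemma ix_parent: "ix (k + 1) x = ix k x div 2"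
proof -
  have "x / 2 powi (k + 1) = (x / 2 powi k) / real_of_int 2"
    by (simp add: power_int_add)
  then show ?thesis unfolding ix_def by (metis floor_divide_real_eq_div zero_le_numeral)
qed

lemma ix_coarser: "k \<le> l \<Longrightarrow> ix k x = ix k y \<Longrightarrow> ix l x = ix l y"
  by (induction l rule: int_ge_induct) (auto simp: ix_parent)

lemma ix_corner: "ix k (of_int i * 2 powi k) = i"
  by (simp add: ix_def)

lemma dyI_split: "dyI k i = dyI (k - 1) (2 * i) \<union> dyI (k - 1) (2 * i + 1)"
proof -
  have "ix k x = ix (k - 1) x div 2" for x using ix_parent[of "k - 1" x] by simp
  then show ?thesis by (auto simp: dyI_def)
qed

lemma dyI_disjoint: "i \<noteq> j \<Longrightarrow> dyI k i \<inter> dyI k j = {}"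
  by (auto simp: dyI_def)

lemma haar_measurable: "haar k g \<Longrightarrow> g \<in> borel_measurable borel"
proof -
  assume "haar k g"
  then obtain \<alpha> where g: "g = (\<lambda>x. if even (ix k x) then \<alpha> (ix (k + 1) x) else - \<alpha> (ix (k + 1) x))"
    unfolding haar_def by blast
  have [measurable]: "(\<lambda>x. \<alpha> (ix (k + 1) x)) \<in> borel_measurable borel"
    by (rule measurable_compose[OF ix_measurable]) simp
  show ?thesis unfolding g by measurable
qed

lemma haar_halves:
  assumes "haar (k - 1) g"
  obtains a where "\<And>x. x \<in> dyI (k - 1) (2 * i) \<Longrightarrow> g x = a" "\<And>x. x \<in> dyI (k - 1) (2 * i + 1) \<Longrightarrow> g x = - a"
proof -
  obtain \<alpha> where g: "\<And>x. g x = (if even (ix (k - 1) x) then \<alpha> (ix k x) else - \<alpha> (ix k x))"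
    using assms unfolding haar_def by auto
  have "ix k x = ix (k - 1) x div 2" for x using ix_parent[of "k - 1" x] by simp
  then show ?thesis by (intro that[of "\<alpha> i"]) (auto simp: g dyI_def)
qed

lemma haar_const: "haar k g \<Longrightarrow> ix k x = ix k y \<Longrightarrow> g x = g y"
  unfolding haar_def by (auto simp: ix_parent)

lemma haar_norm_const: "haar k g \<Longrightarrow> ix (k + 1) x = ix (k + 1) y \<Longrightarrow> norm (g x) = norm (g y)"
  unfolding haar_def by auto

lemma haar_mult:
  assumes "haar k g" and m: "\<And>x y. ix (k + 1) x = ix (k + 1) y \<Longrightarrow> m x = m y"
  shows "haar k (\<lambda>x. m x * g x)"
proof -
  obtain \<alpha> where g: "\<And>x. g x = (if even (ix k x) then \<alpha> (ix (k + 1) x) else - \<alpha> (ix (k + 1) x))"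
    using assms unfolding haar_def by auto
  have "m x = m (of_int (ix (k + 1) x) * 2 powi (k + 1))" for x
    by (rule m) (simp only: ix_corner)
  then show ?thesis
    unfolding haar_def by (intro exI[of _ "\<lambda>i. m (of_int i * 2 powi (k + 1)) * \<alpha> i"]) (auto simp: g)
qed

lemma nn_integral_dyI_split:
  assumes [measurable]: "f \<in> borel_measurable borel"
  shows "(\<integral>\<^sup>+ x\<in>dyI k i. f x \<partial>lborel)
    = (\<integral>\<^sup>+ x\<in>dyI (k - 1) (2 * i). f x \<partial>lborel) + (\<integral>\<^sup>+ x\<in>dyI (k - 1) (2 * i + 1). f x \<partial>lborel)"
proof -
  have "f x * indicator (dyI k i) x = f x * indicator (dyI (k - 1) (2 * i)) x + f x * indicator (dyI (k - 1) (2 * i + 1)) x" for x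
    using dyI_disjoint[of "2 * i" "2 * i + 1" "k - 1"] unfolding dyI_split[of k i]
    by (auto split: split_indicator)
  then show ?thesis by (simp add: nn_integral_add)
qed

lemma nn_integral_dyI_const:
  "(\<And>x. x \<in> dyI k i \<Longrightarrow> f x = c) \<Longrightarrow> (\<integral>\<^sup>+ x\<in>dyI k i. f x \<partial>lborel) = c * ennreal (2 powi k)"
proof -
  assume f: "\<And>x. x \<in> dyI k i \<Longrightarrow> f x = c"
  have "(\<integral>\<^sup>+ x\<in>dyI k i. f x \<partial>lborel) = (\<integral>\<^sup>+ x\<in>dyI k i. c \<partial>lborel)"
    by (intro nn_integral_cong) (auto simp: f split: split_indicator)
  then show ?thesis by (simp add: nn_integral_cmult_indicator emeasure_dyI)
qed

lemma jump_state_measurable: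
  assumes [measurable]: "\<And>j. d j \<in> borel_measurable borel"
  shows "(\<lambda>x. fst (jump_state l (\<lambda>j. d j x) k z n)) \<in> borel_measurable borel"
    and "(\<lambda>x. snd (jump_state l (\<lambda>j. d j x) k z n)) \<in> measurable borel (count_space UNIV)"
proof (induction n)
  case (Suc n)
  note [measurable] = Suc
  have f: "fst (jump_state l c k z (Suc n)) = (if l < norm (c (k - 1 - int n)) \<or> l \<le> norm (fst (jump_state l c k z n) + c (k - 1 - int n)) then 0
      else fst (jump_state l c k z n) + c (k - 1 - int n))" for c
    by (simp add: Let_def case_prod_beta)
  have s: "snd (jump_state l c k z (Suc n)) = (if l < norm (c (k - 1 - int n)) \<or> l \<le> norm (fst (jump_state l c k z n) + c (k - 1 - int n)) then Suc (snd (jump_state l c k z n))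
      else snd (jump_state l c k z n))" for c
    by (simp add: Let_def case_prod_beta)
  { case 1 show ?case unfolding f by measurable }
  { case 2 show ?case unfolding s by measurable }
qed simp_all

text \<open>The potential \<open>l\<^sup>2 \<cdot> (number of jumps) + |current excursion|\<^sup>2\<close> grows, on average over an interval, by at
  most the truncated squares of the increments. The two halves of an interval carry opposite increments, so the
  cross terms cancel. A reset gains \<open>l\<^sup>2\<close> and loses the square of an excursion of size at least \<open>l\<close>, or it is caused by an
  increment above \<open>l\<close> and costs exactly the truncation level.\<close>

lemma jump_potential:
  fixes d :: "int \<Rightarrow> real \<Rightarrow> complex"
  assumes l: "0 < l" and d: "\<And>j. haar j (d j)"
  defines "pot \<equiv> \<lambda>z k n x. l\<^sup>2 * real (snd (jump_state l (\<lambda>j. d j x) k z n)) + (norm (fst (jump_state l (\<lambda>j. d j x) k z n)))\<^sup>2"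
  shows "(\<integral>\<^sup>+ x\<in>dyI k i. ennreal (pot z k n x) \<partial>lborel)
     \<le> ennreal ((norm z)\<^sup>2) * ennreal (2 powi k)
       + (\<integral>\<^sup>+ x\<in>dyI k i. (\<Sum>j\<in>{k - int n..k - 1}. ennreal ((min (norm (d j x)) l)\<^sup>2)) \<partial>lborel)"
proof (induction n arbitrary: z k i)
  case 0
  show ?case by (subst nn_integral_dyI_const[where c = "ennreal ((norm z)\<^sup>2)"]) (auto simp: pot_def)
next
  case (Suc n)
  have dm [measurable]: "d j \<in> borel_measurable borel" for j using d haar_measurable by blast
  have [measurable]: "(\<lambda>x. pot z k n x) \<in> borel_measurable borel" for z k n
    unfolding pot_def using jump_state_measurable[OF dm] by measurable
  have pot0: "0 \<le> pot z k n x" for z k n x unfolding pot_def by simp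
  define F where "F k n x = (\<Sum>j\<in>{k - int n..k - 1}. ennreal ((min (norm (d j x)) l)\<^sup>2))" for k n x
  have [measurable]: "F k n \<in> borel_measurable borel" for k n unfolding F_def by measurable
  have IH: "(\<integral>\<^sup>+ x\<in>dyI (k - 1) i. ennreal (pot z (k - 1) n x) \<partial>lborel)
     \<le> ennreal ((norm z)\<^sup>2 * 2 powi (k - 1)) + (\<integral>\<^sup>+ x\<in>dyI (k - 1) i. F (k - 1) n x \<partial>lborel)" for z i
    using Suc[of z "k - 1" i] by (simp add: F_def ennreal_mult)
  obtain a where a: "\<And>x. x \<in> dyI (k - 1) (2 * i) \<Longrightarrow> d (k - 1) x = a" "\<And>x. x \<in> dyI (k - 1) (2 * i + 1) \<Longrightarrow> d (k - 1) x = - a"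
    using haar_halves[OF d] by blast
  define q where "q b = (if l < norm b then l\<^sup>2 else (norm (z + b))\<^sup>2)" for b
  have half: "(\<integral>\<^sup>+ x\<in>dyI (k - 1) m. ennreal (pot z k (Suc n) x) \<partial>lborel)
     \<le> ennreal (q b * 2 powi (k - 1)) + (\<integral>\<^sup>+ x\<in>dyI (k - 1) m. F (k - 1) n x \<partial>lborel)"
    if b: "\<And>x. x \<in> dyI (k - 1) m \<Longrightarrow> d (k - 1) x = b" for b m
  proof (cases "l < norm b \<or> l \<le> norm (z + b)")
    case True
    have "(\<integral>\<^sup>+ x\<in>dyI (k - 1) m. ennreal (pot z k (Suc n) x) \<partial>lborel)
      = (\<integral>\<^sup>+ x. ennreal (l\<^sup>2) * indicator (dyI (k - 1) m) x + ennreal (pot 0 (k - 1) n x) * indicator (dyI (k - 1) m) x \<partial>lborel)"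
    proof (rule nn_integral_cong)
      fix x
      have "pot z k (Suc n) x = l\<^sup>2 + pot 0 (k - 1) n x" if "x \<in> dyI (k - 1) m"
        unfolding pot_def jump_state_head using True b[OF that] by (simp add: Let_def algebra_simps)
      then show "ennreal (pot z k (Suc n) x) * indicator (dyI (k - 1) m) x
        = ennreal (l\<^sup>2) * indicator (dyI (k - 1) m) x + ennreal (pot 0 (k - 1) n x) * indicator (dyI (k - 1) m) x"
        by (auto split: split_indicator simp: pot0)
    qed
    also have "\<dots> = ennreal (l\<^sup>2 * 2 powi (k - 1)) + (\<integral>\<^sup>+ x\<in>dyI (k - 1) m. ennreal (pot 0 (k - 1) n x) \<partial>lborel)"
      by (subst nn_integral_add) (auto simp: nn_integral_cmult_indicator emeasure_dyI ennreal_mult)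
    also have "\<dots> \<le> ennreal (l\<^sup>2 * 2 powi (k - 1)) + (\<integral>\<^sup>+ x\<in>dyI (k - 1) m. F (k - 1) n x \<partial>lborel)"
      using IH[of 0 m] by (intro add_left_mono) simp
    also have "\<dots> \<le> ennreal (q b * 2 powi (k - 1)) + (\<integral>\<^sup>+ x\<in>dyI (k - 1) m. F (k - 1) n x \<partial>lborel)"
    proof -
      have "l\<^sup>2 \<le> q b" using True l by (auto simp: q_def intro: power_mono)
      then show ?thesis by (intro add_right_mono ennreal_leI mult_right_mono) auto
    qed
    finally show ?thesis .
  next
    case False
    have "(\<integral>\<^sup>+ x\<in>dyI (k - 1) m. ennreal (pot z k (Suc n) x) \<partial>lborel)
      = (\<integral>\<^sup>+ x\<in>dyI (k - 1) m. ennreal (pot (z + b) (k - 1) n x) \<partial>lborel)"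
    proof (rule nn_integral_cong)
      fix x
      have "pot z k (Suc n) x = pot (z + b) (k - 1) n x" if "x \<in> dyI (k - 1) m"
        unfolding pot_def jump_state_head using False b[OF that] by (simp add: Let_def)
      then show "ennreal (pot z k (Suc n) x) * indicator (dyI (k - 1) m) x
        = ennreal (pot (z + b) (k - 1) n x) * indicator (dyI (k - 1) m) x"
        by (auto split: split_indicator)
    qed
    then show ?thesis using IH[of "z + b" m] False by (simp add: q_def)
  qed
  have qq: "q a + q (- a) \<le> 2 * ((norm z)\<^sup>2 + (min (norm a) l)\<^sup>2)"
  proof (cases "l < norm a")
    case True
    then show ?thesis by (simp add: q_def)
  next
    case False
    have "(norm (z + a))\<^sup>2 + (norm (z + - a))\<^sup>2 = 2 * ((norm z)\<^sup>2 + (norm a)\<^sup>2)"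
      unfolding cmod_power2 by (simp add: power2_eq_square algebra_simps)
    then show ?thesis using False by (simp add: q_def)
  qed
  have min_a: "x \<in> dyI k i \<Longrightarrow> ennreal ((min (norm (d (k - 1) x)) l)\<^sup>2) = ennreal ((min (norm a) l)\<^sup>2)" for x
    unfolding dyI_split[of k i] using a by auto
  have pw: "2 powi k = 2 * (2 powi (k - 1) :: real)" by (simp add: power_int_diff)
  have "(\<integral>\<^sup>+ x\<in>dyI k i. ennreal (pot z k (Suc n) x) \<partial>lborel)
     = (\<integral>\<^sup>+ x\<in>dyI (k - 1) (2 * i). ennreal (pot z k (Suc n) x) \<partial>lborel)
      + (\<integral>\<^sup>+ x\<in>dyI (k - 1) (2 * i + 1). ennreal (pot z k (Suc n) x) \<partial>lborel)"
    by (rule nn_integral_dyI_split) measurable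
  also have "\<dots> \<le> (ennreal (q a * 2 powi (k - 1)) + (\<integral>\<^sup>+ x\<in>dyI (k - 1) (2 * i). F (k - 1) n x \<partial>lborel))
     + (ennreal (q (- a) * 2 powi (k - 1)) + (\<integral>\<^sup>+ x\<in>dyI (k - 1) (2 * i + 1). F (k - 1) n x \<partial>lborel))"
    by (intro add_mono half a)
  also have "\<dots> = ennreal ((q a + q (- a)) * 2 powi (k - 1)) + (\<integral>\<^sup>+ x\<in>dyI k i. F (k - 1) n x \<partial>lborel)"
    by (subst nn_integral_dyI_split[of _ k i]) (auto simp: q_def ennreal_plus distrib_right add_ac)
  also have "\<dots> \<le> ennreal (2 * ((norm z)\<^sup>2 + (min (norm a) l)\<^sup>2) * 2 powi (k - 1)) + (\<integral>\<^sup>+ x\<in>dyI k i. F (k - 1) n x \<partial>lborel)"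
    by (intro add_right_mono ennreal_leI mult_right_mono qq) auto
  also have "ennreal (2 * ((norm z)\<^sup>2 + (min (norm a) l)\<^sup>2) * 2 powi (k - 1))
     = ennreal ((norm z)\<^sup>2) * ennreal (2 powi k) + ennreal ((min (norm a) l)\<^sup>2) * ennreal (2 powi k)"
    unfolding pw by (simp add: ennreal_mult[symmetric] ennreal_plus[symmetric] algebra_simps del: ennreal_plus)
  also have "ennreal ((min (norm a) l)\<^sup>2) * ennreal (2 powi k) = (\<integral>\<^sup>+ x\<in>dyI k i. ennreal ((min (norm (d (k - 1) x)) l)\<^sup>2) \<partial>lborel)"
    by (rule nn_integral_dyI_const[symmetric]) (rule min_a)
  also have "ennreal ((norm z)\<^sup>2) * ennreal (2 powi k) + (\<integral>\<^sup>+ x\<in>dyI k i. ennreal ((min (norm (d (k - 1) x)) l)\<^sup>2) \<partial>lborel)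
       + (\<integral>\<^sup>+ x\<in>dyI k i. F (k - 1) n x \<partial>lborel)
     = ennreal ((norm z)\<^sup>2) * ennreal (2 powi k) + (\<integral>\<^sup>+ x\<in>dyI k i. (ennreal ((min (norm (d (k - 1) x)) l)\<^sup>2) + F (k - 1) n x) \<partial>lborel)"
    by (simp add: distrib_right nn_integral_add add.assoc)
  also have "(\<lambda>x. ennreal ((min (norm (d (k - 1) x)) l)\<^sup>2) + F (k - 1) n x) = F k (Suc n)"
  proof -
    have "{k - int (Suc n)..k - 1} = insert (k - 1) {k - 1 - int n..k - 1 - 1}" by auto
    then show ?thesis by (auto simp: F_def fun_eq_iff simp del: sum_ennreal)
  qed
  finally show ?case unfolding F_def .
qed

lemma jump_count_integral:
  fixes d :: "int \<Rightarrow> real \<Rightarrow> complex"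
  assumes l: "0 < l" and d: "\<And>j. haar j (d j)"
  shows "(\<integral>\<^sup>+ x\<in>dyI k i. of_nat (snd (jump_state l (\<lambda>j. d j x) k 0 n)) \<partial>lborel)
     \<le> ennreal (1 / l\<^sup>2) * (\<integral>\<^sup>+ x\<in>dyI k i. (\<Sum>j\<in>{k - int n..k - 1}. ennreal ((min (norm (d j x)) l)\<^sup>2)) \<partial>lborel)"
proof -
  have dm [measurable]: "d j \<in> borel_measurable borel" for j using d haar_measurable by blast
  note [measurable] = jump_state_measurable[OF dm]
  have "(\<integral>\<^sup>+ x\<in>dyI k i. of_nat (snd (jump_state l (\<lambda>j. d j x) k 0 n)) \<partial>lborel)
     \<le> (\<integral>\<^sup>+ x. ennreal (1 / l\<^sup>2) * (ennreal (l\<^sup>2 * real (snd (jump_state l (\<lambda>j. d j x) k 0 n)) + (norm (fst (jump_state l (\<lambda>j. d j x) k 0 n)))\<^sup>2) * indicator (dyI k i) x) \<partial>lborel)"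
  proof (rule nn_integral_mono)
    fix x
    let ?N = "snd (jump_state l (\<lambda>j. d j x) k 0 n)" and ?u = "fst (jump_state l (\<lambda>j. d j x) k 0 n)"
    have "real ?N \<le> 1 / l\<^sup>2 * (l\<^sup>2 * real ?N + (norm ?u)\<^sup>2)" using l by (simp add: field_simps)
    then have "of_nat ?N \<le> ennreal (1 / l\<^sup>2) * ennreal (l\<^sup>2 * real ?N + (norm ?u)\<^sup>2)"
      by (simp add: ennreal_mult'[symmetric] ennreal_of_nat_eq_real_of_nat ennreal_leI del: ennreal_plus)
    then show "of_nat ?N * indicator (dyI k i) x \<le> ennreal (1 / l\<^sup>2) * (ennreal (l\<^sup>2 * real ?N + (norm ?u)\<^sup>2) * indicator (dyI k i) x)"
      by (auto split: split_indicator)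
  qed
  also have "\<dots> = ennreal (1 / l\<^sup>2) * (\<integral>\<^sup>+ x\<in>dyI k i. ennreal (l\<^sup>2 * real (snd (jump_state l (\<lambda>j. d j x) k 0 n)) + (norm (fst (jump_state l (\<lambda>j. d j x) k 0 n)))\<^sup>2) \<partial>lborel)"
    by (rule nn_integral_cmult) measurable
  also have "\<dots> \<le> ennreal (1 / l\<^sup>2) * (\<integral>\<^sup>+ x\<in>dyI k i. (\<Sum>j\<in>{k - int n..k - 1}. ennreal ((min (norm (d j x)) l)\<^sup>2)) \<partial>lborel)"
    using jump_potential[OF l d, where z = 0 and k = k and n = n and i = i] by (intro mult_left_mono) auto
  finally show ?thesis .
qed

text \<open>Only finitely many indices enter a term of the supremum, so that it runs over a countable set of integer lists.\<close>

lemma bvar_measurable: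
  assumes [measurable]: "\<And>j. d j \<in> borel_measurable borel"
  shows "(\<lambda>x. bvar r (\<lambda>j. d j x)) \<in> borel_measurable borel"
proof -
  define P where "P = {(K :: nat, ns :: int list). length ns = Suc K \<and> sorted ns}"
  have "bvar r c = (SUP (K, ns)\<in>P. ennreal (pvar r c (\<lambda>i. ns ! min i K) K powr (1 / r)))" for c
  proof (rule antisym)
    show "bvar r c \<le> (SUP (K, ns)\<in>P. ennreal (pvar r c (\<lambda>i. ns ! min i K) K powr (1 / r)))"
    proof (rule bvar_least)
      fix K n assume n: "mono (n :: nat \<Rightarrow> int)"
      let ?ns = "map n [0..<Suc K]"
      have P: "(K, ?ns) \<in> P" using n by (auto simp: P_def sorted_map sorted_wrt_iff_nth_less monoD simp del: upt_Suc)
      have "pvar r c (\<lambda>i. ?ns ! min i K) K = pvar r c n K"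
        by (intro sum.cong refl) (simp add: blocks_def min_def del: upt_Suc)
      then show "ennreal (pvar r c n K powr (1 / r)) \<le> (SUP (K, ns)\<in>P. ennreal (pvar r c (\<lambda>i. ns ! min i K) K powr (1 / r)))"
        by (intro SUP_upper2[OF P]) simp
    qed
    show "(SUP (K, ns)\<in>P. ennreal (pvar r c (\<lambda>i. ns ! min i K) K powr (1 / r))) \<le> bvar r c"
    proof (rule SUP_least, clarify)
      fix K :: nat and ns :: "int list" assume P: "(K, ns) \<in> P"
      have "mono (\<lambda>i. ns ! min i K)"
        using P by (intro monoI) (auto simp: P_def intro!: sorted_nth_mono)
      then show "ennreal (pvar r c (\<lambda>i. ns ! min i K) K powr (1 / r)) \<le> bvar r c" by (rule bvar_upper)
    qed
  qed
  moreover have "(\<lambda>x. SUP (K, ns)\<in>P. ennreal (pvar r (\<lambda>j. d j x) (\<lambda>i. ns ! min i K) K powr (1 / r))) \<in> borel_measurable borel"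
  proof (rule borel_measurable_SUP)
    show "countable P" by (rule countable_subset[OF subset_UNIV]) simp
    fix z assume "z \<in> P"
    show "(\<lambda>x. case z of (K, ns) \<Rightarrow> ennreal (pvar r (\<lambda>j. d j x) (\<lambda>i. ns ! min i K) K powr (1 / r))) \<in> borel_measurable borel"
      unfolding blocks_def case_prod_beta by measurable
  qed
  ultimately show ?thesis by simp
qed

text \<open>Chebyshev's inequality, twice: jumps of the height \<open>2^M\<close> occur only on a small set if \<open>M\<close> is large, and off this set
  the variation is controlled by the weighted numbers of smaller jumps, whose mean is bounded by the mean of the
  \<open>s\<close>-function.\<close>

lemma local_estimate_unit:
  assumes r: "1 \<le> r" "r \<noteq> 2" and s: "s = min r 2" and \<theta>: "0 < (\<theta>::real)"
  shows "\<exists>\<Lambda>>0. \<forall>k N i d. (\<forall>j. haar j (d j)) \<longrightarrow> (\<forall>j x. j < k - int N \<or> k \<le> j \<longrightarrow> d j x = 0) \<longrightarrow>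
     (\<forall>x\<in>dyI k i. (\<Sum>j\<in>{k - int N..k - 1}. norm (d j x) powr s) \<le> 1) \<longrightarrow>
     emeasure lborel {x \<in> dyI k i. ennreal \<Lambda> \<le> bvar r (\<lambda>j. d j x)} \<le> ennreal (\<theta> * 2 powi k)"
proof -
  have s1: "1 \<le> s" "s \<le> 2" using r s by auto
  obtain n0 :: nat where n0: "1 / 2 ^ n0 < \<theta> / 2" using real_arch_pow_inv[of "\<theta>/2" "1/2"] \<theta> by (auto simp: power_one_over)
  define M where "M = int n0"
  have M: "1 / (2 powr real_of_int M)\<^sup>2 \<le> \<theta> / 2"
  proof -
    have "(1::real) \<le> 2 ^ n0" by simp
    then have "1 / (2 ^ n0)\<^sup>2 \<le> (1 / 2 ^ n0 :: real)" by (simp add: field_simps power2_eq_square)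
    then show ?thesis using n0 by (simp add: M_def powr_realpow)
  qed
  obtain C where C: "0 \<le> C" "\<And>a. 0 \<le> a \<Longrightarrow> a \<le> 1 \<Longrightarrow>
    sumZ (\<lambda>m. jump_weight r m * indicator {..<M} m * ennreal (sq_cap m a))
      \<le> ennreal (C * a powr s)"
    using jump_weights[of r M] r s by auto
  define \<Lambda> where "\<Lambda> = ((2 * C + 1) / \<theta>) powr (1/r)"
  have L: "0 < \<Lambda>" "\<Lambda> powr r = (2 * C + 1) / \<theta>" using C(1) \<theta> r by (auto simp: \<Lambda>_def powr_powr)
  have "emeasure lborel {x \<in> dyI k i. ennreal \<Lambda> \<le> bvar r (\<lambda>j. d j x)} \<le> ennreal (\<theta> * 2 powi k)"
    if haar: "\<forall>j. haar j (d j)" and out: "\<forall>j x. j < k - int N \<or> k \<le> j \<longrightarrow> d j x = 0"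
     and small: "\<forall>x\<in>dyI k i. (\<Sum>j\<in>{k - int N..k - 1}. norm (d j x) powr s) \<le> 1"
    for k N i and d :: "int \<Rightarrow> real \<Rightarrow> complex"
  proof -
    have dm [measurable]: "d j \<in> borel_measurable borel" for j using haar haar_measurable by blast
    note [measurable] = jump_state_measurable[OF dm] bvar_measurable[OF dm]
    define J where "J = {k - int N..k - 1}"
    define I where "I = dyI k i"
    have [measurable]: "I \<in> sets borel" by (simp add: I_def)
    define cnt where "cnt m x = (of_nat (snd (jump_state (2 powr m) (\<lambda>j. d j x) k 0 N)) :: ennreal)" for m :: int and x
    have cm [measurable]: "cnt m \<in> borel_measurable borel" for m unfolding cnt_def by measurable
    have d1: "norm (d j x) \<le> 1" if "x \<in> I" "j \<in> J" for x j
    proof -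
      have "norm (d j x) powr s \<le> (\<Sum>j\<in>J. norm (d j x) powr s)" using that by (intro member_le_sum) (auto simp: J_def)
      also have "\<dots> \<le> 1" using small that by (auto simp: I_def J_def)
      finally have le: "norm (d j x) powr s \<le> 1" .
      show ?thesis
      proof (rule ccontr)
        assume "\<not> norm (d j x) \<le> 1"
        then have "1 powr s < norm (d j x) powr s" using s1 by (intro powr_less_mono2) auto
        then show False using le by simp
      qed
    qed
    have cnt_int: "(\<integral>\<^sup>+ x\<in>I. cnt m x \<partial>lborel)
       \<le> (\<integral>\<^sup>+ x\<in>I. (\<Sum>j\<in>J. ennreal (sq_cap m (norm (d j x)))) \<partial>lborel)" for m
    proof -
      have e: "1 / (2 powr real_of_int m)\<^sup>2 = 2 powr (- 2 * real_of_int m)"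
        by (simp add: power2_eq_square powr_add[symmetric] powr_minus_divide)
      have "(\<integral>\<^sup>+ x\<in>I. cnt m x \<partial>lborel)
         \<le> ennreal (1 / (2 powr real_of_int m)\<^sup>2) * (\<integral>\<^sup>+ x\<in>I. (\<Sum>j\<in>J. ennreal ((min (norm (d j x)) (2 powr m))\<^sup>2)) \<partial>lborel)"
        unfolding cnt_def I_def J_def by (rule jump_count_integral) (use haar in auto)
      also have "\<dots> = (\<integral>\<^sup>+ x. ennreal (2 powr (- 2 * real_of_int m)) * ((\<Sum>j\<in>J. ennreal ((min (norm (d j x)) (2 powr m))\<^sup>2)) * indicator I x) \<partial>lborel)"
        unfolding e by (rule nn_integral_cmult[symmetric]) measurable
      also have "\<dots> = (\<integral>\<^sup>+ x\<in>I. (\<Sum>j\<in>J. ennreal (sq_cap m (norm (d j x)))) \<partial>lborel)"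
        by (intro nn_integral_cong) (simp add: mult.assoc[symmetric] sum_distrib_left ennreal_mult del: sum_ennreal)
      finally show ?thesis .
    qed
    have I2: "emeasure lborel I = ennreal (2 powi k)" by (simp add: I_def emeasure_dyI)
    define B1 where "B1 = {x \<in> I. 1 \<le> cnt M x}"
    define B2 where "B2 = {x \<in> I. ennreal (\<Lambda> powr r) \<le> sumZ (\<lambda>m. jump_weight r m * indicator {..<M} m * cnt m x)}"
    have sub: "{x \<in> I. ennreal \<Lambda> \<le> bvar r (\<lambda>j. d j x)} \<subseteq> B1 \<union> B2"
    proof (rule subsetI)
      fix x assume x: "x \<in> {x \<in> I. ennreal \<Lambda> \<le> bvar r (\<lambda>j. d j x)}"
      show "x \<in> B1 \<union> B2"
      proof (cases "snd (jump_state (2 powr M) (\<lambda>j. d j x) k 0 N) = 0")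
        case False
        then have "(1::ennreal) \<le> cnt M x" unfolding cnt_def
          by (metis One_nat_def Suc_leI neq0_conv of_nat_1 of_nat_mono)
        then show ?thesis using x by (simp add: B1_def)
      next
        case True
        have "ennreal (\<Lambda> powr r) \<le> epowr (bvar r (\<lambda>j. d j x)) r"
          using x L r epowr_mono[of "ennreal \<Lambda>" "bvar r (\<lambda>j. d j x)" r] by simp
        also have "\<dots> \<le> sumZ (\<lambda>m. jump_weight r m * indicator {..<M} m * cnt m x)"
          unfolding cnt_def by (rule bvar_le_jumps) (use r out True in auto)
        finally show ?thesis using x by (simp add: B2_def)
      qed
    qed
    have [measurable]: "B1 \<in> sets borel" "B2 \<in> sets borel"
      unfolding B1_def B2_def by measurable
    have b1: "emeasure lborel B1 \<le> ennreal (\<theta> / 2 * 2 powi k)"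
    proof -
      have "emeasure lborel B1 = (\<integral>\<^sup>+ x. indicator B1 x \<partial>lborel)" by simp
      also have "\<dots> \<le> (\<integral>\<^sup>+ x\<in>I. cnt M x \<partial>lborel)"
        by (intro nn_integral_mono) (auto simp: B1_def split: split_indicator)
      also have "\<dots> \<le> (\<integral>\<^sup>+ x\<in>I. (\<Sum>j\<in>J. ennreal (2 powr (- 2 * real_of_int M) * (min (norm (d j x)) (2 powr M))\<^sup>2)) \<partial>lborel)"
        by (rule cnt_int)
      also have "\<dots> \<le> (\<integral>\<^sup>+ x\<in>I. ennreal (\<theta> / 2) \<partial>lborel)"
      proof (rule nn_integral_mono)
        fix x
        have "(\<Sum>j\<in>J. 2 powr (- 2 * real_of_int M) * (min (norm (d j x)) (2 powr M))\<^sup>2) \<le> \<theta> / 2" if x: "x \<in> I"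
        proof -
          have "(min (norm (d j x)) (2 powr M))\<^sup>2 \<le> norm (d j x) powr s" if j: "j \<in> J" for j
          proof (cases "d j x = 0")
            case False
            have "(min (norm (d j x)) (2 powr M))\<^sup>2 \<le> (norm (d j x))\<^sup>2" by (intro power_mono) auto
            also have "\<dots> = norm (d j x) powr 2" using False by simp
            also have "\<dots> \<le> norm (d j x) powr s" using d1[OF x j] s1 by (intro powr_mono') auto
            finally show ?thesis .
          qed simp
          then have "(\<Sum>j\<in>J. (min (norm (d j x)) (2 powr M))\<^sup>2) \<le> (\<Sum>j\<in>J. norm (d j x) powr s)" by (rule sum_mono)
          also have "\<dots> \<le> 1" using small x by (auto simp: I_def J_def)
          finally have "2 powr (- 2 * real_of_int M) * (\<Sum>j\<in>J. (min (norm (d j x)) (2 powr M))\<^sup>2) \<le> 2 powr (- 2 * real_of_int M) * 1"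
            by (intro mult_left_mono) auto
          also have "2 powr (- 2 * real_of_int M) * 1 = 1 / (2 powr real_of_int M)\<^sup>2"
            by (simp add: power2_eq_square powr_add[symmetric] powr_minus_divide)
          finally show ?thesis using M by (simp add: sum_distrib_left)
        qed
        then show "(\<Sum>j\<in>J. ennreal (2 powr (- 2 * real_of_int M) * (min (norm (d j x)) (2 powr M))\<^sup>2)) * indicator I x \<le> ennreal (\<theta> / 2) * indicator I x"
          by (auto split: split_indicator intro!: ennreal_leI)
      qed
      also have "\<dots> = ennreal (\<theta> / 2 * 2 powi k)" using \<theta> by (simp add: nn_integral_cmult_indicator I2) (subst ennreal_mult[symmetric], auto)
      finally show ?thesis .
    qed
    have b2: "emeasure lborel B2 \<le> ennreal (\<theta> / 2 * 2 powi k)"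
    proof -
      have "ennreal (\<Lambda> powr r) * emeasure lborel B2 = (\<integral>\<^sup>+ x\<in>B2. ennreal (\<Lambda> powr r) \<partial>lborel)"
        by (simp add: nn_integral_cmult_indicator)
      also have "\<dots> \<le> (\<integral>\<^sup>+ x. sumZ (\<lambda>m. jump_weight r m * indicator {..<M} m * (cnt m x * indicator I x)) \<partial>lborel)"
        by (intro nn_integral_mono) (auto simp: B2_def split: split_indicator)
      also have "\<dots> = sumZ (\<lambda>m. \<integral>\<^sup>+ x. jump_weight r m * indicator {..<M} m * (cnt m x * indicator I x) \<partial>lborel)"
        by (rule nn_integral_count_space_nn_integral) auto
      also have "\<dots> = sumZ (\<lambda>m. jump_weight r m * indicator {..<M} m * (\<integral>\<^sup>+ x\<in>I. cnt m x \<partial>lborel))"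
        by (intro nn_integral_cong nn_integral_cmult) measurable
      also have "\<dots> \<le> sumZ (\<lambda>m. jump_weight r m * indicator {..<M} m *
          (\<integral>\<^sup>+ x\<in>I. (\<Sum>j\<in>J. ennreal (sq_cap m (norm (d j x)))) \<partial>lborel))"
        by (intro sumZ_mono mult_left_mono cnt_int) auto
      also have "\<dots> = sumZ (\<lambda>m. \<integral>\<^sup>+ x. jump_weight r m * indicator {..<M} m *
          ((\<Sum>j\<in>J. ennreal (sq_cap m (norm (d j x)))) * indicator I x) \<partial>lborel)"
        by (intro nn_integral_cong nn_integral_cmult[symmetric]) measurable
      also have "\<dots> = (\<integral>\<^sup>+ x. sumZ (\<lambda>m. jump_weight r m * indicator {..<M} m *
          ((\<Sum>j\<in>J. ennreal (sq_cap m (norm (d j x)))) * indicator I x)) \<partial>lborel)"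
        by (rule nn_integral_count_space_nn_integral[symmetric]) auto
      also have "\<dots> \<le> (\<integral>\<^sup>+ x\<in>I. ennreal C \<partial>lborel)"
      proof (rule nn_integral_mono)
        fix x
        show "sumZ (\<lambda>m. jump_weight r m * indicator {..<M} m *
          ((\<Sum>j\<in>J. ennreal (sq_cap m (norm (d j x)))) * indicator I x)) \<le> ennreal C * indicator I x"
        proof (cases "x \<in> I")
          case x: True
          have "sumZ (\<lambda>m. jump_weight r m * indicator {..<M} m *
             (\<Sum>j\<in>J. ennreal (sq_cap m (norm (d j x)))))
            = (\<Sum>j\<in>J. sumZ (\<lambda>m. jump_weight r m * indicator {..<M} m * ennreal (sq_cap m (norm (d j x)))))"
            unfolding sum_distrib_left by (rule nn_integral_sum) auto
          also have "\<dots> \<le> (\<Sum>j\<in>J. ennreal (C * norm (d j x) powr s))"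
            using d1[OF x] by (intro sum_mono C) auto
          also have "\<dots> = ennreal (C * (\<Sum>j\<in>J. norm (d j x) powr s))"
            using C(1) by (simp add: sum_distrib_left)
          also have "\<dots> \<le> ennreal (C * 1)"
            using C(1) small x by (intro ennreal_leI mult_left_mono) (auto simp: I_def J_def)
          finally show ?thesis using x by simp
        qed simp
      qed
      also have "\<dots> = ennreal (C * 2 powi k)" using C(1) by (simp add: nn_integral_cmult_indicator I2 ennreal_mult)
      finally have "ennreal (1 / \<Lambda> powr r) * (ennreal (\<Lambda> powr r) * emeasure lborel B2) \<le> ennreal (1 / \<Lambda> powr r) * ennreal (C * 2 powi k)"
        by (rule mult_left_mono) auto
      also have "ennreal (1 / \<Lambda> powr r) * (ennreal (\<Lambda> powr r) * emeasure lborel B2) = emeasure lborel B2"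
        using L(1) by (simp add: mult.assoc[symmetric] ennreal_mult[symmetric])
      also have "ennreal (1 / \<Lambda> powr r) * ennreal (C * 2 powi k) = ennreal (1 / \<Lambda> powr r * (C * 2 powi k))"
        using C(1) by (intro ennreal_mult[symmetric]) auto
      also have "\<dots> \<le> ennreal (\<theta> / 2 * 2 powi k)"
      proof (rule ennreal_leI)
        have "1 / \<Lambda> powr r * C \<le> \<theta> / 2" unfolding L(2) using C(1) \<theta> by (simp add: field_simps)
        then have "1 / \<Lambda> powr r * C * 2 powi k \<le> \<theta> / 2 * 2 powi k" by (rule mult_right_mono) simp
        then show "1 / \<Lambda> powr r * (C * 2 powi k) \<le> \<theta> / 2 * 2 powi k" by (simp only: mult.assoc)
      qed
      finally show ?thesis .
    qed
    have "emeasure lborel {x \<in> I. ennreal \<Lambda> \<le> bvar r (\<lambda>j. d j x)} \<le> emeasure lborel (B1 \<union> B2)"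
      by (intro emeasure_mono sub) auto
    also have "\<dots> \<le> emeasure lborel B1 + emeasure lborel B2" by (intro emeasure_subadditive) auto
    also have "\<dots> \<le> ennreal (\<theta> / 2 * 2 powi k) + ennreal (\<theta> / 2 * 2 powi k)" by (intro add_mono b1 b2)
    also have "\<dots> = ennreal (\<theta> * 2 powi k)" using \<theta> by (simp add: ennreal_plus[symmetric] del: ennreal_plus)
    finally show ?thesis by (simp add: I_def)
  qed
  then show ?thesis using L(1) by (intro exI[of _ \<Lambda>]) blast
qed

abbreviation small_tails :: "real \<Rightarrow> real \<Rightarrow> real \<Rightarrow> real \<Rightarrow> prop" where
  "small_tails r s \<Lambda> \<theta> \<equiv> (\<And>b k N i d. 0 < b \<Longrightarrow> (\<And>j. haar j (d j)) \<Longrightarrow> (\<And>j x. j < k - int N \<or> k \<le> j \<Longrightarrow> d j x = 0) \<Longrightarrow>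
     (\<And>x. x \<in> dyI k i \<Longrightarrow> (\<Sum>j\<in>{k - int N..k - 1}. norm (d j x) powr s) \<le> b powr s) \<Longrightarrow>
     emeasure lborel {x \<in> dyI k i. ennreal (\<Lambda> * b) \<le> bvar r (\<lambda>j. d j x)} \<le> ennreal (\<theta> * 2 powi k))"

lemma local_estimate:
  assumes r: "1 \<le> r" "r \<noteq> 2" and s: "s = min r 2" and \<theta>: "0 < (\<theta>::real)"
  obtains \<Lambda> where "0 < \<Lambda>" "PROP small_tails r s \<Lambda> \<theta>"
proof -
  obtain \<Lambda> where L: "0 < \<Lambda>" "\<And>k N i d. (\<forall>j. haar j (d j)) \<Longrightarrow> (\<forall>j x. j < k - int N \<or> k \<le> j \<longrightarrow> d j x = 0) \<Longrightarrow>
     (\<forall>x\<in>dyI k i. (\<Sum>j\<in>{k - int N..k - 1}. norm (d j x) powr s) \<le> 1) \<Longrightarrow>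
     emeasure lborel {x \<in> dyI k i. ennreal \<Lambda> \<le> bvar r (\<lambda>j. d j x)} \<le> ennreal (\<theta> * 2 powi k)"
    using local_estimate_unit[OF assms] by blast
  show ?thesis
  proof (rule that[OF L(1)])
    fix b k N i and d :: "int \<Rightarrow> real \<Rightarrow> complex"
    assume b: "0 < b" and haar: "\<And>j. haar j (d j)" and out: "\<And>j x. j < k - int N \<or> k \<le> j \<Longrightarrow> d j x = 0"
      and small: "\<And>x. x \<in> dyI k i \<Longrightarrow> (\<Sum>j\<in>{k - int N..k - 1}. norm (d j x) powr s) \<le> b powr s"
    define e where "e j x = of_real (1 / b) * d j x" for j x
    have "ennreal (\<Lambda> * b) \<le> bvar r (\<lambda>j. d j x) \<longleftrightarrow> ennreal \<Lambda> \<le> bvar r (\<lambda>j. e j x)" for x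
    proof -
      have "bvar r (\<lambda>j. d j x) = ennreal b * bvar r (\<lambda>j. e j x)"
        using bvar_cmult[of r b "\<lambda>j. e j x"] r b by (simp add: e_def)
      moreover have "ennreal (\<Lambda> * b) = ennreal b * ennreal \<Lambda>" using b L by (simp add: ennreal_mult mult.commute)
      ultimately show ?thesis using b by (simp add: ennreal_mult_le_mult_iff)
    qed
    moreover have "emeasure lborel {x \<in> dyI k i. ennreal \<Lambda> \<le> bvar r (\<lambda>j. e j x)} \<le> ennreal (\<theta> * 2 powi k)"
    proof (intro L(2) allI impI ballI)
      show "haar j (e j)" for j unfolding e_def by (rule haar_mult[OF haar]) simp
      show "e j x = 0" if "j < k - int N \<or> k \<le> j" for j x using out[OF that] by (simp add: e_def)
      show "(\<Sum>j\<in>{k - int N..k - 1}. norm (e j x) powr s) \<le> 1" if "x \<in> dyI k i" for x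
      proof -
        have "norm (e j x) powr s = norm (d j x) powr s / b powr s" for j
          using b by (simp add: e_def norm_mult norm_divide powr_divide)
        then show ?thesis using small[OF that] b by (simp add: sum_divide_distrib[symmetric])
      qed
    qed
    ultimately show "emeasure lborel {x \<in> dyI k i. ennreal (\<Lambda> * b) \<le> bvar r (\<lambda>j. d j x)} \<le> ennreal (\<theta> * 2 powi k)"
      by simp
  qed
qed

section \<open>Good-lambda inequality for dyadic martingales\<close>

lemma dyI_subset_Icc: "dyI k i \<subseteq> {of_int i * 2 powi k..(of_int i + 1) * 2 powi k}"
  by (auto simp: dyI_eq)

lemma (in Ap) wt_dyI_finite: "mass w (dyI k i) < top"
proof -
  have "mass w (dyI k i) \<le> mass w {of_int i * 2 powi k..(of_int i + 1) * 2 powi k}"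
    by (intro emeasure_mono dyI_subset_Icc) auto
  also have "\<dots> < top" by (intro w_interval) simp
  finally show ?thesis .
qed

text \<open>The complement of \<open>E\<close> fills half of the interval and hence carries a fixed proportion of its weight.\<close>

lemma (in Ap) small_part:
  assumes [measurable]: "E \<in> sets borel" and E: "E \<subseteq> dyI k i" "emeasure lborel E \<le> ennreal (1/2 * 2 powi k)"
  shows "mass w E \<le> ennreal (max 0 (1 - (1/2) powr p / K)) * mass w (dyI k i)"
proof -
  define L where "L = (2::real) powi k"
  have L: "0 < L" by (simp add: L_def)
  define a where "a = of_int i * L"
  have I: "dyI k i \<subseteq> {a..a + L}" using dyI_subset_Icc[of k i] by (simp add: a_def L_def algebra_simps)
  define A where "A = dyI k i - E"
  have [measurable]: "A \<in> sets borel" by (simp add: A_def)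
  have fin: "mass w E < top" "mass w A < top"
    using wt_dyI_finite[of k i] E emeasure_mono[of E "dyI k i" "wt w"] emeasure_mono[of A "dyI k i" "wt w"]
    by (auto simp: A_def intro: le_less_trans)
  obtain e where e: "mass w E = ennreal e" "0 \<le> e" using fin(1) by (metis ennreal_cases less_irrefl)
  obtain v where v: "mass w A = ennreal v" "0 \<le> v" using fin(2) by (metis ennreal_cases less_irrefl)
  have un: "E \<union> A = dyI k i" "E \<inter> A = {}" using E by (auto simp: A_def)
  have sum: "mass w (dyI k i) = ennreal (e + v)"
    using plus_emeasure[of E "wt w" A] un e v by (simp add: ennreal_plus)
  have "emeasure lborel E + emeasure lborel A = ennreal L"
    using plus_emeasure[of E lborel A] un by (simp add: emeasure_dyI L_def)
  then have "ennreal L \<le> ennreal (1/2 * L) + emeasure lborel A"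
    using E(2) by (metis L_def add_right_mono)
  moreover have "emeasure lborel A \<noteq> top"
    using emeasure_mono[of A "dyI k i" lborel] by (auto simp: A_def emeasure_dyI top_unique)
  ultimately have half: "ennreal (L / 2) \<le> emeasure lborel A"
    using L by (cases "emeasure lborel A") (auto simp: ennreal_plus[symmetric] simp del: ennreal_plus)
  have "ennreal ((L / 2) powr p) * mass w (dyI k i) \<le> epowr (emeasure lborel A) p * mass w {a..a + L}"
    using epowr_mono[OF half, of p] p L I by (intro mult_mono emeasure_mono) auto
  also have "\<dots> \<le> ennreal (K * L powr p) * mass w A"
    using measure_ratio[of a "a + L" A] L I by (auto simp: A_def)
  finally have "(L / 2) powr p * (e + v) \<le> K * L powr p * v"
    unfolding sum v(1) using e v K_pos L by (simp add: ennreal_mult[symmetric] ennreal_plus[symmetric] del: ennreal_plus)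
  then have "L powr p * ((1/2) powr p * (e + v)) \<le> L powr p * (K * v)"
    using powr_mult[of L "1/2" p] by (simp add: mult_ac)
  then have "(1/2) powr p * (e + v) \<le> K * v" using L by simp
  then have "(1/2) powr p / K * (e + v) \<le> v" using K_pos by (simp add: field_simps)
  then have "e \<le> (1 - (1/2) powr p / K) * (e + v)" by (simp add: algebra_simps)
  also have "\<dots> \<le> max 0 (1 - (1/2) powr p / K) * (e + v)" using e v by (intro mult_right_mono) auto
  finally show ?thesis unfolding sum e(1) using e v by (subst ennreal_mult[symmetric]) (auto intro: ennreal_leI)
qed

lemma dyadic_union:
  assumes se: "sets \<mu> = sets borel" and T: "T \<in> sets borel" and B: "B \<in> sets borel"
    and inv: "\<And>x y. ix k x = ix k y \<Longrightarrow> x \<in> T \<Longrightarrow> y \<in> T"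
    and le: "\<And>i. dyI k i \<subseteq> T \<Longrightarrow> emeasure \<mu> (dyI k i \<inter> B) \<le> c * emeasure \<mu> (dyI k i)"
  shows "emeasure \<mu> (T \<inter> B) \<le> c * emeasure \<mu> T"
proof -
  note [measurable_cong] = se
  note [measurable] = T B
  have dec: "emeasure \<mu> (T \<inter> D) = (\<integral>\<^sup>+ i. emeasure \<mu> (dyI k i \<inter> T \<inter> D) \<partial>count_space UNIV)" if [measurable]: "D \<in> sets borel" for D
  proof -
    have "T \<inter> D = (\<Union>i. dyI k i \<inter> T \<inter> D)" by (auto simp: dyI_def)
    also have "emeasure \<mu> \<dots> = (\<integral>\<^sup>+ i. emeasure \<mu> (dyI k i \<inter> T \<inter> D) \<partial>count_space UNIV)"
      by (rule emeasure_UN_countable) (auto simp: disjoint_family_on_def dyI_def)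
    finally show ?thesis .
  qed
  have "emeasure \<mu> (T \<inter> B) = sumZ (\<lambda>i. emeasure \<mu> (dyI k i \<inter> T \<inter> B))" by (rule dec) measurable
  also have "\<dots> \<le> sumZ (\<lambda>i. c * emeasure \<mu> (dyI k i \<inter> T \<inter> UNIV))"
  proof (rule sumZ_mono)
    fix i
    show "emeasure \<mu> (dyI k i \<inter> T \<inter> B) \<le> c * emeasure \<mu> (dyI k i \<inter> T \<inter> UNIV)"
    proof (cases "dyI k i \<inter> T = {}")
      case False
      then have "dyI k i \<subseteq> T" using inv by (auto simp: dyI_def)
      then show ?thesis using le[of i] by (simp add: Int_absorb2)
    qed simp
  qed
  also have "\<dots> = c * sumZ (\<lambda>i. emeasure \<mu> (dyI k i \<inter> T \<inter> UNIV))" by (rule nn_integral_cmult) simp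
  also have "sumZ (\<lambda>i. emeasure \<mu> (dyI k i \<inter> T \<inter> UNIV)) = emeasure \<mu> T"
    using dec[of UNIV] by simp
  finally show ?thesis .
qed

text \<open>Run the martingale from coarse to fine until its variation first exceeds \<open>l\<close>; this happens at scale \<open>k\<close> on a union
  \<open>T k\<close> of dyadic intervals. If the \<open>s\<close>-function is at most \<open>\<gamma> l\<close>, one more increment adds at most \<open>\<gamma> l\<close>, so that the total
  variation can only exceed \<open>(1 + \<delta>) l\<close> if the part of the martingale that is finer than \<open>k\<close> has variation at least
  \<open>\<Lambda> \<gamma> l\<close>. By the local estimate this happens on at most half of each interval. The local
  estimate requires a small \<open>s\<close>-function everywhere on the interval, which is achieved by stopping.\<close>

lemma (in Ap) good_lambda:
  fixes d :: "int \<Rightarrow> real \<Rightarrow> complex"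
  assumes r: "1 \<le> r" and L: "0 < \<Lambda>" "PROP small_tails r p \<Lambda> (1/2)"
    and haar: "\<And>j. haar j (d j)" and out: "\<And>j x. j < a \<or> b < j \<Longrightarrow> d j x = 0" and ab: "a \<le> b"
    and g: "0 < \<gamma>" "\<gamma> * (1 + \<Lambda>) \<le> \<delta>" and l: "0 < l"
  defines "V \<equiv> \<lambda>x. bvar r (\<lambda>j. d j x)" and "S \<equiv> \<lambda>x. ennreal ((\<Sum>j\<in>{a..b}. norm (d j x) powr p) powr (1/p))"
  shows "mass w {x. ennreal ((1 + \<delta>) * l) < V x}
     \<le> ennreal (max 0 (1 - (1/2) powr p / K)) * mass w {x. ennreal l < V x} + mass w {x. ennreal (\<gamma> * l) < S x}"
proof -
  let ?\<eta> = "ennreal (max 0 (1 - (1/2) powr p / K))"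
  have dm [measurable]: "d j \<in> borel_measurable borel" for j using haar haar_measurable by blast
  define Vk where "Vk k x = bvar r (\<lambda>j. if k \<le> j \<and> j \<le> b then d j x else 0)" for k x
  have Vm [measurable]: "V \<in> borel_measurable borel" unfolding V_def by (rule bvar_measurable) measurable
  have Vkm [measurable]: "Vk k \<in> borel_measurable borel" for k
    unfolding Vk_def[abs_def] by (rule bvar_measurable) measurable
  have Sm [measurable]: "S \<in> borel_measurable borel" unfolding S_def by measurable
  have VkV: "Vk k x \<le> V x" for k x unfolding Vk_def V_def by (rule bvar_restrict)
  have Vka: "Vk a x = V x" for x unfolding Vk_def V_def by (intro arg_cong[of _ _ "bvar r"] ext) (use out in auto)
  have Vkb: "Vk (b + 1) x = 0" for x
  proof -
    have "(\<lambda>j. if b + 1 \<le> j \<and> j \<le> b then d j x else 0) = (\<lambda>_. 0)" by (intro ext) auto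
    then show ?thesis unfolding Vk_def by (simp add: bvar_zero r)
  qed
  have Vk_mono: "Vk k' x \<le> Vk k x" if "k \<le> k'" for k k' x
  proof -
    have "(\<lambda>j. if k' \<le> j \<and> j \<le> b then d j x else 0) = (\<lambda>j. if k' \<le> j \<and> j \<le> b then (if k \<le> j \<and> j \<le> b then d j x else 0) else 0)"
      by (intro ext) (use that in auto)
    then show ?thesis unfolding Vk_def using bvar_restrict[of r k' b "\<lambda>j. if k \<le> j \<and> j \<le> b then d j x else 0"] by simp
  qed
  \<comment> \<open>\<open>Vk k\<close> is the variation of the part of scale at least \<open>k\<close>; \<open>T k\<close> is where the level is first passed\<close>
  define T where "T k = {x. ennreal l < Vk k x \<and> Vk (k + 1) x \<le> ennreal l}" for k
  define B where "B = {x. ennreal ((1 + \<delta>) * l) < V x \<and> S x \<le> ennreal (\<gamma> * l)}"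
  have [measurable]: "T k \<in> sets borel" for k unfolding T_def by measurable
  have [measurable]: "B \<in> sets borel" unfolding B_def by measurable
  have \<delta>: "0 < \<delta>"
  proof -
    have "0 < \<gamma> * (1 + \<Lambda>)" using g(1) L(1) by simp
    then show ?thesis using g(2) by linarith
  qed
  have disj: "disjoint_family_on T {a..b}"
  proof -
    have "T k \<inter> T k' = {}" if "k < k'" for k k'
    proof (rule equals0I)
      fix x assume "x \<in> T k \<inter> T k'"
      moreover have "Vk k' x \<le> Vk (k + 1) x" using that by (intro Vk_mono) simp
      ultimately show False by (auto simp: T_def)
    qed
    then show ?thesis unfolding disjoint_family_on_def by (metis linorder_neqE Int_commute)
  qed
  have cover: "x \<in> (\<Union>k\<in>{a..b}. T k)" if x: "ennreal l < V x" for x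
  proof -
    define P where "P n \<longleftrightarrow> ennreal l < Vk (b + 1 - int n) x" for n
    have "P (nat (b + 1 - a))" using x ab Vka[of x] by (simp add: P_def)
    then obtain n where n: "P n" "\<And>m. m < n \<Longrightarrow> \<not> P m" "n \<le> nat (b + 1 - a)"
      by (metis exists_least_iff not_less)
    have "n \<noteq> 0"
    proof
      assume "n = 0"
      then show False using n(1) Vkb[of x] by (simp add: P_def)
    qed
    then have "\<not> P (n - 1)" using n(2) by simp
    moreover have "b + 1 - int n + 1 = b + 1 - int (n - 1)" using \<open>n \<noteq> 0\<close> by (simp add: of_nat_diff)
    ultimately have "x \<in> T (b + 1 - int n)" using n(1) by (simp add: T_def P_def)
    moreover have "b + 1 - int n \<in> {a..b}" using n(3) \<open>n \<noteq> 0\<close> ab by auto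
    ultimately show ?thesis by blast
  qed
  have step: "mass w (T k \<inter> B) \<le> ?\<eta> * mass w (T k)" if k: "k \<in> {a..b}" for k
  proof (rule dyadic_union[where k = k])
    have eq: "Vk k' x = Vk k' y" if "ix k x = ix k y" "k \<le> k'" for x y k'
    proof -
      have "d j x = d j y" if "k' \<le> j" for j
        by (rule haar_const[OF haar], rule ix_coarser[OF _ \<open>ix k x = ix k y\<close>]) (use that \<open>k \<le> k'\<close> in simp)
      then have "(\<lambda>j. if k' \<le> j \<and> j \<le> b then d j x else 0) = (\<lambda>j. if k' \<le> j \<and> j \<le> b then d j y else 0)"
        by (intro ext) simp
      then show ?thesis by (simp add: Vk_def)
    qed
    show "y \<in> T k" if "ix k x = ix k y" "x \<in> T k" for x y
      using that eq[OF that(1), of k] eq[OF that(1), of "k + 1"] by (simp add: T_def)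
    fix i assume I: "dyI k i \<subseteq> T k"
    \<comment> \<open>the differences finer than \<open>k\<close>, stopped before their \<open>s\<close>-function passes \<open>\<gamma> l\<close>; the stopping is predictable since the moduli are\<close>
    define m where "m j y = (if j < k \<and> (\<Sum>i\<in>{j..k - 1}. norm (d i y) powr p) \<le> (\<gamma> * l) powr p then 1 else 0 :: complex)" for j y
    define d' where "d' j y = m j y * d j y" for j y
    have mc: "m j x = m j y" if "ix (j + 1) x = ix (j + 1) y" for j x y
    proof -
      have "norm (d i x) = norm (d i y)" if "j \<le> i" for i
        by (rule haar_norm_const[OF haar], rule ix_coarser[OF _ \<open>ix (j + 1) x = ix (j + 1) y\<close>]) (use that in simp)
      then have "(\<Sum>i\<in>{j..k - 1}. norm (d i x) powr p) = (\<Sum>i\<in>{j..k - 1}. norm (d i y) powr p)" by (intro sum.cong) auto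
      then show ?thesis by (simp add: m_def)
    qed
    have haar': "haar j (d' j)" for j unfolding d'_def by (rule haar_mult[OF haar mc])
    have dm' [measurable]: "d' j \<in> borel_measurable borel" for j using haar' haar_measurable by blast
    define N where "N = nat (k - a)"
    have N: "k - int N = a" using k by (simp add: N_def)
    have out': "d' j x = 0" if "j < k - int N \<or> k \<le> j" for j x
      using that out[of j x] unfolding N by (auto simp: d'_def m_def)
    have small': "(\<Sum>j\<in>{k - int N..k - 1}. norm (d' j x) powr p) \<le> (\<gamma> * l) powr p" for x
    proof -
      define Gd where "Gd = {j \<in> {a..k - 1}. m j x \<noteq> 0}"
      have fin: "finite Gd" unfolding Gd_def by (rule finite_subset[of _ "{a..k - 1}"]) auto
      have "(\<Sum>j\<in>{a..k - 1}. norm (d' j x) powr p) = (\<Sum>j\<in>Gd. norm (d' j x) powr p)"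
        by (rule sum.mono_neutral_right) (auto simp: Gd_def d'_def)
      also have "\<dots> \<le> (\<gamma> * l) powr p"
      proof (cases "Gd = {}")
        case False
        define j0 where "j0 = Min Gd"
        have j0: "j0 \<in> Gd" "\<And>j. j \<in> Gd \<Longrightarrow> j0 \<le> j" using False fin by (auto simp: j0_def)
        have "(\<Sum>j\<in>Gd. norm (d' j x) powr p) \<le> (\<Sum>j\<in>Gd. norm (d j x) powr p)"
          by (intro sum_mono) (auto simp: d'_def m_def)
        also have "\<dots> \<le> (\<Sum>j\<in>{j0..k - 1}. norm (d j x) powr p)"
          by (intro sum_mono2) (use j0 in \<open>auto simp: Gd_def\<close>)
        also have "\<dots> \<le> (\<gamma> * l) powr p" using j0(1) by (auto simp: Gd_def m_def split: if_splits)
        finally show ?thesis .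
      qed simp
      finally show ?thesis unfolding N .
    qed
    define E where "E = {x \<in> dyI k i. ennreal (\<Lambda> * (\<gamma> * l)) \<le> bvar r (\<lambda>j. d' j x)}"
    have bm: "(\<lambda>x. bvar r (\<lambda>j. d' j x)) \<in> borel_measurable borel" by (rule bvar_measurable) measurable
    have Em [measurable]: "E \<in> sets borel" unfolding E_def using bm by measurable
    have sub: "dyI k i \<inter> B \<subseteq> E"
    proof
      fix x assume x: "x \<in> dyI k i \<inter> B"
      have xT: "Vk (k + 1) x \<le> ennreal l" using x I by (auto simp: T_def)
      have xV: "ennreal ((1 + \<delta>) * l) < V x" and xS: "S x \<le> ennreal (\<gamma> * l)" using x by (auto simp: B_def)
      have "(\<Sum>j\<in>{a..b}. norm (d j x) powr p) powr (1/p) \<le> \<gamma> * l"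
        using xS g l by (simp add: S_def)
      then have "((\<Sum>j\<in>{a..b}. norm (d j x) powr p) powr (1/p)) powr p \<le> (\<gamma> * l) powr p"
        using p by (intro powr_mono2) auto
      then have tot: "(\<Sum>j\<in>{a..b}. norm (d j x) powr p) \<le> (\<gamma> * l) powr p"
        using p by (simp add: powr_powr sum_nonneg)
      have part: "(\<Sum>j\<in>J. norm (d j x) powr p) \<le> (\<gamma> * l) powr p" if "J \<inter> {a..b} = J'" "finite J" for J J'
      proof -
        have "(\<Sum>j\<in>J. norm (d j x) powr p) = (\<Sum>j\<in>J'. norm (d j x) powr p)"
        proof (rule sum.mono_neutral_right)
          show "\<forall>i\<in>J - J'. norm (d i x) powr p = 0"
          proof
            fix i assume "i \<in> J - J'"
            then have "i < a \<or> b < i" using that by auto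
            then show "norm (d i x) powr p = 0" using out[of i x] by simp
          qed
        qed (use that in auto)
        also have "\<dots> \<le> (\<Sum>j\<in>{a..b}. norm (d j x) powr p)" using that by (intro sum_mono2) auto
        finally show ?thesis using tot by simp
      qed
      have dk: "norm (d k x) \<le> \<gamma> * l"
      proof -
        have "norm (d k x) powr p \<le> (\<gamma> * l) powr p" using part[of "{k}"] by simp
        then show ?thesis using powr_less_mono2[of p "\<gamma> * l" "norm (d k x)"] p g l by fastforce
      qed
      have dd: "d' j x = (if j < k then d j x else 0)" for j
        using part[of "{j..k - 1}"] by (auto simp: d'_def m_def)
      have "V x = bvar r (\<lambda>j. (if k + 1 \<le> j \<and> j \<le> b then d j x else 0) + ((if j = k then d k x else 0) + d' j x))"
        unfolding V_def by (intro arg_cong[of _ _ "bvar r"] ext) (auto simp: dd out)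
      also have "\<dots> \<le> Vk (k + 1) x + (bvar r (\<lambda>j. if j = k then d k x else 0) + bvar r (\<lambda>j. d' j x))"
        unfolding Vk_def by (rule order_trans[OF bvar_add[OF r] add_left_mono[OF bvar_add[OF r]]])
      also have "\<dots> \<le> ennreal l + (ennreal (\<gamma> * l) + bvar r (\<lambda>j. d' j x))"
        using dk by (intro add_mono xT order_trans[OF bvar_single[OF r]] ennreal_leI order_refl)
      finally have Vx: "V x \<le> ennreal l + (ennreal (\<gamma> * l) + bvar r (\<lambda>j. d' j x))" .
      have "ennreal (\<Lambda> * (\<gamma> * l)) \<le> bvar r (\<lambda>j. d' j x)"
      proof (rule ccontr)
        assume "\<not> ?thesis"
        then have "ennreal l + (ennreal (\<gamma> * l) + bvar r (\<lambda>j. d' j x)) \<le> ennreal l + (ennreal (\<gamma> * l) + ennreal (\<Lambda> * (\<gamma> * l)))"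
          by (intro add_left_mono) simp
        also have "\<dots> = ennreal (l + (\<gamma> * l + \<Lambda> * (\<gamma> * l)))"
          using l g L(1) by (simp add: ennreal_plus)
        also have "\<dots> \<le> ennreal ((1 + \<delta>) * l)"
        proof (rule ennreal_leI)
          have "\<gamma> * (1 + \<Lambda>) * l \<le> \<delta> * l" using g(2) l by (intro mult_right_mono) auto
          then show "l + (\<gamma> * l + \<Lambda> * (\<gamma> * l)) \<le> (1 + \<delta>) * l" by (simp add: algebra_simps)
        qed
        finally show False using Vx xV by (meson leD order_trans)
      qed
      then show "x \<in> E" using x by (simp add: E_def)
    qed
    have "emeasure lborel E \<le> ennreal (1/2 * 2 powi k)"
      unfolding E_def by (rule L(2)[where N = N]) (use g l haar' out' small' in auto)
    then have "mass w E \<le> ?\<eta> * mass w (dyI k i)"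
      by (intro small_part Em) (auto simp: E_def)
    moreover have "mass w (dyI k i \<inter> B) \<le> mass w E"
      by (intro emeasure_mono sub) auto
    ultimately show "mass w (dyI k i \<inter> B) \<le> ?\<eta> * mass w (dyI k i)" by (rule order_trans[rotated])
  qed auto
  have "{x. ennreal ((1 + \<delta>) * l) < V x} \<subseteq> (\<Union>k\<in>{a..b}. T k \<inter> B) \<union> {x. ennreal (\<gamma> * l) < S x}"
  proof
    fix x assume x: "x \<in> {x. ennreal ((1 + \<delta>) * l) < V x}"
    have "ennreal l \<le> ennreal ((1 + \<delta>) * l)" using \<delta> l by (intro ennreal_leI) (simp add: algebra_simps)
    then have "ennreal l < V x" using x by (auto intro: le_less_trans)
    then show "x \<in> (\<Union>k\<in>{a..b}. T k \<inter> B) \<union> {x. ennreal (\<gamma> * l) < S x}"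
      using cover x by (auto simp: B_def not_less)
  qed
  then have "mass w {x. ennreal ((1 + \<delta>) * l) < V x} \<le> mass w ((\<Union>k\<in>{a..b}. T k \<inter> B) \<union> {x. ennreal (\<gamma> * l) < S x})"
    by (intro emeasure_mono) auto
  also have "\<dots> \<le> mass w (\<Union>k\<in>{a..b}. T k \<inter> B) + mass w {x. ennreal (\<gamma> * l) < S x}"
    by (intro emeasure_subadditive) auto
  also have "mass w (\<Union>k\<in>{a..b}. T k \<inter> B) \<le> (\<Sum>k\<in>{a..b}. mass w (T k \<inter> B))"
    by (intro emeasure_subadditive_finite) auto
  also have "\<dots> \<le> (\<Sum>k\<in>{a..b}. ?\<eta> * mass w (T k))" by (intro sum_mono step)
  also have "\<dots> = ?\<eta> * (\<Sum>k\<in>{a..b}. mass w (T k))" by (simp add: sum_distrib_left)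
  also have "(\<Sum>k\<in>{a..b}. mass w (T k)) = mass w (\<Union>k\<in>{a..b}. T k)"
    using disj by (intro sum_emeasure) auto
  also have "\<dots> \<le> mass w {x. ennreal l < V x}"
    by (intro emeasure_mono) (auto simp: T_def intro: less_le_trans[OF _ VkV])
  finally show ?thesis by (simp add: add_right_mono mult_left_mono)
qed

lemma sumZ_shift: "sumZ (\<lambda>m. F (m + 1)) = sumZ F"
proof -
  have "bij (\<lambda>m::int. m + 1)" by (rule bij_betwI[of _ _ _ "\<lambda>m. m - 1"]) auto
  then show ?thesis by (rule nn_integral_bij_count_space)
qed

text \<open>From the good-lambda inequality to norms: summing over geometric levels, the first term on the right is
  absorbed, which needs the a priori finiteness.\<close>

lemma good_lambda_integral:
  assumes p: "0 < p" and q: "1 < q" and eta: "0 \<le> \<eta>" "q powr p * \<eta> < 1" and g: "0 < \<gamma>"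
    and [measurable]: "V \<in> borel_measurable M" "S \<in> borel_measurable M"
    and gl: "\<And>l. 0 < l \<Longrightarrow> emeasure M {x \<in> space M. ennreal (q * l) < V x}
       \<le> ennreal \<eta> * emeasure M {x \<in> space M. ennreal l < V x} + emeasure M {x \<in> space M. ennreal (\<gamma> * l) < S x}"
    and fin: "(\<integral>\<^sup>+ x. epowr (V x) p \<partial>M) < top"
  shows "(\<integral>\<^sup>+ x. epowr (V x) p \<partial>M)
     \<le> ennreal (q powr p * (q powr p / (1 - q powr p * \<eta>) * (1 / (1 - q powr - p) * (1 / \<gamma>) powr p))) * (\<integral>\<^sup>+ x. epowr (S x) p \<partial>M)"
proof -
  have q0: "q powr - p < 1" using q p by (intro powr_less_one) auto
  define G where "G = (\<integral>\<^sup>+ x. layer q p (V x) \<partial>M)"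
  define GS where "GS = (\<integral>\<^sup>+ x. layer q p (ennreal (1 / \<gamma>) * S x) \<partial>M)"
  define F where "F m = emeasure M {x \<in> space M. ennreal (q powr m) < V x}" for m
  have lev: "{x \<in> space M. ennreal (q powr m) < ennreal (1 / \<gamma>) * S x} = {x \<in> space M. ennreal (\<gamma> * q powr m) < S x}" for m :: real
  proof -
    have "ennreal (q powr m) < ennreal (1 / \<gamma>) * y \<longleftrightarrow> ennreal (\<gamma> * q powr m) < y" for y
    proof (cases y)
      case (real z)
      then show ?thesis using g by (simp add: ennreal_mult[symmetric] ennreal_less_iff field_simps)
    next
      case top then show ?thesis using g by (simp add: ennreal_mult_top)
    qed
    then show ?thesis by simp
  qed
  have G: "G = sumZ (\<lambda>m. ennreal (q powr (p * real_of_int m)) * F m)"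
    unfolding G_def F_def by (rule nn_integral_layer) measurable
  also have "\<dots> = sumZ (\<lambda>m. ennreal (q powr (p * real_of_int (m + 1))) * F (real_of_int (m + 1)))"
    by (rule sumZ_shift[symmetric])
  also have "\<dots> \<le> sumZ (\<lambda>m. ennreal (q powr p * \<eta>) * (ennreal (q powr (p * real_of_int m)) * F m)
      + ennreal (q powr p) * (ennreal (q powr (p * real_of_int m)) * emeasure M {x \<in> space M. ennreal (q powr m) < ennreal (1 / \<gamma>) * S x}))"
  proof (rule sumZ_mono)
    fix m :: int
    have e1: "q powr (real_of_int (m + 1)) = q * q powr m" using q by (simp add: powr_add mult.commute)
    have e2: "q powr (p * real_of_int (m + 1)) = q powr p * q powr (p * real_of_int m)"
      by (simp add: powr_add[symmetric] algebra_simps)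
    have "F (real_of_int (m + 1)) \<le> ennreal \<eta> * F m + emeasure M {x \<in> space M. ennreal (\<gamma> * q powr m) < S x}"
      unfolding F_def e1 using q by (intro gl) auto
    then have "ennreal (q powr (p * real_of_int (m + 1))) * F (real_of_int (m + 1))
      \<le> ennreal (q powr p * q powr (p * real_of_int m)) * (ennreal \<eta> * F m + emeasure M {x \<in> space M. ennreal (\<gamma> * q powr m) < S x})"
      unfolding e2 by (rule mult_left_mono) auto
    also have "\<dots> = ennreal (q powr p * \<eta>) * (ennreal (q powr (p * real_of_int m)) * F m)
      + ennreal (q powr p) * (ennreal (q powr (p * real_of_int m)) * emeasure M {x \<in> space M. ennreal (q powr m) < ennreal (1 / \<gamma>) * S x})"
      unfolding lev using eta by (simp add: ennreal_mult distrib_left mult_ac)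
    finally show "ennreal (q powr (p * real_of_int (m + 1))) * F (real_of_int (m + 1)) \<le> \<dots>" .
  qed
  also have "\<dots> = ennreal (q powr p * \<eta>) * G + ennreal (q powr p) * GS"
  proof -
    have GS: "GS = sumZ (\<lambda>m. ennreal (q powr (p * real_of_int m)) * emeasure M {x \<in> space M. ennreal (q powr m) < ennreal (1 / \<gamma>) * S x})"
      unfolding GS_def by (rule nn_integral_layer) measurable
    show ?thesis unfolding G GS by (subst nn_integral_add) (simp_all add: nn_integral_cmult)
  qed
  finally have GG: "G \<le> ennreal (q powr p * \<eta>) * G + ennreal (q powr p) * GS" .
  have Gfin: "G < top"
  proof -
    have "G \<le> (\<integral>\<^sup>+ x. ennreal (1 / (1 - q powr - p)) * epowr (V x) p \<partial>M)"
      unfolding G_def by (intro nn_integral_mono layer_le_epowr q p)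
    also have "\<dots> = ennreal (1 / (1 - q powr - p)) * (\<integral>\<^sup>+ x. epowr (V x) p \<partial>M)" by (rule nn_integral_cmult) measurable
    also have "\<dots> < top" using fin by (simp add: ennreal_mult_less_top)
    finally show ?thesis .
  qed
  have GS_le: "GS \<le> ennreal (1 / (1 - q powr - p) * (1 / \<gamma>) powr p) * (\<integral>\<^sup>+ x. epowr (S x) p \<partial>M)"
  proof -
    have "GS \<le> (\<integral>\<^sup>+ x. ennreal (1 / (1 - q powr - p)) * epowr (ennreal (1 / \<gamma>) * S x) p \<partial>M)"
      unfolding GS_def by (intro nn_integral_mono layer_le_epowr q p)
    also have "\<dots> = (\<integral>\<^sup>+ x. ennreal (1 / (1 - q powr - p) * (1 / \<gamma>) powr p) * epowr (S x) p \<partial>M)"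
    proof (rule nn_integral_cong)
      fix x
      have "ennreal (1 / (1 - q powr - p) * (1 / \<gamma>) powr p) = ennreal (1 / (1 - q powr - p)) * ennreal ((1 / \<gamma>) powr p)"
        using q0 by (intro ennreal_mult) auto
      moreover have "epowr (ennreal (1 / \<gamma>) * S x) p = ennreal ((1 / \<gamma>) powr p) * epowr (S x) p"
        using p g by (simp add: epowr_mult)
      ultimately show "ennreal (1 / (1 - q powr - p)) * epowr (ennreal (1 / \<gamma>) * S x) p
        = ennreal (1 / (1 - q powr - p) * (1 / \<gamma>) powr p) * epowr (S x) p"
        by (simp only: mult.assoc)
    qed
    also have "\<dots> = ennreal (1 / (1 - q powr - p) * (1 / \<gamma>) powr p) * (\<integral>\<^sup>+ x. epowr (S x) p \<partial>M)" by (rule nn_integral_cmult) measurable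
    finally show ?thesis .
  qed
  have absorb: "G \<le> ennreal (q powr p / (1 - q powr p * \<eta>)) * GS"
  proof (cases "GS = top")
    case True
    then show ?thesis using eta q by (simp add: ennreal_mult_top)
  next
    case False
    then obtain y where y: "GS = ennreal y" "0 \<le> y" by (metis ennreal_cases)
    obtain x where x: "G = ennreal x" "0 \<le> x" using Gfin by (metis ennreal_cases less_irrefl)
    have "x \<le> q powr p * \<eta> * x + q powr p * y"
      using GG x y eta by (simp add: ennreal_mult[symmetric] ennreal_plus[symmetric] del: ennreal_plus)
    then have "x * (1 - q powr p * \<eta>) \<le> q powr p * y" by (simp add: algebra_simps)
    then have "x \<le> q powr p / (1 - q powr p * \<eta>) * y" using eta by (simp add: field_simps)
    then show ?thesis using x y eta by (simp add: ennreal_mult[symmetric] ennreal_leI)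
  qed
  have "(\<integral>\<^sup>+ x. epowr (V x) p \<partial>M) \<le> (\<integral>\<^sup>+ x. ennreal (q powr p) * layer q p (V x) \<partial>M)"
    by (intro nn_integral_mono epowr_le_layer q p)
  also have "\<dots> = ennreal (q powr p) * G" unfolding G_def by (rule nn_integral_cmult) measurable
  also have "\<dots> \<le> ennreal (q powr p) * (ennreal (q powr p / (1 - q powr p * \<eta>)) * (ennreal (1 / (1 - q powr - p) * (1 / \<gamma>) powr p) * (\<integral>\<^sup>+ x. epowr (S x) p \<partial>M)))"
    by (intro mult_left_mono order_trans[OF absorb] GS_le) auto
  also have "\<dots> = ennreal (q powr p * (q powr p / (1 - q powr p * \<eta>) * (1 / (1 - q powr - p) * (1 / \<gamma>) powr p))) * (\<integral>\<^sup>+ x. epowr (S x) p \<partial>M)"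
    using eta q0 by (simp only: ennreal_mult mult.assoc powr_ge_zero zero_le_divide_iff zero_le_mult_iff less_imp_le diff_ge_0_iff_ge zero_le_one simp_thms mult_nonneg_nonneg divide_nonneg_nonneg)
  finally show ?thesis .
qed

text \<open>The weighted measure of the exceptional half of an interval is at most a fraction \<open>\<eta> < 1\<close>, so the good-lambda inequality
  with a factor \<open>q\<close> close to one satisfies \<open>q\<^sup>s \<eta> < 1\<close> and can be integrated. For finitely many differences the variation
  is finite a priori, being bounded by the sum of their moduli.\<close>

theorem martingale_variation:
  assumes r: "1 < r" "r \<noteq> 2" and s: "s = min r 2"
  shows "\<exists>C\<ge>0. \<forall>W d a b. Ap s K W \<longrightarrow> (\<forall>j. haar j (d j)) \<longrightarrow> (\<forall>j x. j < a \<or> b < j \<longrightarrow> d j x = 0) \<longrightarrow>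
     Lpow s W (\<lambda>x. bvar r (\<lambda>j. d j x)) \<le> ennreal C * (\<integral>\<^sup>+ x. ennreal (\<Sum>j\<in>{a..b}. norm (d j x) powr s) \<partial>wt W)"
proof -
  have s1: "1 < s" using r s by auto
  obtain \<Lambda> where L: "0 < \<Lambda>" "PROP small_tails r s \<Lambda> (1/2)"
  proof (rule local_estimate[OF less_imp_le[OF r(1)] r(2) s, where \<theta> = "1/2"])
    show "0 < (1/2 :: real)" by simp
    fix \<Lambda> assume "0 < \<Lambda>" "PROP small_tails r s \<Lambda> (1/2)"
    then show ?thesis by (rule that)
  qed
  define \<eta> where "\<eta> = max 0 (1 - (1/2) powr s / K)"
  \<comment> \<open>chosen so that \<open>1 < q\<close> and \<open>q powr s * \<eta> < 1\<close>\<close>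
  define q where "q = (2 / (1 + \<eta>)) powr (1/s)"
  define \<gamma> where "\<gamma> = (q - 1) / (1 + \<Lambda>)"
  define C where "C = q powr s * (q powr s / (1 - q powr s * \<eta>) * (1 / (1 - q powr - s) * (1 / \<gamma>) powr s))"
  show ?thesis
  proof (cases "0 < K")
    case False
    then have "\<not> Ap s K W" for W using Ap.K_pos by blast
    then show ?thesis by (intro exI[of _ 0]) auto
  next
    case K: True
    have \<eta>: "0 \<le> \<eta>" "\<eta> < 1" using K by (auto simp: \<eta>_def)
    have q: "1 < q" unfolding q_def using \<eta> s1 by (intro gr_one_powr) auto
    have qs: "q powr s * \<eta> < 1"
    proof -
      have "q powr s = 2 / (1 + \<eta>)" using \<eta> s1 by (simp add: q_def powr_powr)
      then have "q powr s * \<eta> = 2 * \<eta> / (1 + \<eta>)" by simp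
      also have "\<dots> < 1" using \<eta> by (simp add: divide_less_eq)
      finally show ?thesis .
    qed
    have \<gamma>: "0 < \<gamma>" "\<gamma> * (1 + \<Lambda>) \<le> q - 1" using q L(1) by (auto simp: \<gamma>_def)
    have q0: "q powr - s < 1" using q s1 by (intro powr_less_one) auto
    have C: "0 \<le> C" unfolding C_def using qs q0 by (intro mult_nonneg_nonneg divide_nonneg_nonneg) auto
    show ?thesis
    proof (intro exI[of _ C] conjI C allI impI)
      fix W d a b
      assume W: "Ap s K W" and haar: "\<forall>j. haar j (d j)" and out: "\<forall>j x. j < a \<or> b < j \<longrightarrow> d j x = 0"
      interpret Ap s K W by fact
      have dm [measurable]: "d j \<in> borel_measurable borel" for j using haar haar_measurable by blast
      define V where "V x = bvar r (\<lambda>j. d j x)" for x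
      define S where "S x = ennreal ((\<Sum>j\<in>{a..b}. norm (d j x) powr s) powr (1/s))" for x
      have Vm [measurable]: "V \<in> borel_measurable borel" unfolding V_def by (rule bvar_measurable) measurable
      have Sm [measurable]: "S \<in> borel_measurable borel" unfolding S_def by measurable
      have Ss: "epowr (S x) s = ennreal (\<Sum>j\<in>{a..b}. norm (d j x) powr s)" for x
        using s1 by (simp add: S_def powr_powr sum_nonneg)
      have "Lpow s W V \<le> ennreal C * Lpow s W S"
      proof (cases "a \<le> b")
        case False
        then have "d j x = 0" for j x using out by (cases "j < a") auto
        then have "V x = bvar r (\<lambda>j. 0)" for x unfolding V_def by simp
        then have "V x = 0" for x using bvar_zero[of r] r by simp
        then show ?thesis by simp
      next
        case ab: True
        show ?thesis
        proof (cases "Lpow s W S = top")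
          case True
          have "0 < C" unfolding C_def using q qs q0 \<gamma> by (intro mult_pos_pos divide_pos_pos) auto
          then show ?thesis using True by (simp add: ennreal_mult_top)
        next
          case False
          have VS: "V x \<le> of_nat (card {a..b}) * S x" for x
          proof -
            have "V x = bvar r (\<lambda>j. if j \<in> {a..b} then d j x else 0)"
              unfolding V_def using out by (intro arg_cong[of _ _ "bvar r"] ext) auto
            also have "\<dots> \<le> (\<Sum>j\<in>{a..b}. enorm (d j x))" using r by (intro bvar_le_sum) auto
            also have "\<dots> \<le> (\<Sum>j\<in>{a..b}. S x)"
            proof (rule sum_mono)
              fix j assume j: "j \<in> {a..b}"
              have "norm (d j x) powr s \<le> (\<Sum>j\<in>{a..b}. norm (d j x) powr s)" using j by (intro member_le_sum) auto
              then have "(norm (d j x) powr s) powr (1/s) \<le> (\<Sum>j\<in>{a..b}. norm (d j x) powr s) powr (1/s)"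
                using s1 by (intro powr_mono2) auto
              then show "enorm (d j x) \<le> S x" using s1 by (simp add: S_def powr_powr ennreal_leI)
            qed
            also have "\<dots> = of_nat (card {a..b}) * S x" by simp
            finally show ?thesis .
          qed
          have fin: "Lpow s W V < top"
          proof -
            have "Lpow s W V \<le> (\<integral>\<^sup>+ x. epowr (of_nat (card {a..b})) s * epowr (S x) s \<partial>wt W)"
            proof (rule nn_integral_mono)
              fix x
              have "epowr (V x) s \<le> epowr (of_nat (card {a..b}) * S x) s" using s1 by (intro epowr_mono VS) simp
              also have "\<dots> = epowr (of_nat (card {a..b})) s * epowr (S x) s" using s1 by (intro epowr_mult) simp
              finally show "epowr (V x) s \<le> epowr (of_nat (card {a..b})) s * epowr (S x) s" .
            qed
            also have "\<dots> = epowr (of_nat (card {a..b})) s * Lpow s W S" by (rule nn_integral_cmult) measurable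
            also have "\<dots> < top" using False by (simp add: ennreal_mult_less_top top.not_eq_extremum ennreal_of_nat_eq_real_of_nat)
            finally show ?thesis .
          qed
          have gl: "mass W {x \<in> space (wt W). ennreal (q * l) < V x}
             \<le> ennreal \<eta> * mass W {x \<in> space (wt W). ennreal l < V x} + mass W {x \<in> space (wt W). ennreal (\<gamma> * l) < S x}"
            if l: "0 < l" for l
          proof -
            have "mass W {x. ennreal ((1 + (q - 1)) * l) < bvar r (\<lambda>j. d j x)}
              \<le> ennreal (max 0 (1 - (1/2) powr s / K)) * mass W {x. ennreal l < bvar r (\<lambda>j. d j x)}
                + mass W {x. ennreal (\<gamma> * l) < ennreal ((\<Sum>j\<in>{a..b}. norm (d j x) powr s) powr (1/s))}"
            proof (rule good_lambda[where \<Lambda> = \<Lambda>])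
              fix b k N i and d :: "int \<Rightarrow> real \<Rightarrow> complex"
              assume "0 < b" "\<And>j. haar j (d j)" "\<And>j x. j < k - int N \<or> k \<le> j \<Longrightarrow> d j x = 0"
                "\<And>x. x \<in> dyI k i \<Longrightarrow> (\<Sum>j\<in>{k - int N..k - 1}. norm (d j x) powr s) \<le> b powr s"
              then show "emeasure lborel {x \<in> dyI k i. ennreal (\<Lambda> * b) \<le> bvar r (\<lambda>j. d j x)} \<le> ennreal (1/2 * 2 powi k)"
                by (rule L(2))
            qed (use r L(1) haar out ab \<gamma> l in auto)
            then show ?thesis by (simp add: V_def S_def \<eta>_def)
          qed
          show ?thesis unfolding C_def
            by (rule good_lambda_integral) (use s1 q \<eta> qs \<gamma> gl fin in auto)
        qed
      qed
      then show "Lpow s W (\<lambda>x. bvar r (\<lambda>j. d j x)) \<le> ennreal C * (\<integral>\<^sup>+ x. ennreal (\<Sum>j\<in>{a..b}. norm (d j x) powr s) \<partial>wt W)"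
        unfolding V_def Ss .
    qed
  qed
qed

section \<open>Smooth functions and test functions\<close>

text \<open>Smoothness by existence of successive derivatives, which is preserved by algebraic operations without computing
  iterated vector derivatives.\<close>

fun differentiable_times :: "nat \<Rightarrow> (real \<Rightarrow> complex) \<Rightarrow> bool" where
  "differentiable_times 0 f \<longleftrightarrow> True"
| "differentiable_times (Suc n) f \<longleftrightarrow>
     (\<exists>f'. (\<forall>x. (f has_vector_derivative f' x) (at x)) \<and> differentiable_times n f')"

abbreviation "smooth f \<equiv> (\<forall>n. differentiable_times n f)"

lemma differentiable_times_Suc: "differentiable_times (Suc n) f \<Longrightarrow> differentiable_times n f"
  by (induction n arbitrary: f) auto

lemma differentiable_times_deriv:
  assumes "differentiable_times (Suc n) f" "\<And>x. (f has_vector_derivative f' x) (at x)"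
  shows "differentiable_times n f'"
proof -
  obtain g where g: "\<And>x. (f has_vector_derivative g x) (at x)" "differentiable_times n g"
    using assms(1) by auto
  have "f' = g" using g(1) assms(2) by (auto intro: vector_derivative_unique_at)
  then show ?thesis using g by simp
qed

lemma smooth_deriv: "smooth f \<Longrightarrow> (\<And>x. (f has_vector_derivative f' x) (at x)) \<Longrightarrow> smooth f'"
  using differentiable_times_deriv by blast

lemma smooth_obtain_deriv:
  assumes "smooth f" obtains f' where "\<And>x. (f has_vector_derivative f' x) (at x)" "smooth f'"
proof -
  have "differentiable_times (Suc 0) f" using assms by blast
  then obtain f' where "\<And>x. (f has_vector_derivative f' x) (at x)" by auto
  then show ?thesis using smooth_deriv[OF assms] that by blast
qed

lemma smooth_imp_smooth_fun:
  assumes "smooth f" shows "smooth_fun f"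
proof -
  have "smooth (nth_vderiv N f)" for N
  proof (induction N)
    case 0 then show ?case using assms by (simp add: nth_vderiv_def)
  next
    case (Suc N)
    obtain g where g: "\<And>x. (nth_vderiv N f has_vector_derivative g x) (at x)" "smooth g"
      using smooth_obtain_deriv[OF Suc] by blast
    have "nth_vderiv (Suc N) f = g"
      using g(1) by (auto simp: nth_vderiv_def intro!: vector_derivative_at)
    then show ?case using g by simp
  qed
  then show ?thesis
    unfolding smooth_fun_def by (metis smooth_obtain_deriv differentiableI_vector)
qed

lemma smooth_continuous: "smooth f \<Longrightarrow> continuous_on UNIV f"
  by (metis smooth_obtain_deriv continuous_at_imp_continuous_on has_vector_derivative_continuous)

lemma differentiable_times_const: "differentiable_times n (\<lambda>_. c)"
  by (induction n arbitrary: c) (auto intro!: exI[of _ "\<lambda>_. 0"] derivative_eq_intros)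

lemma differentiable_times_add:
  "differentiable_times n f \<Longrightarrow> differentiable_times n g \<Longrightarrow> differentiable_times n (\<lambda>x. f x + g x)"
proof (induction n arbitrary: f g)
  case (Suc n)
  obtain f' where f': "\<And>x. (f has_vector_derivative f' x) (at x)" "differentiable_times n f'"
    using Suc.prems(1) by auto
  obtain g' where g': "\<And>x. (g has_vector_derivative g' x) (at x)" "differentiable_times n g'"
    using Suc.prems(2) by auto
  show ?case unfolding differentiable_times.simps
    by (intro exI[of _ "\<lambda>x. f' x + g' x"] conjI allI has_vector_derivative_add f' g' Suc.IH)
qed simp

lemma differentiable_times_mult:
  "differentiable_times n f \<Longrightarrow> differentiable_times n g \<Longrightarrow> differentiable_times n (\<lambda>x. f x * g x)"
proof (induction n arbitrary: f g)
  case (Suc n)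
  obtain f' where f': "\<And>x. (f has_vector_derivative f' x) (at x)" "differentiable_times n f'"
    using Suc.prems(1) by auto
  obtain g' where g': "\<And>x. (g has_vector_derivative g' x) (at x)" "differentiable_times n g'"
    using Suc.prems(2) by auto
  have "differentiable_times n (\<lambda>x. f x * g' x + f' x * g x)"
    by (intro differentiable_times_add Suc.IH differentiable_times_Suc[OF Suc.prems(1)] differentiable_times_Suc[OF Suc.prems(2)] f'(2) g'(2))
  then show ?case unfolding differentiable_times.simps
    by (intro exI[of _ "\<lambda>x. f x * g' x + f' x * g x"] conjI allI has_vector_derivative_mult f' g')
qed simp

lemma differentiable_times_affine:
  "differentiable_times n f \<Longrightarrow> differentiable_times n (\<lambda>x. f (a * x + b))"
proof (induction n arbitrary: f)
  case (Suc n)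
  then obtain f' where d: "\<And>x. (f has_vector_derivative f' x) (at x)" "differentiable_times n f'" by auto
  have "((\<lambda>x. f (a * x + b)) has_vector_derivative of_real a * f' (a * x + b)) (at x)" for x
  proof -
    have "((\<lambda>x. a * x + b) has_vector_derivative a) (at x)"
      by (auto intro!: derivative_eq_intros simp: has_real_derivative_iff_has_vector_derivative[symmetric])
    from vector_diff_chain_at[OF this d(1)] show ?thesis by (simp add: o_def scaleR_conv_of_real)
  qed
  moreover have "differentiable_times n (\<lambda>x. of_real a * f' (a * x + b))"
    using d by (intro differentiable_times_mult differentiable_times_const Suc.IH)
  ultimately show ?case unfolding differentiable_times.simps
    by (intro exI[of _ "\<lambda>x. of_real a * f' (a * x + b)"] conjI allI)
qed simp

lemma differentiable_times_inverse:
  "differentiable_times n f \<Longrightarrow> (\<And>x. f x \<noteq> 0) \<Longrightarrow> differentiable_times n (\<lambda>x. inverse (f x))"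
proof (induction n arbitrary: f)
  case (Suc n)
  then obtain f' where d: "\<And>x. (f has_vector_derivative f' x) (at x)" "differentiable_times n f'" by auto
  have "((\<lambda>x. inverse (f x)) has_vector_derivative - (inverse (f x) * f' x * inverse (f x))) (at x)" for x
    using Deriv.has_derivative_inverse[OF Suc.prems(2)[of x] d(1)[of x, unfolded has_vector_derivative_def]]
    unfolding has_vector_derivative_def by (simp add: fun_eq_iff)
  moreover have "differentiable_times n (\<lambda>x. (-1) * (inverse (f x) * f' x * inverse (f x)))"
    by (intro differentiable_times_mult differentiable_times_const Suc.IH differentiable_times_Suc[OF Suc.prems(1)] Suc.prems(2) d(2))
  ultimately show ?case unfolding differentiable_times.simps
    by (intro exI[of _ "\<lambda>x. - (inverse (f x) * f' x * inverse (f x))"] conjI allI) simp_all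
qed simp

lemma differentiable_times_of_real: "differentiable_times n (\<lambda>x. of_real x)"
  by (cases n) (auto intro!: exI[of _ "\<lambda>_. 1"] differentiable_times_const derivative_eq_intros
     simp: has_vector_derivative_of_real)

lemma has_vector_derivative_cis:
  "((\<lambda>x. cis (a * x)) has_vector_derivative \<i> * of_real a * cis (a * x)) (at x)"
proof -
  have "((\<lambda>x. exp (\<i> * of_real (a * x))) has_vector_derivative \<i> * of_real a * exp (\<i> * of_real (a * x))) (at x)"
    by (auto intro!: derivative_eq_intros has_vector_derivative_real_field)
  then show ?thesis by (simp add: cis_conv_exp)
qed

lemma differentiable_times_cis: "differentiable_times n (\<lambda>x. cis (a * x))"
  by (induction n) (auto intro!: exI[of _ "\<lambda>x. \<i> * of_real a * cis (a * x)"] has_vector_derivative_cis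
      differentiable_times_mult differentiable_times_const)

lemmas smooth_intros = differentiable_times_const differentiable_times_add differentiable_times_mult
  differentiable_times_affine differentiable_times_inverse differentiable_times_of_real differentiable_times_cis

text \<open>The family of functions \<open>exp(-1/x) / x\<^sup>n\<close> on the positive half-line is closed under taking derivatives, up to linear
  combinations, and every member vanishes to second order at the origin.\<close>

definition flat_exp :: "nat \<Rightarrow> real \<Rightarrow> real" where
  "flat_exp n x = (if 0 < x then exp (- (1 / x)) * (1 / x) ^ n else 0)"

lemma power_le_fact_exp: "0 \<le> y \<Longrightarrow> y ^ n \<le> fact n * exp (y :: real)"
proof -
  assume y: "0 \<le> y"
  have "(\<Sum>k\<in>{n}. y ^ k /\<^sub>R fact k) \<le> (\<Sum>k. y ^ k /\<^sub>R fact k)"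
    using y by (intro sum_le_suminf summable_exp_generic) auto
  then show ?thesis by (simp add: exp_def field_simps)
qed

lemma flat_exp_quadratic: "\<bar>flat_exp n x\<bar> \<le> fact (n + 2) * x\<^sup>2"
proof (cases "0 < x")
  case True
  have "(1 / x) ^ (n + 2) \<le> fact (n + 2) * exp (1 / x)" using True by (intro power_le_fact_exp) auto
  then have "exp (- (1 / x)) * (1 / x) ^ (n + 2) \<le> exp (- (1 / x)) * (fact (n + 2) * exp (1 / x))"
    by (intro mult_left_mono) auto
  also have "\<dots> = fact (n + 2)" by (simp add: exp_minus)
  finally have "(exp (- (1 / x)) * (1 / x) ^ n) / x\<^sup>2 \<le> fact (n + 2)"
    by (simp only: power_add power_one_over times_divide_eq_right mult_1_right mult.assoc)
  then have le: "exp (- (1 / x)) * (1 / x) ^ n \<le> fact (n + 2) * x\<^sup>2"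
    using True by (simp only: pos_divide_le_eq zero_less_power)
  have nn: "0 \<le> exp (- (1 / x)) * (1 / x) ^ n" using True by simp
  have "flat_exp n x = exp (- (1 / x)) * (1 / x) ^ n" using True by (simp only: flat_exp_def if_True)
  then show ?thesis using le by (simp only: abs_of_nonneg[OF nn])
qed (simp add: flat_exp_def)

lemma flat_exp_deriv: "(flat_exp n has_real_derivative - real n * flat_exp (n + 1) x + flat_exp (n + 2) x) (at x)"
proof -
  consider "0 < x" | "x < 0" | "x = 0" by linarith
  then show ?thesis
  proof cases
    case 1
    define u where "u = 1 / x"
    have "((\<lambda>u. exp (- u) * u ^ n) has_real_derivative (exp (- u) * (real n * u ^ (n - 1)) - exp (- u) * u ^ n)) (at u)"
      by (auto intro!: derivative_eq_intros)
    moreover have "((\<lambda>x. 1 / x) has_real_derivative - u\<^sup>2) (at x)"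
      using 1 by (auto intro!: derivative_eq_intros simp: u_def power2_eq_square)
    ultimately have "((\<lambda>x. exp (- (1 / x)) * (1 / x) ^ n) has_real_derivative
       (exp (- u) * (real n * u ^ (n - 1)) - exp (- u) * u ^ n) * - u\<^sup>2) (at x)"
      unfolding u_def by (rule DERIV_chain2)
    also have "(exp (- u) * (real n * u ^ (n - 1)) - exp (- u) * u ^ n) * - u\<^sup>2 = - real n * flat_exp (n + 1) x + flat_exp (n + 2) x"
    proof -
      have "real n * u ^ (n - 1) * u\<^sup>2 = real n * u ^ (n + 1)"
        by (cases n) (auto simp: power2_eq_square)
      moreover have "(exp (- u) * (real n * u ^ (n - 1)) - exp (- u) * u ^ n) * - u\<^sup>2
         = exp (- u) * (u ^ n * u\<^sup>2) - exp (- u) * (real n * u ^ (n - 1) * u\<^sup>2)"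
        by (simp add: algebra_simps)
      ultimately show ?thesis using 1 by (simp add: flat_exp_def u_def[symmetric] power2_eq_square)
    qed
    finally have "((\<lambda>x. exp (- (1 / x)) * (1 / x) ^ n) has_real_derivative - real n * flat_exp (n + 1) x + flat_exp (n + 2) x) (at x)" .
    moreover have "\<forall>\<^sub>F y in nhds x. 0 < y" using eventually_nhds_in_open[of "{0<..}" x] 1 by (auto elim: eventually_mono)
    ultimately show ?thesis
      by (subst DERIV_cong_ev[OF refl _ refl, where g = "\<lambda>x. exp (- (1 / x)) * (1 / x) ^ n"])
        (auto simp: flat_exp_def elim: eventually_mono)
  next
    case 2
    have "\<forall>\<^sub>F y in nhds x. y < 0" using eventually_nhds_in_open[of "{..<0}" x] 2 by (auto elim: eventually_mono)
    then show ?thesis using 2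
      by (subst DERIV_cong_ev[OF refl _ refl, where g = "\<lambda>x. 0"]) (auto simp: flat_exp_def elim: eventually_mono)
  next
    case 3
    have "((\<lambda>h. flat_exp n h / h) \<longlongrightarrow> 0) (at 0)"
    proof (rule Lim_null_comparison)
      have "norm (flat_exp n h / h) \<le> fact (n + 2) * \<bar>h\<bar>" if "h \<noteq> 0" for h
        using flat_exp_quadratic[of n h] that by (simp add: divide_le_eq power2_eq_square abs_mult[symmetric] mult.assoc)
      then show "\<forall>\<^sub>F h in at 0. norm (flat_exp n h / h) \<le> fact (n + 2) * \<bar>h\<bar>"
        by (auto simp: eventually_at_filter)
      show "((\<lambda>h. fact (n + 2) * \<bar>h\<bar>) \<longlongrightarrow> 0) (at (0::real))"
        by (auto intro!: tendsto_eq_intros)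
    qed
    then show ?thesis using 3 by (simp add: DERIV_def flat_exp_def)
  qed
qed

lemma differentiable_times_flat: "differentiable_times m (\<lambda>x. of_real (flat_exp n x))"
proof (induction m arbitrary: n)
  case (Suc m)
  have "((\<lambda>x. complex_of_real (flat_exp n x)) has_vector_derivative of_real (- real n * flat_exp (n + 1) x + flat_exp (n + 2) x)) (at x)" for x
    using flat_exp_deriv by (intro has_vector_derivative_of_real) (simp add: has_real_derivative_iff_has_vector_derivative)
  moreover have "differentiable_times m (\<lambda>x. complex_of_real (- real n * flat_exp (n + 1) x + flat_exp (n + 2) x))"
    unfolding of_real_add of_real_mult
    by (intro differentiable_times_add differentiable_times_mult differentiable_times_const Suc)
  ultimately show ?case unfolding differentiable_times.simps
    by (intro exI[of _ "\<lambda>x. complex_of_real (- real n * flat_exp (n + 1) x + flat_exp (n + 2) x)"] conjI allI)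
qed simp

definition ramp :: "real \<Rightarrow> real" where
  "ramp x = flat_exp 0 x / (flat_exp 0 x + flat_exp 0 (1 - x))"

lemma ramp_simps: "x \<le> 0 \<Longrightarrow> ramp x = 0" "1 \<le> x \<Longrightarrow> ramp x = 1"
  by (auto simp: ramp_def flat_exp_def)

lemma flat_exp_nonneg: "0 \<le> flat_exp n x"
  by (simp add: flat_exp_def)

lemma flat_exp_sum_pos: "0 < flat_exp 0 x + flat_exp 0 (1 - x)"
  by (cases "0 < x") (auto simp: flat_exp_def add_pos_pos)

lemma ramp_bounds: "0 \<le> ramp x" "ramp x \<le> 1"
  using flat_exp_sum_pos[of x] flat_exp_nonneg[of 0 x] flat_exp_nonneg[of 0 "1 - x"] by (auto simp: ramp_def divide_le_eq_1)

lemma smooth_ramp: "differentiable_times n (\<lambda>x. of_real (ramp (a * x + b)))"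
proof -
  have pos: "flat_exp 0 x + flat_exp 0 (1 - x) \<noteq> 0" for x :: real
    using flat_exp_sum_pos[of x] by simp
  have "(\<lambda>x. complex_of_real (ramp x)) = (\<lambda>x. of_real (flat_exp 0 x) * inverse (of_real (flat_exp 0 x) + of_real (flat_exp 0 ((-1) * x + 1))))"
    by (auto simp: ramp_def divide_inverse)
  moreover have "differentiable_times n (\<lambda>x. complex_of_real (flat_exp 0 x) * inverse (of_real (flat_exp 0 x) + of_real (flat_exp 0 ((-1) * x + 1))))"
  proof (intro differentiable_times_mult differentiable_times_inverse differentiable_times_add differentiable_times_flat)
    show "differentiable_times n (\<lambda>x. complex_of_real (flat_exp 0 (- 1 * x + 1)))"
      by (rule differentiable_times_affine[OF differentiable_times_flat])
    show "complex_of_real (flat_exp 0 x) + complex_of_real (flat_exp 0 (- 1 * x + 1)) \<noteq> 0" for x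
      using pos[of x] unfolding of_real_add[symmetric] of_real_eq_0_iff by simp
  qed
  ultimately have "differentiable_times n (\<lambda>x. complex_of_real (ramp x))" by (simp only:)
  from differentiable_times_affine[OF this, of a b] show ?thesis .
qed

definition test :: "(real \<Rightarrow> complex) \<Rightarrow> bool" where
  "test \<phi> \<longleftrightarrow> smooth \<phi> \<and> (\<exists>R>0. \<forall>x. R \<le> \<bar>x\<bar> \<longrightarrow> \<phi> x = 0)"

lemma test_imp_test_function: "test \<phi> \<Longrightarrow> test_function \<phi>"
proof -
  assume t: "test \<phi>"
  then obtain R where R: "\<And>x. R \<le> \<bar>x\<bar> \<Longrightarrow> \<phi> x = 0" by (auto simp: test_def)
  have "{x. \<phi> x \<noteq> 0} \<subseteq> {-R..R}" using R by (force simp: not_le)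
  then have "bounded {x. \<phi> x \<noteq> 0}" using bounded_closed_interval bounded_subset by blast
  then show ?thesis
    using t smooth_imp_smooth_fun by (auto simp: test_function_def test_def fun_supp_def)
qed

lemma test_smooth: "test \<phi> \<Longrightarrow> smooth \<phi>"
  by (simp add: test_def)

lemma test_mult: "test \<phi> \<Longrightarrow> smooth g \<Longrightarrow> test (\<lambda>x. g x * \<phi> x)"
  unfolding test_def using differentiable_times_mult by fastforce

lemma test_diff: "test f \<Longrightarrow> test g \<Longrightarrow> test (\<lambda>x. f x - g x)"
proof -
  assume fg: "test f" "test g"
  obtain R where R: "0 < R" "\<And>x. R \<le> \<bar>x\<bar> \<Longrightarrow> f x = 0" using fg by (auto simp: test_def)
  obtain Q where Q: "0 < Q" "\<And>x. Q \<le> \<bar>x\<bar> \<Longrightarrow> g x = 0" using fg by (auto simp: test_def)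
  have "differentiable_times n (\<lambda>x. f x + (-1) * g x)" for n
    using fg by (intro smooth_intros) (auto simp: test_def)
  then show ?thesis unfolding test_def using R Q by (intro conjI exI[of _ "max R Q"]) auto
qed

lemma test_deriv:
  assumes t: "test f" and d: "\<And>x. (f has_vector_derivative f' x) (at x)"
  shows "test f'"
proof -
  obtain R where R: "0 < R" "\<And>x. R \<le> \<bar>x\<bar> \<Longrightarrow> f x = 0" using t by (auto simp: test_def)
  have "f' x = 0" if "R + 1 \<le> \<bar>x\<bar>" for x
  proof -
    have "(f has_vector_derivative 0) (at x)"
    proof (rule has_vector_derivative_transform_within_open)
      show "((\<lambda>_. 0) has_vector_derivative 0) (at x)" by (rule has_vector_derivative_const)
      show "open {y. R < \<bar>y\<bar>}" by (intro open_Collect_less continuous_intros)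
      show "x \<in> {y. R < \<bar>y\<bar>}" using that by simp
      show "0 = f y" if "y \<in> {y. R < \<bar>y\<bar>}" for y using R(2)[of y] that by simp
    qed
    then show ?thesis by (rule vector_derivative_unique_at[OF d])
  qed
  then show ?thesis using smooth_deriv[OF _ d] t R(1) unfolding test_def by (intro conjI exI[of _ "R + 1"]) auto
qed

lemma test_integrable:
  assumes "test f" shows "integrable lborel f" "f \<in> borel_measurable borel" "\<exists>B. \<forall>x. norm (f x) \<le> B"
proof -
  obtain R where R: "0 < R" "\<And>x. R \<le> \<bar>x\<bar> \<Longrightarrow> f x = 0" using assms by (auto simp: test_def)
  have c: "continuous_on UNIV f" using assms by (auto simp: test_def intro: smooth_continuous)
  have "set_integrable lborel {-R..R} f"
    using c by (intro borel_integrable_atLeastAtMost' continuous_on_subset[OF c]) auto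
  moreover have "(\<lambda>x. indicator {-R..R} x *\<^sub>R f x) = f" using R by (auto split: split_indicator simp: fun_eq_iff abs_le_iff)
  ultimately show "integrable lborel f" unfolding set_integrable_def by simp
  show "f \<in> borel_measurable borel" using c by (rule borel_measurable_continuous_onI)
  have "bounded (f ` {-R..R})" using c by (intro compact_imp_bounded compact_continuous_image continuous_on_subset[OF c]) auto
  then obtain B where B: "\<And>x. x \<in> {-R..R} \<Longrightarrow> norm (f x) \<le> B" unfolding bounded_iff by blast
  have "norm (f x) \<le> max B 0" for x
  proof (cases "x \<in> {-R..R}")
    case True then show ?thesis using B[OF True] by (simp add: le_max_iff_disj)
  next
    case False
    then have "f x = 0" by (intro R(2)) auto
    then show ?thesis by simp
  qed
  then show "\<exists>B. \<forall>x. norm (f x) \<le> B" by blast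
qed

section \<open>The Fourier transform of test functions\<close>

lemma integrable_cis:
  assumes "integrable lborel f" shows "integrable lborel (\<lambda>x. f x * cis (a * x))"
proof (rule Bochner_Integration.integrable_bound[OF assms])
  have [measurable]: "f \<in> borel_measurable borel" using assms by auto
  have [measurable]: "(\<lambda>x. cis (a * x)) \<in> borel_measurable borel"
    unfolding cis_conv_exp by (intro borel_measurable_continuous_onI continuous_intros)
  show "(\<lambda>x. f x * cis (a * x)) \<in> borel_measurable lborel" by measurable
qed (simp add: norm_mult)

lemma fourier_cis: "fourier \<phi> \<xi> = (LINT x|lborel. \<phi> x * cis ((- 2 * pi * \<xi>) * x))"
  unfolding fourier_def by (simp add: mult_ac)

lemma fourier_derivative:
  assumes t: "test f" and d: "\<And>x. (f has_vector_derivative f' x) (at x)"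
  shows "fourier f' \<xi> = 2 * pi * \<i> * \<xi> * fourier f \<xi>"
proof -
  define a where "a = - 2 * pi * \<xi>"
  obtain R where R: "0 < R" "\<And>x. R \<le> \<bar>x\<bar> \<Longrightarrow> f x = 0" using t by (auto simp: test_def)
  have t': "test f'" by (rule test_deriv[OF t d])
  obtain Q where Q: "0 < Q" "\<And>x. Q \<le> \<bar>x\<bar> \<Longrightarrow> f' x = 0" using t' by (auto simp: test_def)
  define M where "M = max R Q"
  have M: "0 < M" "\<And>x. M \<le> \<bar>x\<bar> \<Longrightarrow> f x = 0" "\<And>x. M \<le> \<bar>x\<bar> \<Longrightarrow> f' x = 0" using R Q by (auto simp: M_def)
  define g where "g x = f x * (\<i> * of_real a * cis (a * x)) + f' x * cis (a * x)" for x
  have i1: "integrable lborel (\<lambda>x. f x * cis (a * x))" "integrable lborel (\<lambda>x. f' x * cis (a * x))"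
    using test_integrable(1)[OF t] test_integrable(1)[OF t'] by (auto intro: integrable_cis)
  have cf: "continuous_on UNIV f" "continuous_on UNIV f'" using t t' by (auto simp: test_def intro!: smooth_continuous)
  have "(LINT x|lborel. indicator {-M..M} x *\<^sub>R g x) = f M * cis (a * M) - f (-M) * cis (a * (-M))"
  proof (rule integral_FTC_Icc)
    show "((\<lambda>x. f x * cis (a * x)) has_vector_derivative g x) (at x within {-M..M})" for x
      unfolding g_def by (rule has_vector_derivative_at_within) (intro has_vector_derivative_mult d has_vector_derivative_cis)
    show "continuous_on {-M..M} g" unfolding g_def cis_conv_exp
      by (intro continuous_intros continuous_on_subset[OF cf(1)] continuous_on_subset[OF cf(2)]) auto
  qed (use M in auto)
  also have "\<dots> = 0" using M(1) M(2)[of M] M(2)[of "-M"] by simp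
  finally have "(LINT x|lborel. indicator {-M..M} x *\<^sub>R g x) = 0" .
  moreover have "(\<lambda>x. indicator {-M..M} x *\<^sub>R g x) = (\<lambda>x. (\<i> * of_real a) * (f x * cis (a * x)) + f' x * cis (a * x))"
  proof
    fix x show "indicator {-M..M} x *\<^sub>R g x = (\<i> * of_real a) * (f x * cis (a * x)) + f' x * cis (a * x)"
    proof (cases "x \<in> {-M..M}")
      case False
      then have "M \<le> \<bar>x\<bar>" by auto
      then show ?thesis using M False by simp
    qed (simp add: g_def algebra_simps)
  qed
  ultimately have "(\<i> * of_real a) * (LINT x|lborel. f x * cis (a * x)) + (LINT x|lborel. f' x * cis (a * x)) = 0"
    using i1 by (simp add: Bochner_Integration.integral_add)
  then show ?thesis unfolding fourier_cis a_def[symmetric]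
    by (simp add: a_def add_eq_0_iff)
qed

lemma norm_fourier_le: "norm (fourier f \<xi>) \<le> (LINT x|lborel. norm (f x))"
  unfolding fourier_def by (rule order_trans[OF integral_norm_bound]) (simp add: norm_mult)

lemma fourier_decay:
  assumes t: "test f"
  obtains C where "0 < C" "\<And>\<xi>. norm (fourier f \<xi>) \<le> C / (1 + \<xi>\<^sup>2)"
proof -
  obtain f' where f': "\<And>x. (f has_vector_derivative f' x) (at x)" "smooth f'"
    using smooth_obtain_deriv[OF test_smooth[OF t]] by blast
  have t': "test f'" by (rule test_deriv[OF t f'(1)])
  obtain f'' where f'': "\<And>x. (f' has_vector_derivative f'' x) (at x)" "smooth f''"
    using smooth_obtain_deriv[OF test_smooth[OF t']] by blast
  define A where "A = (LINT x|lborel. norm (f x))"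
  define B where "B = (LINT x|lborel. norm (f'' x))"
  have "norm (fourier f \<xi>) \<le> (A + B + 1) / (1 + \<xi>\<^sup>2)" for \<xi>
  proof -
    have "fourier f'' \<xi> = (2 * pi * \<i> * \<xi>) * ((2 * pi * \<i> * \<xi>) * fourier f \<xi>)"
      by (simp only: fourier_derivative[OF t' f''(1)] fourier_derivative[OF t f'(1)])
    then have "norm (fourier f'' \<xi>) = (2 * pi)\<^sup>2 * \<xi>\<^sup>2 * norm (fourier f \<xi>)"
      by (simp add: norm_mult power2_eq_square mult_ac) 
    then have 1: "(2 * pi)\<^sup>2 * \<xi>\<^sup>2 * norm (fourier f \<xi>) \<le> B" using norm_fourier_le[of f'' \<xi>] by (simp add: B_def)
    have "1 \<le> (2 * pi)\<^sup>2" using pi_gt3 by (intro one_le_power) auto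
    then have "\<xi>\<^sup>2 * norm (fourier f \<xi>) \<le> (2 * pi)\<^sup>2 * (\<xi>\<^sup>2 * norm (fourier f \<xi>))"
      using mult_right_mono[of 1 "(2 * pi)\<^sup>2" "\<xi>\<^sup>2 * norm (fourier f \<xi>)"] by simp
    then have "(1 + \<xi>\<^sup>2) * norm (fourier f \<xi>) \<le> A + B + 1"
      using 1 norm_fourier_le[of f \<xi>] by (simp add: A_def algebra_simps)
    then show ?thesis by (simp add: pos_le_divide_eq add_pos_nonneg mult.commute)
  qed
  moreover have "0 < A + B + 1" by (auto simp: A_def B_def intro!: add_nonneg_pos add_nonneg_nonneg)
  ultimately show ?thesis by (rule that[rotated])
qed

lemma fourier_has_derivative:
  assumes t: "test f"
  shows "(fourier f has_vector_derivative fourier (\<lambda>y. (- 2 * pi * \<i> * y) * f y) \<xi>) (at \<xi>)"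
proof -
  define g where "g y = (- 2 * pi * \<i> * y) * f y" for y :: real
  have sm: "smooth (\<lambda>y. (- 2 * pi * \<i>) * of_real y)" by (intro allI smooth_intros)
  have tg: "test g" unfolding g_def using test_mult[OF t sm] by (simp add: mult.assoc)
  have tg2: "test (\<lambda>y. (- 2 * pi * \<i> * y) * g y)" using test_mult[OF tg sm] by (simp add: mult.assoc)
  define C where "C = (LINT y|lborel. norm ((- 2 * pi * \<i> * y) * g y))"
  have ig: "integrable lborel f" "integrable lborel g" "integrable lborel (\<lambda>y. norm ((- 2 * pi * \<i> * y) * g y))"
    using test_integrable(1)[OF t] test_integrable(1)[OF tg] integrable_norm[OF test_integrable(1)[OF tg2]] by simp_all
  have bound: "norm (fourier f (\<xi> + h) - fourier f \<xi> - of_real h * fourier g \<xi>) \<le> C * h\<^sup>2" for h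
  proof -
    have eq: "fourier f (\<xi> + h) - fourier f \<xi> - of_real h * fourier g \<xi>
      = (LINT y|lborel. f y * cis ((- 2 * pi * (\<xi> + h)) * y) - f y * cis ((- 2 * pi * \<xi>) * y) - of_real h * (g y * cis ((- 2 * pi * \<xi>) * y)))"
    proof -
      have I: "integrable lborel (\<lambda>y. f y * cis (a * y))" "integrable lborel (\<lambda>y. of_real h * (g y * cis (a * y)))" for a
        using ig by (auto intro: integrable_cis)
      show ?thesis unfolding fourier_cis
        by (simp only: Bochner_Integration.integral_diff[OF Bochner_Integration.integrable_diff[OF I(1) I(1)] I(2)]
            Bochner_Integration.integral_diff[OF I(1) I(1)] integral_mult_right_zero)
    qed
    have "norm (LINT y|lborel. f y * cis ((- 2 * pi * (\<xi> + h)) * y) - f y * cis ((- 2 * pi * \<xi>) * y) - of_real h * (g y * cis ((- 2 * pi * \<xi>) * y))) \<le> (LINT y|lborel. h\<^sup>2 * norm ((- 2 * pi * \<i> * y) * g y))"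
    proof (rule order_trans[OF integral_norm_bound], rule integral_mono)
      fix y
      define s where "s = - 2 * pi * h * y"
      have "cis ((- 2 * pi * (\<xi> + h)) * y) = cis s * cis ((- 2 * pi * \<xi>) * y)"
        by (simp add: cis_mult s_def algebra_simps)
      then have "f y * cis ((- 2 * pi * (\<xi> + h)) * y) - f y * cis ((- 2 * pi * \<xi>) * y) - of_real h * (g y * cis ((- 2 * pi * \<xi>) * y))
        = f y * cis ((- 2 * pi * \<xi>) * y) * (cis s - 1 - \<i> * s)"
        by (simp add: g_def s_def algebra_simps)
      moreover have "norm (cis s - 1 - \<i> * s) \<le> s\<^sup>2"
      proof -
        have "norm (cis s - 1 - \<i> * s) \<le> \<bar>s\<bar> ^ 2 / 2"
          using iexp_approx1[of s 1] by (simp add: cis_conv_exp algebra_simps power2_eq_square)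
        also have "\<dots> \<le> s\<^sup>2" by simp
        finally show ?thesis .
      qed
      ultimately have "norm (f y * cis ((- 2 * pi * (\<xi> + h)) * y) - f y * cis ((- 2 * pi * \<xi>) * y) - of_real h * (g y * cis ((- 2 * pi * \<xi>) * y)))
         \<le> norm (f y) * s\<^sup>2"
        by (simp add: norm_mult mult_left_mono)
      also have "\<dots> = h\<^sup>2 * norm ((- 2 * pi * \<i> * y) * g y)"
        by (simp add: g_def s_def norm_mult power2_eq_square mult_ac) 
      finally show "norm (f y * cis ((- 2 * pi * (\<xi> + h)) * y) - f y * cis ((- 2 * pi * \<xi>) * y) - of_real h * (g y * cis ((- 2 * pi * \<xi>) * y)))
         \<le> h\<^sup>2 * norm ((- 2 * pi * \<i> * y) * g y)" .
    next
      have I: "integrable lborel (\<lambda>y. f y * cis (a * y))" "integrable lborel (\<lambda>y. of_real h * (g y * cis (a * y)))" for a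
        using ig by (auto intro: integrable_cis)
      show "integrable lborel (\<lambda>y. norm (f y * cis ((- 2 * pi * (\<xi> + h)) * y) - f y * cis ((- 2 * pi * \<xi>) * y) - of_real h * (g y * cis ((- 2 * pi * \<xi>) * y))))"
        by (intro integrable_norm Bochner_Integration.integrable_diff I)
      show "integrable lborel (\<lambda>y. h\<^sup>2 * norm ((- 2 * pi * \<i> * y) * g y))"
        by (intro integrable_mult_right ig(3))
    qed
    also have "\<dots> = h\<^sup>2 * C" unfolding C_def by (rule integral_mult_right_zero)
    also have "\<dots> = C * h\<^sup>2" by (rule mult.commute)
    finally show ?thesis unfolding eq .
  qed
  have "((\<lambda>h. norm (fourier f (\<xi> + h) - fourier f \<xi> - h *\<^sub>R fourier g \<xi>) / norm h) \<longlongrightarrow> 0) (at 0)"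
  proof (rule Lim_null_comparison)
    have "norm (norm (fourier f (\<xi> + h) - fourier f \<xi> - h *\<^sub>R fourier g \<xi>) / norm h) \<le> C * \<bar>h\<bar>" if "h \<noteq> 0" for h
    proof -
      have "norm (fourier f (\<xi> + h) - fourier f \<xi> - h *\<^sub>R fourier g \<xi>) \<le> (C * \<bar>h\<bar>) * \<bar>h\<bar>"
        using bound[of h] by (simp add: scaleR_conv_of_real power2_eq_square mult.assoc)
      then have "norm (fourier f (\<xi> + h) - fourier f \<xi> - h *\<^sub>R fourier g \<xi>) / \<bar>h\<bar> \<le> C * \<bar>h\<bar>"
        using that by (simp only: pos_divide_le_eq zero_less_abs_iff not_False_eq_True)
      then show ?thesis by simp
    qed
    then show "\<forall>\<^sub>F h in at 0. norm (norm (fourier f (\<xi> + h) - fourier f \<xi> - h *\<^sub>R fourier g \<xi>) / norm h) \<le> C * \<bar>h\<bar>"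
      by (auto simp: eventually_at_filter)
    show "((\<lambda>h. C * \<bar>h\<bar>) \<longlongrightarrow> 0) (at (0::real))" by (auto intro!: tendsto_eq_intros)
  qed
  then show ?thesis
    unfolding has_vector_derivative_def has_derivative_at g_def[symmetric]
    by (intro conjI bounded_linear_scaleR_left)
qed

lemma fourier_continuous: "test f \<Longrightarrow> continuous_on UNIV (fourier f)"
  by (meson continuous_at_imp_continuous_on fourier_has_derivative has_vector_derivative_continuous)

lemma integrable_inverse_square: "integrable lborel (\<lambda>x::real. 1 / (1 + x\<^sup>2))"
  using integrable_inverse_1_plus_square
  by (simp add: set_integrable_def einterval_def inverse_eq_divide)

section \<open>Fourier inversion and the reproducing formula\<close>

lemma test_add: "test f \<Longrightarrow> test g \<Longrightarrow> test (\<lambda>x. f x + g x)"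
proof -
  assume fg: "test f" "test g"
  obtain R where R: "0 < R" "\<And>x. R \<le> \<bar>x\<bar> \<Longrightarrow> f x = 0" using fg by (auto simp: test_def)
  obtain Q where Q: "0 < Q" "\<And>x. Q \<le> \<bar>x\<bar> \<Longrightarrow> g x = 0" using fg by (auto simp: test_def)
  have "differentiable_times n (\<lambda>x. f x + g x)" for n
    using fg by (intro differentiable_times_add) (auto simp: test_def)
  then show ?thesis unfolding test_def using R Q by (intro conjI exI[of _ "max R Q"]) auto
qed

lemma test_zero: "test (\<lambda>_. 0)"
  unfolding test_def by (intro conjI allI differentiable_times_const exI[of _ 1]) auto

lemma test_scale: "test f \<Longrightarrow> 0 < a \<Longrightarrow> test (\<lambda>x. f (a * x))"
proof -
  assume f: "test f" and a: "0 < a"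
  obtain R where R: "0 < R" "\<And>x. R \<le> \<bar>x\<bar> \<Longrightarrow> f x = 0" using f by (auto simp: test_def)
  have "differentiable_times n (\<lambda>x. f (a * x + 0))" for n
    using f by (intro differentiable_times_affine) (auto simp: test_def)
  moreover have "f (a * x) = 0" if "R / a \<le> \<bar>x\<bar>" for x
    using that a by (intro R(2)) (simp add: abs_mult pos_divide_le_eq mult.commute)
  ultimately show ?thesis unfolding test_def using R(1) a by (intro conjI exI[of _ "R / a"]) auto
qed

lemma integrable_fourier: "test f \<Longrightarrow> integrable lborel (fourier f)"
proof -
  assume t: "test f"
  obtain C where C: "0 < C" "\<And>\<xi>. norm (fourier f \<xi>) \<le> C / (1 + \<xi>\<^sup>2)" using fourier_decay[OF t] by blast
  have "integrable lborel (\<lambda>x. C * (1 / (1 + x\<^sup>2)))" by (intro integrable_mult_right integrable_inverse_square)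
  then show ?thesis
  proof (rule Bochner_Integration.integrable_bound)
    show "fourier f \<in> borel_measurable lborel"
      using borel_measurable_continuous_onI[OF fourier_continuous[OF t]] by simp
    show "AE x in lborel. norm (fourier f x) \<le> norm (C * (1 / (1 + x\<^sup>2)))"
      using C by (auto simp: abs_mult)
  qed
qed

lemma fourier_std_normal:
  "(LINT u|lborel. cis (t * u) * of_real (std_normal_density u)) = of_real (exp (- t\<^sup>2 / 2))"
proof -
  have "(LINT u|lborel. cis (t * u) * of_real (std_normal_density u)) = (LINT u|lborel. std_normal_density u *\<^sub>R iexp (t * u))"
    by (intro Bochner_Integration.integral_cong) (auto simp: cis_conv_exp scaleR_conv_of_real mult.commute)
  also have "\<dots> = (LINT u|std_normal_distribution. iexp (t * u))"
    by (rule integral_density[symmetric]) auto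
  also have "\<dots> = of_real (exp (- t\<^sup>2 / 2))"
    using char_std_normal_distribution by (simp add: char_def fun_eq_iff)
  finally show ?thesis .
qed

text \<open>Both sides are the double integral of \<open>f x exp(-2 \<pi> i x \<xi>)\<close> against a Gaussian in \<open>\<xi>\<close>; the Gaussian is its own Fourier
  transform.\<close>

lemma fourier_gaussian_average:
  assumes t: "test f" and e: "0 < e"
  shows "(LINT \<xi>|lborel. fourier f \<xi> * of_real (exp (- (e * \<xi>)\<^sup>2 / 2)))
    = (LINT v|lborel. f (e / (2 * pi) * v) * of_real (std_normal_density v))"
proof -
  define G where "G \<xi> = exp (- (e * \<xi>)\<^sup>2 / 2)" for \<xi> :: real
  have G: "G \<xi> = sqrt (2 * pi) * std_normal_density (e * \<xi>)" for \<xi>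
    by (simp add: G_def std_normal_density_def)
  have iG: "integrable lborel G"
    unfolding G[abs_def]
    using lborel_integrable_real_affine[of std_normal_density e 0] e integrable_normal_density[of 1 0]
    by (intro integrable_mult_right) simp
  have fi: "integrable lborel f" and fm [measurable]: "f \<in> borel_measurable borel" using test_integrable[OF t] by auto
  have Gm [measurable]: "G \<in> borel_measurable borel" unfolding G_def by measurable
  have inner: "(LINT \<xi>|lborel. f x * cis (- (2 * pi * x * \<xi>)) * of_real (G \<xi>))
     = f x * of_real (2 * pi / e * std_normal_density (2 * pi * x / e))" for x
  proof -
    have "(LINT \<xi>|lborel. cis (- (2 * pi * x * \<xi>)) * of_real (G \<xi>))
       = \<bar>1 / e\<bar> *\<^sub>R (LINT u|lborel. cis (- (2 * pi * x * (0 + 1 / e * u))) * of_real (G (0 + 1 / e * u)))"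
      using e by (intro lborel_integral_real_affine) simp
    also have "(LINT u|lborel. cis (- (2 * pi * x * (0 + 1 / e * u))) * of_real (G (0 + 1 / e * u)))
       = (LINT u|lborel. of_real (sqrt (2 * pi)) * (cis ((- 2 * pi * x / e) * u) * of_real (std_normal_density u)))"
      using e by (intro Bochner_Integration.integral_cong refl) (simp add: G mult_ac)
    also have "\<dots> = of_real (sqrt (2 * pi)) * of_real (exp (- (- 2 * pi * x / e)\<^sup>2 / 2))"
      by (simp only: integral_mult_right_zero fourier_std_normal)
    also have "\<bar>1 / e\<bar> *\<^sub>R (of_real (sqrt (2 * pi)) * of_real (exp (- (- 2 * pi * x / e)\<^sup>2 / 2)))
       = complex_of_real (2 * pi / e * std_normal_density (2 * pi * x / e))"
    proof -
      have "\<bar>1 / e\<bar> * (sqrt (2 * pi) * exp (- (- 2 * pi * x / e)\<^sup>2 / 2)) = 2 * pi / e * std_normal_density (2 * pi * x / e)"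
        using e real_sqrt_mult_self[of "2 * pi"] by (simp add: std_normal_density_def field_simps)
      then show ?thesis by (simp only: scaleR_conv_of_real of_real_mult[symmetric])
    qed
    finally show ?thesis by (simp only: mult.assoc integral_mult_right_zero)
  qed
  have "(LINT \<xi>|lborel. fourier f \<xi> * of_real (G \<xi>)) = (LINT \<xi>|lborel. LINT x|lborel. f x * cis (- (2 * pi * x * \<xi>)) * of_real (G \<xi>))"
    unfolding fourier_def by (simp only: integral_mult_left_zero)
  also have "\<dots> = (LINT x|lborel. LINT \<xi>|lborel. f x * cis (- (2 * pi * x * \<xi>)) * of_real (G \<xi>))"
  proof (rule lborel_pair.Fubini_integral)
    show "integrable (lborel \<Otimes>\<^sub>M lborel) (\<lambda>(x, \<xi>). f x * cis (- (2 * pi * x * \<xi>)) * of_real (G \<xi>))"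
    proof (rule lborel_pair.Fubini_integrable)
      have [measurable]: "(\<lambda>p. cis (- (2 * pi * fst p * snd p))) \<in> borel_measurable (borel \<Otimes>\<^sub>M borel)"
        unfolding borel_prod cis_conv_exp by (intro borel_measurable_continuous_onI continuous_intros)
      show "(\<lambda>(x, \<xi>). f x * cis (- (2 * pi * x * \<xi>)) * of_real (G \<xi>)) \<in> borel_measurable (lborel \<Otimes>\<^sub>M lborel)"
        unfolding case_prod_beta by measurable
      have "(\<lambda>x. LINT \<xi>|lborel. norm (f x * cis (- (2 * pi * x * \<xi>)) * of_real (G \<xi>))) = (\<lambda>x. norm (f x) * (LINT \<xi>|lborel. norm (G \<xi>)))"
        by (simp add: norm_mult)
      then show "integrable lborel (\<lambda>x. LINT \<xi>|lborel. norm (case (x, \<xi>) of (x, \<xi>) \<Rightarrow> f x * cis (- (2 * pi * x * \<xi>)) * of_real (G \<xi>)))"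
        using fi by simp
      have "integrable lborel (\<lambda>\<xi>. f x * cis (- (2 * pi * x * \<xi>)) * of_real (G \<xi>))" for x
      proof -
        have "integrable lborel (\<lambda>\<xi>. complex_of_real (G \<xi>) * cis ((- 2 * pi * x) * \<xi>))"
          by (intro integrable_cis integrable_of_real iG)
        then have "integrable lborel (\<lambda>\<xi>. f x * (complex_of_real (G \<xi>) * cis ((- 2 * pi * x) * \<xi>)))"
          by (rule integrable_mult_right)
        then show ?thesis by (simp add: mult_ac)
      qed
      then show "AE x in lborel. integrable lborel (\<lambda>\<xi>. case (x, \<xi>) of (x, \<xi>) \<Rightarrow> f x * cis (- (2 * pi * x * \<xi>)) * of_real (G \<xi>))"
        by simp
    qed
  qed
  also have "\<dots> = (LINT x|lborel. f x * of_real (2 * pi / e * std_normal_density (2 * pi * x / e)))"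
    by (simp only: inner)
  also have "\<dots> = \<bar>e / (2 * pi)\<bar> *\<^sub>R (LINT v|lborel. f (0 + e / (2 * pi) * v) * of_real (2 * pi / e * std_normal_density (2 * pi * (0 + e / (2 * pi) * v) / e)))"
    using e by (intro lborel_integral_real_affine) simp
  also have "\<dots> = \<bar>e / (2 * pi)\<bar> *\<^sub>R (LINT v|lborel. of_real (2 * pi / e) * (f (e / (2 * pi) * v) * of_real (std_normal_density v)))"
    using e by (intro arg_cong2[of _ _ _ _ scaleR] Bochner_Integration.integral_cong refl) (simp add: mult_ac)
  also have "\<dots> = (LINT v|lborel. f (e / (2 * pi) * v) * of_real (std_normal_density v))"
  proof -
    have "\<bar>e / (2 * pi)\<bar> * (2 * pi / e) = 1" using e by simp
    then have "\<bar>e / (2 * pi)\<bar> *\<^sub>R (of_real (2 * pi / e) * X) = X" for X :: complex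
      by (simp only: scaleR_conv_of_real mult.assoc[symmetric] of_real_mult[symmetric] of_real_1 mult_1)
    then show ?thesis by (simp only: integral_mult_right_zero)
  qed
  finally show ?thesis by (simp add: G_def)
qed

text \<open>Fourier inversion at the origin, by letting the Gaussian regularization disappear on both sides.\<close>

lemma integral_fourier:
  assumes t: "test f"
  shows "(LINT \<xi>|lborel. fourier f \<xi>) = f 0"
proof -
  define e where "e n = 1 / real (Suc n)" for n
  have e: "0 < e n" "e \<longlonglongrightarrow> 0" for n
    unfolding e_def using LIMSEQ_inverse_real_of_nat by (auto simp: inverse_eq_divide)
  have fi: "integrable lborel f" and fm [measurable]: "f \<in> borel_measurable borel" using test_integrable[OF t] by auto
  obtain B where B: "\<And>x. norm (f x) \<le> B" using test_integrable(3)[OF t] by blast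
  have Fm [measurable]: "fourier f \<in> borel_measurable borel"
    by (rule borel_measurable_continuous_onI[OF fourier_continuous[OF t]])
  have cf: "isCont f x" for x
    using smooth_continuous[OF test_smooth[OF t]] by (simp add: continuous_on_eq_continuous_at)
  have 1: "(\<lambda>n. LINT \<xi>|lborel. fourier f \<xi> * of_real (exp (- (e n * \<xi>)\<^sup>2 / 2))) \<longlonglongrightarrow> (LINT \<xi>|lborel. fourier f \<xi>)"
  proof (rule integral_dominated_convergence[where w = "\<lambda>\<xi>. norm (fourier f \<xi>)"])
    show "integrable lborel (\<lambda>\<xi>. norm (fourier f \<xi>))" using integrable_fourier[OF t] by (rule integrable_norm)
    show "AE \<xi> in lborel. (\<lambda>n. fourier f \<xi> * of_real (exp (- (e n * \<xi>)\<^sup>2 / 2))) \<longlonglongrightarrow> fourier f \<xi>"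
    proof (rule AE_I2)
      fix \<xi>
      have "(\<lambda>n. fourier f \<xi> * complex_of_real (exp (- (e n * \<xi>)\<^sup>2 / 2))) \<longlonglongrightarrow> fourier f \<xi> * of_real (exp (- (0 * \<xi>)\<^sup>2 / 2))"
        by (intro tendsto_intros e(2)) auto
      then show "(\<lambda>n. fourier f \<xi> * of_real (exp (- (e n * \<xi>)\<^sup>2 / 2))) \<longlonglongrightarrow> fourier f \<xi>" by simp
    qed
    show "AE \<xi> in lborel. norm (fourier f \<xi> * of_real (exp (- (e n * \<xi>)\<^sup>2 / 2))) \<le> norm (fourier f \<xi>)" for n
      by (intro AE_I2) (simp add: norm_mult mult_left_le)
  qed measurable
  have 2: "(\<lambda>n. LINT v|lborel. f (e n / (2 * pi) * v) * of_real (std_normal_density v)) \<longlonglongrightarrow> (LINT v|lborel. f 0 * of_real (std_normal_density v))"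
  proof (rule integral_dominated_convergence[where w = "\<lambda>v. B * std_normal_density v"])
    show "integrable lborel (\<lambda>v. B * std_normal_density v)" using integrable_normal_density[of 1 0] by (intro integrable_mult_right) simp
    show "AE v in lborel. (\<lambda>n. f (e n / (2 * pi) * v) * of_real (std_normal_density v)) \<longlonglongrightarrow> f 0 * of_real (std_normal_density v)"
    proof (intro AE_I2 tendsto_mult_right)
      fix v
      have "(\<lambda>n. e n / (2 * pi) * v) \<longlonglongrightarrow> 0 / (2 * pi) * v" by (intro tendsto_intros e(2)) auto
      then show "(\<lambda>n. f (e n / (2 * pi) * v)) \<longlonglongrightarrow> f 0" using isCont_tendsto_compose[OF cf, of "\<lambda>n. e n / (2 * pi) * v" 0] by simp
    qed
    show "AE v in lborel. norm (f (e n / (2 * pi) * v) * of_real (std_normal_density v)) \<le> B * std_normal_density v" for n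
      by (intro AE_I2) (simp add: norm_mult mult_right_mono B)
  qed measurable
  have 3: "(LINT v|lborel. f 0 * complex_of_real (std_normal_density v)) = f 0"
    using integral_normal_density[of 1 0] by simp
  have "(\<lambda>n. LINT v|lborel. f (e n / (2 * pi) * v) * of_real (std_normal_density v)) \<longlonglongrightarrow> (LINT \<xi>|lborel. fourier f \<xi>)"
    using 1 by (simp only: fourier_gaussian_average[OF t e(1)])
  then show ?thesis using 2 unfolding 3 by (rule LIMSEQ_unique)
qed

lemma fourier_scale: "0 < a \<Longrightarrow> fourier (\<lambda>x. f (a * x)) \<xi> = of_real (1 / a) * fourier f (\<xi> / a)"
proof -
  assume a: "0 < a"
  have "fourier (\<lambda>x. f (a * x)) \<xi> = \<bar>1 / a\<bar> *\<^sub>R (LINT x|lborel. f (a * (0 + 1 / a * x)) * cis (- (2 * pi * (0 + 1 / a * x) * \<xi>)))"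
    unfolding fourier_def using a by (intro lborel_integral_real_affine) simp
  also have "\<dots> = of_real (1 / a) * fourier f (\<xi> / a)"
    using a unfolding fourier_def by (simp add: scaleR_conv_of_real)
  finally show ?thesis .
qed

lemma fourier_modulate: "fourier (\<lambda>\<xi>. cis ((2 * pi * x) * \<xi>) * f \<xi>) y = fourier f (y - x)"
  unfolding fourier_def
proof (intro Bochner_Integration.integral_cong refl)
  fix \<xi>
  have "cis ((2 * pi * x) * \<xi>) * cis (- (2 * pi * \<xi> * y)) = cis (- (2 * pi * \<xi> * (y - x)))"
    by (simp add: cis_mult algebra_simps)
  then show "cis ((2 * pi * x) * \<xi>) * f \<xi> * cis (- (2 * pi * \<xi> * y)) = f \<xi> * cis (- (2 * pi * \<xi> * (y - x)))"
    by (metis mult.assoc mult.commute)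
qed

lemma fourier_diff: "test f \<Longrightarrow> test g \<Longrightarrow> fourier (\<lambda>x. f x - g x) \<xi> = fourier f \<xi> - fourier g \<xi>"
  unfolding fourier_cis left_diff_distrib
  by (intro Bochner_Integration.integral_diff integrable_cis test_integrable)

lemma fourier_add: "test f \<Longrightarrow> test g \<Longrightarrow> fourier (\<lambda>x. f x + g x) \<xi> = fourier f \<xi> + fourier g \<xi>"
  unfolding fourier_cis distrib_right
  by (intro Bochner_Integration.integral_add integrable_cis test_integrable)

lemma integrable_bounded_fourier:
  assumes "f \<in> borel_measurable borel" "\<And>x. norm (f x) \<le> B" and t: "test \<phi>"
  shows "integrable lborel (\<lambda>x. f x * fourier \<phi> x)"
proof (rule Bochner_Integration.integrable_bound)
  show "integrable lborel (\<lambda>x. B * norm (fourier \<phi> x))"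
    using integrable_fourier[OF t] by (intro integrable_mult_right integrable_norm)
  have [measurable]: "fourier \<phi> \<in> borel_measurable borel"
    by (rule borel_measurable_continuous_onI[OF fourier_continuous[OF t]])
  note [measurable] = assms(1)
  show "(\<lambda>x. f x * fourier \<phi> x) \<in> borel_measurable lborel" by measurable
  have "0 \<le> B" using assms(2)[of 0] norm_ge_zero order_trans by blast
  then show "AE x in lborel. norm (f x * fourier \<phi> x) \<le> norm (B * norm (fourier \<phi> x))"
    by (intro AE_I2) (simp add: norm_mult mult_right_mono assms(2))
qed

lemma fourier_dist_add:
  assumes "f \<in> borel_measurable borel" "\<And>x. norm (f x) \<le> B" and "test \<phi>" "test \<psi>"
  shows "fourier_dist f (\<lambda>x. \<phi> x + \<psi> x) = fourier_dist f \<phi> + fourier_dist f \<psi>"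
  unfolding fourier_dist_def fourier_add[OF assms(3,4)] distrib_left
  by (intro Bochner_Integration.integral_add integrable_bounded_fourier[OF assms(1,2)] assms(3,4))

lemma fourier_dist_diff:
  assumes "f \<in> borel_measurable borel" "\<And>x. norm (f x) \<le> B" and "test \<phi>" "test \<psi>"
  shows "fourier_dist f (\<lambda>x. \<phi> x - \<psi> x) = fourier_dist f \<phi> - fourier_dist f \<psi>"
  unfolding fourier_dist_def fourier_diff[OF assms(3,4)] right_diff_distrib
  by (intro Bochner_Integration.integral_diff integrable_bounded_fourier[OF assms(1,2)] assms(3,4))

lemma fourier_dist_zero [simp]: "fourier_dist f (\<lambda>_. 0) = 0"
  by (simp add: fourier_dist_def fourier_def)

text \<open>The frequency support is the complement of a union of open sets on each of which the distribution vanishes. A smooth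
  partition of unity at the scale of the Lebesgue number of this cover splits \<open>\<phi>\<close> into pieces supported in single members.\<close>

lemma fourier_dist_off_support:
  assumes fm: "f \<in> borel_measurable borel" and fB: "\<And>x. norm (f x) \<le> B" and t: "test \<phi>"
    and disj: "fun_supp \<phi> \<inter> freq_supp f = {}"
  shows "fourier_dist f \<phi> = 0"
proof -
  define \<C> where "\<C> = {U. open U \<and> (\<forall>\<phi>. test_function \<phi> \<and> fun_supp \<phi> \<subseteq> U \<longrightarrow> fourier_dist f \<phi> = 0)}"
  have sub: "fun_supp \<phi> \<subseteq> \<Union>\<C>" using disj by (auto simp: freq_supp_def \<C>_def)
  have cpt: "compact (fun_supp \<phi>)" using test_imp_test_function[OF t] by (simp add: test_function_def)
  have "{} \<in> \<C>"
  proof -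
    have "\<phi> = (\<lambda>_. 0)" if "fun_supp \<phi> \<subseteq> {}" for \<phi>
      using that closure_subset[of "{x. \<phi> x \<noteq> 0}"] by (auto simp: fun_supp_def fun_eq_iff)
    then have "\<forall>\<phi>. test_function \<phi> \<and> fun_supp \<phi> \<subseteq> {} \<longrightarrow> fourier_dist f \<phi> = 0"
      by (metis fourier_dist_zero)
    then show ?thesis by (simp add: \<C>_def)
  qed
  then have ne: "\<C> \<noteq> {}" by blast
  have op: "open U" if "U \<in> \<C>" for U using that by (simp add: \<C>_def)
  obtain \<delta> where \<delta>: "0 < \<delta>" "\<And>T. T \<subseteq> fun_supp \<phi> \<Longrightarrow> diameter T < \<delta> \<Longrightarrow> \<exists>U\<in>\<C>. T \<subseteq> U"
    using Lebesgue_number_lemma[OF cpt ne sub op] by metis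
  define h where "h = \<delta> / 4"
  have h: "0 < h" "2 * h < \<delta>" using \<delta> by (auto simp: h_def)
  \<comment> \<open>\<open>\<eta> k\<close> is a difference of consecutive translates of a ramp: supported in an interval of length \<open>2 h\<close>, with telescoping sum\<close>
  define \<eta> where "\<eta> k x = complex_of_real (ramp (1 / h * x + (1 - real_of_int k))) + (-1) * of_real (ramp (1 / h * x + - real_of_int k))" for k x
  have sm: "smooth (\<eta> k)" for k
    unfolding \<eta>_def by (intro allI differentiable_times_add differentiable_times_mult differentiable_times_const smooth_ramp)
  obtain R where R: "0 < R" "\<And>x. R \<le> \<bar>x\<bar> \<Longrightarrow> \<phi> x = 0" using t by (auto simp: test_def)
  define n where "n = \<lceil>R / h\<rceil>"
  have n: "R \<le> h * n" "0 \<le> n"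
  proof -
    have le: "R / h \<le> n" by (simp add: n_def)
    then show "R \<le> h * n" using h by (simp add: pos_divide_le_eq mult.commute)
    have "0 \<le> R / h" using h R by simp
    then have "0 \<le> real_of_int n" using le by linarith
    then show "0 \<le> n" by simp
  qed
  have tk: "test (\<lambda>x. \<eta> k x * \<phi> x)" for k by (rule test_mult[OF t sm])
  have zero: "fourier_dist f (\<lambda>x. \<eta> k x * \<phi> x) = 0" for k
  proof -
    let ?S = "fun_supp (\<lambda>x. \<eta> k x * \<phi> x)"
    have S1: "?S \<subseteq> fun_supp \<phi>" unfolding fun_supp_def by (intro closure_mono) auto
    have "?S \<subseteq> {h * (k - 1)..h * (k + 1)}" unfolding fun_supp_def
    proof (rule closure_minimal)
      show "{x. \<eta> k x * \<phi> x \<noteq> 0} \<subseteq> {h * (k - 1)..h * (k + 1)}"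
      proof
        fix x assume "x \<in> {x. \<eta> k x * \<phi> x \<noteq> 0}"
        then have e: "\<eta> k x \<noteq> 0" by auto
        have "\<not> x / h \<le> k - 1"
        proof
          assume "x / h \<le> k - 1"
          then have "ramp (1 / h * x + (1 - real_of_int k)) = 0" "ramp (1 / h * x + - real_of_int k) = 0" by (auto intro!: ramp_simps)
          then show False using e by (simp add: \<eta>_def)
        qed
        moreover have "\<not> k + 1 \<le> x / h"
        proof
          assume "k + 1 \<le> x / h"
          then have "ramp (1 / h * x + (1 - real_of_int k)) = 1" "ramp (1 / h * x + - real_of_int k) = 1" by (auto intro!: ramp_simps)
          then show False using e by (simp add: \<eta>_def)
        qed
        ultimately show "x \<in> {h * (k - 1)..h * (k + 1)}" using h by (simp add: field_simps)
      qed
    qed simp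
    then have "diameter ?S \<le> diameter {h * (real_of_int k - 1)..h * (k + 1)}"
      by (intro diameter_subset) auto
    also have "\<dots> \<le> 2 * h" using h by (simp add: diameter_closed_interval algebra_simps)
    finally have "diameter ?S < \<delta>" using h by simp
    then obtain U where "U \<in> \<C>" "?S \<subseteq> U" using \<delta>(2)[OF S1] by blast
    then show ?thesis using test_imp_test_function[OF tk] by (auto simp: \<C>_def)
  qed
  have sum: "test (\<lambda>x. \<Sum>k\<in>A. \<eta> k x * \<phi> x) \<and> fourier_dist f (\<lambda>x. \<Sum>k\<in>A. \<eta> k x * \<phi> x) = 0" if "finite A" for A :: "int set"
    using that
  proof (induction A)
    case empty then show ?case using test_zero by simp
  next
    case (insert k A)
    then show ?case using fourier_dist_add[OF fm fB tk, of "\<lambda>x. \<Sum>k\<in>A. \<eta> k x * \<phi> x" k] test_add[OF tk, of "\<lambda>x. \<Sum>k\<in>A. \<eta> k x * \<phi> x" k] zero[of k]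
      by simp
  qed
  have "(\<lambda>x. \<Sum>k\<in>{- n..n}. \<eta> k x * \<phi> x) = \<phi>"
  proof
    fix x
    define b where "b k = complex_of_real (ramp (1 / h * x + - real_of_int k))" for k :: int
    have eb: "\<eta> k x = b (k - 1) - b k" for k by (simp add: \<eta>_def b_def algebra_simps)
    have tele: "(\<Sum>k\<in>{- n..m}. \<eta> k x) = b (- n - 1) - b m" if "- n - 1 \<le> m" for m
      using that
    proof (induction m rule: int_ge_induct)
      case (step i)
      have "{- n..i + 1} = insert (i + 1) {- n..i}" using step by auto
      then show ?case using step by (simp add: eb)
    qed simp
    have "(\<Sum>k\<in>{- n..n}. \<eta> k x) = 1" if "\<phi> x \<noteq> 0"
    proof -
      have "\<bar>x\<bar> \<le> h * n" using R(2)[of x] that n by linarith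
      then have "\<bar>x / h\<bar> \<le> n" using h by (simp add: pos_divide_le_eq mult.commute)
      then have "x / h \<le> n" "- (x / h) \<le> n" unfolding abs_le_iff by blast+
      then have "1 \<le> 1 / h * x + - real_of_int (- n - 1)" "1 / h * x + - real_of_int n \<le> 0" by simp_all
      then have "b (- n - 1) = 1" "b n = 0" by (simp_all only: b_def ramp_simps of_real_1 of_real_0)
      then show ?thesis using tele[of n] n by simp
    qed
    then show "(\<Sum>k\<in>{- n..n}. \<eta> k x * \<phi> x) = \<phi> x"
      by (cases "\<phi> x = 0") (simp_all add: sum_distrib_right[symmetric])
  qed
  then show ?thesis using sum[of "{- n..n}"] by simp
qed

definition plateau :: "real \<Rightarrow> complex" where
  "plateau x = of_real (ramp (1 * x + 2)) * of_real (ramp ((-1) * x + 2))"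

lemma test_plateau: "test plateau" and plateau_eq_1: "\<bar>x\<bar> \<le> 1 \<Longrightarrow> plateau x = 1"
proof -
  have "differentiable_times n plateau" for n
    unfolding plateau_def by (intro differentiable_times_mult smooth_ramp)
  moreover have "plateau x = 0" if "2 \<le> \<bar>x\<bar>" for x
    using that ramp_simps(1)[of "1 * x + 2"] ramp_simps(1)[of "(-1) * x + 2"] by (auto simp: plateau_def abs_if split: if_splits)
  ultimately show "test plateau" unfolding test_def by (intro conjI exI[of _ 2]) auto
  show "\<bar>x\<bar> \<le> 1 \<Longrightarrow> plateau x = 1"
    using ramp_simps(2)[of "1 * x + 2"] ramp_simps(2)[of "(-1) * x + 2"] by (auto simp: plateau_def)
qed

text \<open>Convolution of \<open>f\<close> with dilates of the Fourier transform of \<open>plateau\<close> converges to \<open>f\<close>. Once the dilated plateau is one on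
  \<open>U\<close>, its difference from \<open>\<kappa>\<close> is supported away from the frequencies of \<open>f\<close>, so all these convolutions equal the one
  with the transform of \<open>\<kappa>\<close>.\<close>

lemma reproducing_formula:
  assumes cont: "continuous_on UNIV f" and fB: "\<And>x. norm (f x) \<le> B" and t: "test \<kappa>"
    and U: "open U" "freq_supp f \<subseteq> U" "\<And>\<xi>. \<xi> \<in> U \<Longrightarrow> \<kappa> \<xi> = 1" "\<And>\<xi>. \<xi> \<in> U \<Longrightarrow> \<bar>\<xi>\<bar> \<le> R0" and R0: "0 < R0"
  shows "f x = (LINT y|lborel. f y * fourier \<kappa> (y - x))"
proof -
  have fm [measurable]: "f \<in> borel_measurable borel" using cont by (rule borel_measurable_continuous_onI)
  \<comment> \<open>multiplication by \<open>E\<close> moves the evaluation point of the convolution to \<open>x\<close>\<close>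
  define E where "E \<xi> = cis ((2 * pi * x) * \<xi>)" for \<xi>
  have smE: "smooth E" unfolding E_def using differentiable_times_cis by blast
  define R where "R n = R0 + real n" for n
  have R: "0 < R n" "R0 \<le> R n" for n using R0 by (auto simp: R_def)
  define p where "p n \<xi> = plateau (1 / R n * \<xi>)" for n \<xi>
  have tp: "test (p n)" for n unfolding p_def using R by (intro test_scale test_plateau) auto
  have eq: "fourier_dist f (\<lambda>\<xi>. E \<xi> * p n \<xi>) = fourier_dist f (\<lambda>\<xi>. E \<xi> * \<kappa> \<xi>)" for n
  proof -
    have "fun_supp (\<lambda>\<xi>. E \<xi> * p n \<xi> - E \<xi> * \<kappa> \<xi>) \<subseteq> - U"
      unfolding fun_supp_def
    proof (rule closure_minimal)
      show "{\<xi>. E \<xi> * p n \<xi> - E \<xi> * \<kappa> \<xi> \<noteq> 0} \<subseteq> - U"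
      proof (intro subsetI ComplI)
        fix \<xi> assume a: "\<xi> \<in> {\<xi>. E \<xi> * p n \<xi> - E \<xi> * \<kappa> \<xi> \<noteq> 0}" and u: "\<xi> \<in> U"
        have "\<bar>1 / R n * \<xi>\<bar> \<le> 1" using U(4)[OF u] R[of n] by (simp add: abs_mult)
        then have "p n \<xi> = 1" unfolding p_def by (rule plateau_eq_1)
        then show False using a U(3)[OF u] by simp
      qed
      show "closed (- U)" unfolding closed_def using U(1) by simp
    qed
    then have "fourier_dist f (\<lambda>\<xi>. E \<xi> * p n \<xi> - E \<xi> * \<kappa> \<xi>) = 0"
      using U(2) by (intro fourier_dist_off_support[OF fm fB] test_diff test_mult tp t smE) auto
    then show ?thesis using fourier_dist_diff[OF fm fB test_mult[OF tp smE] test_mult[OF t smE], of n] by simp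
  qed
  have fp: "fourier (p n) u = of_real (R n) * fourier plateau (u * R n)" for n u
    unfolding p_def[abs_def] using fourier_scale[of "1 / R n" plateau u] R[of n] by simp
  have lhs: "fourier_dist f (\<lambda>\<xi>. E \<xi> * p n \<xi>) = (LINT v|lborel. f (x + 1 / R n * v) * fourier plateau v)" for n
  proof -
    have "fourier_dist f (\<lambda>\<xi>. E \<xi> * p n \<xi>) = (LINT y|lborel. f y * (of_real (R n) * fourier plateau ((y - x) * R n)))"
      by (simp only: fourier_dist_def E_def fourier_modulate fp)
    also have "\<dots> = \<bar>1 / R n\<bar> *\<^sub>R (LINT v|lborel. f (x + 1 / R n * v) * (of_real (R n) * fourier plateau ((x + 1 / R n * v - x) * R n)))"
      using R[of n] by (intro lborel_integral_real_affine) simp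
    also have "(LINT v|lborel. f (x + 1 / R n * v) * (of_real (R n) * fourier plateau ((x + 1 / R n * v - x) * R n)))
       = (LINT v|lborel. of_real (R n) * (f (x + 1 / R n * v) * fourier plateau v))"
      using R[of n] by (intro Bochner_Integration.integral_cong refl) (simp add: mult_ac)
    also have "\<bar>1 / R n\<bar> *\<^sub>R \<dots> = (LINT v|lborel. f (x + 1 / R n * v) * fourier plateau v)"
      using R[of n] by (simp only: integral_mult_right_zero) (simp add: scaleR_conv_of_real)
    finally show ?thesis .
  qed
  have Pm [measurable]: "fourier plateau \<in> borel_measurable borel"
    by (rule borel_measurable_continuous_onI[OF fourier_continuous[OF test_plateau]])
  have "(\<lambda>n. LINT v|lborel. f (x + 1 / R n * v) * fourier plateau v) \<longlonglongrightarrow> (LINT v|lborel. f x * fourier plateau v)"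
  proof (rule integral_dominated_convergence[where w = "\<lambda>v. B * norm (fourier plateau v)"])
    show "integrable lborel (\<lambda>v. B * norm (fourier plateau v))"
      using integrable_fourier[OF test_plateau] by (intro integrable_mult_right integrable_norm)
    show "AE v in lborel. (\<lambda>n. f (x + 1 / R n * v) * fourier plateau v) \<longlonglongrightarrow> f x * fourier plateau v"
    proof (intro AE_I2 tendsto_mult_right)
      fix v
      have "(\<lambda>n. 1 / R n) \<longlonglongrightarrow> 0" unfolding R_def
        by (intro tendsto_divide_0[OF tendsto_const] filterlim_at_top_imp_at_infinity
            filterlim_tendsto_add_at_top[OF tendsto_const filterlim_real_sequentially])
      then have "(\<lambda>n. x + 1 / R n * v) \<longlonglongrightarrow> x + 0 * v" by (intro tendsto_intros)
      moreover have "isCont f x" using cont by (simp add: continuous_on_eq_continuous_at)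
      ultimately show "(\<lambda>n. f (x + 1 / R n * v)) \<longlonglongrightarrow> f x" using isCont_tendsto_compose[of x f] by simp
    qed
    show "AE v in lborel. norm (f (x + 1 / R n * v) * fourier plateau v) \<le> B * norm (fourier plateau v)" for n
      by (intro AE_I2) (simp add: norm_mult mult_right_mono fB)
  qed measurable
  also have "(LINT v|lborel. f x * fourier plateau v) = f x"
    using integral_fourier[OF test_plateau] plateau_eq_1[of 0] by simp
  finally have "(\<lambda>n. fourier_dist f (\<lambda>\<xi>. E \<xi> * \<kappa> \<xi>)) \<longlonglongrightarrow> f x"
    unfolding lhs[symmetric] eq .
  then have "fourier_dist f (\<lambda>\<xi>. E \<xi> * \<kappa> \<xi>) = f x" by (simp add: LIMSEQ_const_iff)
  then show ?thesis unfolding fourier_dist_def E_def fourier_modulate by simp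
qed

lemma LP_family_bounded:
  assumes LP: "LP_family C0 A m f" and m: "0 \<le> m"
  shows "norm (f j x) \<le> \<bar>A 0\<bar>"
proof -
  have "norm (nth_vderiv 0 (f j) x) \<le> A 0 * 2 powi (- j * int 0) * (1 + \<bar>x\<bar> * 2 powi (- j)) powr (- m)"
    using LP unfolding LP_family_def by blast
  then have "norm (f j x) \<le> A 0 * (1 + \<bar>x\<bar> * 2 powi (- j)) powr (- m)" by (simp add: nth_vderiv_def)
  also have "\<dots> \<le> \<bar>A 0\<bar> * 1"
  proof (rule mult_mono)
    have "(1 + \<bar>x\<bar> * 2 powi (- j)) powr (- m) \<le> (1 + \<bar>x\<bar> * 2 powi (- j)) powr 0"
      using m by (intro powr_mono) auto
    also have "\<dots> = 1" by (simp add: add_pos_nonneg less_imp_neq[symmetric])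
    finally show "(1 + \<bar>x\<bar> * 2 powi (- j)) powr (- m) \<le> 1" .
  qed auto
  finally show ?thesis by simp
qed

lemma LP_family_continuous:
  assumes LP: "LP_family C0 A m f" shows "continuous_on UNIV (f j)"
proof -
  have "smooth_fun (f j)" using LP by (simp add: LP_family_def)
  then have "f j differentiable (at x)" for x unfolding smooth_fun_def by (metis nth_vderiv_def funpow_0)
  then show ?thesis
    by (simp add: continuous_at_imp_continuous_on differentiable_imp_continuous_within)
qed

text \<open>The kernel is the Fourier transform of a bump that is one on the annulus \<open>1/C0 < |\<xi>| < C0\<close> and vanishes near the
  origin; the latter makes the kernel the derivative of a function with the same decay.\<close>

lemma LP_kernel:
  assumes C0: "1 < C0"
  obtains \<phi> \<phi>' \<Phi> C where "0 < C" "continuous_on UNIV \<phi>"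
    "\<And>x. norm (\<phi> x) \<le> C / (1 + x\<^sup>2)" "\<And>x. norm (\<phi>' x) \<le> C / (1 + x\<^sup>2)" "\<And>x. norm (\<Phi> x) \<le> C / (1 + x\<^sup>2)"
    "\<And>x. (\<phi> has_vector_derivative \<phi>' x) (at x)" "\<And>x. (\<Phi> has_vector_derivative \<phi> x) (at x)"
    "\<And>f A m j x. LP_family C0 A m f \<Longrightarrow> 0 \<le> m \<Longrightarrow> f j x = (LINT y|lborel. f j y * (of_real (2 powi (- j)) * \<phi> ((y - x) * 2 powi (- j))))"
proof -
  define a where "a = 1 / C0"
  have a: "0 < a" "a < 1" using C0 by (auto simp: a_def)
  define \<theta> where "\<theta> x = complex_of_real (ramp (2 / a * x + (-1))) * of_real (ramp ((- 1 / C0) * x + 2))" for x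
  have \<theta>1: "\<theta> x = 1" if "a \<le> x" "x \<le> C0" for x
  proof -
    have "ramp (2 / a * x + (-1)) = 1" using that a by (intro ramp_simps) (simp add: field_simps)
    moreover have "ramp ((- 1 / C0) * x + 2) = 1" using that C0 by (intro ramp_simps) (simp add: field_simps)
    ultimately show ?thesis by (simp add: \<theta>_def)
  qed
  have \<theta>0: "\<theta> x = 0" if "x \<le> a / 2 \<or> 2 * C0 \<le> x" for x
  proof -
    have "ramp (2 / a * x + (-1)) = 0 \<or> ramp ((- 1 / C0) * x + 2) = 0"
      using that
    proof
      assume "x \<le> a / 2"
      then have "ramp (2 / a * x + (-1)) = 0" using a by (intro ramp_simps) (simp add: field_simps)
      then show ?thesis ..
    next
      assume "2 * C0 \<le> x"
      then have "ramp ((- 1 / C0) * x + 2) = 0" using C0 by (intro ramp_simps) (simp add: field_simps)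
      then show ?thesis ..
    qed
    then show ?thesis by (auto simp: \<theta>_def)
  qed
  have sm\<theta>: "differentiable_times n \<theta>" for n
    unfolding \<theta>_def by (intro differentiable_times_mult smooth_ramp)
  define \<kappa> where "\<kappa> x = \<theta> x + \<theta> ((-1) * x + 0)" for x
  have sm\<kappa>: "differentiable_times n \<kappa>" for n
    unfolding \<kappa>_def by (intro differentiable_times_add sm\<theta> differentiable_times_affine[OF sm\<theta>])
  have \<kappa>1: "\<kappa> x = 1" if "a < \<bar>x\<bar>" "\<bar>x\<bar> < C0" for x
    using that \<theta>1[of x] \<theta>1[of "-x"] \<theta>0[of x] \<theta>0[of "-x"] a by (cases "0 < x") (auto simp: \<kappa>_def)
  have \<kappa>0: "\<kappa> x = 0" if "\<bar>x\<bar> \<le> a / 2 \<or> 2 * C0 \<le> \<bar>x\<bar>" for x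
    using that \<theta>0[of x] \<theta>0[of "-x"] a C0 by (auto simp: \<kappa>_def abs_if split: if_splits)
  have t\<kappa>: "test \<kappa>" unfolding test_def using sm\<kappa> \<kappa>0 C0 by (intro conjI exI[of _ "2 * C0"]) auto
  \<comment> \<open>\<open>g\<close> is a zero-free smooth function equal to \<open>x\<^sup>2\<close> on the support of \<open>\<kappa>\<close>, so \<open>x / g x\<close> is a smooth version of \<open>1 / x\<close>\<close>
  define g where "g x = x\<^sup>2 + (1 - (ramp (2 / a * x + 0) + ramp ((- 2 / a) * x + 0)))" for x :: real
  have r0: "ramp (2 / a * x + 0) = 0 \<or> ramp ((- 2 / a) * x + 0) = 0" for x
  proof (cases "0 \<le> x")
    case True
    then have "0 \<le> 2 / a * x" using a by simp
    then have "(- 2 / a) * x + 0 \<le> 0" by simp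
    then show ?thesis using ramp_simps(1) by blast
  next
    case False
    then have "2 / a * x + 0 \<le> 0" using a by (simp add: divide_nonpos_pos)
    then show ?thesis using ramp_simps(1) by blast
  qed
  have gpos: "g x \<noteq> 0" for x
  proof (cases "x = 0")
    case True then show ?thesis using ramp_simps(1)[of 0] by (simp add: g_def)
  next
    case False
    then have "0 < x\<^sup>2" by simp
    then show ?thesis using r0[of x] ramp_bounds(2)[of "2 / a * x + 0"] ramp_bounds(2)[of "(- 2 / a) * x + 0"]
      unfolding g_def by (smt (verit))
  qed
  have gx: "g x = x\<^sup>2" if "a / 2 \<le> \<bar>x\<bar>" for x
  proof -
    have "ramp (2 / a * x + 0) + ramp ((- 2 / a) * x + 0) = 1"
    proof (cases "0 \<le> x")
      case True
      then have "ramp (2 / a * x + 0) = 1" using that a by (intro ramp_simps) (simp add: field_simps)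
      moreover have "ramp ((- 2 / a) * x + 0) = 0" using True a by (intro ramp_simps) (simp add: field_simps)
      ultimately show ?thesis by simp
    next
      case False
      then have "ramp ((- 2 / a) * x + 0) = 1" using that a by (intro ramp_simps) (simp add: field_simps)
      moreover have "ramp (2 / a * x + 0) = 0" using False a by (intro ramp_simps) (simp add: field_simps)
      ultimately show ?thesis by simp
    qed
    then show ?thesis by (simp add: g_def)
  qed
  have smg: "differentiable_times n (\<lambda>x. of_real (g x))" for n
  proof -
    have "(\<lambda>x. complex_of_real (g x)) = (\<lambda>x. of_real x * of_real x + (1 + (-1) * (of_real (ramp (2 / a * x + 0)) + of_real (ramp ((- 2 / a) * x + 0)))))"
      by (auto simp: g_def power2_eq_square)
    moreover have "differentiable_times n (\<lambda>x. of_real x * of_real x + (1 + (-1) * (of_real (ramp (2 / a * x + 0)) + of_real (ramp ((- 2 / a) * x + 0)))))"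
      by (intro differentiable_times_add differentiable_times_mult differentiable_times_of_real differentiable_times_const smooth_ramp)
    ultimately show ?thesis by (simp only:)
  qed
  define \<psi> where "\<psi> x = ((1 / (- 2 * pi * \<i>)) * of_real x * inverse (of_real (g x))) * \<kappa> x" for x
  have t\<psi>: "test \<psi>" unfolding \<psi>_def
    by (rule test_mult[OF t\<kappa>]) (intro allI differentiable_times_mult differentiable_times_const differentiable_times_of_real differentiable_times_inverse smg, simp add: gpos)
  have \<psi>\<kappa>: "(\<lambda>y. (- 2 * pi * \<i> * y) * \<psi> y) = \<kappa>"
  proof
    fix y
    show "(- 2 * pi * \<i> * y) * \<psi> y = \<kappa> y"
    proof (cases "\<bar>y\<bar> \<le> a / 2")
      case True then show ?thesis using \<kappa>0[of y] by (simp add: \<psi>_def)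
    next
      case False
      then have "g y = y\<^sup>2" "y \<noteq> 0" using gx[of y] a by auto
      then show ?thesis by (simp add: \<psi>_def power2_eq_square field_simps)
    qed
  qed
  have sm: "smooth (\<lambda>y. (- 2 * pi * \<i>) * of_real y)" by (intro allI differentiable_times_mult differentiable_times_const differentiable_times_of_real)
  have t\<kappa>': "test (\<lambda>y. (- 2 * pi * \<i> * y) * \<kappa> y)" using test_mult[OF t\<kappa> sm] by (simp add: mult.assoc)
  obtain C1 where C1: "0 < C1" "\<And>\<xi>. norm (fourier \<kappa> \<xi>) \<le> C1 / (1 + \<xi>\<^sup>2)" using fourier_decay[OF t\<kappa>] by blast
  obtain C2 where C2: "0 < C2" "\<And>\<xi>. norm (fourier (\<lambda>y. (- 2 * pi * \<i> * y) * \<kappa> y) \<xi>) \<le> C2 / (1 + \<xi>\<^sup>2)" using fourier_decay[OF t\<kappa>'] by blast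
  obtain C3 where C3: "0 < C3" "\<And>\<xi>. norm (fourier \<psi> \<xi>) \<le> C3 / (1 + \<xi>\<^sup>2)" using fourier_decay[OF t\<psi>] by blast
  define C where "C = C1 + C2 + C3"
  have up: "z \<le> D / (1 + x\<^sup>2) \<Longrightarrow> D \<le> C \<Longrightarrow> z \<le> C / (1 + x\<^sup>2)" for z D x :: real
    by (erule order_trans) (auto intro!: divide_right_mono add_nonneg_nonneg)
  show ?thesis
  proof (rule that[of C "fourier \<kappa>" "fourier (\<lambda>y. (- 2 * pi * \<i> * y) * \<kappa> y)" "fourier \<psi>"])
    show "0 < C" using C1 C2 C3 by (simp add: C_def)
    show "continuous_on UNIV (fourier \<kappa>)" by (rule fourier_continuous[OF t\<kappa>])
    show "norm (fourier \<kappa> x) \<le> C / (1 + x\<^sup>2)" for x using C1(1) C2(1) C3(1) by (intro up[OF C1(2)]) (simp add: C_def)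
    show "norm (fourier (\<lambda>y. (- 2 * pi * \<i> * y) * \<kappa> y) x) \<le> C / (1 + x\<^sup>2)" for x using C1(1) C2(1) C3(1) by (intro up[OF C2(2)]) (simp add: C_def)
    show "norm (fourier \<psi> x) \<le> C / (1 + x\<^sup>2)" for x using C1(1) C2(1) C3(1) by (intro up[OF C3(2)]) (simp add: C_def)
    show "(fourier \<kappa> has_vector_derivative fourier (\<lambda>y. (- 2 * pi * \<i> * y) * \<kappa> y) x) (at x)" for x
      by (rule fourier_has_derivative[OF t\<kappa>])
    show "(fourier \<psi> has_vector_derivative fourier \<kappa> x) (at x)" for x
      using fourier_has_derivative[OF t\<psi>, of x] unfolding \<psi>\<kappa> .
    fix f A m j x assume LP: "LP_family C0 A m f" and m: "0 \<le> m"
    define d where "d = (2::real) powi j"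
    have d: "0 < d" "2 powi (- j) = 1 / d" by (auto simp: d_def power_int_minus inverse_eq_divide)
    note bnd = LP_family_bounded[OF LP m, of j] and cont = LP_family_continuous[OF LP, of j]
    define U where "U = {\<xi>. 1 / C0 * 2 powi (- j) < \<bar>\<xi>\<bar> \<and> \<bar>\<xi>\<bar> < C0 * 2 powi (- j)}"
    have td: "test (\<lambda>\<xi>. \<kappa> (d * \<xi>))" by (rule test_scale[OF t\<kappa> d(1)])
    have "f j x = (LINT y|lborel. f j y * fourier (\<lambda>\<xi>. \<kappa> (d * \<xi>)) (y - x))"
    proof (rule reproducing_formula[OF cont bnd td])
      show "open U" unfolding U_def by (intro open_Collect_conj open_Collect_less continuous_intros)
      show "freq_supp (f j) \<subseteq> U" using LP by (simp add: LP_family_def U_def)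
      show "\<kappa> (d * \<xi>) = 1" if "\<xi> \<in> U" for \<xi>
        using that d C0 by (intro \<kappa>1) (auto simp: U_def a_def abs_mult field_simps)
      show "\<bar>\<xi>\<bar> \<le> C0 * 2 powi (- j)" if "\<xi> \<in> U" for \<xi> using that by (simp add: U_def)
      show "0 < C0 * 2 powi (- j)" using C0 by simp
    qed
    also have "\<dots> = (LINT y|lborel. f j y * (of_real (2 powi (- j)) * fourier \<kappa> ((y - x) * 2 powi (- j))))"
      unfolding d(2) fourier_scale[OF d(1)] by simp
    finally show "f j x = (LINT y|lborel. f j y * (of_real (2 powi (- j)) * fourier \<kappa> ((y - x) * 2 powi (- j))))" .
  qed
qed

section \<open>Averages on weighted spaces\<close>

text \<open>A substitute for Minkowski's inequality that stays inside one integral: a sum is bounded by the supremum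
  of its terms against summable weights.\<close>

lemma epowr_sum_weighted:
  assumes s: "0 < s" and w: "\<And>i. 0 < w i" and c: "0 \<le> c" "(\<integral>\<^sup>+ i. ennreal (1 / w i) \<partial>count_space UNIV) \<le> ennreal c"
  shows "epowr (\<integral>\<^sup>+ i. a i \<partial>count_space UNIV) s
     \<le> ennreal (c powr s) * (\<integral>\<^sup>+ i. epowr (ennreal (w i) * a i) s \<partial>count_space UNIV)"
proof -
  define S where "S = (\<integral>\<^sup>+ i. epowr (ennreal (w i) * a i) s \<partial>count_space UNIV)"
  have "a i \<le> ennreal (1 / w i) * epowr S (1/s)" for i
  proof -
    have "epowr (ennreal (w i) * a i) s \<le> S" unfolding S_def by (rule nn_integral_ge_point) simp
    then have "ennreal (w i) * a i \<le> epowr S (1/s)" using s by (simp add: epowr_le_iff)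
    then have "ennreal (1 / w i) * (ennreal (w i) * a i) \<le> ennreal (1 / w i) * epowr S (1/s)"
      by (rule mult_left_mono) simp
    moreover have "ennreal (1 / w i) * (ennreal (w i) * a i) = a i"
      using w[of i] by (simp add: mult.assoc[symmetric] ennreal_mult[symmetric])
    ultimately show ?thesis by simp
  qed
  then have "(\<integral>\<^sup>+ i. a i \<partial>count_space UNIV) \<le> (\<integral>\<^sup>+ i. ennreal (1 / w i) * epowr S (1/s) \<partial>count_space UNIV)"
    by (intro nn_integral_mono)
  also have "\<dots> = (\<integral>\<^sup>+ i. ennreal (1 / w i) \<partial>count_space UNIV) * epowr S (1/s)"
    by (rule nn_integral_multc) simp
  also have "\<dots> \<le> ennreal c * epowr S (1/s)" by (intro mult_right_mono c) simp
  finally have "epowr (\<integral>\<^sup>+ i. a i \<partial>count_space UNIV) s \<le> epowr (ennreal c * epowr S (1/s)) s"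
    using s by (intro epowr_mono) auto
  then show ?thesis using s c by (simp add: epowr_mult S_def)
qed

lemma sumZ_indicator_dyI: "sumZ (\<lambda>m. y * indicator (dyI k m) x) = y"
proof -
  have "sumZ (\<lambda>m. y * indicator (dyI k m) x) = (\<integral>\<^sup>+ m. y * indicator {ix k x} m \<partial>count_space UNIV)"
    by (intro nn_integral_cong) (auto simp: dyI_def split: split_indicator)
  also have "\<dots> = y" by (subst nn_integral_count_space'[of "{ix k x}"]) (auto split: split_indicator)
  finally show ?thesis .
qed

lemma nn_integral_dyadic:
  assumes se: "sets \<mu> = sets borel" and fm: "f \<in> borel_measurable borel"
  shows "(\<integral>\<^sup>+ x. f x \<partial>\<mu>) = sumZ (\<lambda>m. \<integral>\<^sup>+ x. f x * indicator (dyI k m) x \<partial>\<mu>)"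
proof -
  note [measurable_cong] = se
  note [measurable] = fm
  have "(\<integral>\<^sup>+ x. f x \<partial>\<mu>) = (\<integral>\<^sup>+ x. sumZ (\<lambda>m. f x * indicator (dyI k m) x) \<partial>\<mu>)"
    by (simp only: sumZ_indicator_dyI)
  also have "\<dots> = sumZ (\<lambda>m. \<integral>\<^sup>+ x. f x * indicator (dyI k m) x \<partial>\<mu>)"
    by (rule nn_integral_count_space_nn_integral) auto
  finally show ?thesis .
qed

text \<open>A dyadic interval together with its two neighbours of the same length.\<close>

definition nbhd :: "int \<Rightarrow> int \<Rightarrow> real set" where
  "nbhd k m = {y. \<bar>ix k y - m\<bar> \<le> 1}"

lemma nbhd_measurable [measurable]: "nbhd k m \<in> sets borel"
proof -
  have "nbhd k m = ix k -` {m - 1..m + 1} \<inter> space borel" by (auto simp: nbhd_def)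
  then show ?thesis using measurable_sets[OF ix_measurable, of "{m - 1..m + 1}" k] by simp
qed

lemma nbhd_subset: "nbhd k m \<subseteq> {(real_of_int m - 1) * 2 powi k..(real_of_int m + 2) * 2 powi k}"
proof
  fix y assume "y \<in> nbhd k m"
  then have i: "m - 1 \<le> ix k y" "ix k y \<le> m + 1" by (auto simp: nbhd_def)
  have "y \<in> dyI k (ix k y)" by (simp add: dyI_def)
  then have y: "of_int (ix k y) * 2 powi k \<le> y" "y < (of_int (ix k y) + 1) * 2 powi k" by (auto simp: dyI_eq)
  have "(real_of_int m - 1) * 2 powi k \<le> of_int (ix k y) * 2 powi k" using i by (intro mult_right_mono) auto
  moreover have "(of_int (ix k y) + 1) * 2 powi k \<le> (real_of_int m + 2) * 2 powi k" using i by (intro mult_right_mono) auto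
  ultimately show "y \<in> {(real_of_int m - 1) * 2 powi k..(real_of_int m + 2) * 2 powi k}"
    unfolding atLeastAtMost_iff using y by linarith
qed

definition nbhd_avg :: "int \<Rightarrow> (real \<Rightarrow> ennreal) \<Rightarrow> real \<Rightarrow> ennreal" where
  "nbhd_avg k h x = ennreal (2 powi (- k)) * (\<integral>\<^sup>+ y\<in>nbhd k (ix k x). h y \<partial>lborel)"

lemma nbhd_avg_measurable [measurable]: "nbhd_avg k h \<in> borel_measurable borel"
proof -
  have "(\<lambda>x. (\<lambda>m. ennreal (2 powi (- k)) * (\<integral>\<^sup>+ y\<in>nbhd k m. h y \<partial>lborel)) (ix k x)) \<in> borel_measurable borel"
    by (rule measurable_compose[OF ix_measurable]) simp
  then show ?thesis by (simp add: nbhd_avg_def[abs_def])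
qed

lemma (in Ap) nbhd_avg_bound:
  assumes [measurable]: "h \<in> borel_measurable borel"
  shows "Lpow p w (nbhd_avg k h) \<le> ennreal (3 * (K * 3 powr p)) * Lpow p w h"
proof -
  define L where "L = (2::real) powi k"
  have L: "0 < L" "2 powi (- k) = 1 / L" by (auto simp: L_def power_int_minus inverse_eq_divide)
  have piece: "(\<integral>\<^sup>+ x\<in>dyI k m. epowr (nbhd_avg k h x) p \<partial>wt w)
     \<le> ennreal (K * 3 powr p) * (\<integral>\<^sup>+ x\<in>nbhd k m. epowr (h x) p \<partial>wt w)" for m
  proof -
    define a where "a = (real_of_int m - 1) * L"
    define b where "b = (real_of_int m + 2) * L"
    have ab: "a < b" "b - a = 3 * L" using L by (auto simp: a_def b_def algebra_simps)
    define H where "H = (\<integral>\<^sup>+ y\<in>nbhd k m. h y \<partial>lborel)"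
    have N: "nbhd k m \<subseteq> {a..b}" unfolding a_def b_def L_def by (rule nbhd_subset)
    have dN: "dyI k m \<subseteq> nbhd k m" by (auto simp: dyI_def nbhd_def)
    have "(\<integral>\<^sup>+ x\<in>dyI k m. epowr (nbhd_avg k h x) p \<partial>wt w)
       = (\<integral>\<^sup>+ x\<in>dyI k m. epowr (ennreal (1 / L) * H) p \<partial>wt w)"
      by (intro nn_integral_cong) (auto simp: nbhd_avg_def dyI_def H_def L split: split_indicator)
    also have "\<dots> = epowr (ennreal (1 / L) * H) p * mass w (dyI k m)"
      by (rule nn_integral_cmult_indicator) simp
    also have "\<dots> \<le> epowr (ennreal (1 / L) * H) p * mass w {a..b}"
      using N dN by (intro mult_left_mono emeasure_mono) auto
    also have "\<dots> = ennreal ((1 / L) powr p) * (epowr H p * mass w {a..b})"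
      using p L by (simp add: epowr_mult mult.assoc)
    also have "\<dots> \<le> ennreal ((1 / L) powr p) * (ennreal (K * (b - a) powr p) * (\<integral>\<^sup>+ x\<in>nbhd k m. epowr (h x) p \<partial>wt w))"
      unfolding H_def by (intro mult_left_mono average_bound ab N) auto
    also have "\<dots> = ennreal ((1 / L) powr p * (K * (b - a) powr p)) * (\<integral>\<^sup>+ x\<in>nbhd k m. epowr (h x) p \<partial>wt w)"
      using K_pos by (simp add: ennreal_mult mult.assoc)
    also have "(1 / L) powr p * (K * (b - a) powr p) = K * 3 powr p"
      unfolding ab using L by (simp add: powr_mult powr_divide)
    finally show ?thesis .
  qed
  have cnt: "sumZ (\<lambda>m. y * indicator (nbhd k m) x) = 3 * y" for y x
  proof -
    have "sumZ (\<lambda>m. y * indicator (nbhd k m) x) = (\<integral>\<^sup>+ m. y * indicator {ix k x - 1..ix k x + 1} m \<partial>count_space UNIV)"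
      by (intro nn_integral_cong) (auto simp: nbhd_def split: split_indicator)
    also have "\<dots> = y * emeasure (count_space UNIV) {ix k x - 1..ix k x + 1}" by (rule nn_integral_cmult_indicator) simp
    also have "\<dots> = 3 * y" by (simp add: emeasure_count_space mult.commute)
    finally show ?thesis .
  qed
  have "Lpow p w (nbhd_avg k h) = sumZ (\<lambda>m. \<integral>\<^sup>+ x. epowr (nbhd_avg k h x) p * indicator (dyI k m) x \<partial>wt w)"
    by (rule nn_integral_dyadic) auto
  also have "\<dots> \<le> sumZ (\<lambda>m. ennreal (K * 3 powr p) * (\<integral>\<^sup>+ x\<in>nbhd k m. epowr (h x) p \<partial>wt w))"
    by (intro sumZ_mono piece)
  also have "\<dots> = ennreal (K * 3 powr p) * sumZ (\<lambda>m. \<integral>\<^sup>+ x. epowr (h x) p * indicator (nbhd k m) x \<partial>wt w)"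
    by (rule nn_integral_cmult) simp
  also have "sumZ (\<lambda>m. \<integral>\<^sup>+ x. epowr (h x) p * indicator (nbhd k m) x \<partial>wt w) = (\<integral>\<^sup>+ x. sumZ (\<lambda>m. epowr (h x) p * indicator (nbhd k m) x) \<partial>wt w)"
    by (rule nn_integral_count_space_nn_integral[symmetric]) auto
  also have "\<dots> = 3 * Lpow p w h"
    unfolding cnt by (rule nn_integral_cmult) measurable
  also have "ennreal (K * 3 powr p) * (3 * Lpow p w h) = ennreal (3 * (K * 3 powr p)) * Lpow p w h"
    using K_pos by (simp add: ennreal_mult mult_ac)
  finally show ?thesis .
qed

definition bump :: "int \<Rightarrow> real \<Rightarrow> real" where
  "bump j t = 2 powi (- j) / (1 + (t * 2 powi (- j))\<^sup>2)"

text \<open>The majorant for all pointwise estimates at scale \<open>2\<^sup>j\<close>: it dominates convolutions with kernels that decay like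
  \<open>1 / (1 + x\<^sup>2)\<close> and is essentially constant on intervals of length \<open>2\<^sup>j\<close>.\<close>

definition bump_avg :: "int \<Rightarrow> (real \<Rightarrow> ennreal) \<Rightarrow> real \<Rightarrow> ennreal" where
  "bump_avg j h x = (\<integral>\<^sup>+ y. h y * ennreal (bump j (y - x)) \<partial>lborel)"

lemma bump_measurable [measurable]: "bump j \<in> borel_measurable borel"
  unfolding bump_def by measurable

lemma bump_pos: "0 < bump j t"
  unfolding bump_def by (intro divide_pos_pos add_pos_nonneg) auto

lemma bump_avg_measurable [measurable]:
  assumes [measurable]: "h \<in> borel_measurable borel" shows "bump_avg j h \<in> borel_measurable borel"
  unfolding bump_avg_def by measurable

lemma bump_comparable:
  assumes "\<bar>x - x'\<bar> \<le> 2 powi j" shows "bump j (y - x) \<le> 3 * bump j (y - x')"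
proof -
  define d where "d = (2::real) powi (- j)"
  have d: "0 < d" "2 powi j * d = 1" by (auto simp: d_def power_int_minus)
  define a where "a = (y - x) * d"
  define b where "b = (y - x') * d"
  have "\<bar>a - b\<bar> = \<bar>x - x'\<bar> * d" 
  proof -
    have "a - b = (x' - x) * d" by (simp add: a_def b_def algebra_simps)
    then show ?thesis using d by (simp add: abs_mult abs_minus_commute)
  qed
  also have "\<dots> \<le> 1" using mult_right_mono[OF assms, of d] d by simp
  finally have "\<bar>b\<bar> \<le> \<bar>a\<bar> + 1" by linarith
  then have "b\<^sup>2 \<le> (\<bar>a\<bar> + 1)\<^sup>2" by (metis abs_ge_zero power2_abs power_mono)
  also have "\<dots> \<le> 2 * a\<^sup>2 + 2"
    using sum_squares_bound[of "\<bar>a\<bar>" 1] by (simp add: power2_sum)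
  finally have "1 + b\<^sup>2 \<le> 3 + 2 * a\<^sup>2" by simp
  also have "\<dots> \<le> 3 * (1 + a\<^sup>2)" by simp
  finally have "1 + b\<^sup>2 \<le> 3 * (1 + a\<^sup>2)" .
  then have "1 / (1 + a\<^sup>2) \<le> 3 / (1 + b\<^sup>2)"
    using zero_le_power2[of a] zero_le_power2[of b] by (simp add: divide_simps add_pos_nonneg)
  then have "d * (1 / (1 + a\<^sup>2)) \<le> d * (3 / (1 + b\<^sup>2))" using d by (intro mult_left_mono) auto
  then have "d / (1 + a\<^sup>2) \<le> 3 * (d / (1 + b\<^sup>2))" by (simp add: mult.commute)
  then show ?thesis by (simp add: bump_def a_def b_def d_def)
qed

lemma bump_avg_comparable:
  assumes "\<bar>x - x'\<bar> \<le> 2 powi j" and [measurable]: "h \<in> borel_measurable borel"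
  shows "bump_avg j h x \<le> 3 * bump_avg j h x'"
proof -
  have "bump_avg j h x \<le> (\<integral>\<^sup>+ y. 3 * (h y * ennreal (bump j (y - x'))) \<partial>lborel)"
    unfolding bump_avg_def
  proof (rule nn_integral_mono)
    fix y
    have "ennreal (bump j (y - x)) \<le> ennreal (3 * bump j (y - x'))" by (intro ennreal_leI bump_comparable assms)
    also have "\<dots> = 3 * ennreal (bump j (y - x'))" using bump_pos[of j "y - x'"] by (simp add: ennreal_mult)
    finally have "h y * ennreal (bump j (y - x)) \<le> h y * (3 * ennreal (bump j (y - x')))" by (intro mult_left_mono) auto
    then show "h y * ennreal (bump j (y - x)) \<le> 3 * (h y * ennreal (bump j (y - x')))" by (simp add: mult_ac)
  qed
  also have "\<dots> = 3 * bump_avg j h x'" unfolding bump_avg_def by (rule nn_integral_cmult) measurable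
  finally show ?thesis .
qed

lemma ix_close: "\<bar>y - x\<bar> \<le> 2 powi k \<Longrightarrow> \<bar>ix k y - ix k x\<bar> \<le> 1"
proof -
  assume a: "\<bar>y - x\<bar> \<le> 2 powi k"
  have "\<bar>y / 2 powi k - x / 2 powi k\<bar> \<le> 1"
    using a by (simp add: diff_divide_distrib[symmetric] abs_divide)
  then show ?thesis unfolding ix_def by linarith
qed

text \<open>At a distance of about \<open>2^(j + n)\<close> the bump has size \<open>2^(-j) 4^(-n)\<close>, which is \<open>2^(-n)\<close> times the normalized
  indicator function of an interval of that length.\<close>

lemma bump_le_averages:
  "ennreal (bump j (y - x)) \<le> (\<Sum>n. ennreal (4 / 2 ^ n) * (ennreal (2 powi (- (j + int n))) * indicator (nbhd (j + int n) (ix (j + int n) x)) y))"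
proof -
  define v where "v = \<bar>(y - x) * 2 powi (- j)\<bar>"
  have "\<exists>n::nat. v \<le> 2 ^ n" using real_arch_pow[of 2 v] less_imp_le by auto
  then obtain n where n: "v \<le> 2 ^ n" "\<And>m. m < n \<Longrightarrow> \<not> v \<le> 2 ^ m" 
    unfolding exists_least_iff[of "\<lambda>n. v \<le> 2 ^ n"] by blast
  have "\<bar>y - x\<bar> \<le> 2 powi (j + int n)"
  proof -
    have "\<bar>y - x\<bar> = v * 2 powi j" by (simp add: v_def abs_mult power_int_minus)
    also have "\<dots> \<le> 2 ^ n * 2 powi j" using n by (intro mult_right_mono) auto
    finally show ?thesis by (simp add: power_int_add mult.commute)
  qed
  then have ind: "y \<in> nbhd (j + int n) (ix (j + int n) x)" unfolding nbhd_def by (auto dest: ix_close)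
  have "4 ^ n \<le> 4 * (1 + v\<^sup>2)"
  proof (cases n)
    case 0 then show ?thesis using zero_le_power2[of v] by simp
  next
    case (Suc m)
    then have "2 ^ m \<le> v" using n(2)[of m] by simp
    then have "(2 ^ m)\<^sup>2 \<le> v\<^sup>2" by (intro power_mono) auto
    moreover have "(2 ^ m)\<^sup>2 = (4::real) ^ m" by (simp add: power2_eq_square power_mult_distrib[symmetric])
    ultimately show ?thesis using Suc by simp
  qed
  then have "1 / (1 + v\<^sup>2) \<le> 4 / 4 ^ n" using zero_le_power2[of v] by (simp add: field_simps add_pos_nonneg)
  then have "2 powi (- j) * (1 / (1 + v\<^sup>2)) \<le> 2 powi (- j) * (4 / 4 ^ n)" by (intro mult_left_mono) auto
  also have "\<dots> = 4 / 2 ^ n * 2 powi (- (j + int n))"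
  proof -
    have "(4::real) ^ n = 2 ^ n * 2 ^ n" by (simp add: power_mult_distrib[symmetric])
    moreover have "2 powi (- (j + int n)) = 2 powi (- j) / (2::real) ^ n"
      by (simp add: power_int_diff)
    ultimately show ?thesis by simp
  qed
  finally have "bump j (y - x) \<le> 4 / 2 ^ n * 2 powi (- (j + int n))" by (simp add: bump_def v_def)
  then have "ennreal (bump j (y - x)) \<le> ennreal (4 / 2 ^ n) * (ennreal (2 powi (- (j + int n))) * indicator (nbhd (j + int n) (ix (j + int n) x)) y)"
    using ind by (simp add: ennreal_mult[symmetric] ennreal_leI)
  also have "\<dots> \<le> (\<Sum>n. ennreal (4 / 2 ^ n) * (ennreal (2 powi (- (j + int n))) * indicator (nbhd (j + int n) (ix (j + int n) x)) y))"
    using sum_le_suminf[of "\<lambda>n. ennreal (4 / 2 ^ n) * (ennreal (2 powi (- (j + int n))) * indicator (nbhd (j + int n) (ix (j + int n) x)) y)" "{n}"] by simp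
  finally show ?thesis .
qed

lemma bump_avg_le_averages:
  assumes [measurable]: "h \<in> borel_measurable borel"
  shows "bump_avg j h x \<le> (\<Sum>n. ennreal (4 / 2 ^ n) * nbhd_avg (j + int n) h x)"
proof -
  have "bump_avg j h x \<le> (\<integral>\<^sup>+ y. h y * (\<Sum>n. ennreal (4 / 2 ^ n) * (ennreal (2 powi (- (j + int n))) * indicator (nbhd (j + int n) (ix (j + int n) x)) y)) \<partial>lborel)"
    unfolding bump_avg_def by (intro nn_integral_mono mult_left_mono bump_le_averages) auto
  also have "\<dots> = (\<integral>\<^sup>+ y. (\<Sum>n. ennreal (4 / 2 ^ n) * (ennreal (2 powi (- (j + int n))) * (h y * indicator (nbhd (j + int n) (ix (j + int n) x)) y))) \<partial>lborel)"
    unfolding ennreal_suminf_cmult[symmetric] by (intro nn_integral_cong suminf_cong) (simp only: mult_ac)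
  also have "\<dots> = (\<Sum>n. ennreal (4 / 2 ^ n) * nbhd_avg (j + int n) h x)"
    unfolding nbhd_avg_def by (subst nn_integral_suminf) (auto simp: nn_integral_cmult)
  finally show ?thesis .
qed

definition bump_avg_const :: "real \<Rightarrow> real \<Rightarrow> real" where
  "bump_avg_const p K = (1 / (1 - 2 powr (-1/2))) powr p * ((4 powr p / (1 - 2 powr (-1/2))) * (3 * (K * 3 powr p)))"

lemma (in Ap) bump_avg_bound:
  assumes [measurable]: "h \<in> borel_measurable borel"
  shows "Lpow p w (bump_avg j h) \<le> ennreal (bump_avg_const p K) * Lpow p w h"
proof -
  \<comment> \<open>half of the available geometric decay \<open>2^(-n)\<close> pays for the sum over \<open>n\<close>\<close>
  define r where "r = (2::real) powr (-1/2)"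
  have r: "0 < r" "r < 1" by (auto simp: r_def intro!: powr_less_one)
  have r2: "r * r = 1 / 2" by (simp add: r_def powr_add[symmetric] powr_minus_divide)
  define c where "c = 1 / (1 - r)"
  have c: "0 < c" using r by (simp add: c_def)
  have geo: "(\<Sum>n. ennreal (r ^ n)) = ennreal c"
    using r by (subst suminf_ennreal2) (auto simp: suminf_geometric summable_geometric c_def)
  have pt: "epowr (bump_avg j h x) p \<le> ennreal (c powr p) * (\<Sum>n. ennreal (4 powr p * r ^ n) * epowr (nbhd_avg (j + int n) h x) p)" for x
  proof -
    have "epowr (bump_avg j h x) p \<le> epowr (\<integral>\<^sup>+ n. ennreal (4 / 2 ^ n) * nbhd_avg (j + int n) h x \<partial>count_space UNIV) p"
      using p by (intro epowr_mono) (auto simp: nn_integral_count_space_nat intro: bump_avg_le_averages)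
    also have "\<dots> \<le> ennreal (c powr p) * (\<integral>\<^sup>+ n. epowr (ennreal ((1 / r) ^ n) * (ennreal (4 / 2 ^ n) * nbhd_avg (j + int n) h x)) p \<partial>count_space UNIV)"
    proof (rule epowr_sum_weighted)
      show "(\<integral>\<^sup>+ n. ennreal (1 / (1 / r) ^ n) \<partial>count_space (UNIV :: nat set)) \<le> ennreal c"
        using geo by (simp add: nn_integral_count_space_nat power_one_over)
    qed (use p r c in auto)
    also have "\<dots> \<le> ennreal (c powr p) * (\<integral>\<^sup>+ n. ennreal (4 powr p * r ^ n) * epowr (nbhd_avg (j + int n) h x) p \<partial>count_space UNIV)"
    proof (intro mult_left_mono nn_integral_mono)
      fix n :: nat
      have e: "(1 / r) ^ n * (4 / 2 ^ n) = 4 * r ^ n"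
      proof -
        have "1 / (2::real) ^ n = r ^ n * r ^ n" 
          by (simp only: power_mult_distrib[symmetric] r2) (simp add: power_one_over)
        moreover have "(1 / r) ^ n * r ^ n = 1" using r by (simp add: power_mult_distrib[symmetric])
        moreover have "(1 / r) ^ n * (4 / 2 ^ n) = 4 * ((1 / r) ^ n * (1 / 2 ^ n))" by simp
        ultimately show ?thesis by (simp only: mult.assoc[symmetric])
      qed
      have "ennreal ((1 / r) ^ n) * (ennreal (4 / 2 ^ n) * nbhd_avg (j + int n) h x) = ennreal (4 * r ^ n) * nbhd_avg (j + int n) h x"
        unfolding e[symmetric] using r by (simp only: mult.assoc[symmetric]) (subst ennreal_mult, auto)
      then have "epowr (ennreal ((1 / r) ^ n) * (ennreal (4 / 2 ^ n) * nbhd_avg (j + int n) h x)) p = ennreal ((4 * r ^ n) powr p) * epowr (nbhd_avg (j + int n) h x) p"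
        using p r by (simp add: epowr_mult)
      also have "(4 * r ^ n) powr p \<le> 4 powr p * r ^ n"
      proof -
        have "(r ^ n) powr p \<le> r ^ n"
          using powr_mono'[of 1 p "r ^ n"] r p by (simp add: power_le_one)
        then show ?thesis using r by (simp add: powr_mult)
      qed
      finally show "epowr (ennreal ((1 / r) ^ n) * (ennreal (4 / 2 ^ n) * nbhd_avg (j + int n) h x)) p \<le> ennreal (4 powr p * r ^ n) * epowr (nbhd_avg (j + int n) h x) p"
        by (simp add: mult_right_mono ennreal_leI)
    qed auto
    finally show ?thesis by (simp add: nn_integral_count_space_nat)
  qed
  have "Lpow p w (bump_avg j h) \<le> (\<integral>\<^sup>+ x. ennreal (c powr p) * (\<Sum>n. ennreal (4 powr p * r ^ n) * epowr (nbhd_avg (j + int n) h x) p) \<partial>wt w)"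
    by (intro nn_integral_mono pt)
  also have "\<dots> = ennreal (c powr p) * (\<Sum>n. ennreal (4 powr p * r ^ n) * Lpow p w (\<lambda>x. nbhd_avg (j + int n) h x))"
    by (simp add: nn_integral_cmult nn_integral_suminf)
  also have "\<dots> \<le> ennreal (c powr p) * (\<Sum>n. ennreal (4 powr p * r ^ n) * (ennreal (3 * (K * 3 powr p)) * Lpow p w h))"
    by (intro mult_left_mono suminf_le nbhd_avg_bound allI) auto
  also have "\<dots> = ennreal (c powr p) * ((ennreal (4 powr p) * ennreal c) * (ennreal (3 * (K * 3 powr p)) * Lpow p w h))"
    using r by (simp add: geo ennreal_mult)
  also have "\<dots> = ennreal (c powr p * ((4 powr p * c) * (3 * (K * 3 powr p)))) * Lpow p w h"
    using c K_pos by (simp add: ennreal_mult mult_ac)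
  finally show ?thesis by (simp add: bump_avg_const_def c_def r_def)
qed

section \<open>Reverse doubling\<close>

abbreviation contraction :: "real \<Rightarrow> real \<Rightarrow> real" where
  "contraction p K \<equiv> max (1/2) (1 - (1/2) powr (p / (p - 1)) / (K powr (1 / (p - 1))))"

text \<open>\<open>contraction\<close> bounds the fraction of the dual weight that sits in one dyadic half of an interval; the maximum keeps it
  positive. \<open>decay\<close> is the resulting gain for the weight itself.\<close>

definition decay :: "real \<Rightarrow> real \<Rightarrow> real" where
  "decay p K = contraction p K powr (p - 1)"

lemma decay_bounds: "1 < p \<Longrightarrow> 0 < K \<Longrightarrow> 0 < decay p K" "1 < p \<Longrightarrow> 0 < K \<Longrightarrow> decay p K < 1"
proof -
  assume pK: "1 < p" "0 < K"
  show "0 < decay p K" by (simp add: decay_def less_max_iff_disj)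
  show "decay p K < 1" unfolding decay_def using pK
    using powr_less_mono2[of "p - 1" "contraction p K" 1] by simp
qed

lemma dyI_parent: "dyI k m \<subseteq> dyI (k + 1) (m div 2)"
  by (auto simp: dyI_def ix_parent)

text \<open>Each passage to a dyadic half loses a fixed fraction of the dual weight, since the discarded half carries one.\<close>

lemma (in Ap) dual_small_descendant:
  assumes "dyI j m \<subseteq> dyI (j + int n) i"
  shows "mass \<sigma> (dyI j m) \<le> ennreal (contraction p K ^ n) * mass \<sigma> (dyI (j + int n) i)"
  using assms
proof (induction n arbitrary: i)
  case 0
  have "m = i"
  proof -
    have "of_int m * 2 powi j \<in> dyI j m" by (simp add: dyI_def ix_corner)
    then show ?thesis using 0 by (auto simp: dyI_def)
  qed
  then show ?case by simp
next
  case (Suc n)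
  interpret D: Ap "p / (p - 1)" "K powr (1 / (p - 1))" \<sigma> using Ap_dual[OF Ap_axioms] .
  define \<eta> where "\<eta> = contraction p K"
  have \<eta>: "0 \<le> \<eta>" by (simp add: \<eta>_def le_max_iff_disj)
  let ?c = "of_int m * (2::real) powi j"
  have c: "?c \<in> dyI j m" by (simp add: dyI_def ix_corner)
  define i' where "i' = ix (j + int n) ?c"
  have sub1: "dyI j m \<subseteq> dyI (j + int n) i'"
  proof
    fix x assume "x \<in> dyI j m"
    then have "ix j x = ix j ?c" using c by (simp add: dyI_def)
    then have "ix (j + int n) x = ix (j + int n) ?c" by (rule ix_coarser[rotated]) simp
    then show "x \<in> dyI (j + int n) i'" by (simp add: dyI_def i'_def)
  qed
  have e1: "j + int (Suc n) = (j + int n) + 1" by simp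
  have sub2: "dyI (j + int n) i' \<subseteq> dyI (j + int (Suc n)) i"
  proof -
    have "ix (j + int (Suc n)) ?c = i" using c Suc.prems by (auto simp: dyI_def)
    then have "i' div 2 = i" unfolding e1 ix_parent i'_def .
    then show ?thesis using dyI_parent[of "j + int n" i'] unfolding e1 by simp
  qed
  have "mass \<sigma> (dyI (j + int n) i') \<le> ennreal (max 0 (1 - (1/2) powr (p / (p - 1)) / (K powr (1 / (p - 1))))) * mass \<sigma> (dyI (j + int (Suc n)) i)"
    by (rule D.small_part) (use sub2 in \<open>auto simp: emeasure_dyI power_int_add\<close>)
  also have "\<dots> \<le> ennreal \<eta> * mass \<sigma> (dyI (j + int (Suc n)) i)"
    by (intro mult_right_mono ennreal_leI) (auto simp: \<eta>_def)
  finally have 1: "mass \<sigma> (dyI (j + int n) i') \<le> ennreal \<eta> * mass \<sigma> (dyI (j + int (Suc n)) i)" .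
  have "mass \<sigma> (dyI j m) \<le> ennreal (\<eta> ^ n) * mass \<sigma> (dyI (j + int n) i')"
    using Suc.IH[OF sub1] by (simp add: \<eta>_def)
  also have "\<dots> \<le> ennreal (\<eta> ^ n) * (ennreal \<eta> * mass \<sigma> (dyI (j + int (Suc n)) i))"
    by (intro mult_left_mono 1) auto
  also have "\<dots> = ennreal (\<eta> ^ Suc n) * mass \<sigma> (dyI (j + int (Suc n)) i)"
    using \<eta> by (simp add: ennreal_mult mult_ac)
  finally show ?case by (simp add: \<eta>_def)
qed

text \<open>The trivial bound for the ratio of the weights of an interval and a descendant is \<open>2^(n p)\<close>; the gain
  \<open>decay^n\<close> comes from the reverse doubling of the dual weight.\<close>

lemma (in Ap) weight_ratio:
  assumes sub: "dyI j m \<subseteq> dyI (j + int n) i"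
  shows "mass w (dyI (j + int n) i) \<le> ennreal (K * (2 ^ n) powr p * decay p K ^ n) * mass w (dyI j m)"
proof -
  define \<eta> where "\<eta> = contraction p K"
  have \<eta>: "0 < \<eta>" by (simp add: \<eta>_def less_max_iff_disj)
  let ?I = "dyI (j + int n) i" and ?J = "dyI j m"
  define L where "L = (2::real) powi j"
  have L: "0 < L" by (simp add: L_def)
  have e: "(2::real) powi (j + int n) = 2 ^ n * L" by (simp add: L_def power_int_add mult.commute)
  define a where "a = of_int i * (2 ^ n * L)"
  have I: "?I \<subseteq> {a..a + 2 ^ n * L}" using dyI_subset_Icc[of "j + int n" i] unfolding e by (simp add: a_def algebra_simps)
  have H: "ennreal (L powr p) \<le> mass w ?J * epowr (mass \<sigma> ?J) (p - 1)"
    using Holder_dual[of ?J "\<lambda>_. 1"] L by (simp add: emeasure_dyI L_def[symmetric])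
  have s: "epowr (mass \<sigma> ?J) (p - 1) \<le> ennreal (decay p K ^ n) * epowr (mass \<sigma> ?I) (p - 1)"
  proof -
    have "epowr (mass \<sigma> ?J) (p - 1) \<le> epowr (ennreal (\<eta> ^ n) * mass \<sigma> ?I) (p - 1)"
      using p dual_small_descendant[OF sub] by (intro epowr_mono) (auto simp: \<eta>_def)
    also have "\<dots> = ennreal ((\<eta> ^ n) powr (p - 1)) * epowr (mass \<sigma> ?I) (p - 1)"
      using p \<eta> by (simp add: epowr_mult)
    also have "(\<eta> ^ n) powr (p - 1) = decay p K ^ n"
      unfolding decay_def \<eta>_def[symmetric] using \<eta> by (simp add: powr_realpow[symmetric] powr_powr mult.commute)
    finally show ?thesis .
  qed
  have WI: "mass w ?I * epowr (mass \<sigma> ?I) (p - 1) \<le> ennreal (K * (2 ^ n * L) powr p)"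
  proof -
    have "mass w ?I * epowr (mass \<sigma> ?I) (p - 1)
       \<le> mass w {a..a + 2 ^ n * L} * epowr (mass \<sigma> {a..a + 2 ^ n * L}) (p - 1)"
      using p I by (intro mult_mono epowr_mono emeasure_mono) auto
    also have "\<dots> \<le> ennreal (K * (2 ^ n * L) powr p)"
      using Ap_bound[of a "a + 2 ^ n * L"] L by simp
    finally show ?thesis .
  qed
  have "ennreal (L powr p) * mass w ?I \<le> (mass w ?J * epowr (mass \<sigma> ?J) (p - 1)) * mass w ?I"
    by (intro mult_right_mono H) auto
  also have "\<dots> \<le> (mass w ?J * (ennreal (decay p K ^ n) * epowr (mass \<sigma> ?I) (p - 1))) * mass w ?I"
    by (intro mult_right_mono mult_left_mono s) auto
  also have "\<dots> = (ennreal (decay p K ^ n) * mass w ?J) * (mass w ?I * epowr (mass \<sigma> ?I) (p - 1))"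
    by (simp add: mult_ac)
  also have "\<dots> \<le> (ennreal (decay p K ^ n) * mass w ?J) * ennreal (K * (2 ^ n * L) powr p)"
    by (intro mult_left_mono WI) auto
  also have "\<dots> = ennreal (L powr p) * (ennreal (K * (2 ^ n) powr p * decay p K ^ n) * mass w ?J)"
  proof -
    have "ennreal (K * (2 ^ n * L) powr p) = ennreal (L powr p) * ennreal (K * (2 ^ n) powr p)"
      using K_pos L by (subst ennreal_mult[symmetric]) (auto simp: powr_mult mult_ac)
    moreover have "ennreal (K * (2 ^ n) powr p * decay p K ^ n) = ennreal (K * (2 ^ n) powr p) * ennreal (decay p K ^ n)"
      using K_pos decay_bounds(1)[OF p K_pos] by (intro ennreal_mult) auto
    ultimately show ?thesis by (simp only: mult_ac)
  qed
  finally show ?thesis using L by (subst (asm) ennreal_mult_le_mult_iff) auto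
qed

section \<open>Dyadic averages of functions with a reproducing kernel\<close>

lemma norm_diff_le_segment_derivative:
  fixes g :: "real \<Rightarrow> complex"
  assumes g: "\<And>x. (g has_vector_derivative g' x) (at x)" and B: "\<And>x. x \<in> closed_segment a b \<Longrightarrow> norm (g' x) \<le> B"
  shows "norm (g a - g b) \<le> B * \<bar>a - b\<bar>"
proof -
  have "norm (g a - g b) \<le> B * norm (a - b)"
  proof (rule differentiable_bound[where S = "closed_segment a b" and f' = "\<lambda>x h. h *\<^sub>R g' x"])
    show "(g has_derivative (\<lambda>h. h *\<^sub>R g' x)) (at x within closed_segment a b)" for x
      using g[of x] unfolding has_vector_derivative_def by (rule has_derivative_at_withinI)
    show "onorm (\<lambda>h. h *\<^sub>R g' x) \<le> B" if "x \<in> closed_segment a b" for x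
    proof (rule onorm_bound)
      show "0 \<le> B" using B[OF that] norm_ge_zero order_trans by blast
      show "norm (h *\<^sub>R g' x) \<le> B * norm h" for h :: real
        using mult_left_mono[OF B[OF that], of "\<bar>h\<bar>"] by (simp add: mult.commute)
    qed
  qed auto
  then show ?thesis by simp
qed

text \<open>The part of the information on a single member of a Littlewood--Paley family that the estimates use. The kernel
  \<open>\<phi>\<close>, its derivative and its primitive \<open>\<Phi>\<close> obey the same bound; the bound \<open>B\<close> makes all integrals
  converge absolutely.\<close>

locale reproducing =
  fixes \<phi> \<phi>' \<Phi> :: "real \<Rightarrow> complex" and C :: real and j :: int and f :: "real \<Rightarrow> complex" and B :: real
  assumes C: "0 < C" and \<phi>_cont: "continuous_on UNIV \<phi>"
    and \<phi>_bound: "\<And>x. norm (\<phi> x) \<le> C / (1 + x\<^sup>2)" and \<phi>'_bound: "\<And>x. norm (\<phi>' x) \<le> C / (1 + x\<^sup>2)"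
    and \<Phi>_bound: "\<And>x. norm (\<Phi> x) \<le> C / (1 + x\<^sup>2)"
    and \<phi>_deriv: "\<And>x. (\<phi> has_vector_derivative \<phi>' x) (at x)"
    and \<Phi>_deriv: "\<And>x. (\<Phi> has_vector_derivative \<phi> x) (at x)"
    and f_cont: "continuous_on UNIV f" and f_bounded: "\<And>x. norm (f x) \<le> B"
    and reproduce: "\<And>x. f x = (LINT y|lborel. f y * (of_real (2 powi (- j)) * \<phi> ((y - x) * 2 powi (- j))))"
begin

abbreviation "P \<equiv> bump_avg j (\<lambda>x. enorm (f x))"
abbreviation "d \<equiv> (2::real) powi (- j)"

lemma f_meas [measurable]: "f \<in> borel_measurable borel"
  using f_cont by (rule borel_measurable_continuous_onI)

lemma \<phi>_meas [measurable]: "\<phi> \<in> borel_measurable borel"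
  using \<phi>_cont by (rule borel_measurable_continuous_onI)

lemma B_nonneg: "0 \<le> B"
  using f_bounded[of 0] norm_ge_zero order_trans by blast

lemma bump_integral: "(\<integral>\<^sup>+ y. ennreal (bump j (y - x)) \<partial>lborel) = (\<integral>\<^sup>+ u. ennreal (1 / (1 + u\<^sup>2)) \<partial>lborel)"
proof -
  have "(\<integral>\<^sup>+ u. ennreal (1 / (1 + u\<^sup>2)) \<partial>lborel) = ennreal \<bar>d\<bar> * (\<integral>\<^sup>+ y. ennreal (1 / (1 + (- (x * d) + d * y)\<^sup>2)) \<partial>lborel)"
    by (rule nn_integral_real_affine) auto
  also have "\<dots> = (\<integral>\<^sup>+ y. ennreal \<bar>d\<bar> * ennreal (1 / (1 + (- (x * d) + d * y)\<^sup>2)) \<partial>lborel)"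
    by (rule nn_integral_cmult[symmetric]) simp
  also have "\<dots> = (\<integral>\<^sup>+ y. ennreal (bump j (y - x)) \<partial>lborel)"
  proof (rule nn_integral_cong)
    fix y
    have "- (x * d) + d * y = (y - x) * d" by (simp add: algebra_simps)
    moreover have "ennreal \<bar>d\<bar> * ennreal (1 / (1 + ((y - x) * d)\<^sup>2)) = ennreal (\<bar>d\<bar> * (1 / (1 + ((y - x) * d)\<^sup>2)))"
      by (rule ennreal_mult[symmetric]) auto
    ultimately show "ennreal \<bar>d\<bar> * ennreal (1 / (1 + (- (x * d) + d * y)\<^sup>2)) = ennreal (bump j (y - x))"
      by (simp add: bump_def)
  qed
  finally show ?thesis by simp
qed

definition "Q = B * enn2real (\<integral>\<^sup>+ u. ennreal (1 / (1 + u\<^sup>2)) \<partial>lborel)"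

lemma Q_nonneg: "0 \<le> Q"
  using B_nonneg by (simp add: Q_def)

lemma P_bounded: "P x \<le> ennreal Q"
proof -
  have fin: "(\<integral>\<^sup>+ u. ennreal (1 / (1 + u\<^sup>2)) \<partial>lborel) < top"
  proof -
    have "(\<integral>\<^sup>+ u. ennreal (norm (1 / (1 + u\<^sup>2) :: real)) \<partial>lborel) < \<infinity>"
      using integrable_inverse_square unfolding integrable_iff_bounded by blast
    then show ?thesis by simp
  qed
  have "P x \<le> (\<integral>\<^sup>+ y. ennreal B * ennreal (bump j (y - x)) \<partial>lborel)"
    unfolding bump_avg_def by (intro nn_integral_mono mult_right_mono ennreal_leI f_bounded) auto
  also have "\<dots> = ennreal B * (\<integral>\<^sup>+ u. ennreal (1 / (1 + u\<^sup>2)) \<partial>lborel)"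
    by (subst nn_integral_cmult) (auto simp: bump_integral)
  also have "\<dots> = ennreal Q" using fin B_nonneg by (simp add: Q_def ennreal_mult)
  finally show ?thesis .
qed

lemma kernel_bound:
  assumes [measurable]: "g \<in> borel_measurable borel" and c: "0 \<le> c" and g: "\<And>y. norm (g y) \<le> c * bump j (y - x)"
  shows "integrable lborel (\<lambda>y. f y * g y)" "enorm (LINT y|lborel. f y * g y) \<le> ennreal c * P x"
proof -
  have le: "(\<integral>\<^sup>+ y. enorm (f y * g y) \<partial>lborel) \<le> ennreal c * P x"
  proof -
    have "(\<integral>\<^sup>+ y. enorm (f y * g y) \<partial>lborel) \<le> (\<integral>\<^sup>+ y. ennreal c * (enorm (f y) * ennreal (bump j (y - x))) \<partial>lborel)"
    proof (rule nn_integral_mono)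
      fix y
      have "enorm (f y * g y) \<le> ennreal (c * (norm (f y) * bump j (y - x)))"
      proof (rule ennreal_leI)
        have "norm (f y * g y) \<le> norm (f y) * (c * bump j (y - x))"
          unfolding norm_mult by (intro mult_left_mono g) auto
        then show "norm (f y * g y) \<le> c * (norm (f y) * bump j (y - x))" by (simp only: mult.left_commute)
      qed
      also have "\<dots> = ennreal c * (enorm (f y) * ennreal (bump j (y - x)))"
        using c bump_pos[of j "y - x"] by (simp add: ennreal_mult)
      finally show "enorm (f y * g y) \<le> ennreal c * (enorm (f y) * ennreal (bump j (y - x)))" .
    qed
    also have "\<dots> = ennreal c * P x" unfolding bump_avg_def by (rule nn_integral_cmult) measurable
    finally show ?thesis .
  qed
  have fin: "(\<integral>\<^sup>+ y. enorm (f y * g y) \<partial>lborel) < \<infinity>"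
  proof -
    have "ennreal c * P x \<le> ennreal c * ennreal Q" by (intro mult_left_mono P_bounded) auto
    also have "\<dots> < \<infinity>" by (simp add: ennreal_mult_less_top)
    finally show ?thesis using le by (rule le_less_trans[rotated])
  qed
  show "integrable lborel (\<lambda>y. f y * g y)" by (rule integrableI_bounded) (use fin in auto)
  then have "enorm (LINT y|lborel. f y * g y) \<le> (\<integral>\<^sup>+ y. enorm (f y * g y) \<partial>lborel)"
    by (rule integral_norm_bound_ennreal)
  with le show "enorm (LINT y|lborel. f y * g y) \<le> ennreal c * P x" by (rule order_trans[rotated])
qed

lemma scaled_bound:
  assumes "\<And>x. norm (g x :: complex) \<le> C / (1 + x\<^sup>2)"
  shows "norm (of_real d * g ((y - x) * d)) \<le> C * bump j (y - x)"
proof -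
  have "norm (of_real d * g ((y - x) * d)) = d * norm (g ((y - x) * d))"
    by (simp add: norm_mult del: of_real_power_int)
  also have "\<dots> \<le> d * (C / (1 + ((y - x) * d)\<^sup>2))" by (intro mult_left_mono assms) auto
  finally show ?thesis by (simp add: bump_def mult.commute)
qed

lemma kernel_integrable: "integrable lborel (\<lambda>y. f y * (of_real d * \<phi> ((y - x) * d)))"
  by (rule kernel_bound(1)[where c = C and x = x]) (use C scaled_bound[OF \<phi>_bound] in auto)

text \<open>The mean value theorem for the kernel; the intermediate point stays within distance \<open>2\<^sup>j\<close> of \<open>x'\<close>, where bumps are
  comparable.\<close>

lemma smooth_difference:
  assumes xx: "\<bar>x - x'\<bar> \<le> 2 powi j"
  shows "enorm (f x - f x') \<le> ennreal (3 * C * \<bar>x - x'\<bar> * d) * P x'"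
proof -
  define g where "g y = complex_of_real d * \<phi> ((y - x) * d) - of_real d * \<phi> ((y - x') * d)" for y
  have [measurable]: "g \<in> borel_measurable borel" unfolding g_def by measurable
  have "f x - f x' = (LINT y|lborel. f y * g y)"
  proof -
    have "f x - f x' = (LINT y|lborel. f y * (of_real d * \<phi> ((y - x) * d)) - f y * (of_real d * \<phi> ((y - x') * d)))"
      by (subst (1 2) reproduce) (rule Bochner_Integration.integral_diff[OF kernel_integrable kernel_integrable, symmetric])
    then show ?thesis by (simp add: g_def right_diff_distrib)
  qed
  moreover have "norm (g y) \<le> (3 * C * \<bar>x - x'\<bar> * d) * bump j (y - x')" for y
  proof -
    define g1 where "g1 u = complex_of_real d * \<phi> ((y - u) * d)" for u
    have der: "(g1 has_vector_derivative - (of_real (d * d) * \<phi>' ((y - u) * d))) (at u)" for u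
    proof -
      have a: "((\<lambda>u. (y - u) * d) has_vector_derivative - d) (at u)"
        by (auto intro!: derivative_eq_intros simp flip: has_real_derivative_iff_has_vector_derivative)
      have "(\<phi> \<circ> (\<lambda>u. (y - u) * d) has_vector_derivative (- d) *\<^sub>R \<phi>' ((y - u) * d)) (at u)"
        by (rule vector_diff_chain_at[OF a \<phi>_deriv])
      then have "((\<lambda>u. complex_of_real d * \<phi> ((y - u) * d)) has_vector_derivative of_real d * ((- d) *\<^sub>R \<phi>' ((y - u) * d))) (at u)"
        unfolding comp_def by (rule has_vector_derivative_mult_right)
      moreover have "of_real d * ((- d) *\<^sub>R \<phi>' ((y - u) * d)) = - (of_real (d * d) * \<phi>' ((y - u) * d))"
        by (simp add: scaleR_conv_of_real)
      ultimately show ?thesis unfolding g1_def[abs_def] by simp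
    qed
    have "norm (g1 x - g1 x') \<le> (3 * C * d * bump j (y - x')) * \<bar>x - x'\<bar>"
    proof (rule norm_diff_le_segment_derivative[OF der])
      fix u assume "u \<in> closed_segment x x'"
      then have "\<bar>u - x'\<bar> \<le> \<bar>x - x'\<bar>" by (auto simp: closed_segment_eq_real_ivl split: if_splits)
      then have u: "\<bar>u - x'\<bar> \<le> 2 powi j" using xx by simp
      have "norm (- (complex_of_real (d * d) * \<phi>' ((y - u) * d))) = d * norm (of_real d * \<phi>' ((y - u) * d))"
        by (simp add: norm_mult del: of_real_power_int)
      also have "\<dots> \<le> d * (C * bump j (y - u))" by (intro mult_left_mono scaled_bound \<phi>'_bound) auto
      also have "\<dots> \<le> d * (C * (3 * bump j (y - x')))" using C by (intro mult_left_mono bump_comparable u) auto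
      finally show "norm (- (complex_of_real (d * d) * \<phi>' ((y - u) * d))) \<le> 3 * C * d * bump j (y - x')" by (simp add: mult_ac)
    qed
    then show ?thesis by (simp add: g_def g1_def mult_ac)
  qed
  ultimately show ?thesis using C by (simp only:) (rule kernel_bound(2), auto)
qed

lemma end_kernel:
  "integrable lborel (\<lambda>y. f y * \<Phi> ((y - x) * d))"
  "enorm (LINT y|lborel. f y * \<Phi> ((y - x) * d)) \<le> ennreal (C * 2 powi j) * P x"
proof -
  have "continuous_on UNIV \<Phi>"
    by (intro continuous_at_imp_continuous_on ballI has_vector_derivative_continuous[OF \<Phi>_deriv])
  then have [measurable]: "\<Phi> \<in> borel_measurable borel" by (rule borel_measurable_continuous_onI)
  have "norm (\<Phi> ((y - x) * d)) \<le> (C * 2 powi j) * bump j (y - x)" for y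
  proof -
    have "(2::real) powi j * d = 1" by (simp add: power_int_minus)
    then have "(C * 2 powi j) * bump j (y - x) = C / (1 + ((y - x) * d)\<^sup>2)" by (simp add: bump_def)
    then show ?thesis using \<Phi>_bound[of "(y - x) * d"] by simp
  qed
  note k = kernel_bound[of "\<lambda>y. \<Phi> ((y - x) * d)" "C * 2 powi j" x, OF _ _ this]
  show "integrable lborel (\<lambda>y. f y * \<Phi> ((y - x) * d))"
     "enorm (LINT y|lborel. f y * \<Phi> ((y - x) * d)) \<le> ennreal (C * 2 powi j) * P x"
    by (rule k; use C in simp)+
qed

text \<open>Since \<open>\<Phi>\<close> is a primitive of \<open>\<phi>\<close>, the integral of \<open>f\<close> over a long interval only sees its end points.\<close>

lemma integral_ends:
  assumes ab: "a \<le> b"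
  shows "enorm (integral {a..b} f) \<le> ennreal (C * 2 powi j) * (P a + P b)"
proof -
  define k where "k x y = f y * (complex_of_real d * \<phi> ((y - x) * d))" for x y
  have [measurable]: "(\<lambda>(x, y). indicator {a..b} x *\<^sub>R k x y) \<in> borel_measurable (lborel \<Otimes>\<^sub>M lborel)"
    unfolding k_def by measurable
  have kle: "(\<integral>\<^sup>+ y. enorm (k x y) \<partial>lborel) \<le> ennreal (C * Q)" for x
  proof -
    have "(\<integral>\<^sup>+ y. enorm (k x y) \<partial>lborel) \<le> (\<integral>\<^sup>+ y. ennreal C * (enorm (f y) * ennreal (bump j (y - x))) \<partial>lborel)"
    proof (rule nn_integral_mono)
      fix y
      have "norm (k x y) \<le> norm (f y) * (C * bump j (y - x))"
        unfolding k_def norm_mult[of "f y"] by (intro mult_left_mono scaled_bound \<phi>_bound) auto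
      then have "enorm (k x y) \<le> ennreal (C * (norm (f y) * bump j (y - x)))"
        by (intro ennreal_leI) (simp only: mult.left_commute)
      then show "enorm (k x y) \<le> ennreal C * (enorm (f y) * ennreal (bump j (y - x)))"
        using C bump_pos[of j "y - x"] by (simp add: ennreal_mult)
    qed
    also have "\<dots> = ennreal C * P x" unfolding bump_avg_def by (rule nn_integral_cmult) measurable
    also have "\<dots> \<le> ennreal C * ennreal Q" by (intro mult_left_mono P_bounded) auto
    finally show ?thesis using C Q_nonneg by (simp add: ennreal_mult)
  qed
  have int: "integrable (lborel \<Otimes>\<^sub>M lborel) (\<lambda>(x, y). indicator {a..b} x *\<^sub>R k x y)"
  proof (rule integrableI_bounded)
    have "(\<integral>\<^sup>+ z. enorm (case z of (x, y) \<Rightarrow> indicator {a..b} x *\<^sub>R k x y) \<partial>(lborel \<Otimes>\<^sub>M lborel))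
       = (\<integral>\<^sup>+ x. \<integral>\<^sup>+ y. enorm (indicator {a..b} x *\<^sub>R k x y) \<partial>lborel \<partial>lborel)"
      by (subst lborel.nn_integral_fst[symmetric]) auto
    also have "\<dots> \<le> (\<integral>\<^sup>+ x\<in>{a..b}. ennreal (C * Q) \<partial>lborel)"
      by (intro nn_integral_mono) (use kle in \<open>auto split: split_indicator\<close>)
    also have "\<dots> = ennreal (C * Q) * emeasure lborel {a..b}" by (rule nn_integral_cmult_indicator) simp
    also have "\<dots> < \<infinity>" using ab by (simp add: ennreal_mult_less_top)
    finally show "(\<integral>\<^sup>+ z. enorm (case z of (x, y) \<Rightarrow> indicator {a..b} x *\<^sub>R k x y) \<partial>(lborel \<Otimes>\<^sub>M lborel)) < \<infinity>" .
  qed simp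
  have "integral {a..b} f = (LINT x:{a..b}|lborel. f x)"
    by (rule set_borel_integral_eq_integral(2)[symmetric], rule borel_integrable_atLeastAtMost')
       (rule continuous_on_subset[OF f_cont], simp)
  also have "\<dots> = (LINT x|lborel. LINT y|lborel. indicator {a..b} x *\<^sub>R k x y)"
    unfolding set_lebesgue_integral_def k_def by (intro Bochner_Integration.integral_cong refl) (simp add: reproduce[symmetric] del: of_real_power_int)
  also have "\<dots> = (LINT y|lborel. LINT x|lborel. indicator {a..b} x *\<^sub>R k x y)"
    by (rule lborel_pair.Fubini_integral[OF int, symmetric])
  also have "\<dots> = (LINT y|lborel. f y * (\<Phi> ((y - a) * d) - \<Phi> ((y - b) * d)))"
  proof (rule Bochner_Integration.integral_cong[OF refl])
    fix y
    have der: "((\<lambda>x. - (f y * \<Phi> ((y - x) * d))) has_vector_derivative k x y) (at x within {a..b})" for x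
    proof -
      have a: "((\<lambda>u. (y - u) * d) has_vector_derivative - d) (at x)"
        by (auto intro!: derivative_eq_intros simp flip: has_real_derivative_iff_has_vector_derivative)
      have "(\<Phi> \<circ> (\<lambda>u. (y - u) * d) has_vector_derivative (- d) *\<^sub>R \<phi> ((y - x) * d)) (at x)"
        by (rule vector_diff_chain_at[OF a \<Phi>_deriv])
      then have "((\<lambda>u. (- f y) * \<Phi> ((y - u) * d)) has_vector_derivative (- f y) * ((- d) *\<^sub>R \<phi> ((y - x) * d))) (at x)"
        unfolding comp_def by (rule has_vector_derivative_mult_right)
      moreover have "(- f y) * ((- d) *\<^sub>R \<phi> ((y - x) * d)) = k x y"
        by (simp add: scaleR_conv_of_real k_def)
      ultimately show ?thesis using has_vector_derivative_at_within by simp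
    qed
    have "(LINT x|lborel. indicator {a..b} x *\<^sub>R k x y) = - (f y * \<Phi> ((y - b) * d)) - - (f y * \<Phi> ((y - a) * d))"
      by (rule integral_FTC_Icc[OF ab der]) (auto simp: k_def intro!: continuous_intros continuous_on_compose2[OF \<phi>_cont])
    then show "(LINT x|lborel. indicator {a..b} x *\<^sub>R k x y) = f y * (\<Phi> ((y - a) * d) - \<Phi> ((y - b) * d))"
      by (simp add: right_diff_distrib)
  qed
  also have "\<dots> = (LINT y|lborel. f y * \<Phi> ((y - a) * d)) - (LINT y|lborel. f y * \<Phi> ((y - b) * d))"
    unfolding right_diff_distrib by (rule Bochner_Integration.integral_diff) (rule end_kernel)+
  finally have "enorm (integral {a..b} f)
     \<le> ennreal (norm (LINT y|lborel. f y * \<Phi> ((y - a) * d)) + norm (LINT y|lborel. f y * \<Phi> ((y - b) * d)))"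
    by (simp only:) (intro ennreal_leI norm_triangle_ineq4)
  also have "\<dots> \<le> ennreal (C * 2 powi j) * P a + ennreal (C * 2 powi j) * P b"
    by (subst ennreal_plus) (auto intro!: add_mono end_kernel)
  finally show ?thesis by (simp add: distrib_left)
qed

end

section \<open>Almost orthogonality of frequency localisation and martingale differences\<close>

definition avg :: "int \<Rightarrow> (real \<Rightarrow> complex) \<Rightarrow> real \<Rightarrow> complex" where
  "avg k f x = (2 powi (- k)) *\<^sub>R integral {of_int (ix k x) * 2 powi k..(of_int (ix k x) + 1) * 2 powi k} f"

definition mdiff :: "int \<Rightarrow> (real \<Rightarrow> complex) \<Rightarrow> real \<Rightarrow> complex" where
  "mdiff k f x = avg k f x - avg (k + 1) f x"

lemma avg_measurable [measurable]: "avg k f \<in> borel_measurable borel"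
proof -
  have "(\<lambda>x. (\<lambda>m. (2 powi (- k)) *\<^sub>R integral {of_int m * 2 powi k..(of_int m + 1) * 2 powi k} f) (ix k x)) \<in> borel_measurable borel"
    by (rule measurable_compose[OF ix_measurable]) simp
  then show ?thesis by (simp add: avg_def[abs_def])
qed

lemma mdiff_measurable [measurable]: "mdiff k f \<in> borel_measurable borel"
  unfolding mdiff_def by measurable

lemma mdiff_haar:
  assumes f: "continuous_on UNIV f" shows "haar k (mdiff k f)"
proof -
  define L where "L = (2::real) powi k"
  have L: "0 < L" "2 powi (- k) = 1 / L" "2 powi (k + 1) = 2 * L" "2 powi (- (k + 1)) = 1 / (2 * L)"
    by (auto simp: L_def power_int_minus power_int_add inverse_eq_divide simp del: minus_add_distrib)
  define A where "A m = (1 / L) *\<^sub>R integral {of_int m * L..(of_int m + 1) * L} f" for m :: int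
  have a: "avg k f x = A (ix k x)" for x by (simp add: avg_def A_def L L_def[symmetric])
  have a1: "avg (k + 1) f x = (1/2) *\<^sub>R (A (2 * ix (k + 1) x) + A (2 * ix (k + 1) x + 1))" for x
  proof -
    define i where "i = real_of_int (ix (k + 1) x)"
    have "integral {i * (2 * L)..(i + 1) * (2 * L)} f = integral {i * (2 * L)..(2 * i + 1) * L} f + integral {(2 * i + 1) * L..(i + 1) * (2 * L)} f"
      by (rule Henstock_Kurzweil_Integration.integral_combine[symmetric])
        (use L in \<open>auto simp: algebra_simps intro!: integrable_continuous_interval continuous_on_subset[OF f]\<close>)
    moreover have "A (2 * ix (k + 1) x) = (1 / L) *\<^sub>R integral {i * (2 * L)..(2 * i + 1) * L} f"
      by (simp add: A_def i_def mult_ac)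
    moreover have "A (2 * ix (k + 1) x + 1) = (1 / L) *\<^sub>R integral {(2 * i + 1) * L..(i + 1) * (2 * L)} f"
    proof -
      have "real_of_int (2 * ix (k + 1) x + 1) = 2 * i + 1" "(2 * i + 1 + 1) * L = (i + 1) * (2 * L)"
        by (simp_all add: i_def algebra_simps)
      then show ?thesis unfolding A_def by (simp only:)
    qed
    ultimately show ?thesis
      unfolding avg_def L(3,4) i_def[symmetric] by (simp add: scaleR_add_right)
  qed
  have "mdiff k f x = (if even (ix k x) then (\<lambda>i. (1/2) *\<^sub>R (A (2 * i) - A (2 * i + 1))) (ix (k + 1) x)
      else - (\<lambda>i. (1/2) *\<^sub>R (A (2 * i) - A (2 * i + 1))) (ix (k + 1) x))" for x
  proof -
    define i where "i = ix (k + 1) x"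
    have "ix k x = 2 * i \<or> ix k x = 2 * i + 1" unfolding i_def ix_parent by presburger
    then show ?thesis
    proof
      assume e: "ix k x = 2 * i"
      then show ?thesis unfolding mdiff_def a a1 i_def[symmetric] e by (simp add: scaleR_conv_of_real field_simps)
    next
      assume e: "ix k x = 2 * i + 1"
      then show ?thesis unfolding mdiff_def a a1 i_def[symmetric] e by (simp add: scaleR_conv_of_real field_simps)
    qed
  qed
  then show ?thesis unfolding haar_def by (intro exI allI)
qed

lemma epowr_add_le:
  assumes "0 < s" shows "epowr (x + y) s \<le> ennreal (2 powr s) * (epowr x s + epowr y s)"
proof -
  have "epowr (x + y) s \<le> epowr (ennreal 2 * max x y) s"
  proof (rule epowr_mono)
    have "x + y \<le> max x y + max x y" by (intro add_mono) auto
    then show "x + y \<le> ennreal 2 * max x y" by (simp add: mult_2)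
  qed (use assms in simp)
  also have "\<dots> = ennreal (2 powr s) * epowr (max x y) s" using assms by (simp add: epowr_mult del: ennreal_numeral)
  also have "\<dots> \<le> ennreal (2 powr s) * (epowr x s + epowr y s)"
    by (intro mult_left_mono) (auto simp: max_def)
  finally show ?thesis .
qed

lemma bump_avg_const_nonneg: "0 \<le> K \<Longrightarrow> 0 \<le> bump_avg_const p K"
proof -
  have "(2::real) powr (-1/2) \<le> 1" using powr_mono[of "-1/2" 0 "2::real"] by simp
  then show "0 \<le> K \<Longrightarrow> 0 \<le> bump_avg_const p K"
    unfolding bump_avg_const_def by (intro mult_nonneg_nonneg divide_nonneg_nonneg) auto
qed

lemma end_children:
  "dyI j (m * 2 ^ n) \<subseteq> dyI (j + int n) m" "dyI j ((m + 1) * 2 ^ n - 1) \<subseteq> dyI (j + int n) m"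
  "x \<in> dyI j (m * 2 ^ n) \<Longrightarrow> \<bar>of_int m * 2 powi (j + int n) - x\<bar> \<le> 2 powi j"
  "x \<in> dyI j ((m + 1) * 2 ^ n - 1) \<Longrightarrow> \<bar>(of_int m + 1) * 2 powi (j + int n) - x\<bar> \<le> 2 powi j"
proof -
  define L where "L = (2::real) powi j"
  define N where "N = (2::real) ^ n"
  have L: "0 < L" and N: "1 \<le> N" by (auto simp: L_def N_def)
  have e: "2 powi (j + int n) = N * L" by (simp add: L_def N_def power_int_add mult.commute)
  have NL: "L \<le> N * L" using L N by simp
  have a: "y \<in> dyI j (m * 2 ^ n) \<longleftrightarrow> of_int m * (N * L) \<le> y \<and> y < of_int m * (N * L) + L" for y
    by (simp add: dyI_eq L_def[symmetric] N_def algebra_simps)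
  have b: "y \<in> dyI j ((m + 1) * 2 ^ n - 1) \<longleftrightarrow> (of_int m + 1) * (N * L) - L \<le> y \<and> y < (of_int m + 1) * (N * L)" for y
    by (simp add: dyI_eq L_def[symmetric] N_def algebra_simps)
  have c: "y \<in> dyI (j + int n) m \<longleftrightarrow> of_int m * (N * L) \<le> y \<and> y < of_int m * (N * L) + N * L" for y
    unfolding dyI_eq e by (simp add: algebra_simps)
  have f: "(of_int m + 1) * (N * L) = of_int m * (N * L) + N * L" by (simp add: algebra_simps)
  show "dyI j (m * 2 ^ n) \<subseteq> dyI (j + int n) m" "dyI j ((m + 1) * 2 ^ n - 1) \<subseteq> dyI (j + int n) m"
    using NL by (auto simp only: subset_iff a b c f)
  show "x \<in> dyI j (m * 2 ^ n) \<Longrightarrow> \<bar>of_int m * 2 powi (j + int n) - x\<bar> \<le> 2 powi j"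
    "x \<in> dyI j ((m + 1) * 2 ^ n - 1) \<Longrightarrow> \<bar>(of_int m + 1) * 2 powi (j + int n) - x\<bar> \<le> 2 powi j"
    unfolding a b e L_def[symmetric] by linarith+
qed

context reproducing begin

lemma avg_small_scale:
  assumes k: "k \<le> j"
  shows "enorm (avg k f x - f x) \<le> ennreal (3 * C * 2 powi (k - j)) * P x"
proof -
  obtain p where p: "P x = ennreal p" "0 \<le> p"
    using P_bounded[of x] by (cases "P x") (auto simp: top_unique)
  define L where "L = (2::real) powi k"
  have L: "0 < L" by (simp add: L_def)
  have Lj: "L \<le> 2 powi j" unfolding L_def using k by (intro power_int_increasing) auto
  define a where "a = of_int (ix k x) * L"
  have I: "{of_int (ix k x) * 2 powi k..(of_int (ix k x) + 1) * 2 powi k} = {a..a + L}"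
    by (simp add: a_def L_def algebra_simps)
  have x: "x \<in> {a..a + L}" using dyI_subset_Icc[of k "ix k x"] unfolding I[symmetric] by (auto simp: dyI_def)
  have pt: "norm (f y - f x) \<le> 3 * C * L * d * p" if "y \<in> {a..a + L}" for y
  proof -
    have yx: "\<bar>y - x\<bar> \<le> L" using that x by auto
    have "enorm (f y - f x) \<le> ennreal (3 * C * \<bar>y - x\<bar> * d) * P x"
      using yx Lj by (intro smooth_difference) simp
    also have "\<dots> = ennreal (3 * C * \<bar>y - x\<bar> * d * p)" using C p by (simp add: ennreal_mult)
    finally have "norm (f y - f x) \<le> 3 * C * \<bar>y - x\<bar> * d * p" using C p by (subst (asm) ennreal_le_iff) auto
    also have "\<dots> \<le> 3 * C * L * d * p" using C p yx by (intro mult_right_mono mult_left_mono) auto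
    finally show ?thesis .
  qed
  have "integral {a..a + L} (\<lambda>y. f y - f x) = integral {a..a + L} f - L *\<^sub>R f x"
    by (subst Henstock_Kurzweil_Integration.integral_diff)
      (use L in \<open>auto intro!: integrable_continuous_interval continuous_on_subset[OF f_cont]\<close>)
  then have e: "avg k f x - f x = (1 / L) *\<^sub>R integral {a..a + L} (\<lambda>y. f y - f x)"
    unfolding avg_def I using L by (simp add: power_int_minus L_def[symmetric] inverse_eq_divide scaleR_diff_right)
  have "norm (integral {a..a + L} (\<lambda>y. f y - f x)) \<le> 3 * C * L * d * p * (a + L - a)"
    by (rule integral_bound) (use L pt in \<open>auto intro!: continuous_intros continuous_on_subset[OF f_cont]\<close>)
  then have "norm (avg k f x - f x) \<le> 3 * C * L * d * p" unfolding e using L by (simp add: field_simps)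
  also have "3 * C * L * d * p = 3 * C * 2 powi (k - j) * p" by (simp add: L_def power_int_diff power_int_minus divide_inverse)
  finally show ?thesis unfolding p(1) using C p by (subst ennreal_mult[symmetric]) (auto intro: ennreal_leI)
qed

lemma avg_large_scale:
  "enorm (avg k f x) \<le> ennreal (C * 2 powi (j - k)) * (P (of_int (ix k x) * 2 powi k) + P ((of_int (ix k x) + 1) * 2 powi k))"
proof -
  define a where "a = of_int (ix k x) * (2::real) powi k"
  define b where "b = (of_int (ix k x) + 1) * (2::real) powi k"
  have "enorm (avg k f x) = ennreal (2 powi (- k)) * enorm (integral {a..b} f)"
    by (simp add: avg_def a_def b_def ennreal_mult)
  also have "\<dots> \<le> ennreal (2 powi (- k)) * (ennreal (C * 2 powi j) * (P a + P b))"
    by (intro mult_left_mono integral_ends) (auto simp: a_def b_def intro: mult_right_mono)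
  also have "\<dots> = ennreal (C * 2 powi (j - k)) * (P a + P b)"
  proof -
    have "ennreal (2 powi (- k)) * ennreal (C * 2 powi j) = ennreal (2 powi (- k) * (C * 2 powi j))"
      using C by (intro ennreal_mult[symmetric]) auto
    also have "2 powi (- k) * (C * 2 powi j) = C * 2 powi (j - k)"
      by (simp add: power_int_diff power_int_minus divide_inverse)
    finally show ?thesis by (simp only: mult.assoc[symmetric])
  qed
  finally show ?thesis by (simp add: a_def b_def)
qed

lemma average_differences_norm:
  assumes "Ap s K W" and k: "k \<le> j"
  shows "Lpow s W (\<lambda>x. enorm (avg k f x - f x))
     \<le> ennreal ((3 * C) powr s * bump_avg_const s K * (2 powi (k - j)) powr s) * Lpow s W (\<lambda>x. enorm (f x))"
proof -
  interpret Ap s K W by fact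
  have Pc: "0 \<le> bump_avg_const s K" using K_pos by (intro bump_avg_const_nonneg) simp
  have "Lpow s W (\<lambda>x. enorm (avg k f x - f x)) \<le> (\<integral>\<^sup>+ x. ennreal ((3 * C * 2 powi (k - j)) powr s) * epowr (P x) s \<partial>wt W)"
  proof (rule nn_integral_mono)
    fix x
    have "epowr (enorm (avg k f x - f x)) s \<le> epowr (ennreal (3 * C * 2 powi (k - j)) * P x) s"
      using p by (intro epowr_mono avg_small_scale k) auto
    also have "\<dots> = ennreal ((3 * C * 2 powi (k - j)) powr s) * epowr (P x) s"
      using p C by (simp add: epowr_mult del: ennreal_mult)
    finally show "epowr (enorm (avg k f x - f x)) s \<le> ennreal ((3 * C * 2 powi (k - j)) powr s) * epowr (P x) s" .
  qed
  also have "\<dots> = ennreal ((3 * C * 2 powi (k - j)) powr s) * Lpow s W P"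
    by (rule nn_integral_cmult) measurable
  also have "\<dots> \<le> ennreal ((3 * C * 2 powi (k - j)) powr s) * (ennreal (bump_avg_const s K) * Lpow s W (\<lambda>x. enorm (f x)))"
    by (intro mult_left_mono bump_avg_bound) auto
  also have "\<dots> = ennreal ((3 * C * 2 powi (k - j)) powr s * bump_avg_const s K) * Lpow s W (\<lambda>x. enorm (f x))"
    using Pc by (simp add: ennreal_mult mult.assoc)
  also have "(3 * C * 2 powi (k - j)) powr s * bump_avg_const s K = (3 * C) powr s * bump_avg_const s K * (2 powi (k - j)) powr s"
    using C by (simp add: powr_mult)
  finally show ?thesis .
qed

text \<open>An end point value of \<open>P\<close> is comparable with \<open>P\<close> on a whole interval of length \<open>2\<^sup>j\<close> at that end, and the weight
  of the large interval is controlled by the weight of this small one.\<close>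

lemma end_value:
  assumes "Ap s K W" and sub: "dyI j m' \<subseteq> dyI (j + int n) m" and e: "\<And>x. x \<in> dyI j m' \<Longrightarrow> \<bar>e - x\<bar> \<le> 2 powi j"
  shows "epowr (P e) s * mass W (dyI (j + int n) m)
     \<le> ennreal (3 powr s * (K * (2 ^ n) powr s * decay s K ^ n)) * (\<integral>\<^sup>+ x\<in>dyI (j + int n) m. epowr (P x) s \<partial>wt W)"
proof -
  interpret Ap s K W by fact
  define R where "R = K * (2 ^ n) powr s * decay s K ^ n"
  have R: "0 \<le> R" using K_pos decay_bounds(1)[OF p K_pos] by (simp add: R_def)
  have "epowr (P e) s * mass W (dyI (j + int n) m) \<le> epowr (P e) s * (ennreal R * mass W (dyI j m'))"
    unfolding R_def by (intro mult_left_mono weight_ratio sub) auto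
  also have "\<dots> = ennreal R * (epowr (P e) s * mass W (dyI j m'))" by (simp add: mult_ac)
  also have "epowr (P e) s * mass W (dyI j m') = (\<integral>\<^sup>+ x\<in>dyI j m'. epowr (P e) s \<partial>wt W)"
    by (rule nn_integral_cmult_indicator[symmetric]) simp
  also have "ennreal R * \<dots> \<le> ennreal R * (\<integral>\<^sup>+ x. ennreal (3 powr s) * (epowr (P x) s * indicator (dyI (j + int n) m) x) \<partial>wt W)"
  proof (intro mult_left_mono nn_integral_mono)
    fix x
    show "epowr (P e) s * indicator (dyI j m') x \<le> ennreal (3 powr s) * (epowr (P x) s * indicator (dyI (j + int n) m) x)"
    proof (cases "x \<in> dyI j m'")
      case True
      have "epowr (P e) s \<le> epowr (ennreal 3 * P x) s"
        using bump_avg_comparable[OF e[OF True], of "\<lambda>x. enorm (f x)"] p by (intro epowr_mono) auto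
      also have "\<dots> = ennreal (3 powr s) * epowr (P x) s" using p by (simp add: epowr_mult del: ennreal_numeral)
      finally show ?thesis using True sub by auto
    qed simp
  qed auto
  also have "\<dots> = ennreal R * (ennreal (3 powr s) * (\<integral>\<^sup>+ x\<in>dyI (j + int n) m. epowr (P x) s \<partial>wt W))"
    by (subst nn_integral_cmult) auto
  also have "\<dots> = ennreal (3 powr s * R) * (\<integral>\<^sup>+ x\<in>dyI (j + int n) m. epowr (P x) s \<partial>wt W)"
    using R by (simp add: ennreal_mult mult_ac)
  finally show ?thesis by (simp add: R_def)
qed

text \<open>The primitive of the kernel gains \<open>2^(-n)\<close> pointwise, hence \<open>2^(-n s)\<close> in the power of the norm; concentrating the norm
  of an end point value on a short interval costs \<open>2^(n s)\<close> times the decay from reverse doubling.\<close>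

lemma average_norm:
  assumes "Ap s K W"
  shows "Lpow s W (\<lambda>x. enorm (avg (j + int n) f x))
     \<le> ennreal (2 * (6 * C) powr s * K * bump_avg_const s K * decay s K ^ n) * Lpow s W (\<lambda>x. enorm (f x))"
proof -
  interpret Ap s K W by fact
  define k where "k = j + int n"
  define c where "c = (2 * (C * 2 powi (- int n))) powr s"
  have c: "0 \<le> c" by (simp add: c_def)
  define R where "R = 3 powr s * (K * (2 ^ n) powr s * decay s K ^ n)"
  have dec: "0 < decay s K" by (rule decay_bounds(1)[OF p K_pos])
  have R: "0 \<le> R" using K_pos dec by (simp add: R_def)
  have Pc: "0 \<le> bump_avg_const s K" using K_pos by (intro bump_avg_const_nonneg) simp
  let ?a = "\<lambda>m::int. of_int m * (2::real) powi k" and ?b = "\<lambda>m::int. (of_int m + 1) * (2::real) powi k"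
  have piece: "(\<integral>\<^sup>+ x\<in>dyI k m. epowr (enorm (avg k f x)) s \<partial>wt W)
     \<le> ennreal (2 * c * R) * (\<integral>\<^sup>+ x\<in>dyI k m. epowr (P x) s \<partial>wt W)" for m
  proof -
    have "(\<integral>\<^sup>+ x\<in>dyI k m. epowr (enorm (avg k f x)) s \<partial>wt W)
      \<le> (\<integral>\<^sup>+ x\<in>dyI k m. ennreal c * (epowr (P (?a m)) s + epowr (P (?b m)) s) \<partial>wt W)"
    proof (rule nn_integral_mono)
      fix x
      show "epowr (enorm (avg k f x)) s * indicator (dyI k m) x \<le> ennreal c * (epowr (P (?a m)) s + epowr (P (?b m)) s) * indicator (dyI k m) x"
      proof (cases "x \<in> dyI k m")
        case True
        then have m: "ix k x = m" by (simp add: dyI_def)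
        have "epowr (enorm (avg k f x)) s \<le> epowr (ennreal (C * 2 powi (j - k)) * (P (?a m) + P (?b m))) s"
          using avg_large_scale[of k x] p unfolding m by (intro epowr_mono) auto
        also have "\<dots> = ennreal ((C * 2 powi (j - k)) powr s) * epowr (P (?a m) + P (?b m)) s"
          using p C by (simp add: epowr_mult)
        also have "\<dots> \<le> ennreal ((C * 2 powi (j - k)) powr s) * (ennreal (2 powr s) * (epowr (P (?a m)) s + epowr (P (?b m)) s))"
          using p by (intro mult_left_mono epowr_add_le) auto
        also have "\<dots> = ennreal ((C * 2 powi (j - k)) powr s * 2 powr s) * (epowr (P (?a m)) s + epowr (P (?b m)) s)"
          by (simp add: ennreal_mult mult.assoc)
        also have "(C * 2 powi (j - k)) powr s * 2 powr s = c"
          using C by (simp add: c_def k_def powr_mult[symmetric] mult_ac)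
        finally show ?thesis using True by simp
      qed simp
    qed
    also have "\<dots> = ennreal c * (epowr (P (?a m)) s + epowr (P (?b m)) s) * mass W (dyI k m)"
      by (rule nn_integral_cmult_indicator) simp
    also have "\<dots> = ennreal c * (epowr (P (?a m)) s * mass W (dyI k m) + epowr (P (?b m)) s * mass W (dyI k m))"
      by (simp only: distrib_right mult.assoc)
    also have "\<dots> \<le> ennreal c * (ennreal R * (\<integral>\<^sup>+ x\<in>dyI k m. epowr (P x) s \<partial>wt W) + ennreal R * (\<integral>\<^sup>+ x\<in>dyI k m. epowr (P x) s \<partial>wt W))"
      unfolding R_def k_def by (intro mult_left_mono add_mono end_value[OF assms end_children(1)] end_value[OF assms end_children(2)] end_children(3,4)) auto
    also have "\<dots> = ennreal (2 * c * R) * (\<integral>\<^sup>+ x\<in>dyI k m. epowr (P x) s \<partial>wt W)"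
      using c R by (simp add: ennreal_mult mult_2[symmetric] mult_ac)
    finally show ?thesis .
  qed
  have "Lpow s W (\<lambda>x. enorm (avg k f x)) = sumZ (\<lambda>m. \<integral>\<^sup>+ x. epowr (enorm (avg k f x)) s * indicator (dyI k m) x \<partial>wt W)"
    by (rule nn_integral_dyadic) auto
  also have "\<dots> \<le> sumZ (\<lambda>m. ennreal (2 * c * R) * (\<integral>\<^sup>+ x\<in>dyI k m. epowr (P x) s \<partial>wt W))"
    by (intro sumZ_mono piece)
  also have "\<dots> = ennreal (2 * c * R) * sumZ (\<lambda>m. \<integral>\<^sup>+ x. epowr (P x) s * indicator (dyI k m) x \<partial>wt W)"
    by (rule nn_integral_cmult) simp
  also have "sumZ (\<lambda>m. \<integral>\<^sup>+ x. epowr (P x) s * indicator (dyI k m) x \<partial>wt W) = Lpow s W P"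
    by (rule nn_integral_dyadic[symmetric]) auto
  also have "ennreal (2 * c * R) * \<dots> \<le> ennreal (2 * c * R) * (ennreal (bump_avg_const s K) * Lpow s W (\<lambda>x. enorm (f x)))"
    by (intro mult_left_mono bump_avg_bound) auto
  also have "\<dots> = ennreal (2 * c * R * bump_avg_const s K) * Lpow s W (\<lambda>x. enorm (f x))"
    using c R Pc by (simp add: ennreal_mult mult.assoc)
  also have "2 * c * R * bump_avg_const s K = 2 * (6 * C) powr s * K * bump_avg_const s K * decay s K ^ n"
  proof -
    have "c * 3 powr s * (2 ^ n) powr s = (6 * C) powr s"
    proof -
      have "2 * (C * 2 powi (- int n)) * 3 * 2 ^ n = 6 * C" by (simp add: power_int_minus)
      moreover have "c * 3 powr s * (2 ^ n) powr s = (2 * (C * 2 powi (- int n)) * 3 * 2 ^ n) powr s"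
        using C by (simp add: c_def powr_mult[symmetric])
      ultimately show ?thesis by (simp only:)
    qed
    moreover have "2 * c * R * bump_avg_const s K = 2 * (c * 3 powr s * (2 ^ n) powr s) * K * bump_avg_const s K * decay s K ^ n"
      by (simp add: R_def)
    ultimately show ?thesis by (simp only:)
  qed
  finally show ?thesis by (simp add: k_def)
qed

text \<open>Decay in the distance of the two scales: for fine differences it comes from the smoothness of \<open>f\<close>, as
  \<open>D\<^sub>k f = (E\<^sub>k f - f) - (E\<^sub>k\<^sub>+\<^sub>1 f - f)\<close>; for coarse ones from the smallness of \<open>E\<^sub>k f\<close> and \<open>E\<^sub>k\<^sub>+\<^sub>1 f\<close> separately.\<close>

lemma mdiff_norm:
  assumes "Ap s K W" and rho: "\<rho> = max (decay s K) (1/2)"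
    and M: "M = 6 * 2 powr s * ((6 * C) powr s * bump_avg_const s K * (K + 1))"
  shows "Lpow s W (\<lambda>x. enorm (mdiff (j + i) f x))
     \<le> ennreal (M * \<rho> ^ nat \<bar>i\<bar>) * Lpow s W (\<lambda>x. enorm (f x))"
proof -
  interpret Ap s K W by fact
  define X where "X = Lpow s W (\<lambda>x. enorm (f x))"
  define c where "c = (6 * C) powr s * bump_avg_const s K * (K + 1)"
  have Pc: "0 \<le> bump_avg_const s K" using K_pos by (intro bump_avg_const_nonneg) simp
  have dec: "0 < decay s K" "decay s K < 1" by (rule decay_bounds[OF p K_pos])+
  have rr: "0 < \<rho>" "\<rho> < 1" "1 / 2 \<le> \<rho>" "decay s K \<le> \<rho>" using dec by (auto simp: rho)
  have c0: "0 \<le> c" using Pc K_pos by (simp add: c_def)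
  \<comment> \<open>both ranges of scales in one shape, so that they can be combined below\<close>
  have coarse: "Lpow s W (\<lambda>x. enorm (avg (j + int n) f x)) \<le> ennreal (2 * c * \<rho> ^ n) * X" for n
  proof -
    have "2 * (6 * C) powr s * K * bump_avg_const s K * decay s K ^ n \<le> 2 * c * \<rho> ^ n"
    proof (rule mult_mono)
      have "(6 * C) powr s * bump_avg_const s K * K \<le> c" unfolding c_def by (intro mult_left_mono) (use Pc in auto)
      then show "2 * (6 * C) powr s * K * bump_avg_const s K \<le> 2 * c" by (simp add: mult_ac)
      show "decay s K ^ n \<le> \<rho> ^ n" using rr dec by (intro power_mono) auto
    qed (use c0 dec in auto)
    then show ?thesis
      unfolding X_def by (intro order_trans[OF average_norm[OF assms(1)]] mult_right_mono ennreal_leI) auto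
  qed
  have fine: "Lpow s W (\<lambda>x. enorm (avg (j - int n) f x - f x)) \<le> ennreal (2 * c * \<rho> ^ n) * X" for n
  proof -
    have "(3 * C) powr s * bump_avg_const s K * (2 powi (j - int n - j)) powr s \<le> 2 * c * \<rho> ^ n"
    proof (rule mult_mono)
      have "(3 * C) powr s \<le> (6 * C) powr s" using C p by (intro powr_mono2) auto
      then have "(3 * C) powr s * bump_avg_const s K * 1 \<le> c" unfolding c_def using K_pos Pc by (intro mult_mono) auto
      then show "(3 * C) powr s * bump_avg_const s K \<le> 2 * c" using c0 by simp
      have "(2 powi (j - int n - j)) powr s = ((1/2::real) ^ n) powr s" by (simp add: power_int_minus power_one_over inverse_eq_divide)
      also have "\<dots> \<le> ((1/2) ^ n) powr 1" using p by (intro powr_mono') (auto simp: power_le_one)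
      also have "\<dots> = (1/2) ^ n" by simp
      also have "\<dots> \<le> \<rho> ^ n" using rr by (intro power_mono) auto
      finally show "(2 powi (j - int n - j)) powr s \<le> \<rho> ^ n" .
    qed (use c0 in auto)
    then show ?thesis
      unfolding X_def by (intro order_trans[OF average_differences_norm[OF assms(1)]] mult_right_mono ennreal_leI) auto
  qed
  have comb: "Lpow s W (\<lambda>x. enorm (g x - h x)) \<le> ennreal (M * \<rho> ^ n) * X"
    if [measurable]: "g \<in> borel_measurable borel" "h \<in> borel_measurable borel"
    and g: "Lpow s W (\<lambda>x. enorm (g x)) \<le> ennreal (2 * c * \<rho> ^ a) * X"
    and h: "Lpow s W (\<lambda>x. enorm (h x)) \<le> ennreal (2 * c * \<rho> ^ b) * X"
    and ab: "\<rho> ^ a + \<rho> ^ b \<le> 3 * \<rho> ^ n" for g h :: "real \<Rightarrow> complex" and a b n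
  proof -
    have "Lpow s W (\<lambda>x. enorm (g x - h x))
       \<le> (\<integral>\<^sup>+ x. ennreal (2 powr s) * (epowr (enorm (g x)) s + epowr (enorm (h x)) s) \<partial>wt W)"
    proof (rule nn_integral_mono)
      fix x
      have "epowr (enorm (g x - h x)) s \<le> epowr (enorm (g x) + enorm (h x)) s"
        using p norm_triangle_ineq4[of "g x" "h x"]
        by (intro epowr_mono) (auto simp: ennreal_plus[symmetric] simp del: ennreal_plus intro: ennreal_leI)
      also have "\<dots> \<le> ennreal (2 powr s) * (epowr (enorm (g x)) s + epowr (enorm (h x)) s)"
        using p by (intro epowr_add_le) auto
      finally show "epowr (enorm (g x - h x)) s \<le> ennreal (2 powr s) * (epowr (enorm (g x)) s + epowr (enorm (h x)) s)" .
    qed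
    also have "\<dots> = ennreal (2 powr s) * (Lpow s W (\<lambda>x. enorm (g x)) + Lpow s W (\<lambda>x. enorm (h x)))"
      
      by (subst nn_integral_cmult, measurable) (subst nn_integral_add, auto simp del: epowr_ennreal)
    also have "\<dots> \<le> ennreal (2 powr s) * (ennreal (2 * c * \<rho> ^ a) * X + ennreal (2 * c * \<rho> ^ b) * X)"
      by (intro mult_left_mono add_mono g h) auto
    also have "\<dots> = ennreal (2 powr s * (2 * c * \<rho> ^ a + 2 * c * \<rho> ^ b)) * X"
      using c0 rr by (simp add: ennreal_mult distrib_right mult.assoc)
    also have "\<dots> \<le> ennreal (M * \<rho> ^ n) * X"
    proof (intro mult_right_mono ennreal_leI)
      have "2 powr s * (2 * c * \<rho> ^ a + 2 * c * \<rho> ^ b) = (2 * 2 powr s * c) * (\<rho> ^ a + \<rho> ^ b)" by (simp add: algebra_simps)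
      also have "\<dots> \<le> (2 * 2 powr s * c) * (3 * \<rho> ^ n)" using c0 by (intro mult_left_mono ab) auto
      also have "\<dots> = M * \<rho> ^ n" by (simp add: M c_def)
      finally show "2 powr s * (2 * c * \<rho> ^ a + 2 * c * \<rho> ^ b) \<le> M * \<rho> ^ n" .
    qed auto
    finally show ?thesis .
  qed
  show ?thesis
  proof (cases "0 \<le> i")
    case True
    define n where "n = nat i"
    have i: "i = int n" using True by (simp add: n_def)
    have "\<rho> ^ Suc n \<le> \<rho> ^ n" using rr by (intro power_decreasing) auto
    then have ab: "\<rho> ^ n + \<rho> ^ Suc n \<le> 3 * \<rho> ^ n" using zero_le_power[of \<rho> n] rr by linarith
    have "Lpow s W (\<lambda>x. enorm (avg (j + int n) f x - avg (j + int (Suc n)) f x)) \<le> ennreal (M * \<rho> ^ n) * X"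
      by (rule comb[OF _ _ coarse coarse ab]) auto
    then show ?thesis by (simp add: mdiff_def[abs_def] i X_def add_ac)
  next
    case False
    define n where "n = nat (- i - 1)"
    have i: "i = - int (Suc n)" "nat \<bar>i\<bar> = Suc n" using False by (auto simp: n_def)
    have "\<rho> ^ n * (1 / 2) \<le> \<rho> ^ n * \<rho>" using rr by (intro mult_left_mono) auto
    then have ab: "\<rho> ^ Suc n + \<rho> ^ n \<le> 3 * \<rho> ^ Suc n" by (simp add: mult.commute)
    have "Lpow s W (\<lambda>x. enorm ((avg (j - int (Suc n)) f x - f x) - (avg (j - int n) f x - f x))) \<le> ennreal (M * \<rho> ^ Suc n) * X"
      by (rule comb[OF _ _ fine fine ab]) auto
    moreover have "mdiff (j + i) f x = (avg (j - int (Suc n)) f x - f x) - (avg (j - int n) f x - f x)" for x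
    proof -
      have "j + i = j - int (Suc n)" "j + i + 1 = j - int n" using i(1) by auto
      then show ?thesis unfolding mdiff_def by (simp only:) simp
    qed
    ultimately show ?thesis unfolding i(2) X_def by (simp only:)
  qed
qed

lemma mdiff_telescope: "(\<Sum>i = - int N..int N. mdiff (j + i) f x) = avg (j - int N) f x - avg (j + int N + 1) f x"
proof -
  have "(\<Sum>i = a..a + int n. mdiff (j + i) f x) = avg (j + a) f x - avg (j + a + int n + 1) f x" for a n
  proof (induction n)
    case 0 show ?case by (simp add: mdiff_def)
  next
    case (Suc n)
    have "{a..a + int (Suc n)} = insert (a + int n + 1) {a..a + int n}" by auto
    then show ?case using Suc by (simp add: mdiff_def add_ac)
  qed
  from this[of "- int N" "2 * N"] show ?thesis by (simp add: add_ac)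
qed

lemma mdiff_expansion: "(\<lambda>N. f x - (\<Sum>i = - int N..int N. mdiff (j + i) f x)) \<longlonglongrightarrow> 0"
proof (rule Lim_null_comparison)
  have h: "(\<lambda>N. (1 / 2) ^ N) \<longlonglongrightarrow> (0::real)" by (rule LIMSEQ_power_zero) simp
  show "(\<lambda>N. 5 * C * Q * (1 / 2) ^ N) \<longlonglongrightarrow> 0" using tendsto_mult[OF tendsto_const[of "5 * C * Q"] h] by simp
  show "\<forall>\<^sub>F N in sequentially. norm (f x - (\<Sum>i = - int N..int N. mdiff (j + i) f x)) \<le> 5 * C * Q * (1 / 2) ^ N"
  proof (intro always_eventually allI)
    fix N
    have "enorm (avg (j - int N) f x - f x) \<le> ennreal (3 * C * 2 powi (j - int N - j)) * ennreal Q"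
      by (intro order_trans[OF avg_small_scale] mult_left_mono P_bounded) auto
    also have "\<dots> = ennreal (3 * C * 2 powi (j - int N - j) * Q)" using C Q_nonneg by (intro ennreal_mult[symmetric]) auto
    also have "3 * C * 2 powi (j - int N - j) * Q = 3 * C * Q * (1 / 2) ^ N" by (simp add: power_int_minus power_one_over inverse_eq_divide)
    finally have 1: "norm (avg (j - int N) f x - f x) \<le> 3 * C * Q * (1 / 2) ^ N"
      using C Q_nonneg by (subst (asm) ennreal_le_iff) auto
    have "enorm (avg (j + int N + 1) f x) \<le> ennreal (C * 2 powi (j - (j + int N + 1))) * (ennreal Q + ennreal Q)"
      by (intro order_trans[OF avg_large_scale] mult_left_mono add_mono P_bounded) auto
    also have "\<dots> = ennreal (C * 2 powi (j - (j + int N + 1)) * (Q + Q))"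
      using C Q_nonneg by (simp only: ennreal_plus[symmetric]) (intro ennreal_mult[symmetric], auto)
    also have "C * 2 powi (j - (j + int N + 1)) * (Q + Q) = C * Q * (1 / 2) ^ N"
    proof -
      have "j - (j + int N + 1) = - int (Suc N)" by simp
      then have "(2::real) powi (j - (j + int N + 1)) = (1 / 2) ^ Suc N" by (simp only: power_int_minus power_int_of_nat) (simp add: power_one_over inverse_eq_divide)
      then show ?thesis by (simp only:) simp
    qed
    finally have 2: "norm (avg (j + int N + 1) f x) \<le> C * Q * (1 / 2) ^ N"
      using C Q_nonneg by (subst (asm) ennreal_le_iff) auto
    have "norm (f x - (avg (j - int N) f x - avg (j + int N + 1) f x)) = norm (avg (j + int N + 1) f x - (avg (j - int N) f x - f x))"
      by (simp add: algebra_simps)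
    also have "\<dots> \<le> norm (avg (j + int N + 1) f x) + norm (avg (j - int N) f x - f x)" by (rule norm_triangle_ineq4)
    also have "\<dots> \<le> C * Q * (1 / 2) ^ N + 3 * C * Q * (1 / 2) ^ N" by (intro add_mono 1 2)
    also have "\<dots> \<le> 5 * C * Q * (1 / 2) ^ N" using C Q_nonneg by (simp add: algebra_simps)
    finally show "norm (f x - (\<Sum>i = - int N..int N. mdiff (j + i) f x)) \<le> 5 * C * Q * (1 / 2) ^ N"
      by (simp add: mdiff_telescope)
  qed
qed

end

section \<open>Variation of Littlewood--Paley families\<close>

lemma sumZ_geometric:
  assumes t: "0 < t" "t < 1"
  shows "sumZ (\<lambda>i. ennreal (t ^ nat \<bar>i\<bar>)) \<le> ennreal (2 / (1 - t))"
proof -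
  have geo: "(\<Sum>n. ennreal (t ^ n)) = ennreal (1 / (1 - t))"
    using t by (subst suminf_ennreal2) (auto simp: suminf_geometric summable_geometric)
  let ?F = "\<lambda>i::int. ennreal (t ^ nat \<bar>i\<bar>)"
  have "sumZ ?F \<le> sumZ (\<lambda>i. ?F i * indicator {i. 1 * i \<le> 0} i + ?F i * indicator {i. (-1) * i \<le> 0} i)"
    by (rule sumZ_mono) (auto split: split_indicator)
  also have "\<dots> = sumZ (\<lambda>i. ?F i * indicator {i. 1 * i \<le> 0} i) + sumZ (\<lambda>i. ?F i * indicator {i. (-1) * i \<le> 0} i)"
    by (rule nn_integral_add) auto
  also have "\<dots> = (\<Sum>n. ?F (1 * (0 - int n))) + (\<Sum>n. ?F ((-1) * (0 - int n)))"
    by (subst (1 2) sumZ_half_line) auto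
  also have "\<dots> = ennreal (1 / (1 - t)) + ennreal (1 / (1 - t))" by (simp add: geo)
  also have "\<dots> = ennreal (2 / (1 - t))" using t by (simp add: ennreal_plus[symmetric] del: ennreal_plus)
  finally show ?thesis .
qed

lemma bvar_shift: "bvar r (\<lambda>j. c (j + i)) = bvar r c"
proof -
  have le: "bvar r (\<lambda>j. c (j + i)) \<le> bvar r c" for c :: "int \<Rightarrow> complex" and i
  proof (rule bvar_least)
    fix K n assume n: "mono (n :: nat \<Rightarrow> int)"
    have "blocks (\<lambda>j. c (j + i)) n k = blocks c (\<lambda>k. n k + i) k" for k
      unfolding blocks_def by (rule sum.reindex_bij_witness[of _ "\<lambda>j. j - i" "\<lambda>j. j + i"]) auto
    moreover have "mono (\<lambda>k. n k + i)" using n by (auto simp: mono_def)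
    ultimately show "ennreal (pvar r (\<lambda>j. c (j + i)) n K powr (1 / r)) \<le> bvar r c"
      using bvar_upper[where n = "\<lambda>k. n k + i" and c = c and K = K and r = r] by simp
  qed
  show ?thesis
  proof (rule antisym[OF le])
    show "bvar r c \<le> bvar r (\<lambda>j. c (j + i))" using le[of "\<lambda>j. c (j + i)" "- i"] by simp
  qed
qed

lemma bvar_sum:
  assumes r: "1 \<le> r" and fin: "finite I"
  shows "bvar r (\<lambda>j. \<Sum>i\<in>I. c i j) \<le> (\<Sum>i\<in>I. bvar r (c i))"
  using fin
proof (induction I)
  case empty then show ?case using bvar_zero[OF r] by simp
next
  case (insert i I)
  have "bvar r (\<lambda>j. \<Sum>i\<in>insert i I. c i j) = bvar r (\<lambda>j. c i j + (\<Sum>i\<in>I. c i j))" using insert by simp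
  also have "\<dots> \<le> bvar r (c i) + bvar r (\<lambda>j. \<Sum>i\<in>I. c i j)" by (rule bvar_add[OF r])
  also have "\<dots> \<le> bvar r (c i) + (\<Sum>i\<in>I. bvar r (c i))" by (intro add_left_mono insert.IH)
  finally show ?case using insert by simp
qed

abbreviation window :: "int \<Rightarrow> (int \<Rightarrow> complex) \<Rightarrow> int \<Rightarrow> complex" where
  "window J c \<equiv> (\<lambda>j. if - J \<le> j \<and> j \<le> J then c j else 0)"

text \<open>Windows make the remainder of the partial sums a finite sum over \<open>j\<close>, which tends to zero although the convergence need
  not be uniform in \<open>j\<close>.\<close>

lemma bvar_expansion:
  fixes c :: "int \<Rightarrow> complex"
  assumes r: "1 \<le> r" and conv: "\<And>j. (\<lambda>N. c j - (\<Sum>i = - int N..int N. e i j)) \<longlonglongrightarrow> 0"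
  shows "bvar r (window J c) \<le> sumZ (\<lambda>i. bvar r (window J (\<lambda>j. e i j)))"
    (is "?L \<le> ?S")
proof -
  let ?I = "\<lambda>N. {- int N..int N}"
  have le: "?L \<le> ?S + ennreal (\<Sum>j\<in>{- J..J}. norm (c j - (\<Sum>i\<in>?I N. e i j)))" for N
  proof -
    have "?L = bvar r (\<lambda>j. (\<Sum>i\<in>?I N. if - J \<le> j \<and> j \<le> J then e i j else 0)
        + (if j \<in> {- J..J} then c j - (\<Sum>i\<in>?I N. e i j) else 0))"
      by (intro arg_cong[where f = "bvar r"] ext) auto
    also have "\<dots> \<le> bvar r (\<lambda>j. \<Sum>i\<in>?I N. if - J \<le> j \<and> j \<le> J then e i j else 0)
        + bvar r (\<lambda>j. if j \<in> {- J..J} then c j - (\<Sum>i\<in>?I N. e i j) else 0)"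
      by (rule bvar_add[OF r])
    also have "\<dots> \<le> (\<Sum>i\<in>?I N. bvar r (window J (\<lambda>j. e i j)))
        + (\<Sum>j\<in>{- J..J}. enorm (c j - (\<Sum>i\<in>?I N. e i j)))"
      by (intro add_mono bvar_sum bvar_le_sum r) auto
    also have "(\<Sum>i\<in>?I N. bvar r (window J (\<lambda>j. e i j))) \<le> ?S"
    proof -
      have "(\<Sum>i\<in>?I N. bvar r (window J (\<lambda>j. e i j)))
         = (\<integral>\<^sup>+ i. bvar r (window J (\<lambda>j. e i j)) * indicator (?I N) i \<partial>count_space UNIV)"
        by (subst nn_integral_count_space'[of "?I N"]) (auto split: split_indicator)
      also have "\<dots> \<le> ?S" by (rule sumZ_mono) (auto split: split_indicator)
      finally show ?thesis .
    qed
    also have "(\<Sum>j\<in>{- J..J}. enorm (c j - (\<Sum>i\<in>?I N. e i j))) = ennreal (\<Sum>j\<in>{- J..J}. norm (c j - (\<Sum>i\<in>?I N. e i j)))"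
      by (rule sum_ennreal) simp
    finally show ?thesis by (simp add: add_right_mono)
  qed
  have "(\<lambda>N. \<Sum>j\<in>{- J..J}. norm (c j - (\<Sum>i\<in>?I N. e i j))) \<longlonglongrightarrow> (\<Sum>j\<in>{- J..J}. norm (0::complex))"
    by (intro tendsto_sum tendsto_norm conv)
  then have "(\<lambda>N. ennreal (\<Sum>j\<in>{- J..J}. norm (c j - (\<Sum>i\<in>?I N. e i j)))) \<longlonglongrightarrow> ennreal 0"
    by (intro tendsto_ennrealI) simp
  then have "(\<lambda>N. ?S + ennreal (\<Sum>j\<in>{- J..J}. norm (c j - (\<Sum>i\<in>?I N. e i j)))) \<longlonglongrightarrow> ?S + ennreal 0"
    by (intro tendsto_add tendsto_const)
  then have "?L \<le> ?S + ennreal 0" by (rule LIMSEQ_le_const) (use le in auto)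
  then show ?thesis by simp
qed

lemma bvar_windows:
  "bvar r c \<le> (SUP J::nat. bvar r (window (int J) c))"
proof (rule bvar_least)
  fix K n assume n: "mono (n :: nat \<Rightarrow> int)"
  define J where "J = nat (max \<bar>n 0\<bar> \<bar>n K\<bar>)"
  have "blocks (window (int J) c) n k = blocks c n k" if "k < K" for k
  proof -
    have "n 0 \<le> n k" "n (Suc k) \<le> n K" using n that by (auto simp: mono_def)
    then show ?thesis unfolding blocks_def by (intro sum.cong) (auto simp: J_def)
  qed
  then have "ennreal (pvar r c n K powr (1 / r))
      = ennreal (pvar r (window (int J) c) n K powr (1 / r))" by simp
  also have "\<dots> \<le> bvar r (window (int J) c)" by (rule bvar_upper[OF n])
  also have "\<dots> \<le> (SUP J::nat. bvar r (window (int J) c))" by (rule SUP_upper) simp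
  finally show "ennreal (pvar r c n K powr (1 / r))
     \<le> (SUP J::nat. bvar r (window (int J) c))" .
qed

lemma bvar_windows_mono:
  assumes "J \<le> J'"
  shows "bvar r (window (int J) c) \<le> bvar r (window (int J') c)"
proof -
  have "bvar r (window (int J) c)
     = bvar r (window (int J) (window (int J') c))"
    using assms by (intro arg_cong[where f = "bvar r"] ext) auto
  also have "\<dots> \<le> bvar r (window (int J') c)" by (rule bvar_restrict)
  finally show ?thesis .
qed

lemma bvar_norm_le_windows:
  assumes [measurable]: "\<And>j. f j \<in> borel_measurable borel" and s: "0 < s"
    and le: "\<And>J. (Lpow s W (\<lambda>x. bvar r (window (int J) (\<lambda>j. f j x)))) \<le> T"
  shows "Lpow s W (\<lambda>x. bvar r (\<lambda>j. f j x)) \<le> T"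
proof -
  let ?V = "\<lambda>J x. bvar r (window (int J) (\<lambda>j. f j x))"
  have [measurable]: "?V J \<in> borel_measurable borel" for J by (rule bvar_measurable) measurable
  have "Lpow s W (\<lambda>x. bvar r (\<lambda>j. f j x)) \<le> (\<integral>\<^sup>+ x. (SUP J. epowr (?V J x) s) \<partial>wt W)"
  proof (rule nn_integral_mono)
    fix x
    have "epowr (bvar r (\<lambda>j. f j x)) s \<le> epowr (SUP J. ?V J x) s" using s by (intro epowr_mono bvar_windows) auto
    then show "epowr (bvar r (\<lambda>j. f j x)) s \<le> (SUP J. epowr (?V J x) s)" by (simp only: epowr_SUP[OF s])
  qed
  also have "\<dots> = (SUP J. \<integral>\<^sup>+ x. epowr (?V J x) s \<partial>wt W)"
    by (rule nn_integral_monotone_convergence_SUP)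
      (use s in \<open>auto simp: incseq_def le_fun_def intro!: epowr_mono bvar_windows_mono\<close>)
  also have "\<dots> \<le> T" by (rule SUP_least) (rule le)
  finally show ?thesis .
qed

text \<open>For every shift \<open>i\<close> the functions \<open>D\<^sub>j\<^sub>+\<^sub>i f\<^sub>j\<close>, reindexed by \<open>l = j + i\<close>, form one sequence of martingale differences.\<close>

theorem LP_variation:
  assumes r: "1 < r" "r \<noteq> 2" and s: "s = min r 2" and C0: "1 < C0"
  shows "\<exists>D\<ge>0. \<forall>W f A m. Ap s K W \<longrightarrow> LP_family C0 A m f \<longrightarrow> 0 \<le> m \<longrightarrow>
    (Lpow s W (\<lambda>x. bvar r (\<lambda>j. f j x))) \<le> ennreal D * (\<integral>\<^sup>+ x. sumZ (\<lambda>j. ennreal (norm (f j x) powr s)) \<partial>wt W)"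
proof (cases "0 < K")
  case False
  then have "\<not> Ap s K W" for W using Ap.K_pos by blast
  then show ?thesis by (intro exI[of _ 0]) auto
next
  case K: True
  have s1: "1 < s" using r s by auto
  have r1: "1 \<le> r" using r by simp
  obtain \<phi> \<phi>' \<Phi> C where k: "0 < C" "continuous_on UNIV \<phi>"
    "\<And>x. norm (\<phi> x) \<le> C / (1 + x\<^sup>2)" "\<And>x. norm (\<phi>' x) \<le> C / (1 + x\<^sup>2)" "\<And>x. norm (\<Phi> x) \<le> C / (1 + x\<^sup>2)"
    "\<And>x. (\<phi> has_vector_derivative \<phi>' x) (at x)" "\<And>x. (\<Phi> has_vector_derivative \<phi> x) (at x)"
    "\<And>f A m j x. LP_family C0 A m f \<Longrightarrow> 0 \<le> m \<Longrightarrow> f j x = (LINT y|lborel. f j y * (of_real (2 powi (- j)) * \<phi> ((y - x) * 2 powi (- j))))"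
  proof (rule LP_kernel[OF C0])
    fix \<phi> \<phi>' \<Phi> C
    assume "0 < C" "continuous_on UNIV \<phi>"
    "\<And>x. norm (\<phi> x) \<le> C / (1 + x\<^sup>2)" "\<And>x. norm (\<phi>' x) \<le> C / (1 + x\<^sup>2)" "\<And>x. norm (\<Phi> x) \<le> C / (1 + x\<^sup>2)"
    "\<And>x. (\<phi> has_vector_derivative \<phi>' x) (at x)" "\<And>x. (\<Phi> has_vector_derivative \<phi> x) (at x)"
    "\<And>f A m j x. LP_family C0 A m f \<Longrightarrow> 0 \<le> m \<Longrightarrow> f j x = (LINT y|lborel. f j y * (of_real (2 powi (- j)) * \<phi> ((y - x) * 2 powi (- j))))"
    then show ?thesis by (rule that)
  qed
  obtain Cm where Cm: "0 \<le> Cm" "\<forall>W d a b. Ap s K W \<longrightarrow> (\<forall>j. haar j (d j)) \<longrightarrow> (\<forall>j x. j < a \<or> b < j \<longrightarrow> d j x = 0) \<longrightarrow>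
     Lpow s W (\<lambda>x. bvar r (\<lambda>j. d j x)) \<le> ennreal Cm * (\<integral>\<^sup>+ x. ennreal (\<Sum>j\<in>{a..b}. norm (d j x) powr s) \<partial>wt W)"
    using martingale_variation[OF r s, of K] by (elim exE conjE) (rule that)
  define \<rho> where "\<rho> = max (decay s K) (1/2)"
  define M where "M = 6 * 2 powr s * ((6 * C) powr s * bump_avg_const s K * (K + 1))"
  have M0: "0 \<le> M" using K bump_avg_const_nonneg[of K s] by (simp add: M_def)
  have rho: "0 < \<rho>" "\<rho> < 1" using decay_bounds[OF s1 K] by (auto simp: \<rho>_def)
  \<comment> \<open>half of the decay \<open>\<rho>^|i|\<close> pays for exchanging the sum over \<open>i\<close> with the power \<open>s\<close>, the other half remains\<close>
  define t1 where "t1 = \<rho> powr (1 / (2 * s))"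
  define t2 where "t2 = \<rho> powr (1 / 2)"
  have t1: "0 < t1" "t1 < 1" using rho s1 powr_less_mono2[of "1 / (2 * s)" \<rho> 1] by (auto simp: t1_def)
  have t2: "0 < t2" "t2 < 1" using rho powr_less_mono2[of "1 / 2" \<rho> 1] by (auto simp: t2_def)
  define c where "c = 2 / (1 - t1)"
  have c: "0 \<le> c" using t1 by (simp add: c_def)
  define v where "v i = (1 / t1) ^ nat \<bar>i\<bar>" for i :: int
  have v: "0 < v i" for i using t1 by (simp add: v_def)
  have v_sum: "sumZ (\<lambda>i. ennreal (1 / v i)) \<le> ennreal c"
    using sumZ_geometric[OF t1] t1 by (simp add: v_def c_def power_one_over)
  have v_rho: "v i powr s * \<rho> ^ nat \<bar>i\<bar> = t2 ^ nat \<bar>i\<bar>" for i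
  proof -
    have "t1 powr s = t2" using s1 by (simp add: t1_def t2_def powr_powr)
    then have "(1 / t1) powr s * \<rho> = t2"
    proof -
      have "t2 * t2 = \<rho>" using rho by (simp add: t2_def powr_add[symmetric])
      moreover have "(1 / t1) powr s = 1 / t2" using t1 \<open>t1 powr s = t2\<close> by (simp add: powr_divide)
      ultimately show ?thesis using t2 by (metis divide_self_if less_irrefl mult.assoc mult_1 times_divide_eq_left)
    qed
    moreover have "v i powr s = ((1 / t1) powr s) ^ nat \<bar>i\<bar>"
      using t1 unfolding v_def by (simp add: powr_realpow[symmetric] powr_powr mult.commute)
    ultimately show ?thesis by (simp add: power_mult_distrib[symmetric])
  qed
  define D where "D = c powr s * (Cm * M * (2 / (1 - t2)))"
  have D: "0 \<le> D" using Cm M0 t2 by (simp add: D_def)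
  have "Lpow s W (\<lambda>x. bvar r (\<lambda>j. f j x)) \<le> ennreal D * (\<integral>\<^sup>+ x. sumZ (\<lambda>j. ennreal (norm (f j x) powr s)) \<partial>wt W)"
    if W: "Ap s K W" and LP: "LP_family C0 A m f" and m: "0 \<le> m" for W f A m
  proof -
    have rep: "reproducing \<phi> \<phi>' \<Phi> C j (f j) \<bar>A 0\<bar>" for j
      by (rule reproducing.intro[OF k(1-7) LP_family_continuous[OF LP] LP_family_bounded[OF LP m] k(8)[OF LP m]])
    have [measurable]: "f j \<in> borel_measurable borel" for j
      using LP_family_continuous[OF LP] by (rule borel_measurable_continuous_onI)
    define N where "N j = (\<integral>\<^sup>+ x. ennreal (norm (f j x) powr s) \<partial>wt W)" for j
    define T where "T = sumZ N"
    have T: "(\<integral>\<^sup>+ x. sumZ (\<lambda>j. ennreal (norm (f j x) powr s)) \<partial>wt W) = T"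
      unfolding T_def N_def by (rule nn_integral_count_space_nn_integral) auto
    show ?thesis unfolding T
    proof (rule bvar_norm_le_windows)
      fix J :: nat
      define b where "b i x = bvar r (window (int J) (\<lambda>j. mdiff (j + i) (f j) x))" for i x
      have [measurable]: "b i \<in> borel_measurable borel" for i
        unfolding b_def by (rule bvar_measurable) measurable
      have b: "Lpow s W (b i) \<le> ennreal (Cm * M * \<rho> ^ nat \<bar>i\<bar>) * T" for i
      proof -
        define g where "g l x = (if - int J \<le> l - i \<and> l - i \<le> int J then mdiff l (f (l - i)) x else 0)" for l x
        have [measurable]: "g l \<in> borel_measurable borel" for l unfolding g_def by measurable
        have bg: "b i x = bvar r (\<lambda>l. g l x)" for x
          using bvar_shift[of r "\<lambda>l. g l x" i] by (simp add: b_def g_def cong: if_cong)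
        have haar: "haar l (g l)" for l
        proof (cases "- int J \<le> l - i \<and> l - i \<le> int J")
          case True
          then have "g l = mdiff l (f (l - i))" by (intro ext) (simp add: g_def)
          then show ?thesis using mdiff_haar[OF LP_family_continuous[OF LP]] by simp
        next
          case False
          then show ?thesis unfolding haar_def g_def by (intro exI[of _ "\<lambda>_. 0"]) auto
        qed
        have "Lpow s W (b i) \<le> ennreal Cm * (\<integral>\<^sup>+ x. ennreal (\<Sum>l\<in>{i - int J..i + int J}. norm (g l x) powr s) \<partial>wt W)"
          unfolding bg by (rule Cm(2)[rule_format, OF W haar]) (auto simp: g_def)
        also have "(\<integral>\<^sup>+ x. ennreal (\<Sum>l\<in>{i - int J..i + int J}. norm (g l x) powr s) \<partial>wt W)
            = (\<integral>\<^sup>+ x. (\<Sum>l\<in>{i - int J..i + int J}. ennreal (norm (g l x) powr s)) \<partial>wt W)"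
          by (intro nn_integral_cong sum_ennreal[symmetric]) simp
        also have "\<dots> = (\<Sum>l\<in>{i - int J..i + int J}. \<integral>\<^sup>+ x. ennreal (norm (g l x) powr s) \<partial>wt W)"
          by (rule nn_integral_sum) measurable
        also have "\<dots> \<le> (\<Sum>l\<in>{i - int J..i + int J}. ennreal (M * \<rho> ^ nat \<bar>i\<bar>) * N (l - i))"
        proof (rule sum_mono)
          fix l assume l: "l \<in> {i - int J..i + int J}"
          show "(\<integral>\<^sup>+ x. ennreal (norm (g l x) powr s) \<partial>wt W) \<le> ennreal (M * \<rho> ^ nat \<bar>i\<bar>) * N (l - i)"
            using reproducing.mdiff_norm[OF rep[of "l - i"] W \<rho>_def M_def, of i] l by (simp add: g_def N_def)
        qed
        also have "\<dots> = ennreal (M * \<rho> ^ nat \<bar>i\<bar>) * (\<Sum>l\<in>{i - int J..i + int J}. N (l - i))" by (rule sum_distrib_left[symmetric])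
        also have "(\<Sum>l\<in>{i - int J..i + int J}. N (l - i)) = (\<Sum>j\<in>{- int J..int J}. N j)"
          by (rule sum.reindex_bij_witness[of _ "\<lambda>j. j + i" "\<lambda>l. l - i"]) auto
        also have "\<dots> \<le> T"
        proof -
          have "(\<Sum>j\<in>{- int J..int J}. N j) = (\<integral>\<^sup>+ j. N j * indicator {- int J..int J} j \<partial>count_space UNIV)"
            by (subst nn_integral_count_space'[of "{- int J..int J}"]) (auto split: split_indicator)
          also have "\<dots> \<le> T" unfolding T_def by (rule sumZ_mono) (auto split: split_indicator)
          finally show ?thesis .
        qed
        finally have "Lpow s W (b i) \<le> ennreal Cm * (ennreal (M * \<rho> ^ nat \<bar>i\<bar>) * T)"
          by (simp add: mult_left_mono)
        also have "\<dots> = ennreal (Cm * M * \<rho> ^ nat \<bar>i\<bar>) * T"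
          using Cm M0 rho by (simp add: ennreal_mult mult.assoc)
        finally show ?thesis .
      qed
      have "Lpow s W (\<lambda>x. bvar r (window (int J) (\<lambda>j. f j x)))
         \<le> (\<integral>\<^sup>+ x. ennreal (c powr s) * sumZ (\<lambda>i. epowr (ennreal (v i) * b i x) s) \<partial>wt W)"
      proof (rule nn_integral_mono)
        fix x
        have "bvar r (window (int J) (\<lambda>j. f j x)) \<le> sumZ (\<lambda>i. b i x)"
          unfolding b_def by (rule bvar_expansion[OF r1 reproducing.mdiff_expansion[OF rep]])
        then have "epowr (bvar r (window (int J) (\<lambda>j. f j x))) s \<le> epowr (sumZ (\<lambda>i. b i x)) s"
          using s1 by (intro epowr_mono) auto
        also have "\<dots> \<le> ennreal (c powr s) * sumZ (\<lambda>i. epowr (ennreal (v i) * b i x) s)"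
          using s1 by (intro epowr_sum_weighted v c v_sum) auto
        finally show "epowr (bvar r (window (int J) (\<lambda>j. f j x))) s \<le> ennreal (c powr s) * sumZ (\<lambda>i. epowr (ennreal (v i) * b i x) s)" .
      qed
      also have "\<dots> = ennreal (c powr s) * (\<integral>\<^sup>+ x. sumZ (\<lambda>i. epowr (ennreal (v i) * b i x) s) \<partial>wt W)"
        by (rule nn_integral_cmult) measurable
      also have "(\<integral>\<^sup>+ x. sumZ (\<lambda>i. epowr (ennreal (v i) * b i x) s) \<partial>wt W) = sumZ (\<lambda>i. \<integral>\<^sup>+ x. epowr (ennreal (v i) * b i x) s \<partial>wt W)"
        by (rule nn_integral_count_space_nn_integral) auto
      also have "\<dots> \<le> sumZ (\<lambda>i. ennreal (Cm * M) * T * ennreal (t2 ^ nat \<bar>i\<bar>))"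
      proof (rule sumZ_mono)
        fix i
        have "Lpow s W (\<lambda>x. ennreal (v i) * b i x) = (\<integral>\<^sup>+ x. ennreal (v i powr s) * epowr (b i x) s \<partial>wt W)"
          using s1 v[of i] by (intro nn_integral_cong) (simp add: epowr_mult)
        also have "\<dots> = ennreal (v i powr s) * Lpow s W (b i)" by (rule nn_integral_cmult) measurable
        also have "\<dots> \<le> ennreal (v i powr s) * (ennreal (Cm * M * \<rho> ^ nat \<bar>i\<bar>) * T)" by (intro mult_left_mono b) auto
        also have "\<dots> = ennreal (Cm * M * (v i powr s * \<rho> ^ nat \<bar>i\<bar>)) * T"
          using Cm M0 rho by (simp add: ennreal_mult mult_ac)
        also have "\<dots> = ennreal (Cm * M) * T * ennreal (t2 ^ nat \<bar>i\<bar>)"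
          unfolding v_rho using Cm M0 t2 by (simp add: ennreal_mult mult_ac)
        finally show "Lpow s W (\<lambda>x. ennreal (v i) * b i x) \<le> ennreal (Cm * M) * T * ennreal (t2 ^ nat \<bar>i\<bar>)" .
      qed
      also have "\<dots> = ennreal (Cm * M) * T * sumZ (\<lambda>i. ennreal (t2 ^ nat \<bar>i\<bar>))" by (rule nn_integral_cmult) simp
      also have "\<dots> \<le> ennreal (Cm * M) * T * ennreal (2 / (1 - t2))" by (intro mult_left_mono sumZ_geometric t2) auto
      finally have "Lpow s W (\<lambda>x. bvar r (window (int J) (\<lambda>j. f j x)))
         \<le> ennreal (c powr s) * (ennreal (Cm * M) * T * ennreal (2 / (1 - t2)))" by (simp add: mult_left_mono)
      also have "\<dots> = ennreal D * T"
      proof -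
        have nn: "0 \<le> Cm * M" "0 \<le> 2 / (1 - t2)" "0 \<le> c powr s" using Cm(1) M0 t2 by auto
        have "ennreal D = ennreal (c powr s) * (ennreal (Cm * M) * ennreal (2 / (1 - t2)))"
          by (simp only: D_def ennreal_mult[OF nn(3) mult_nonneg_nonneg[OF nn(1,2)]] ennreal_mult[OF nn(1,2)])
        then show ?thesis by (simp only: mult_ac)
      qed
      finally show "Lpow s W (\<lambda>x. bvar r (window (int J) (\<lambda>j. f j x))) \<le> ennreal D * T" .
    qed (use s1 in auto)
  qed
  then show ?thesis using D by (intro exI[of _ D] conjI allI impI)
qed

section \<open>Lebesgue measurable weights and the exponents up to one\<close>

text \<open>A Lebesgue measurable weight agrees almost everywhere with a Borel function, which may be changed to one where it fails
  to be positive.\<close>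

lemma Ap_weight_borel:
  assumes p: "1 < p" and w: "Ap_weight p w"
  obtains K w0 where "Ap p K w0" "AE x in lebesgue. w x = w0 x"
proof -
  have pos: "AE x in lebesgue. 0 < w x" and int: "\<And>a b. set_integrable lebesgue {a..b} w" and fin: "Ap_const p w < \<infinity>"
    using w by (auto simp: Ap_weight_def)
  have "w \<in> borel_measurable lebesgue"
  proof (rule borel_measurable_LIMSEQ_real)
    fix x
    show "(\<lambda>n. indicat_real {- real n..real n} x *\<^sub>R w x) \<longlonglongrightarrow> w x"
    proof (rule tendsto_eventually)
      obtain n0 :: nat where "\<bar>x\<bar> \<le> real n0" using real_arch_simple by blast
      then have "indicat_real {- real n..real n} x *\<^sub>R w x = w x" if "n0 \<le> n" for n
      proof -
        have "\<bar>x\<bar> \<le> real n" using \<open>\<bar>x\<bar> \<le> real n0\<close> that by linarith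
        then show ?thesis by (auto simp: indicator_def abs_le_iff)
      qed
      then show "\<forall>\<^sub>F n in sequentially. indicat_real {- real n..real n} x *\<^sub>R w x = w x"
        by (auto simp: eventually_sequentially)
    qed
  next
    fix n
    show "(\<lambda>x. indicat_real {- real n..real n} x *\<^sub>R w x) \<in> borel_measurable lebesgue"
      using int[of "- real n" "real n"] unfolding set_integrable_def by (rule borel_measurable_integrable)
  qed
  then obtain g where g: "g \<in> borel_measurable lborel" "AE x in lborel. w x = g x"
    using completion_ex_borel_measurable_real by blast
  define w0 where "w0 x = (if 0 < g x then g x else 1)" for x
  have [measurable]: "w0 \<in> borel_measurable borel" using g(1) unfolding w0_def by measurable
  have w0: "0 < w0 x" for x by (simp add: w0_def)
  have AE: "AE x in lebesgue. w x = w0 x"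
    using AE_completion[OF g(2)] pos by eventually_elim (simp add: w0_def)
  obtain K where K: "Ap_const p w = ennreal K" "0 \<le> K" using fin by (cases "Ap_const p w") auto
  have "Apw p K w0"
    unfolding Apw_def
  proof (intro conjI allI impI w0)
    fix a b :: real assume ab: "a < b"
    define A where "A = mass w0 {a..b}"
    define B where "B = mass (dualw p w0) {a..b}"
    have A: "(\<integral>\<^sup>+ x\<in>{a..b}. ennreal (w x) \<partial>lebesgue) = A"
    proof -
      have "(\<integral>\<^sup>+ x\<in>{a..b}. ennreal (w x) \<partial>lebesgue) = (\<integral>\<^sup>+ x\<in>{a..b}. ennreal (w0 x) \<partial>lebesgue)"
        by (rule nn_integral_cong_AE) (use AE in eventually_elim, simp)
      then show ?thesis by (simp add: A_def emeasure_wt nn_integral_completion)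
    qed
    have B: "(\<integral>\<^sup>+ x\<in>{a..b}. ennreal (w x powr (- 1 / (p - 1))) \<partial>lebesgue) = B"
    proof -
      have "(\<integral>\<^sup>+ x\<in>{a..b}. ennreal (w x powr (- 1 / (p - 1))) \<partial>lebesgue) = (\<integral>\<^sup>+ x\<in>{a..b}. ennreal (w0 x powr (- 1 / (p - 1))) \<partial>lebesgue)"
        by (rule nn_integral_cong_AE) (use AE in eventually_elim, simp)
      then show ?thesis by (simp add: B_def emeasure_wt nn_integral_completion dualw_def)
    qed
    define L where "L = b - a"
    have L: "0 < L" using ab by (simp add: L_def)
    have "(ennreal (1 / L) * A) * epowr (ennreal (1 / L) * B) (p - 1) \<le> ennreal K"
      unfolding K(1)[symmetric] Ap_const_def A[symmetric] B[symmetric] L_def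
      by (rule SUP_upper2[of "(a, b)"]) (use ab in auto)
    also have "(ennreal (1 / L) * A) * epowr (ennreal (1 / L) * B) (p - 1)
       = ennreal ((1 / L) powr p) * (A * epowr B (p - 1))"
    proof -
      have "ennreal (1 / L) * ennreal ((1 / L) powr (p - 1)) = ennreal ((1 / L) powr p)"
        using L powr_add[of "1 / L" 1 "p - 1"] by (simp add: ennreal_mult[symmetric])
      then show ?thesis using p L by (simp add: epowr_mult mult_ac)
    qed
    finally have "ennreal (L powr p) * (ennreal ((1 / L) powr p) * (A * epowr B (p - 1))) \<le> ennreal (L powr p) * ennreal K"
      by (rule mult_left_mono) simp
    also have "ennreal (L powr p) * ennreal K = ennreal (K * (b - a) powr p)"
      using K by (simp add: ennreal_mult L_def mult.commute)
    also have "ennreal (L powr p) * (ennreal ((1 / L) powr p) * (A * epowr B (p - 1))) = A * epowr B (p - 1)"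
    proof -
      have "ennreal (L powr p) * ennreal ((1 / L) powr p) = 1"
        using L by (simp add: ennreal_mult[symmetric] powr_mult[symmetric])
      then show ?thesis by (simp only: mult.assoc[symmetric] mult_1)
    qed
    finally show "mass w0 {a..b} * epowr (mass (dualw p w0) {a..b}) (p - 1) \<le> ennreal (K * (b - a) powr p)"
      by (simp only: A_def B_def)
  qed auto
  then have "Ap p K w0" using p by unfold_locales
  then show ?thesis using AE by (rule that)
qed

lemma weighted_Lp_norm_borel:
  assumes w0: "w0 \<in> borel_measurable borel" and AE: "AE x in lebesgue. w x = w0 x" and h: "h \<in> borel_measurable borel"
  shows "weighted_Lp_norm p w h = epowr (Lpow p w0 h) (1 / p)"
proof -
  have "(\<integral>\<^sup>+ x. epowr (h x) p * ennreal (w x) \<partial>lebesgue) = (\<integral>\<^sup>+ x. epowr (h x) p * ennreal (w0 x) \<partial>lebesgue)"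
    by (rule nn_integral_cong_AE) (use AE in eventually_elim, simp)
  also have "\<dots> = Lpow p w0 h"
    using w0 h by (subst nn_integral_wt) (auto simp: nn_integral_completion mult.commute)
  finally show ?thesis by (simp add: weighted_Lp_norm_def)
qed

lemma weighted_Lp_norm_mono:
  assumes "0 < p" and "\<And>x. g x \<le> h x" shows "weighted_Lp_norm p w g \<le> weighted_Lp_norm p w h"
  unfolding weighted_Lp_norm_def
  using assms by (intro epowr_mono nn_integral_mono mult_right_mono) auto

lemma sum_le_infsum_ennreal:
  fixes F :: "int \<Rightarrow> ennreal" assumes "finite J" shows "sum F J \<le> (\<Sum>\<^sub>\<infinity>j\<in>UNIV. F j)"
  unfolding nonneg_infsum_complete[where f = F and A = UNIV, simplified] using assms by (intro SUP_upper) auto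

lemma sumZ_le_infsum: "sumZ F \<le> (\<Sum>\<^sub>\<infinity>j\<in>UNIV. F j)"
  unfolding sumZ_suminf suminf_eq_SUP
proof (rule SUP_least)
  fix n
  have "(\<Sum>i<n. F (int_decode i)) = sum F (int_decode ` {..<n})"
    by (subst sum.reindex) (auto simp: inj_on_def inj_int_decode[THEN inj_eq])
  then show "(\<Sum>i<n. F (int_decode i)) \<le> (\<Sum>\<^sub>\<infinity>j\<in>UNIV. F j)" using sum_le_infsum_ennreal by simp
qed

lemma block_variation_blocks:
  assumes K: "1 \<le> K" and n: "strict_mono_on {0..K} n" and n': "n' = (\<lambda>i. n (min i K))"
  shows "mono n'" "(\<Sum>k = 1..K. norm (\<Sum>j\<in>{n (k - 1)<..n k}. c j) powr r) = pvar r c n' K"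
proof -
  show "mono n'"
  proof (rule monoI)
    fix i i' :: nat assume "i \<le> i'"
    then have "min i K < min i' K \<or> min i K = min i' K" by auto
    then show "n' i \<le> n' i'" unfolding n'
      using strict_mono_onD[OF n, of "min i K" "min i' K"] by fastforce
  qed
  show "(\<Sum>k = 1..K. norm (\<Sum>j\<in>{n (k - 1)<..n k}. c j) powr r) = pvar r c n' K"
    by (rule sum.reindex_bij_witness[of _ Suc "\<lambda>k. k - 1"]) (auto simp: blocks_def n' min_def)
qed

lemma block_variation_le_bvar: "block_variation r f x \<le> bvar r (\<lambda>j. f j x)"
  unfolding block_variation_def
proof (rule SUP_least, clarify)
  fix K n assume K: "1 \<le> K" "strict_mono_on {0..K} (n :: nat \<Rightarrow> int)"
  show "ennreal ((\<Sum>k = 1..K. norm (\<Sum>j\<in>{n (k - 1)<..n k}. f j x) powr r) powr (1 / r)) \<le> bvar r (\<lambda>j. f j x)"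
    unfolding block_variation_blocks(2)[OF K refl] by (rule bvar_upper[OF block_variation_blocks(1)[OF K refl]])
qed

lemma powr_add_le:
  fixes x y r :: real
  assumes r: "0 < r" "r \<le> 1" and xy: "0 \<le> x" "0 \<le> y"
  shows "(x + y) powr r \<le> x powr r + y powr r"
proof (cases "x + y = 0")
  case True then show ?thesis using xy by simp
next
  case False
  then have z: "0 < x + y" using xy by simp
  have le: "u \<le> u powr r" if "0 \<le> u" "u \<le> 1" for u
    using powr_mono'[of r 1 u] that r by (cases "u = 0") auto
  have "1 = x / (x + y) + y / (x + y)" using z by (simp add: add_divide_distrib[symmetric])
  also have "\<dots> \<le> (x / (x + y)) powr r + (y / (x + y)) powr r"
    using z xy by (intro add_mono le) auto
  also have "\<dots> = (x powr r + y powr r) / (x + y) powr r" using z xy by (simp add: powr_divide add_divide_distrib)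
  finally show ?thesis using z by (simp add: field_simps)
qed

lemma norm_sum_powr_le:
  fixes c :: "'a \<Rightarrow> complex"
  assumes r: "0 < r" "r \<le> 1" and "finite J"
  shows "norm (\<Sum>j\<in>J. c j) powr r \<le> (\<Sum>j\<in>J. norm (c j) powr r)"
  using assms(3)
proof (induction J)
  case empty then show ?case by simp
next
  case (insert i J)
  have "norm (c i + (\<Sum>j\<in>J. c j)) powr r \<le> (norm (c i) + norm (\<Sum>j\<in>J. c j)) powr r"
    using r by (intro powr_mono2 norm_triangle_ineq) auto
  also have "\<dots> \<le> norm (c i) powr r + norm (\<Sum>j\<in>J. c j) powr r" by (rule powr_add_le[OF r]) auto
  also have "\<dots> \<le> norm (c i) powr r + (\<Sum>j\<in>J. norm (c j) powr r)" using insert.IH by simp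
  finally show ?case using insert by simp
qed

lemma sum_blocks:
  assumes n: "mono (n :: nat \<Rightarrow> int)"
  shows "(\<Sum>k<K. \<Sum>j\<in>{n k<..n (Suc k)}. g j) = (\<Sum>j\<in>{n 0<..n K}. g j :: real)"
proof (induction K)
  case (Suc K)
  have "n 0 \<le> n K" "n K \<le> n (Suc K)" using n by (auto simp: mono_def)
  then have "{n 0<..n (Suc K)} = {n 0<..n K} \<union> {n K<..n (Suc K)}" by auto
  moreover have "(\<Sum>j\<in>{n 0<..n K} \<union> {n K<..n (Suc K)}. g j) = (\<Sum>j\<in>{n 0<..n K}. g j) + (\<Sum>j\<in>{n K<..n (Suc K)}. g j)"
    by (rule sum.union_disjoint) auto
  ultimately show ?case using Suc by simp
qed simp

lemma block_variation_le_ls: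
  assumes r: "0 < r" "r \<le> 1"
  shows "block_variation r f x \<le> ls_function r f x"
  unfolding block_variation_def
proof (rule SUP_least, clarify)
  fix K n assume K: "1 \<le> K" "strict_mono_on {0..K} (n :: nat \<Rightarrow> int)"
  define n' where "n' = (\<lambda>i. n (min i K))"
  note b = block_variation_blocks[OF K n'_def]
  have "pvar r (\<lambda>j. f j x) n' K \<le> (\<Sum>k<K. \<Sum>j\<in>{n' k<..n' (Suc k)}. norm (f j x) powr r)"
    unfolding blocks_def by (intro sum_mono norm_sum_powr_le r) auto
  also have "\<dots> = (\<Sum>j\<in>{n' 0<..n' K}. norm (f j x) powr r)" by (rule sum_blocks[OF b(1)])
  finally have "ennreal (pvar r (\<lambda>j. f j x) n' K) \<le> (\<Sum>j\<in>{n' 0<..n' K}. ennreal (norm (f j x) powr r))"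
    by (subst sum_ennreal) (auto intro: ennreal_leI)
  also have "\<dots> \<le> (\<Sum>\<^sub>\<infinity>j\<in>UNIV. ennreal (norm (f j x) powr r))" by (rule sum_le_infsum_ennreal) simp
  finally have "epowr (ennreal (pvar r (\<lambda>j. f j x) n' K)) (1 / r) \<le> ls_function r f x"
    unfolding ls_function_def using r by (intro epowr_mono) auto
  then show "ennreal ((\<Sum>k = 1..K. norm (\<Sum>j\<in>{n (k - 1)<..n k}. f j x) powr r) powr (1 / r)) \<le> ls_function r f x"
    unfolding b(2) by (subst (asm) epowr_ennreal) (auto intro: sum_nonneg)
qed

theorem lemma5p2:
  fixes p r s m C0 :: real and w :: "real \<Rightarrow> real" and A :: "nat \<Rightarrow> real"
  assumes "1 < C0" and "1 \<le> m"
    and "1 < p" and "Ap_weight p w"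
    and "0 < r" and "r \<noteq> 2" and "s = min r 2"
  shows "\<exists>C>0. \<forall>f. LP_family C0 A m f \<longrightarrow>
           weighted_Lp_norm p w (block_variation r f)
             \<le> ennreal C * weighted_Lp_norm p w (ls_function s f)"
proof (cases "r \<le> 1")
  case True
  then have "s = r" using assms by simp
  then show ?thesis
    using weighted_Lp_norm_mono[OF _ block_variation_le_ls[OF \<open>0 < r\<close> True]] assms by (intro exI[of _ 1]) auto
next
  case False
  then have r: "1 < r" and s1: "1 < s" using assms by auto
  have m: "0 \<le> m" using assms by simp
  obtain K w0 where K: "Ap p K w0" and w0: "AE x in lebesgue. w x = w0 x"
    using Ap_weight_borel[OF assms(3,4)] .
  interpret Ap p K w0 by fact
  obtain K' where K': "\<forall>C\<ge>0. \<exists>C'>0. \<forall>V\<in>borel_measurable borel. \<forall>S\<in>borel_measurable borel.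
     (\<forall>W. Ap s K' W \<longrightarrow> Lpow s W V \<le> ennreal C * Lpow s W S) \<longrightarrow>
     Lpow p w0 V \<le> ennreal C' * Lpow p w0 S"
    using extrapolation[OF s1] by (rule exE) (rule that)
  obtain D where D: "0 \<le> D" "\<forall>W f A m. Ap s K' W \<longrightarrow> LP_family C0 A m f \<longrightarrow> 0 \<le> m \<longrightarrow>
    (Lpow s W (\<lambda>x. bvar r (\<lambda>j. f j x))) \<le> ennreal D * (\<integral>\<^sup>+ x. sumZ (\<lambda>j. ennreal (norm (f j x) powr s)) \<partial>wt W)"
    using LP_variation[OF r \<open>r \<noteq> 2\<close> \<open>s = min r 2\<close> \<open>1 < C0\<close>, of K'] by (elim exE conjE) (rule that)
  obtain C' where C': "0 < C'" "\<forall>V\<in>borel_measurable borel. \<forall>S\<in>borel_measurable borel.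
     (\<forall>W. Ap s K' W \<longrightarrow> Lpow s W V \<le> ennreal D * Lpow s W S) \<longrightarrow>
     Lpow p w0 V \<le> ennreal C' * Lpow p w0 S"
    using K'[rule_format, OF D(1)] by (elim exE conjE) (rule that)
  have "weighted_Lp_norm p w (block_variation r f) \<le> ennreal (C' powr (1 / p)) * weighted_Lp_norm p w (ls_function s f)"
    if LP: "LP_family C0 A m f" for f
  proof -
    have fm [measurable]: "f j \<in> borel_measurable borel" for j
      using LP_family_continuous[OF LP] by (rule borel_measurable_continuous_onI)
    define V where "V x = bvar r (\<lambda>j. f j x)" for x
    define S where "S x = epowr (sumZ (\<lambda>j. ennreal (norm (f j x) powr s))) (1 / s)" for x
    have Vm: "V \<in> borel_measurable borel" unfolding V_def by (rule bvar_measurable[OF fm])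
    have Sm: "S \<in> borel_measurable borel" unfolding S_def by measurable
    have "Lpow p w0 V \<le> ennreal C' * Lpow p w0 S"
    proof (rule C'(2)[rule_format, OF Vm Sm])
      fix W assume W: "Ap s K' W"
      have "epowr (S x) s = sumZ (\<lambda>j. ennreal (norm (f j x) powr s))" for x
        using s1 by (simp add: S_def)
      then show "Lpow s W V \<le> ennreal D * Lpow s W S"
        using D(2)[rule_format, OF W LP m] by (simp only: V_def)
    qed
    then have "epowr (Lpow p w0 V) (1 / p) \<le> epowr (ennreal C' * Lpow p w0 S) (1 / p)"
      using p by (intro epowr_mono) auto
    also have "\<dots> = ennreal (C' powr (1 / p)) * epowr (Lpow p w0 S) (1 / p)"
      using p C'(1) by (simp add: epowr_mult)
    finally have VS: "weighted_Lp_norm p w V \<le> ennreal (C' powr (1 / p)) * weighted_Lp_norm p w S"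
      by (simp only: weighted_Lp_norm_borel[OF w_meas w0 Vm] weighted_Lp_norm_borel[OF w_meas w0 Sm])
    have "weighted_Lp_norm p w (block_variation r f) \<le> weighted_Lp_norm p w V"
      using p by (intro weighted_Lp_norm_mono) (auto simp: V_def block_variation_le_bvar)
    also note VS
    also have "weighted_Lp_norm p w S \<le> weighted_Lp_norm p w (ls_function s f)"
      using p s1 unfolding S_def ls_function_def by (intro weighted_Lp_norm_mono epowr_mono sumZ_le_infsum) auto
    finally show ?thesis by (simp add: mult_left_mono)
  qed
  then show ?thesis using C'(1) by (intro exI[of _ "C' powr (1 / p)"]) auto
qed

end
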